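(* Let $N\ge3$, $2^*:=\frac{2N}{N-2}$, let $\ell\ge1$ be an integer and $\beta<0$. Let $G$ be a closed subgroup of $O(N)$, let $\phi:G\to S_\ell$ be a continuous homomorphism of groups, and let $\Omega$ be a $G$-invariant smooth domain in $\mathbb{R}^N$. Let $c^\phi(\Omega)$ and $c^\phi(\mathbb{R}^N)$ be the infima defined in the context. (1) If $\Omega\cap\mathrm{Fix}(G)\neq\emptyset$, then $c^\phi(\Omega)=c^\phi(\mathbb{R}^N)$. (2) If $\Omega\cap\mathrm{Fix}(G)\neq\emptyset$ and, in addition, $\mathbb{R}^N\setminus\Omega$ has non-empty interior, then the system $$-\Delta u_i=|u_i|^{2^*-2}u_i+\beta\sum_{\substack{j=1\\ j\ne i}}^{\ell}|u_j|^{\frac{2^*}{2}}|u_i|^{\frac{2^*}{2}-2}u_i\quad\text{in }\Omega,\qquad u_i\in D^{1,2}_0(\Omega),\qquad i=1,\ldots,\ell,$$ does not have a $\phi$-equivariant least energy solution; that is, there is no $\mathbf{u}\in\mathcal{N}^\phi(\Omega)$ with $\mathcal{J}(\mathbf{u})=c^\phi(\Omega)$.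
   Context: All functions are real-valued. $O(N)$ is the group of linear isometries of $\mathbb{R}^N$, and $S_\ell$ is the group of permutations of $\{1,\ldots,\ell\}$, acting on $\mathbb{R}^\ell$ by $\sigma(u_1,\ldots,u_\ell)=(u_{\sigma(1)},\ldots,u_{\sigma(\ell)})$. A set $\Omega\subset\mathbb{R}^N$ is $G$-invariant if $gx\in\Omega$ for all $g\in G$, $x\in\Omega$. Put $\mathrm{Fix}(G):=\{x\in\mathbb{R}^N: gx=x\text{ for every }g\in G\}$. For $\Omega$ a $G$-invariant smooth domain (including $\Omega=\mathbb{R}^N$), $D^{1,2}_0(\Omega)$ is the completion of $C_c^\infty(\Omega)$ with respect to the norm $\left(\int_\Omega|\nabla u|^2\right)^{1/2}$. A function $\mathbf{u}:\Omega\to\mathbb{R}^\ell$ is $\phi$-equivariant if $\mathbf{u}(gx)=\phi(g)\mathbf{u}(x)$ for all $g\in G$, $x\in\Omega$. Let $$\mathcal{H}:=\{\mathbf{u}\in (D^{1,2}_0(\Omega))^\ell:\mathbf{u}\text{ is }\phi\text{-equivariant}\},$$ and define $\mathcal{J}:\mathcal{H}\to\mathbb{R}$ by $$\mathcal{J}(\mathbf{u}):=\frac12\sum_{i=1}^\ell\int_\Omega|\nabla u_i|^2-\frac1{2^*}\sum_{i=1}^\ell\int_\Omega|u_i|^{2^*}-\frac{\beta}{2^*}\sum_{\substack{i,j=1\\ i\ne j}}^\ell\int_\Omega|u_i|^{\frac{2^*}{2}}|u_j|^{\frac{2^*}{2}}.$$ Let $$\mathcal{N}^\phi(\Omega):=\{\mathbf{u}\in\mathcal{H}: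 u_i\ne0,\ \partial_i\mathcal{J}(\mathbf{u})u_i=0\ \text{ for all } i=1,\ldots,\ell\},$$ where $\partial_i\mathcal{J}(\mathbf{u})u_i=\int_\Omega|\nabla u_i|^2-\int_\Omega|u_i|^{2^*}-\beta\sum_{j\ne i}\int_\Omega|u_i|^{\frac{2^*}{2}}|u_j|^{\frac{2^*}{2}}$ is the derivative of $\mathcal{J}$ with respect to the $i$-th component in the direction $u_i$. Define $$c^\phi(\Omega):=\inf_{\mathbf{u}\in\mathcal{N}^\phi(\Omega)}\mathcal{J}(\mathbf{u})$$ (with $\inf\emptyset=+\infty$). $c^\phi(\mathbb{R}^N)$ is the same quantity with $\Omega$ replaced by $\mathbb{R}^N$. A $\phi$-equivariant least energy solution is an element $\mathbf{u}\in\mathcal{N}^\phi(\Omega)$ with $\mathcal{J}(\mathbf{u})=c^\phi(\Omega)$ (any such $\mathbf{u}$ is a weak solution of the system). The expression $|t|^{\frac{2^*}{2}-2}t$ is understood as $0$ when $t=0$. *)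

theory Defs
  imports "HOL-Analysis.Analysis" "HOL-Algebra.Sym_Groups"
begin

section \<open>Smooth functions and smooth domains\<close>

text \<open>\<open>C\<^sup>k\<close> regularity on an open set, by recursion on directional derivatives.\<close>

primrec Ck_on :: "nat \<Rightarrow> (real^'n) set \<Rightarrow> (real^'n \<Rightarrow> real) \<Rightarrow> bool" where
  "Ck_on 0 S f \<longleftrightarrow> continuous_on S f"
| "Ck_on (Suc k) S f \<longleftrightarrow>
     f differentiable_on S \<and> (\<forall>v. Ck_on k S (\<lambda>x. frechet_derivative f (at x) v))"

definition smooth_on :: "(real^'n) set \<Rightarrow> (real^'n \<Rightarrow> real) \<Rightarrow> bool" where
  "smooth_on S f \<longleftrightarrow> (\<forall>k. Ck_on k S f)"

definition grad :: "(real^'n \<Rightarrow> real) \<Rightarrow> real^'n \<Rightarrow> real^'n" where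
  "grad f x = (\<chi> i. frechet_derivative f (at x) (axis i 1))"

text \<open>The boundary is smooth in the usual sense: near each boundary point the domain is the
  sublevel set of a smooth function without critical points. There is no condition if the
  boundary is empty, so the whole space is a smooth domain; domains may be unbounded.\<close>

definition smooth_domain :: "(real^'n) set \<Rightarrow> bool" where
  "smooth_domain \<Omega> \<longleftrightarrow> open \<Omega> \<and> connected \<Omega> \<and> \<Omega> \<noteq> {} \<and>
     (\<forall>x\<in>frontier \<Omega>. \<exists>U \<rho>. open U \<and> x \<in> U \<and> smooth_on U \<rho> \<and>
        (\<forall>y\<in>U. grad \<rho> y \<noteq> 0) \<and>
        \<Omega> \<inter> U = {y\<in>U. \<rho> y < 0} \<and> frontier \<Omega> \<inter> U = {y\<in>U. \<rho> y = 0})"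

section \<open>The groups and the permutation action\<close>

definition O_group :: "(real^'n^'n) monoid" where
  "O_group = \<lparr>carrier = {A. orthogonal_matrix A}, mult = (**), one = mat 1\<rparr>"

lemma group_O_group: "group (O_group :: (real^'n^'n) monoid)"
proof (rule groupI)
  fix A :: "real^'n^'n" assume "A \<in> carrier O_group"
  then show "\<exists>B\<in>carrier O_group. B \<otimes>\<^bsub>O_group\<^esub> A = \<one>\<^bsub>O_group\<^esub>"
    by (intro bexI[of _ "transpose A"]) (auto simp: O_group_def orthogonal_matrix_def)
qed (auto simp: O_group_def orthogonal_matrix_mul orthogonal_matrix_id matrix_mul_assoc)

definition perm_act :: "(nat \<Rightarrow> nat) \<Rightarrow> (nat \<Rightarrow> real) \<Rightarrow> (nat \<Rightarrow> real)" where
  "perm_act \<sigma> v = (\<lambda>i. v (\<sigma> i))"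

text \<open>For \<open>\<sigma>(u\<^sub>1,\<dots>,u\<^sub>l) = (u\<^bsub>\<sigma>(1)\<^esub>,\<dots>,u\<^bsub>\<sigma>(l)\<^esub>)\<close> to be a (left) action, permutations have to be
  multiplied from left to right: \<open>(\<sigma>\<tau>)(i) = \<tau>(\<sigma>(i))\<close>. With this product, which gives a group
  isomorphic to \<^const>\<open>sym_group\<close> via inversion, \<open>\<phi>(gh)u = \<phi>(g)(\<phi>(h)u)\<close> holds for every
  homomorphism \<open>\<phi>\<close>, as equivariance requires. For commutative images the two products agree.\<close>

definition perm_group :: "nat \<Rightarrow> (nat \<Rightarrow> nat) monoid" where
  "perm_group l = (sym_group l)\<lparr>mult := (\<lambda>\<sigma> \<tau>. \<tau> \<circ> \<sigma>)\<rparr>"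

lemma group_perm_group: "group (perm_group l)"
proof (rule groupI)
  fix p assume "p \<in> carrier (perm_group l)"
  then have "p permutes {1..l}"
    by (simp add: perm_group_def sym_group_def)
  then show "\<exists>q\<in>carrier (perm_group l). q \<otimes>\<^bsub>perm_group l\<^esub> p = \<one>\<^bsub>perm_group l\<^esub>"
    by (intro bexI[of _ "inv' p"])
      (auto simp: perm_group_def sym_group_def permutes_inv_o permutes_inv)
qed (auto simp: perm_group_def sym_group_def permutes_compose permutes_id comp_assoc)

lemma perm_act_mult: "perm_act (\<sigma> \<otimes>\<^bsub>perm_group l\<^esub> \<tau>) v = perm_act \<sigma> (perm_act \<tau> v)"
  by (simp add: perm_group_def perm_act_def)

lemma perm_act_one: "perm_act (\<one>\<^bsub>perm_group l\<^esub>) v = v"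
  by (simp add: perm_group_def sym_group_def perm_act_def)

definition G_invariant :: "(real^'n^'n) set \<Rightarrow> (real^'n) set \<Rightarrow> bool" where
  "G_invariant G \<Omega> \<longleftrightarrow> (\<forall>g\<in>G. \<forall>x\<in>\<Omega>. g *v x \<in> \<Omega>)"

definition Fix :: "(real^'n^'n) set \<Rightarrow> (real^'n) set" where
  "Fix G = {x. \<forall>g\<in>G. g *v x = x}"

section \<open>The space \<open>D\<^sub>0\<^sup>1\<^sup>,\<^sup>2\<close>\<close>

text \<open>The critical exponent \<open>2\<^sup>*\<close> in dimension \<open>N\<close>.\<close>

definition crit_exp :: "nat \<Rightarrow> real" where
  "crit_exp N = 2 * real N / (real N - 2)"

definition test_functions :: "(real^'n) set \<Rightarrow> (real^'n \<Rightarrow> real) set" where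
  "test_functions \<Omega> =
     {f. smooth_on UNIV f \<and> compact (closure {x. f x \<noteq> 0}) \<and> closure {x. f x \<noteq> 0} \<subseteq> \<Omega>}"

text \<open>By the Sobolev inequality, a sequence of test functions that is Cauchy for the gradient
  norm converges in \<open>L\<^bsup>2*\<^esup>(\<Omega>)\<close>, and its gradients converge in \<open>L\<^sup>2(\<Omega>)\<close>. The completion is
  therefore realised as the space of all functions \<open>u\<close> arising as such limits, and the limit \<open>g\<close>
  of the gradients is the (weak) gradient of \<open>u\<close>. Functions are identified when they agree almost
  everywhere on \<open>\<Omega>\<close>; their values outside \<open>\<Omega>\<close> play no role.\<close>

definition D12_limit ::
  "(real^'n) set \<Rightarrow> (real^'n \<Rightarrow> real) \<Rightarrow> (real^'n \<Rightarrow> real^'n) \<Rightarrow> bool" where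
  "D12_limit \<Omega> u g \<longleftrightarrow>
     u \<in> borel_measurable (lebesgue_on \<Omega>) \<and> g \<in> borel_measurable (lebesgue_on \<Omega>) \<and>
     (\<exists>f. (\<forall>k::nat. f k \<in> test_functions \<Omega>) \<and>
        (\<lambda>k. \<integral>\<^sup>+x. ennreal (\<bar>f k x - u x\<bar> powr crit_exp CARD('n)) \<partial>lebesgue_on \<Omega>)
          \<longlonglongrightarrow> 0 \<and>
        (\<lambda>k. \<integral>\<^sup>+x. ennreal ((norm (grad (f k) x - g x))\<^sup>2) \<partial>lebesgue_on \<Omega>) \<longlonglongrightarrow> 0)"

definition D12_0 :: "(real^'n) set \<Rightarrow> (real^'n \<Rightarrow> real) set" where
  "D12_0 \<Omega> = {u. \<exists>g. D12_limit \<Omega> u g}"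

text \<open>The gradient is unique up to null sets, so integrals of it do not depend on the choice.\<close>

definition D12_grad :: "(real^'n) set \<Rightarrow> (real^'n \<Rightarrow> real) \<Rightarrow> real^'n \<Rightarrow> real^'n" where
  "D12_grad \<Omega> u = (SOME g. D12_limit \<Omega> u g)"

section \<open>The variational problem\<close>

text \<open>A vector function is \<open>u :: real^'n \<Rightarrow> nat \<Rightarrow> real\<close>; only the components \<open>u x i\<close> with
  \<open>i \<in> {1..l}\<close> matter. Equivariance, like any identity between elements of \<open>D\<^sub>0\<^sup>1\<^sup>,\<^sup>2\<close>, is
  understood almost everywhere.\<close>

definition equivariant ::
  "(real^'n^'n) set \<Rightarrow> (real^'n^'n \<Rightarrow> nat \<Rightarrow> nat) \<Rightarrow> nat \<Rightarrow> (real^'n) set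
    \<Rightarrow> (real^'n \<Rightarrow> nat \<Rightarrow> real) \<Rightarrow> bool" where
  "equivariant G \<phi> l \<Omega> u \<longleftrightarrow>
     (\<forall>g\<in>G. AE x in lebesgue_on \<Omega>. \<forall>i\<in>{1..l}. u (g *v x) i = perm_act (\<phi> g) (u x) i)"

definition H_space ::
  "(real^'n^'n) set \<Rightarrow> (real^'n^'n \<Rightarrow> nat \<Rightarrow> nat) \<Rightarrow> nat \<Rightarrow> (real^'n) set
    \<Rightarrow> (real^'n \<Rightarrow> nat \<Rightarrow> real) set" where
  "H_space G \<phi> l \<Omega> =
     {u. (\<forall>i\<in>{1..l}. (\<lambda>x. u x i) \<in> D12_0 \<Omega>) \<and> equivariant G \<phi> l \<Omega> u}"

definition grad_term :: "(real^'n) set \<Rightarrow> (real^'n \<Rightarrow> nat \<Rightarrow> real) \<Rightarrow> nat \<Rightarrow> real" where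
  "grad_term \<Omega> u i = (LINT x|lebesgue_on \<Omega>. (norm (D12_grad \<Omega> (\<lambda>y. u y i) x))\<^sup>2)"

definition power_term :: "(real^'n) set \<Rightarrow> (real^'n \<Rightarrow> nat \<Rightarrow> real) \<Rightarrow> nat \<Rightarrow> real" where
  "power_term \<Omega> u i = (LINT x|lebesgue_on \<Omega>. \<bar>u x i\<bar> powr crit_exp CARD('n))"

definition coupling_term ::
  "(real^'n) set \<Rightarrow> (real^'n \<Rightarrow> nat \<Rightarrow> real) \<Rightarrow> nat \<Rightarrow> nat \<Rightarrow> real" where
  "coupling_term \<Omega> u i j =
     (LINT x|lebesgue_on \<Omega>. \<bar>u x i\<bar> powr (crit_exp CARD('n) / 2)
                            * \<bar>u x j\<bar> powr (crit_exp CARD('n) / 2))"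

definition J :: "real \<Rightarrow> nat \<Rightarrow> (real^'n) set \<Rightarrow> (real^'n \<Rightarrow> nat \<Rightarrow> real) \<Rightarrow> real" where
  "J \<beta> l \<Omega> u =
     1 / 2 * (\<Sum>i\<in>{1..l}. grad_term \<Omega> u i)
     - 1 / crit_exp CARD('n) * (\<Sum>i\<in>{1..l}. power_term \<Omega> u i)
     - \<beta> / crit_exp CARD('n) * (\<Sum>i\<in>{1..l}. \<Sum>j\<in>{1..l} - {i}. coupling_term \<Omega> u i j)"

text \<open>\<open>\<partial>\<^sub>iJ(u)u\<^sub>i\<close>, the derivative of \<open>J\<close> in the \<open>i\<close>-th component in the direction \<open>u\<^sub>i\<close>.\<close>

definition dJ :: "real \<Rightarrow> nat \<Rightarrow> (real^'n) set \<Rightarrow> (real^'n \<Rightarrow> nat \<Rightarrow> real) \<Rightarrow> nat \<Rightarrow> real" where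
  "dJ \<beta> l \<Omega> u i =
     grad_term \<Omega> u i - power_term \<Omega> u i - \<beta> * (\<Sum>j\<in>{1..l} - {i}. coupling_term \<Omega> u i j)"

definition Nehari ::
  "(real^'n^'n) set \<Rightarrow> (real^'n^'n \<Rightarrow> nat \<Rightarrow> nat) \<Rightarrow> nat \<Rightarrow> real \<Rightarrow> (real^'n) set
    \<Rightarrow> (real^'n \<Rightarrow> nat \<Rightarrow> real) set" where
  "Nehari G \<phi> l \<beta> \<Omega> =
     {u \<in> H_space G \<phi> l \<Omega>.
        \<forall>i\<in>{1..l}. \<not> (AE x in lebesgue_on \<Omega>. u x i = 0) \<and> dJ \<beta> l \<Omega> u i = 0}"

text \<open>An extended real, so that the infimum over an empty Nehari set is \<open>\<infinity>\<close>.\<close>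

definition c_inf ::
  "(real^'n^'n) set \<Rightarrow> (real^'n^'n \<Rightarrow> nat \<Rightarrow> nat) \<Rightarrow> nat \<Rightarrow> real \<Rightarrow> (real^'n) set \<Rightarrow> ereal" where
  "c_inf G \<phi> l \<beta> \<Omega> = (INF u\<in>Nehari G \<phi> l \<beta> \<Omega>. ereal (J \<beta> l \<Omega> u))"

definition least_energy_solution ::
  "(real^'n^'n) set \<Rightarrow> (real^'n^'n \<Rightarrow> nat \<Rightarrow> nat) \<Rightarrow> nat \<Rightarrow> real \<Rightarrow> (real^'n) set
    \<Rightarrow> (real^'n \<Rightarrow> nat \<Rightarrow> real) \<Rightarrow> bool" where
  "least_energy_solution G \<phi> l \<beta> \<Omega> u \<longleftrightarrow>
     u \<in> Nehari G \<phi> l \<beta> \<Omega> \<and> ereal (J \<beta> l \<Omega> u) = c_inf G \<phi> l \<beta> \<Omega>"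

end

theory Submission
imports Defs "HOL-Real_Asymp.Real_Asymp"
begin

text \<open>Extension by zero gives \<open>c(\<real>\<^sup>N) \<le> c(\<Omega>)\<close>. Conversely an element of the Nehari set of \<open>\<real>\<^sup>N\<close> is cut off by an
invariant function, scaled by the critical dilation into a small ball around a fixed point of \<open>G\<close> in \<open>\<Omega>\<close>, and
projected back to the Nehari set; the energy changes arbitrarily little.

If \<open>u\<close> attains \<open>c(\<Omega>) = c(\<real>\<^sup>N)\<close>, its extension by zero is a minimizer on \<open>\<real>\<^sup>N\<close> that vanishes on an open set.
A minimizer satisfies the Euler-Lagrange equation against equivariant variations, hence is bounded (De Giorgi), and
by symmetric criticality its mollifications satisfy the mollified system. As \<open>\<bar>\<Delta>u\<bar> \<le> M \<Sum>\<bar>u\<^sub>j\<bar>\<close>, a Carleman estimate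
with the weights \<open>\<bar>x\<bar>\<^sup>-\<^sup>s\<close> forces \<open>u = 0\<close>, which the Nehari set excludes.\<close>

text \<open>The dilation costs no energy because all three kinds of integrals in J are invariant
  under it. After the cutoff the coefficients of the Nehari equations converge, and as \<beta> < 0
  these equations form a cooperative system for the scaling factors: a zero near (1, ..., 1) is
  found as a supremum, and a supremum inherits the symmetries that equivariance needs. For the
  Euler-Lagrange equation the projection to the Nehari set is never differentiated; minimality is
  played against the maximality of J along rays. Let p be half the critical exponent. For N > 4 it
  is below 2, so |u_j|^p |u_i|^(p-2) u_i is not bounded by a multiple of |u_i| and the equations
  cannot be continued one by one. A bound by |u_j| gives an inequality for the whole vector, which
  the Carleman estimate can absorb. That estimate wants second derivatives, which a weak solution
  need not have; it is therefore applied to mollifications, whose squared L^2 errors are O(r^2) and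
  are removed at fixed s, before s tends to infinity.\<close>

abbreviation BM :: "('a::topological_space \<Rightarrow> 'b::topological_space) set" where "BM \<equiv> borel_measurable borel"
abbreviation nnlb :: "('a::euclidean_space \<Rightarrow> ennreal) \<Rightarrow> ennreal" (binder "NN " 10) where "nnlb f \<equiv> nn_integral lborel f"
abbreviation tends :: "(nat \<Rightarrow> 'a::topological_space) \<Rightarrow> 'a \<Rightarrow> bool" (infixr "~>" 60) where "X ~> L \<equiv> (X \<longlongrightarrow> L) sequentially"

lemmas integrable_dom = Bochner_Integration.integrable_bound
lemmas integrable_plus = Bochner_Integration.integrable_add
lemmas integral_plus = Bochner_Integration.integral_add

section \<open>Smooth functions\<close>

primrec Dk :: "nat => (real => real) => bool" where
 "Dk 0 f \<longleftrightarrow> True"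
| "Dk (Suc k) f \<longleftrightarrow> (\<exists>f'. (\<forall>t. (f has_real_derivative f' t) (at t)) \<and> Dk k f')"

lemma Dk_const: "Dk k (%_. c)"
proof (induction k arbitrary: c)
 case (Suc k) then show ?case by (auto intro!: exI[of _ "%_. 0"])
qed auto

lemma Dk_id: "Dk k (%t. t)"
proof (cases k)
 case (Suc k) then show ?thesis by (auto intro!: exI[of _ "%_. 1"] Dk_const)
qed auto

lemma Dk_Suc_imp: "Dk (Suc k) f ==> Dk k f"
 by (induction k arbitrary: f) auto

lemma Dk_add: "Dk k f ==> Dk k g ==> Dk k (%t. f t + g t)"
proof (induction k arbitrary: f g)
 case (Suc k)
 then obtain f' g' where "\<forall>t. (f has_real_derivative f' t) (at t)" "Dk k f'"
 "\<forall>t. (g has_real_derivative g' t) (at t)" "Dk k g'" by auto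
 then show ?case using Suc.IH
 by (auto intro!: exI[of _ "%t. f' t + g' t"] derivative_intros)
qed auto

lemma Dk_mult: "Dk k f ==> Dk k g ==> Dk k (%t. f t * g t)"
proof (induction k arbitrary: f g)
 case (Suc k)
 have fg: "Dk k f" "Dk k g" using Suc.prems by (simp_all only: Dk_Suc_imp)
 from Suc.prems obtain f' g' where "\<forall>t. (f has_real_derivative f' t) (at t)" "Dk k f'"
 "\<forall>t. (g has_real_derivative g' t) (at t)" "Dk k g'" by auto
 then show ?case using Suc.IH fg
 by (auto intro!: exI[of _ "%t. f' t * g t + g' t * f t"] Dk_add DERIV_mult)
qed auto

lemma Dk_affine: "Dk k f ==> Dk k (%t. f (a * t + b))"
proof (induction k arbitrary: f)
 case (Suc k)
 then obtain f' where f': "\<forall>t. (f has_real_derivative f' t) (at t)" "Dk k f'" by auto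
 have "((%t. f (a * t + b)) has_real_derivative (f' (a * t + b) * a)) (at t)" for t
 by (rule DERIV_chain2[OF f'(1)[rule_format]]) (auto intro!: derivative_eq_intros)
 moreover have "Dk k (%t. f' (a * t + b) * a)"
 using Suc.IH f' by (auto intro!: Dk_mult Dk_const)
 ultimately have "\<exists>f''. (\<forall>t. ((%t. f (a * t + b)) has_real_derivative f'' t) (at t)) \<and> Dk k f''"
 by (intro exI[of _ "%t. f' (a * t + b) * a"]) simp
 then show ?case by simp
qed auto

text \<open>Differentiation maps this family into linear combinations of its members, so one
  induction covers all derivatives of the flat function exp(-1/t). \<open>expm 0\<close> is the
  profile of the bump.\<close>

definition expm :: "nat => real => real" where
 "expm m t = (if t > 0 then (1 / t) ^ m * exp (- (1 / t)) else 0)"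

lemma expm_deriv:
 "(expm m has_real_derivative (expm (m + 2) t - real m * expm (m + 1) t)) (at t)"
proof -
 consider "t > 0" | "t < 0" | "t = 0" by linarith
 then show ?thesis
 proof cases
 case 1
 have "((%t. (1 / t) ^ m * exp (- (1 / t))) has_real_derivative
 ((1 / t) ^ (m + 2) * exp (- (1 / t)) - real m * ((1 / t) ^ (m + 1) * exp (- (1 / t))))) (at t)"
 proof -
 define y where "y = 1 / t"
 have i: "((%t. 1 / t) has_real_derivative - (y ^ 2)) (at t)"
 using 1 by (auto intro!: derivative_eq_intros simp: y_def power2_eq_square)
 have p: "((%t. (1 / t) ^ m) has_real_derivative (real m * (- (y ^ 2) * y ^ (m - 1)))) (at t)"
 using DERIV_power[OF i, of m] by (simp add: y_def)
 have e: "((%t. exp (- (1 / t))) has_real_derivative exp (- y) * - (- (y ^ 2))) (at t)"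
 using DERIV_chain2[OF DERIV_exp DERIV_minus[OF i]] by (simp add: y_def)
 have "real m * (- (y ^ 2) * y ^ (m - 1)) = - real m * y ^ (m + 1)"
 by (cases m) (auto simp: power2_eq_square algebra_simps)
 then have "real m * (- (y ^ 2) * y ^ (m - 1)) * exp (- (1 / t))
 + exp (- y) * - (- (y ^ 2)) * (1 / t) ^ m
 = y ^ (m + 2) * exp (- y) - real m * (y ^ (m + 1) * exp (- y))"
 unfolding y_def[symmetric]
 by (cases m) (simp_all add: power2_eq_square algebra_simps)
 then show ?thesis using DERIV_mult[OF p e] by (simp add: y_def)
 qed
 then have "((%t. (1 / t) ^ m * exp (- (1 / t))) has_real_derivative
 (expm (m + 2) t - real m * expm (m + 1) t)) (at t)"
 using 1 by (simp add: expm_def)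
 moreover have "eventually (%s. s > 0) (nhds t)"
 using 1 eventually_nhds_in_open[of "{0<..}" t] by simp
 ultimately show ?thesis
 by (subst DERIV_cong_ev[OF refl _ refl, of _ "%t. (1 / t) ^ m * exp (- (1 / t))"])
 (auto simp: expm_def elim!: eventually_mono)
 next
 case 2
 have "eventually (%s. s < 0) (nhds t)"
 using 2 eventually_nhds_in_open[of "{..<0}" t] by simp
 then show ?thesis using 2
 by (subst DERIV_cong_ev[OF refl _ refl, of _ "%t. 0"])
 (auto simp: expm_def elim!: eventually_mono)
 next
 \<comment> \<open>At 0 the right difference quotient is t^-(m+1) exp(-1/t), which tends to 0; on
   the left everything vanishes.\<close>
 case 3
 have "((%t. (1 / t) ^ Suc m * exp (- (1 / t))) \<longlongrightarrow> 0) (at_right (0::real))"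
 by real_asymp
 then have R: "((%t. (expm m t - expm m 0) / t) \<longlongrightarrow> 0) (at_right 0)"
 by (rule Lim_transform_eventually)
 (auto simp: eventually_at_filter expm_def field_simps)
 have L: "((%t. (expm m t - expm m 0) / t) \<longlongrightarrow> 0) (at_left 0)"
 by (rule Lim_transform_eventually[OF tendsto_const])
 (auto simp: eventually_at_filter expm_def)
 have "((%t. (expm m t - expm m 0) / t) \<longlongrightarrow> 0) (at 0)"
 using R L filterlim_split_at by blast
 then show ?thesis using 3 by (simp add: has_field_derivative_iff expm_def)
 qed
qed

lemma Dk_expm: "Dk k (expm m)"
proof (induction k arbitrary: m)
 case (Suc k)
 have "Dk k (%t. expm (m + 2) t + (- real m) * expm (m + 1) t)"
 by (intro Dk_add Dk_mult Dk_const Suc.IH)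
 then show ?case
 using expm_deriv[of m] by (auto intro!: exI[of _ "%t. expm (m + 2) t - real m * expm (m + 1) t"])
qed auto

section \<open>C^k functions of several variables and gradients\<close>

lemma Ck_SucI:
 assumes "!!x. (f has_derivative D x) (at x)" "!!v. Ck_on k UNIV (%x. D x v)"
 shows "Ck_on (Suc k) UNIV f"
proof -
 have "frechet_derivative f (at x) = D x" for x
 using frechet_derivative_at[OF assms(1)] by simp
 then show ?thesis using assms by (auto simp: differentiable_on_def differentiable_def)
qed

text \<open>With its converse above, this lets inductions on k work with any family of derivatives
  \<open>D\<close> in place of \<open>frechet_derivative\<close>.\<close>

lemma Ck_SucE:
 assumes "Ck_on (Suc k) UNIV f"
 shows "\<exists>D. (\<forall>x. (f has_derivative D x) (at x)) \<and> (\<forall>v. Ck_on k UNIV (%x. D x v))"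
 using assms frechet_derivative_works
 by (intro exI[of _ "%x. frechet_derivative f (at x)"]) (auto simp: differentiable_on_def)

lemma Ck_Suc_imp: "Ck_on (Suc k) UNIV f ==> Ck_on k UNIV f"
proof (induction k arbitrary: f)
 case 0 then show ?case by (auto simp: differentiable_imp_continuous_on)
qed auto

lemma Ck_const: "Ck_on k UNIV (%_. c)"
proof (induction k arbitrary: c)
 case (Suc k) show ?case
 by (rule Ck_SucI[where D = "%x h. 0"]) (auto simp: Suc)
qed auto

lemma Ck_add: "Ck_on k UNIV f ==> Ck_on k UNIV g ==> Ck_on k UNIV (%x. f x + g x)"
proof (induction k arbitrary: f g)
 case (Suc k)
 obtain D where D: "!!x. (f has_derivative D x) (at x)" "!!v. Ck_on k UNIV (%x. D x v)"
 using Ck_SucE[OF Suc.prems(1)] by blast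
 obtain E where E: "!!x. (g has_derivative E x) (at x)" "!!v. Ck_on k UNIV (%x. E x v)"
 using Ck_SucE[OF Suc.prems(2)] by blast
 show ?case
 by (rule Ck_SucI[where D = "%x h. D x h + E x h"])
 (auto intro!: has_derivative_add D E Suc.IH)
qed (auto intro: continuous_on_add)

lemma Ck_mult: "Ck_on k UNIV f ==> Ck_on k UNIV g ==> Ck_on k UNIV (%x. f x * g x)"
proof (induction k arbitrary: f g)
 case (Suc k)
 obtain D where D: "!!x. (f has_derivative D x) (at x)" "!!v. Ck_on k UNIV (%x. D x v)"
 using Ck_SucE[OF Suc.prems(1)] by blast
 obtain E where E: "!!x. (g has_derivative E x) (at x)" "!!v. Ck_on k UNIV (%x. E x v)"
 using Ck_SucE[OF Suc.prems(2)] by blast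
 show ?case
 by (rule Ck_SucI[where D = "%x h. f x * E x h + D x h * g x"])
 (auto intro!: has_derivative_mult D E Suc.IH Ck_add Ck_Suc_imp[OF Suc.prems(1)]
 Ck_Suc_imp[OF Suc.prems(2)])
qed (auto intro: continuous_on_mult)

lemma Ck_sum:
 "finite A ==> (!!a. a \<in> A ==> Ck_on k UNIV (f a)) ==> Ck_on k UNIV (%x. \<Sum>a\<in>A. f a x)"
 by (induction A rule: finite_induct) (auto intro: Ck_const Ck_add)

lemma Ck_linear: assumes "bounded_linear f" shows "Ck_on k UNIV f"
proof (cases k)
 case (Suc k')
 show ?thesis unfolding Suc
 by (rule Ck_SucI[where D = "%x. f"])
 (auto intro: bounded_linear_imp_has_derivative assms Ck_const)
qed (use assms in \<open>auto simp: linear_continuous_on\<close>)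

text \<open>\<open>Dk 0\<close> says nothing, so the continuity of \<open>H\<close> in the base case
  has to come from one extra order.\<close>

lemma Ck_Dk_compose: "Dk (Suc k) H ==> Ck_on k UNIV f ==> Ck_on k UNIV (%x. H (f x))"
proof (induction k arbitrary: f H)
 case 0
 then obtain H' where "\<forall>t. (H has_real_derivative H' t) (at t)" by auto
 then have "continuous_on UNIV H" using DERIV_continuous_on by blast
 then show ?case using 0(2) continuous_on_compose2[of UNIV H UNIV f] by auto
next
 case (Suc k)
 from Suc.prems(1) obtain H' where H': "!!t. (H has_real_derivative H' t) (at t)" "Dk (Suc k) H'"
 by auto
 obtain D where D: "!!x. (f has_derivative D x) (at x)" "!!v. Ck_on k UNIV (%x. D x v)"
 using Ck_SucE[OF Suc.prems(2)] by blast
 have "((%x. H (f x)) has_derivative (%h. H' (f x) * D x h)) (at x)" for x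
 using has_derivative_compose[OF D(1) H'(1)[unfolded has_field_derivative_def]] by simp
 moreover have "Ck_on k UNIV (%x. H' (f x) * D x v)" for v
 by (rule Ck_mult[OF Suc.IH[OF H'(2) Ck_Suc_imp[OF Suc.prems(2)]] D(2)])
 ultimately show ?case by (rule Ck_SucI[where D = "%x h. H' (f x) * D x h"])
qed

lemma Ck_affine:
 assumes "bounded_linear A"
 shows "Ck_on k UNIV f ==> Ck_on k UNIV (%x. f (A x + b))"
proof (induction k arbitrary: f)
 case 0
 have "continuous_on UNIV (%x. A x + b)"
 using linear_continuous_on[OF assms] by (intro continuous_on_add continuous_on_const)
 then show ?case using continuous_on_compose2[of UNIV f UNIV "%x. A x + b"] 0
 by (simp only: Ck_on.simps) simp
next
 case (Suc k)
 obtain D where D: "!!x. (f has_derivative D x) (at x)" "!!v. Ck_on k UNIV (%x. D x v)"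
 using Ck_SucE[OF Suc.prems(1)] by blast
 have "((%x. A x + b) has_derivative A) (at x)" for x
 using has_derivative_add_const bounded_linear_imp_has_derivative[OF assms] by blast
 then have "((%x. f (A x + b)) has_derivative (%h. D (A x + b) (A h))) (at x)" for x
 by (rule has_derivative_compose[OF _ D(1)])
 then show ?case
 by (intro Ck_SucI[where D = "%x h. D (A x + b) (A h)"] Suc.IH[of "%x. D x _"] D) auto
qed

lemma has_derivative_grad:
 assumes "f differentiable (at x)"
 shows "(f has_derivative (%h. grad f x \<bullet> h)) (at x)"
proof -
 have d: "(f has_derivative frechet_derivative f (at x)) (at x)"
 using assms frechet_derivative_works by blast
 then interpret bounded_linear "frechet_derivative f (at x)" by (rule has_derivative_bounded_linear)
 have "frechet_derivative f (at x) h = grad f x \<bullet> h" for h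
 proof -
 have "frechet_derivative f (at x) h = frechet_derivative f (at x) (\<Sum>i\<in>UNIV. (h $ i) *\<^sub>R axis i 1)"
 using basis_expansion[of h] by (simp add: scalar_mult_eq_scaleR)
 also have "\<dots> = grad f x \<bullet> h"
 by (simp add: sum scaleR inner_vec_def grad_def mult.commute)
 finally show ?thesis .
 qed
 then have "frechet_derivative f (at x) = (%h. grad f x \<bullet> h)" by auto
 with d show ?thesis by simp
qed

lemma grad_eqI:
 assumes "(f has_derivative (%h. v \<bullet> h)) (at x)"
 shows "grad f x = v"
 using frechet_derivative_at[OF assms, symmetric]
 by (simp add: grad_def vec_eq_iff inner_axis)

lemma smooth_differentiable: "smooth_on UNIV f ==> f differentiable (at x)"
 unfolding smooth_on_def using Ck_SucE[of 0 f] by (metis differentiable_def)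

lemma smooth_has_grad: "smooth_on UNIV f ==> (f has_derivative (%h. grad f x \<bullet> h)) (at x)"
 using has_derivative_grad smooth_differentiable by blast

lemma smooth_continuous: "smooth_on UNIV f ==> continuous_on S f"
 using Ck_on.simps(1) continuous_on_subset unfolding smooth_on_def by blast

lemma smooth_deriv: "smooth_on UNIV f ==> smooth_on UNIV (%x. grad f x \<bullet> v)"
 unfolding smooth_on_def
proof
 fix k assume f: "\<forall>k. Ck_on k UNIV f"
 then obtain D where D: "!!x. (f has_derivative D x) (at x)" "!!v. Ck_on k UNIV (%x. D x v)"
 by (metis Ck_SucE)
 have "D x v = grad f x \<bullet> v" for x
 using smooth_has_grad[of f x] f D(1)[of x] has_derivative_unique
 unfolding smooth_on_def by metis
 then show "Ck_on k UNIV (%x. grad f x \<bullet> v)" using D(2)[of v] by simp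
qed

lemma grad_continuous: "smooth_on UNIV f ==> continuous_on S (grad f)"
proof -
 assume f: "smooth_on UNIV f"
 have "continuous_on S (%x. \<chi> i. grad f x \<bullet> axis i 1)"
 by (intro continuous_on_vec_lambda smooth_continuous smooth_deriv f)
 then show ?thesis by (simp add: inner_axis)
qed

lemma smooth_mult: "smooth_on UNIV f ==> smooth_on UNIV g ==> smooth_on UNIV (%x. f x * g x)"
 by (auto simp: smooth_on_def Ck_mult)

lemma smooth_add: "smooth_on UNIV f ==> smooth_on UNIV g ==> smooth_on UNIV (%x. f x + g x)"
 by (auto simp: smooth_on_def Ck_add)

lemma smooth_const: "smooth_on UNIV (%x. c)"
 by (auto simp: smooth_on_def Ck_const)

lemma smooth_cmult: "smooth_on UNIV f ==> smooth_on UNIV (%x. c * f x)"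
 by (intro smooth_mult smooth_const)

lemma smooth_compose: "(!!k. Dk k H) ==> smooth_on UNIV f ==> smooth_on UNIV (%x. H (f x))"
 unfolding smooth_on_def using Ck_Dk_compose by blast

lemma smooth_affine: "bounded_linear A ==> smooth_on UNIV f ==> smooth_on UNIV (%x. f (A x + b))"
 unfolding smooth_on_def using Ck_affine by blast

lemma smooth_norm2: "smooth_on UNIV (%x::real^'n. (norm x)^2)"
proof -
 have "(norm x)^2 = (\<Sum>i\<in>UNIV. (x $ i) * (x $ i))" for x :: "real^'n"
 by (simp add: power2_norm_eq_inner inner_vec_def)
 then show ?thesis
 by (simp add: smooth_on_def, intro allI Ck_sum Ck_mult Ck_linear bounded_linear_vec_nth) auto
qed

section \<open>Test functions\<close>

lemma test_functionsD:
 assumes "f \<in> test_functions \<Omega>"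
 shows "smooth_on UNIV f" "compact (closure {x. f x ~= 0})" "closure {x. f x ~= 0} \<subseteq> \<Omega>"
 using assms by (auto simp: test_functions_def)

lemma test_functionsI:
 assumes "smooth_on UNIV f" "compact K" "K \<subseteq> \<Omega>" "!!x. x \<notin> K ==> f x = 0"
 shows "f \<in> test_functions \<Omega>"
proof -
 have "closure {x. f x ~= 0} \<subseteq> K"
 using assms by (intro closure_minimal compact_imp_closed) auto
 moreover from this have "compact (closure {x. f x ~= 0})"
 using compact_Int_closed[OF assms(2) closed_closure, of "{x. f x ~= 0}"]
 by (simp add: Int_absorb1)
 ultimately show ?thesis using assms by (auto simp: test_functions_def)
qed

lemma test_functions_mono: "\<Omega> \<subseteq> \<Omega>' ==> f \<in> test_functions \<Omega> ==> f \<in> test_functions \<Omega>'"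
 by (auto simp: test_functions_def)

lemma zero_notin_closure: "x \<notin> closure {x. f x ~= 0} ==> f x = 0"
 using closure_subset[of "{x. f x ~= 0}"] by blast

lemma test_functions_add:
 assumes "f \<in> test_functions \<Omega>" "g \<in> test_functions \<Omega>"
 shows "(%x. f x + c * g x) \<in> test_functions \<Omega>"
proof (rule test_functionsI[where K = "closure {x. f x ~= 0} \<union> closure {x. g x ~= 0}"])
 show "f x + c * g x = 0" if "x \<notin> closure {x. f x ~= 0} \<union> closure {x. g x ~= 0}" for x
 using that zero_notin_closure[of x f] zero_notin_closure[of x g] by auto
qed (use test_functionsD[OF assms(1)] test_functionsD[OF assms(2)] in
 \<open>auto intro: smooth_add smooth_cmult\<close>)

lemma test_functions_mult:
 assumes "f \<in> test_functions \<Omega>" "smooth_on UNIV g"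
 shows "(%x. g x * f x) \<in> test_functions \<Omega>"
proof (rule test_functionsI[where K = "closure {x. f x ~= 0}"])
 show "g x * f x = 0" if "x \<notin> closure {x. f x ~= 0}" for x
 using that zero_notin_closure[of x f] by auto
qed (use test_functionsD[OF assms(1)] assms(2) in \<open>auto intro: smooth_mult\<close>)

lemma test_functions_compose:
 assumes "f \<in> test_functions \<Omega>" "!!k. Dk k H" "H 0 = 0"
 shows "(%x. H (f x)) \<in> test_functions \<Omega>"
proof (rule test_functionsI[where K = "closure {x. f x ~= 0}"])
 show "H (f x) = 0" if "x \<notin> closure {x. f x ~= 0}" for x
 using that zero_notin_closure[of x f] assms(3) by auto
qed (use test_functionsD[OF assms(1)] assms(2) in \<open>auto intro: smooth_compose\<close>)

lemma test_functions_affine: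
 fixes A B :: "real^'n => real^'n"
 assumes f: "f \<in> test_functions \<Omega>" and "linear A" "linear B"
 and A: "!!x. B (A x) = x" "!!x. A (B x) = x"
 and "!!x. A x + b \<in> \<Omega> ==> x \<in> \<Omega>'"
 shows "(%x. f (A x + b)) \<in> test_functions \<Omega>'"
proof (rule test_functionsI[where K = "(%y. B (y - b)) ` closure {x. f x ~= 0}"])
 have "continuous_on UNIV B"
 using assms(3) by (simp add: linear_continuous_on linear_linear)
 then have "continuous_on (closure {x. f x ~= 0}) (%y. B (y - b))"
 by (rule continuous_on_compose2) (auto intro!: continuous_intros)
 then show "compact ((%y. B (y - b)) ` closure {x. f x ~= 0})"
 by (intro compact_continuous_image test_functionsD(2)[OF f])
 show "(%y. B (y - b)) ` closure {x. f x ~= 0} \<subseteq> \<Omega>'"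
 using test_functionsD(3)[OF f] A by (auto intro!: assms(6))
 show "f (A x + b) = 0" if "x \<notin> (%y. B (y - b)) ` closure {x. f x ~= 0}" for x
 proof (rule ccontr)
 assume "f (A x + b) ~= 0"
 then have "A x + b \<in> closure {x. f x ~= 0}" using zero_notin_closure[of _ f] by blast
 moreover have "x = B ((A x + b) - b)" by (simp add: A)
 ultimately show False using that by (simp only: image_iff) blast
 qed
qed (use test_functionsD(1)[OF f] assms(2) linear_linear in \<open>auto intro: smooth_affine\<close>)

lemma zero_notin_closure_grad:
 assumes "x \<notin> closure {x. f x ~= 0}"
 shows "f x = 0" "grad f x = 0"
proof -
 show "f x = 0" using assms by (rule zero_notin_closure)
 have "eventually (%y. f y = 0) (nhds x)"
 using assms closure_subset[of "{x. f x ~= 0}"]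
 by (auto simp: eventually_nhds intro!: exI[of _ "- closure {x. f x ~= 0}"])
 then have "eventually (%y. 0 = f y) (at x)"
 by (auto simp: eventually_at_filter elim: eventually_mono)
 then have "(f has_derivative (%h. 0)) (at x)"
 using has_derivative_transform_eventually[OF has_derivative_const, of 0 f x UNIV] \<open>f x = 0\<close> by simp
 then have "(f has_derivative (%h. 0 \<bullet> h)) (at x)" by simp
 then show "grad f x = 0" by (rule grad_eqI)
qed

lemma deriv_test_functions:
 assumes "f \<in> test_functions \<Omega>"
 shows "(%x. grad f x \<bullet> v) \<in> test_functions \<Omega>"
 by (rule test_functionsI[where K = "closure {x. f x ~= 0}"])
 (use test_functionsD[OF assms] in \<open>auto intro: smooth_deriv simp: zero_notin_closure_grad(2)[of _ f]\<close>)

text \<open>The standard bump exp(-1/(1 - |x|^2/r^2)) on the ball of radius r. It is radial, hence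
  invariant under every orthogonal matrix; this keeps cutoffs and mollifications
  equivariant.\<close>

definition bump :: "real => real^'n => real" where
 "bump r x = expm 0 (1 - (norm x)^2 / r\<^sup>2)"

lemma bump_smooth: "smooth_on UNIV (bump r)"
proof -
 have "smooth_on UNIV (%x::real^'n. 1 + (- 1 / r\<^sup>2) * (norm x)^2)"
 by (intro smooth_add smooth_cmult smooth_norm2 smooth_const)
 then have "smooth_on UNIV (%x::real^'n. expm 0 (1 + (- 1 / r\<^sup>2) * (norm x)^2))"
 by (rule smooth_compose[OF Dk_expm])
 then show ?thesis by (simp add: bump_def[abs_def])
qed

lemma bump_pos: "r > 0 ==> norm x < r ==> bump r x > 0"
proof -
 assume "r > 0" "norm x < r"
 then have "(norm x)^2 < r\<^sup>2" by (intro power_strict_mono) auto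
 then show ?thesis using \<open>r > 0\<close> by (simp add: bump_def expm_def)
qed

lemma bump_zero: "r > 0 ==> norm x >= r ==> bump r x = 0"
proof -
 assume "r > 0" "norm x >= r"
 then have "r\<^sup>2 <= (norm x)^2" by (intro power_mono) auto
 then show ?thesis using \<open>r > 0\<close> by (auto simp: bump_def expm_def not_less)
qed

lemma bump_nonneg: "bump r x >= 0" and bump_le_1: "bump r x <= 1"
 by (auto simp: bump_def expm_def)

lemma bump_test: "r > 0 ==> bump r \<in> test_functions UNIV"
 by (rule test_functionsI[where K = "cball 0 r"]) (auto intro: bump_smooth bump_zero)

lemma norm_orthogonal_matrix_mult: "orthogonal_matrix g ==> norm (g *v x) = norm (x::real^'n)"
 using orthogonal_transformation_matrix[of "(*v) g"]
 by (simp add: orthogonal_transformation_norm)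

lemma bump_orthogonal: "orthogonal_matrix g ==> bump r (g *v x) = bump r x"
 by (simp add: bump_def norm_orthogonal_matrix_mult)

section \<open>Lebesgue measure\<close>

definition mp :: "(real^'n => real^'n) => bool" where
 "mp T \<longleftrightarrow> T \<in> BM \<and> distr lborel borel T = lborel"

lemma mp_nn:
 assumes "mp T" "f \<in> BM"
 shows "(NN x. f (T x)) = (NN x. f x)"
 using assms nn_integral_distr[of T lborel borel f] by (simp add: mp_def)

lemma mp_integral:
 fixes f :: "_ => 'b::{banach, second_countable_topology}"
 assumes "mp T" "f \<in> BM"
 shows "(LBINT x. f (T x)) = (LBINT x. f x)"
 using assms integral_distr[of T lborel borel f] by (simp add: mp_def)

lemma mp_integrable:
 fixes f :: "_ => 'b::{banach, second_countable_topology}"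
 assumes "mp T" "f \<in> BM"
 shows "integrable lborel (%x. f (T x)) \<longleftrightarrow> integrable lborel f"
 using assms integrable_distr_eq[of T lborel borel f] by (simp add: mp_def)

lemma mp_AE:
 assumes "mp T" "AE x in lborel. P x"
 shows "AE x in lborel. P (T x)"
proof -
 obtain N where N: "N \<in> null_sets lborel" "{x. \<not> P x} \<subseteq> N"
 using assms(2) by (auto simp: eventually_ae_filter)
 have T: "T \<in> measurable lborel borel" using assms(1) by (simp add: mp_def)
 have "AE x in distr lborel borel T. x \<notin> N"
 using assms(1) N(1) by (simp add: mp_def AE_not_in)
 then have "AE x in lborel. T x \<notin> N"
 using N(1) by (subst (asm) AE_distr_iff[OF T]) (auto simp: null_sets_def)
 then show ?thesis using N(2) by (auto elim!: eventually_mono)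
qed

lemma mp_translate: "mp (%x. x + a)"
proof -
 have "(+) a = (%x. x + a)" by (auto simp: add.commute)
 then show ?thesis using lborel_distr_plus[of a] by (simp add: mp_def)
qed

lemma mp_reflect: "mp (%x. a - x)"
proof -
 have "lborel = density (distr lborel borel (%x. a - x)) (%_. 1)"
 using lborel_affine[of "-1" a] by simp
 also have "\<dots> = distr lborel borel (%x. a - x)" by (simp add: density_1)
 finally show ?thesis by (simp add: mp_def)
qed

lemma nn_integral_scale:
 fixes f :: "real^'n => ennreal"
 assumes [measurable]: "f \<in> BM" and "c > 0"
 shows "(NN x. f x) = ennreal (c ^ CARD('n)) * (NN x. f (t + c *\<^sub>R x))"
proof -
 have *: "lborel = density (distr lborel borel (%x. t + c *\<^sub>R x)) (%_. \<bar>c\<bar> ^ DIM(real^'n))"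
 using lborel_affine[of c t] assms by simp
 show ?thesis
 by (subst *) (use assms(2) in \<open>auto simp: nn_integral_density nn_integral_distr nn_integral_cmult
 ennreal_power\<close>)
qed

lemma AE_scale:
 fixes t :: "real^'n"
 assumes "c > 0" "AE x in lborel. P x"
 shows "AE x in lborel. P (t + c *\<^sub>R x)"
proof -
 obtain N where N: "N \<in> null_sets lborel" "{x. \<not> P x} \<subseteq> N"
 using assms(2) by (auto simp: eventually_ae_filter)
 then have N': "N \<in> sets borel" by (auto simp: null_sets_def)
 have "0 = (NN x. indicator N x)" using N by (auto simp: null_sets_def)
 also have "\<dots> = ennreal (c ^ CARD('n)) * (NN x. indicator N (t + c *\<^sub>R x))"
 using N' assms by (intro nn_integral_scale) auto
 finally have "(NN x. indicator N (t + c *\<^sub>R x)) = 0" using assms by auto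
 then have "AE x in lborel. indicator N (t + c *\<^sub>R x) = (0::ennreal)"
 using N' by (subst (asm) nn_integral_0_iff_AE) auto
 then show ?thesis using N(2) by (auto elim!: eventually_mono simp: indicator_def split: if_splits)
qed

lemma orth_measurable [measurable]: "((*v) (g::real^'n^'m)) \<in> BM"
 by (intro borel_measurable_continuous_onI matrix_vector_mult_linear_continuous_on)

text \<open>Uniqueness of Haar measure in disguise: for nonnegative \<open>f\<close> and \<open>h\<close>,
 \<open>\<integral> f \<circ> g * \<integral> h = \<integral> h \<circ> g * \<integral> f\<close> by translation invariance; take for \<open>h\<close> the indicator
 of the unit ball.\<close>

lemma mp_orthogonal:
 fixes g :: "real^'n^'n"
 assumes g: "orthogonal_matrix g"
 shows "mp ((*v) g)"
proof -
 have key: "(NN x. f (g *v x)) = (NN x. f x)"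
 if [measurable]: "f \<in> BM" for f :: "real^'n => ennreal"
 proof -
 define h :: "real^'n => ennreal" where "h = indicator (ball 0 1)"
 have [measurable]: "h \<in> BM"
 unfolding h_def by (rule borel_measurable_indicator) simp
 have hg: "h (g *v x) = h x" for x
 using norm_orthogonal_matrix_mult[OF g] by (simp add: h_def indicator_def)
 have inv: "g *v (transpose g *v y) = y" for y
 proof -
 have "g *v (transpose g *v y) = (g ** transpose g) *v y"
 by (simp only: matrix_vector_mul_assoc)
 then show ?thesis using g by (simp add: orthogonal_matrix_def)
 qed
 have "(NN x. f (g *v x)) * (NN y. h y) = (NN x. (NN y. f (g *v x) * h y))"
 by (simp add: nn_integral_cmult nn_integral_multc)
 also have "\<dots> = (NN x. (NN y. f (g *v x) * h (y + g *v x)))"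
 proof (rule nn_integral_cong)
 fix x
 show "(NN y. f (g *v x) * h y) = (NN y. f (g *v x) * h (y + g *v x))"
 by (rule mp_nn[OF mp_translate, symmetric, of "%y. f (g *v x) * h y"]) measurable
 qed
 \<comment> \<open>After Fubini, x is shifted by the preimage of -y under g, which moves the
   translation from \<open>h\<close> to \<open>f\<close>; a reflection in y then removes it.\<close>
 also have "\<dots> = (NN y. (NN x. f (g *v x) * h (y + g *v x)))"
 by (rule lborel_pair.Fubini') measurable
 also have "\<dots> = (NN y. (NN x. f (g *v (x + transpose g *v (- y))) * h (y + g *v (x + transpose g *v (- y)))))"
 proof (rule nn_integral_cong)
 fix y
 show "(NN x. f (g *v x) * h (y + g *v x))
 = (NN x. f (g *v (x + transpose g *v (- y))) * h (y + g *v (x + transpose g *v (- y))))"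
 by (rule mp_nn[OF mp_translate, symmetric, of "%x. f (g *v x) * h (y + g *v x)"]) measurable
 qed
 also have "\<dots> = (NN y. (NN x. f (g *v x - y) * h (g *v x)))"
 by (simp only: matrix_vector_right_distrib inv) simp
 also have "\<dots> = (NN x. (NN y. f (g *v x - y) * h (g *v x)))"
 by (rule lborel_pair.Fubini') measurable
 also have "\<dots> = (NN x. (NN y. f y * h (g *v x)))"
 proof (rule nn_integral_cong)
 fix x
 show "(NN y. f (g *v x - y) * h (g *v x)) = (NN y. f y * h (g *v x))"
 by (rule mp_nn[OF mp_reflect, of "%y. f y * h (g *v x)"]) measurable
 qed
 also have "\<dots> = (NN y. f y) * (NN x. h x)"
 by (simp add: nn_integral_cmult nn_integral_multc hg)
 finally have eq: "(NN x. f (g *v x)) * (NN y. h y)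
 = (NN y. f y) * (NN x. h x)" .
 have H: "(NN y. h y) = emeasure lborel (ball 0 1 :: (real^'n) set)"
 by (simp add: h_def)
 have fin: "(NN y. h y) < \<infinity>"
 unfolding H using emeasure_lborel_ball_finite[of "0::real^'n" 1] by simp
 have pos: "(NN y. h y) ~= 0"
 unfolding H using content_ball_pos[of 1 "0::real^'n"] by (auto simp: measure_def)
 have "(NN x. f (g *v x)) * (NN y. h y) / (NN y. h y)
 = (NN y. f y) * (NN x. h x) / (NN y. h y)"
 using eq by simp
 then show ?thesis using fin pos by (simp add: ennreal_mult_divide_eq)
 qed
 have "distr lborel borel ((*v) g) = lborel"
 proof (rule measure_eqI)
 fix A assume "A \<in> sets (distr lborel borel ((*v) g))"
 then have [measurable]: "A \<in> sets borel" by simp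
 have "emeasure (distr lborel borel ((*v) g)) A = (\<integral>\<^sup>+x. indicator A x \<partial>distr lborel borel ((*v) g))"
 by simp
 also have "\<dots> = (NN x. indicator A (g *v x))"
 by (subst nn_integral_distr) auto
 also have "\<dots> = emeasure lborel A" by (subst key) auto
 finally show "emeasure (distr lborel borel ((*v) g)) A = emeasure lborel A" .
 qed simp
 then show ?thesis by (simp add: mp_def)
qed

lemma compact_support_bounded:
 fixes f :: "real^'n => 'b::real_normed_vector"
 assumes "continuous_on UNIV f" "!!x. norm x > R ==> f x = 0"
 shows "\<exists>M\<ge>0. \<forall>x. norm (f x) <= M"
proof -
 have "compact (f ` cball 0 R)"
 using assms(1) continuous_on_subset by (intro compact_continuous_image) auto
 then obtain M where M: "\<forall>y\<in>f ` cball 0 R. norm y <= M"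
 using compact_imp_bounded bounded_iff by blast
 show ?thesis
 proof (intro exI[of _ "\<bar>M\<bar>"] conjI allI)
 show "norm (f x) <= \<bar>M\<bar>" for x
 proof (cases "norm x <= R")
 case True
 then have "norm (f x) <= M" using M by (simp add: image_iff)
 then show ?thesis by linarith
 qed (use assms(2)[of x] in auto)
 qed simp
qed

lemma emeasure_cball_finite: "emeasure lborel (cball a r :: (real^'n) set) < \<infinity>"
 using emeasure_lborel_cball_finite by auto

lemma integrable_bounded_support:
 fixes f :: "real^'n => real"
 assumes [measurable]: "f \<in> BM"
 and "!!x. \<bar>f x\<bar> <= M" "!!x. norm x > R ==> f x = 0"
 shows "integrable lborel f"
proof -
 have "integrable lborel (%x. M * indicator (cball (0::real^'n) R) x :: real)"
 using emeasure_cball_finite[of "0::real^'n" R] by (intro integrable_mult_right) (auto simp: integrable_indicator_iff)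
 then show ?thesis
 proof (rule integrable_dom)
 show "AE x in lborel. norm (f x) <= norm (M * indicator (cball 0 R) x)"
 proof (rule AE_I2)
 fix x show "norm (f x) <= norm (M * indicator (cball 0 R) x)"
 using assms(2)[of x] assms(3)[of x] by (cases "norm x <= R") (auto simp: indicator_def)
 qed
 qed simp
qed

lemma integrable_continuous_support:
 fixes f :: "real^'n => real"
 assumes "continuous_on UNIV f" "!!x. norm x > R ==> f x = 0"
 shows "integrable lborel f"
proof -
 obtain M where "\<forall>x. norm (f x) <= M" using compact_support_bounded[OF assms] by auto
 then show ?thesis using assms
 by (intro integrable_bounded_support[of f M R]) (auto intro: borel_measurable_continuous_onI)
qed

text \<open>Difference quotients integrate to zero by translation invariance.\<close>

lemma integral_directional_derivative:
 fixes f :: "real^'n => real"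
 assumes d: "!!x. (f has_derivative f' x) (at x)" and c: "continuous_on UNIV (%x. f' x v)"
 and s: "!!x. norm x > R ==> f x = 0" "!!x. norm x > R ==> f' x v = 0"
 shows "(LBINT x. f' x v) = 0"
proof -
 have cf: "continuous_on UNIV f"
 using d by (meson has_derivative_continuous continuous_at_imp_continuous_on)
 then have [measurable]: "f \<in> BM" by (rule borel_measurable_continuous_onI)
 have [measurable]: "(%x. f' x v) \<in> BM"
 using c by (rule borel_measurable_continuous_onI)
 obtain M where M: "!!x. \<bar>f' x v\<bar> <= M" and "M >= 0"
 using compact_support_bounded[of "%x. f' x v" R, OF c s(2)] by auto
 have fi: "integrable lborel f" using integrable_continuous_support[OF cf s(1)] .
 define q where "q k x = real (Suc k) * (f (x + (1 / real (Suc k)) *\<^sub>R v) - f x)" for k x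
 have int0: "(LBINT x. q k x) = 0" for k
 proof -
 have "integrable lborel (%x. f (x + (1 / real (Suc k)) *\<^sub>R v))"
 using mp_integrable[OF mp_translate, of f] fi by simp
 then have "(LBINT x. q k x)
 = real (Suc k) * ((LBINT x. f (x + (1 / real (Suc k)) *\<^sub>R v)) - (LBINT x. f x))"
 unfolding q_def using fi by simp
 then show ?thesis using mp_integral[OF mp_translate, of f] by simp
 qed
 have line: "((%t. f (x + t *\<^sub>R v)) has_real_derivative f' (x + t *\<^sub>R v) v) (at t)" for x t
 proof -
 have "((%t. x + t *\<^sub>R v) has_derivative (%h. h *\<^sub>R v)) (at t)"
 by (auto intro!: derivative_eq_intros)
 from has_derivative_compose[OF this d]
 have "((%t. f (x + t *\<^sub>R v)) has_derivative (%h. f' (x + t *\<^sub>R v) (h *\<^sub>R v))) (at t)" .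
 moreover have "f' (x + t *\<^sub>R v) (h *\<^sub>R v) = f' (x + t *\<^sub>R v) v * h" for h
 using has_derivative_bounded_linear[OF d] by (simp add: linear_simps)
 ultimately show ?thesis by (simp add: has_field_derivative_def)
 qed
 have "(%k. (LBINT x. q k x)) ~> (LBINT x. f' x v)"
 \<comment> \<open>By the mean value theorem the difference quotients are values of the derivative,
   so M bounds them; steps of length at most |v| enlarge the support to radius R + |v|.\<close>
 proof (rule integral_dominated_convergence[where w = "%x. M * indicator (cball 0 (R + norm v)) x"])
 show "integrable lborel (%x. M * indicator (cball (0::real^'n) (R + norm v)) x :: real)"
 using emeasure_cball_finite[of "0::real^'n" "R + norm v"]
 by (intro integrable_mult_right) (auto simp: integrable_indicator_iff)
 show "AE x in lborel. (%k. q k x) ~> f' x v"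
 proof (rule AE_I2)
 fix x
 have "((%h. (f (x + h *\<^sub>R v) - f x) / h) \<longlongrightarrow> f' x v) (at 0)"
 using line[of x 0] by (simp add: has_field_derivative_iff)
 moreover have "filterlim (%k. 1 / real (Suc k)) (at 0) sequentially"
 by (rule filterlim_atI) (use LIMSEQ_inverse_real_of_nat in \<open>auto simp: inverse_eq_divide\<close>)
 ultimately have "((%k. (f (x + (1 / real (Suc k)) *\<^sub>R v) - f x) / (1 / real (Suc k))) \<longlongrightarrow> f' x v) sequentially"
 by (rule filterlim_compose)
 then show "(%k. q k x) ~> f' x v" by (simp add: q_def mult.commute del: of_nat_Suc)
 qed
 show "AE x in lborel. norm (q k x) <= M * indicator (cball 0 (R + norm v)) x" for k
 proof (rule AE_I2)
 fix x :: "real^'n"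
 let ?h = "1 / real (Suc k)"
 have h: "0 < ?h" "?h <= 1" by auto
 show "norm (q k x) <= M * indicator (cball 0 (R + norm v)) x"
 proof (cases "norm x <= R + norm v")
 case True
 obtain z where "f (x + ?h *\<^sub>R v) - f (x + 0 *\<^sub>R v) = (?h - 0) * f' (x + z *\<^sub>R v) v"
 using MVT2[OF h(1), of "%t. f (x + t *\<^sub>R v)" "%t. f' (x + t *\<^sub>R v) v"] line by blast
 then have "q k x = f' (x + z *\<^sub>R v) v" by (simp add: q_def)
 then show ?thesis using M True by simp
 next
 case False
 have "norm (?h *\<^sub>R v) = ?h * norm v" by simp
 also have "\<dots> <= norm v" using h by (intro mult_left_le_one_le) auto
 finally have "norm (?h *\<^sub>R v) <= norm v" .
 then have "norm (x + ?h *\<^sub>R v) > R" using False norm_diff_ineq[of x "?h *\<^sub>R v"] by linarith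
 moreover have "norm x > R" using False norm_ge_zero[of v] by linarith
 ultimately show ?thesis using s(1) False by (simp add: q_def)
 qed
 qed
 qed (auto simp: q_def)
 then show ?thesis using int0 by (simp add: LIMSEQ_const_iff)
qed

section \<open>Convolution\<close>

definition locint :: "(real^'n => real) => bool" where
 "locint u \<longleftrightarrow> u \<in> BM \<and>
 (\<forall>R. integrable lborel (%y. indicator (cball 0 R) y * u y))"

definition conv :: "(real^'n => real) => (real^'n => real) => real^'n => real" where
 "conv k u x = (LBINT y. k (x - y) * u y)"

lemma locint_measurable: "locint u ==> u \<in> BM"
 by (simp add: locint_def)

lemma locint_integrable_mult:
 assumes u: "locint u" and [measurable]: "k \<in> BM"
 and "!!z. \<bar>k z\<bar> <= M" "!!z. norm z > r ==> k z = 0"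
 shows "integrable lborel (%y. k y * u y)"
proof -
 have [measurable]: "u \<in> BM" using u by (rule locint_measurable)
 have "integrable lborel (%y. M * (indicator (cball 0 r) y * u y))"
 using u by (simp add: locint_def)
 then show ?thesis
 proof (rule integrable_dom)
 show "AE y in lborel. norm (k y * u y) <= norm (M * (indicator (cball 0 r) y * u y))"
 proof (rule AE_I2)
 fix y
 have "\<bar>k y\<bar> <= \<bar>M\<bar>" using assms(3)[of y] by linarith
 then show "norm (k y * u y) <= norm (M * (indicator (cball 0 r) y * u y))"
 using assms(4)[of y] by (cases "norm y <= r") (auto simp: abs_mult intro: mult_right_mono)
 qed
 qed simp
qed

lemma conv_integrable:
 assumes "locint u" and [measurable]: "k \<in> BM"
 and "!!z. \<bar>k z\<bar> <= M" "!!z. norm z > r ==> k z = 0"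
 shows "integrable lborel (%y. k (x - y) * u y)"
proof (rule locint_integrable_mult[OF assms(1), of _ M "norm x + r"])
 show "k (x - z) = 0" if "norm z > norm x + r" for z
 using that norm_triangle_ineq2[of z x] by (intro assms(4)) (simp add: norm_minus_commute)
qed (use assms in auto)

lemma locint_integrable: "integrable lborel u ==> locint u"
 by (auto simp: locint_def intro!: integrable_real_mult_indicator integrable_mult_indicator[where 'b = real, simplified])

lemma test_measurable [measurable_dest]: "k \<in> test_functions \<Omega> ==> k \<in> BM"
 by (intro borel_measurable_continuous_onI smooth_continuous test_functionsD(1))

lemma test_grad_measurable: "k \<in> test_functions \<Omega> ==> grad k \<in> BM"
 by (intro borel_measurable_continuous_onI grad_continuous test_functionsD(1))

lemma test_support:
 assumes "k \<in> test_functions \<Omega>"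
 shows "\<exists>r>0. \<forall>z. norm z > r --> k z = 0 \<and> grad k z = 0"
proof -
 obtain r where r: "r > 0" "\<forall>z\<in>closure {x. k x ~= 0}. norm z <= r"
 using test_functionsD(2)[OF assms] compact_imp_bounded bounded_pos by blast
 have "k z = 0 \<and> grad k z = 0" if "norm z > r" for z
 using r(2) that zero_notin_closure_grad[of z k] by force
 then show ?thesis using r(1) by blast
qed

lemma test_bounds:
 assumes "k \<in> test_functions \<Omega>"
 shows "\<exists>r M. r > 0 \<and> M >= 0 \<and> (\<forall>z. norm z > r --> k z = 0 \<and> grad k z = 0) \<and>
 (\<forall>z. \<bar>k z\<bar> <= M \<and> norm (grad k z) <= M)"
proof -
 obtain r where r: "r > 0" "!!z. norm z > r ==> k z = 0" "!!z. norm z > r ==> grad k z = 0"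
 using test_support[OF assms] by blast
 obtain A where A: "A >= 0" "!!z. norm (k z) <= A"
 using compact_support_bounded[of k r] smooth_continuous test_functionsD(1)[OF assms] r by blast
 obtain B where B: "B >= 0" "!!z. norm (grad k z) <= B"
 using compact_support_bounded[of "grad k" r] grad_continuous test_functionsD(1)[OF assms] r by blast
 have "\<bar>k z\<bar> <= A + B \<and> norm (grad k z) <= A + B" for z
 using A(1) A(2)[of z] B(1) B(2)[of z] by auto
 then show ?thesis using r A B by (intro exI[of _ r] exI[of _ "A + B"]) auto
qed

lemma conv_integrable_test:
 assumes "locint u" "k \<in> test_functions \<Omega>"
 shows "integrable lborel (%y. k (x - y) * u y)"
 and "integrable lborel (%y. (grad k (x - y) \<bullet> v) * u y)"
proof -
 have *: "integrable lborel (%y. k (x - y) * u y)" if "k \<in> test_functions \<Omega>" for k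
 using conv_integrable[OF assms(1)] test_bounds[OF that] test_measurable[OF that] by metis
 show "integrable lborel (%y. k (x - y) * u y)" by (rule *) fact
 show "integrable lborel (%y. (grad k (x - y) \<bullet> v) * u y)"
 using *[OF deriv_test_functions[OF assms(2), of v]] .
qed

text \<open>The gradient is continuous with compact support, hence uniformly continuous, and the
  mean value theorem makes the Taylor remainder small uniformly in z. This uniformity lets the
  derivative pass under a convolution integral.\<close>

lemma test_taylor:
 assumes k: "k \<in> test_functions \<Omega>" and "e > 0"
 shows "\<exists>d>0. \<forall>z h. norm h < d --> \<bar>k (z + h) - k z - grad k z \<bullet> h\<bar> <= e * norm h"
proof -
 obtain r where r: "r > 0" "!!z. norm z > r ==> k z = 0" "!!z. norm z > r ==> grad k z = 0"
 using test_support[OF k] by blast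
 \<comment> \<open>With |h| < 1, either z and z + h both lie in this larger ball or both lie outside
   the support.\<close>
 have "uniformly_continuous_on (cball 0 (r + 2)) (grad k)"
 by (intro compact_uniformly_continuous grad_continuous test_functionsD(1)[OF k]) simp
 then obtain d where d: "d > 0"
 "!!z w. z \<in> cball 0 (r + 2) ==> w \<in> cball 0 (r + 2) ==> dist w z < d ==> dist (grad k w) (grad k z) < e"
 using \<open>e > 0\<close> unfolding uniformly_continuous_on_def by metis
 have gd: "norm (grad k (z + h) - grad k z) <= e" if "norm h < min d 1" for z h
 proof (cases "norm z <= r + 1")
 case True
 moreover have "norm (z + h) <= r + 2"
 using True that norm_triangle_ineq[of z h] by linarith
 ultimately show ?thesis using d(2)[of z "z + h"] that
 by (simp add: mem_cball_0 del: mem_cball) (simp add: dist_norm less_imp_le)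
 next
 case False
 then have "norm (z + h) > r" using that norm_diff_ineq[of z h] by linarith
 then show ?thesis using r(3)[of z] r(3)[of "z + h"] False \<open>e > 0\<close> by simp
 qed
 have "\<bar>k (z + h) - k z - grad k z \<bullet> h\<bar> <= e * norm h" if h: "norm h < min d 1" for z h
 proof -
 define f where "f t = k (z + t *\<^sub>R h) - t * (grad k z \<bullet> h)" for t :: real
 have "((%t. k (z + t *\<^sub>R h)) has_derivative (%s. grad k (z + t *\<^sub>R h) \<bullet> (s *\<^sub>R h))) (at t)" for t
 by (rule has_derivative_compose[OF _ smooth_has_grad[OF test_functionsD(1)[OF k]], of "%t. z + t *\<^sub>R h" "%s. s *\<^sub>R h"])
 (auto intro!: derivative_eq_intros)
 then have "((%t. k (z + t *\<^sub>R h)) has_real_derivative (grad k (z + t *\<^sub>R h) \<bullet> h)) (at t)" for t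
 proof -
 have "(%s. grad k (z + t *\<^sub>R h) \<bullet> (s *\<^sub>R h)) = (*) (grad k (z + t *\<^sub>R h) \<bullet> h)" by auto
 then show ?thesis using \<open>!!t. (_ has_derivative _) (at t)\<close>[of t]
 by (simp only: has_field_derivative_def)
 qed
 then have df: "(f has_real_derivative (grad k (z + t *\<^sub>R h) \<bullet> h - grad k z \<bullet> h)) (at t)" for t
 unfolding f_def by (auto intro!: derivative_eq_intros)
 obtain t where t: "0 < t" "t < 1" "f 1 - f 0 = (1 - 0) * (grad k (z + t *\<^sub>R h) \<bullet> h - grad k z \<bullet> h)"
 using MVT2[of 0 1 f, OF _ df] by auto
 have "norm (t *\<^sub>R h) < min d 1"
 proof -
 have "norm (t *\<^sub>R h) = t * norm h" using t by simp
 also have "\<dots> <= norm h" using t by (intro mult_left_le_one_le) auto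
 finally show ?thesis using h by linarith
 qed
 have "\<bar>f 1 - f 0\<bar> = \<bar>(grad k (z + t *\<^sub>R h) - grad k z) \<bullet> h\<bar>"
 using t(3) by (simp add: inner_diff_left)
 also have "\<dots> <= norm (grad k (z + t *\<^sub>R h) - grad k z) * norm h" by (rule Cauchy_Schwarz_ineq2)
 also have "\<dots> <= e * norm h" by (rule mult_right_mono[OF gd]) (use \<open>norm (t *\<^sub>R h) < min d 1\<close> in auto)
 finally show ?thesis by (simp add: f_def)
 qed
 then show ?thesis using d(1) by (intro exI[of _ "min d 1"]) auto
qed

lemma conv_linear:
 assumes "locint u" "k \<in> test_functions \<Omega>"
 shows "conv (%z. grad k z \<bullet> h) u x = (LBINT y. u y *\<^sub>R grad k (x - y)) \<bullet> h"
proof -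
 have "integrable lborel (%y. u y *\<^sub>R grad k (x - y))"
 proof -
 have "integrable lborel (%y. \<Sum>b\<in>Basis. ((grad k (x - y) \<bullet> b) * u y) *\<^sub>R b)"
 by (intro Bochner_Integration.integrable_sum integrable_scaleR_left conv_integrable_test(2)[OF assms])
 moreover have "(\<Sum>b\<in>Basis. ((grad k (x - y) \<bullet> b) * u y) *\<^sub>R b) = u y *\<^sub>R grad k (x - y)" for y
 using euclidean_representation[of "u y *\<^sub>R grad k (x - y)"] by (simp add: mult.commute)
 ultimately show ?thesis by simp
 qed
 from integral_inner_left[OF this, of h] show ?thesis
 by (simp add: conv_def mult.commute)
qed

text \<open>The derivative falls on the kernel, so local integrability of u is enough.\<close>

lemma conv_has_derivative:
 assumes u: "locint u" and k: "k \<in> test_functions \<Omega>"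
 shows "(conv k u has_derivative (%h. conv (%z. grad k z \<bullet> h) u x)) (at x)"
proof -
 have [measurable]: "u \<in> BM" using u by (rule locint_measurable)
 have bl: "bounded_linear (%h. conv (%z. grad k z \<bullet> h) u x)"
 unfolding conv_linear[OF u k] by (rule bounded_linear_inner_right)
 obtain r where r: "r > 0" "!!z. norm z > r ==> k z = 0" "!!z. norm z > r ==> grad k z = 0"
 using test_support[OF k] by blast
 \<comment> \<open>The L^1 norm of u on a ball containing the supports of all kernels centred within
   distance 1 of x; dividing by I + 1 below avoids a zero denominator.\<close>
 define I where "I = (LBINT y. \<bar>indicator (cball 0 (norm x + r + 1)) y * u y\<bar>)"
 have Iint: "integrable lborel (%y. \<bar>indicator (cball 0 (norm x + r + 1)) y * u y\<bar>)"
 using u by (auto simp: locint_def intro!: integrable_abs)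
 have "I >= 0" unfolding I_def by (rule integral_nonneg_AE) auto
 show ?thesis unfolding has_derivative_at_alt
 proof (intro conjI bl allI impI)
 fix e :: real assume "e > 0"
 then have e': "e / (I + 1) > 0" using \<open>I >= 0\<close> by simp
 obtain d where d: "d > 0"
 "!!z h. norm h < d ==> \<bar>k (z + h) - k z - grad k z \<bullet> h\<bar> <= e / (I + 1) * norm h"
 using test_taylor[OF k e'] by blast
 show "\<exists>d>0. \<forall>y. norm (y - x) < d -->
 norm (conv k u y - conv k u x - conv (%z. grad k z \<bullet> (y - x)) u x) <= e * norm (y - x)"
 proof (intro exI[of _ "min d 1"] conjI allI impI)
 fix y assume y: "norm (y - x) < min d 1"
 define h where "h = y - x"
 have yh: "y = x + h" by (simp add: h_def)
 define K where "K w = k (x + h - w) - k (x - w) - grad k (x - w) \<bullet> h" for w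
 have "conv k u y - conv k u x - conv (%z. grad k z \<bullet> h) u x = (LBINT w. K w * u w)"
 unfolding conv_def yh K_def using conv_integrable_test[OF u k]
 by (simp add: left_diff_distrib)
 also have "norm \<dots> <= (LBINT w. e / (I + 1) * norm h * \<bar>indicator (cball 0 (norm x + r + 1)) w * u w\<bar>)"
 proof (rule order_trans[OF integral_norm_bound integral_mono])
 show "integrable lborel (%w. norm (K w * u w))"
 by (rule integrable_norm)
 (use conv_integrable_test[OF u k] in \<open>simp add: K_def left_diff_distrib\<close>)
 show "integrable lborel (%w. e / (I + 1) * norm h * \<bar>indicator (cball 0 (norm x + r + 1)) w * u w\<bar>)"
 using Iint by (rule integrable_mult_right)
 fix w
 show "norm (K w * u w) <= e / (I + 1) * norm h * \<bar>indicator (cball 0 (norm x + r + 1)) w * u w\<bar>"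
 proof (cases "norm w <= norm x + r + 1")
 case True
 have "\<bar>K w\<bar> <= e / (I + 1) * norm h"
 using d(2)[of h "x - w"] y by (simp add: K_def h_def algebra_simps)
 from mult_right_mono[OF this abs_ge_zero[of "u w"]]
 show ?thesis using True by (simp add: abs_mult)
 next
 case False
 have "norm (x - w) > r" using False norm_triangle_ineq2[of w x] by (simp add: norm_minus_commute)
 moreover have "norm (x + h - w) > r"
 proof -
 have "norm w <= norm (x + h - w) + norm x + norm h"
 using norm_triangle_ineq4[of "x + h" "x + h - w"] norm_triangle_ineq[of x h] by simp
 then show ?thesis using False y by (simp add: h_def)
 qed
 ultimately have "K w = 0" by (simp add: K_def r)
 then show ?thesis using False by simp
 qed
 qed
 also have "\<dots> = e / (I + 1) * norm h * I" by (simp add: I_def)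
 also have "\<dots> <= e * norm h"
 proof -
 have "e * I <= e * (I + 1)" using \<open>e > 0\<close> by simp
 then have "e / (I + 1) * I <= e" using \<open>I >= 0\<close> by (simp add: divide_le_eq)
 then show ?thesis using mult_right_mono[of "e / (I + 1) * I" e "norm h"] by (simp add: mult_ac)
 qed
 finally show "norm (conv k u y - conv k u x - conv (%z. grad k z \<bullet> (y - x)) u x) <= e * norm (y - x)"
 by (simp add: h_def)
 qed (use d(1) in simp)
 qed
qed

text \<open>A derivative of the convolution is a convolution with another test function, so the
  induction runs over all kernels at once.\<close>

lemma conv_smooth:
 assumes u: "locint u" and k: "k \<in> test_functions \<Omega>"
 shows "smooth_on UNIV (conv k u)"
proof -
 have "Ck_on m UNIV (conv k u)" if "k \<in> test_functions \<Omega>" for m k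
 using that
 proof (induction m arbitrary: k)
 case 0
 then show ?case using conv_has_derivative[OF u 0]
 by (auto intro!: continuous_at_imp_continuous_on has_derivative_continuous)
 next
 case (Suc m)
 show ?case
 by (rule Ck_SucI[OF conv_has_derivative[OF u Suc.prems]])
 (rule Suc.IH[OF deriv_test_functions[OF Suc.prems]])
 qed
 then show ?thesis using k by (simp add: smooth_on_def)
qed

lemma conv_zero:
 assumes "!!y. norm (x - y) <= r ==> u y = 0" "!!z. norm z > r ==> k z = 0"
 shows "conv k u x = 0"
proof -
 have "k (x - y) * u y = 0" for y
 using assms(1)[of y] assms(2)[of "x - y"] by (cases "norm (x - y) <= r") auto
 then show ?thesis unfolding conv_def by (simp only: integral_zero)
qed

lemma conv_test_functions:
 assumes "locint u" "k \<in> test_functions \<Omega>" "!!y. norm y > R ==> u y = 0"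
 shows "conv k u \<in> test_functions UNIV"
proof -
 obtain r where r: "r > 0" "!!z. norm z > r ==> k z = 0" using test_support[OF assms(2)] by blast
 show ?thesis
 proof (rule test_functionsI[where K = "cball 0 (R + r)"])
 show "conv k u x = 0" if "x \<notin> cball 0 (R + r)" for x
 proof (rule conv_zero[OF _ r(2)])
 fix y assume "norm (x - y) <= r"
 then have "norm y > R" using that norm_triangle_ineq2[of x y] norm_triangle_ineq3[of x y] by simp
 then show "u y = 0" by (rule assms(3))
 qed
 qed (use conv_smooth[OF assms(1,2)] in auto)
qed

lemma conv_cong_AE:
 assumes "AE y in lborel. u y = v y" "u \<in> BM" "v \<in> BM"
 and [measurable]: "k \<in> BM"
 shows "conv k u x = conv k v x"
 unfolding conv_def using assms by (intro integral_cong_AE) (auto elim!: eventually_mono)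

text \<open>Substitute g y for y: averaging against an invariant kernel commutes with g, so
  mollification preserves equivariance.\<close>

lemma conv_orthogonal:
 assumes "orthogonal_matrix g" and [measurable]: "k \<in> BM" "u \<in> BM"
 and "!!z. k (g *v z) = k z"
 shows "conv k u (g *v x) = conv k (%y. u (g *v y)) x"
proof -
 have "conv k u (g *v x) = (LBINT y. k (g *v x - g *v y) * u (g *v y))"
 unfolding conv_def
 using mp_integral[OF mp_orthogonal[OF assms(1)], of "%y. k (g *v x - y) * u y"] by simp
 then show ?thesis
 by (simp add: conv_def assms(4) flip: matrix_vector_mult_diff_distrib)
qed

text \<open>Convolution with an even kernel is symmetric. The factor \<open>a\<close> is cut to the
  ball that the kernel reaches from the support of \<open>b\<close>, which makes the double integral
  absolutely convergent.\<close>

lemma conv_fubini: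
 assumes a: "locint a" and b: "integrable lborel b" "!!y. norm y > R ==> b y = 0"
 and k: "k \<in> test_functions \<Omega>" and ev: "!!z. k (- z) = k z"
 shows "(LBINT x. a x * conv k b x) = (LBINT y. conv k a y * b y)"
proof -
 obtain r M where r: "r > 0" "!!z. norm z > r ==> k z = 0" and M: "!!z. \<bar>k z\<bar> <= M"
 using test_bounds[OF k] by metis
 have M0: "M >= 0" using M[of 0] by linarith
 have [measurable]: "a \<in> BM" "b \<in> BM" "k \<in> BM"
 using locint_measurable[OF a] b(1) test_measurable[OF k] by auto
 define A where "A x = indicator (cball 0 (R + r)) x * a x" for x
 have Ai: "integrable lborel A" using a by (simp add: A_def[abs_def] locint_def)
 have [measurable]: "A \<in> BM" using Ai by auto
 have int: "integrable (lborel \<Otimes>\<^sub>M lborel) (%(x, y). a x * (k (x - y) * b y))"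
 proof (rule integrableI_bounded)
 have "norm (a x * (k (x - y) * b y)) <= M * \<bar>A x\<bar> * \<bar>b y\<bar>" for x y
 proof (cases "norm (x - y) <= r \<and> norm y <= R")
 case True
 then have "norm x <= R + r" using norm_triangle_sub[of x y] by linarith
 then have "A x = a x" by (simp add: A_def)
 moreover have "\<bar>a x\<bar> * \<bar>b y\<bar> * \<bar>k (x - y)\<bar> <= \<bar>a x\<bar> * \<bar>b y\<bar> * M"
 using M by (intro mult_left_mono) auto
 ultimately show ?thesis by (simp add: abs_mult mult_ac)
 next
 case False
 then have "k (x - y) * b y = 0" using r(2)[of "x - y"] b(2)[of y] by auto
 then have "a x * (k (x - y) * b y) = 0" by simp
 then show ?thesis using M0 by (simp only:) simp
 qed
 then have "(\<integral>\<^sup>+z. ennreal (norm (case z of (x, y) => a x * (k (x - y) * b y))) \<partial>(lborel \<Otimes>\<^sub>M lborel))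
 <= (\<integral>\<^sup>+z. ennreal (M * \<bar>A (fst z)\<bar>) * ennreal \<bar>b (snd z)\<bar> \<partial>(lborel \<Otimes>\<^sub>M lborel))"
 using M0 by (intro nn_integral_mono) (auto simp: ennreal_mult[symmetric] split: prod.split intro!: ennreal_leI)
 also have "\<dots> = (NN x. \<integral>\<^sup>+y. ennreal (M * \<bar>A x\<bar>) * ennreal \<bar>b y\<bar> \<partial>lborel)"
 by (subst lborel.nn_integral_fst[symmetric]) auto
 also have "\<dots> = (NN x. ennreal (M * \<bar>A x\<bar>)) * (NN y. ennreal \<bar>b y\<bar>)"
 by (simp add: nn_integral_cmult nn_integral_multc)
 also have "\<dots> < \<infinity>"
 proof -
 have "integrable lborel (%x. M * \<bar>A x\<bar>)" using Ai by auto
 then have "(NN x. ennreal (M * \<bar>A x\<bar>)) < \<infinity>"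
 using M0 unfolding integrable_iff_bounded
 by (simp only: real_norm_def abs_of_nonneg[OF mult_nonneg_nonneg[OF M0 abs_ge_zero]])
 moreover have "(NN y. ennreal \<bar>b y\<bar>) < \<infinity>"
 using b(1) by (simp add: integrable_iff_bounded)
 ultimately show ?thesis by (simp add: ennreal_mult_less_top)
 qed
 finally show "(\<integral>\<^sup>+z. ennreal (norm (case z of (x, y) => a x * (k (x - y) * b y))) \<partial>(lborel \<Otimes>\<^sub>M lborel)) < \<infinity>" .
 qed measurable
 have "(LBINT x. a x * conv k b x) = (LBINT x. (LBINT y. a x * (k (x - y) * b y)))"
 by (simp add: conv_def)
 also have "\<dots> = (LBINT y. (LBINT x. a x * (k (x - y) * b y)))"
 using lborel_pair.Fubini_integral[OF int] by simp
 also have "\<dots> = (LBINT y. conv k a y * b y)"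
 proof (rule Bochner_Integration.integral_cong[OF refl])
 fix y
 have "k (x - y) = k (y - x)" for x using ev[of "x - y"] by simp
 then have "(LBINT x. a x * (k (x - y) * b y)) = (LBINT x. (k (y - x) * a x) * b y)"
 by (simp add: mult_ac)
 then show "(LBINT x. a x * (k (x - y) * b y)) = conv k a y * b y" by (simp add: conv_def)
 qed
 finally show ?thesis .
qed

text \<open>Jensen's inequality for the probability density \<mu>, by Cauchy-Schwarz with sqrt \<mu>
  split off. If the product is not integrable, the left side is 0 by convention.\<close>

lemma integral_square_le:
 assumes [measurable]: "w \<in> borel_measurable M" "\<mu> \<in> borel_measurable M"
 and \<mu>: "!!y. \<mu> y >= 0" "(\<integral>\<^sup>+y. ennreal (\<mu> y) \<partial>M) = 1"
 shows "ennreal ((\<integral>y. \<mu> y * w y \<partial>M)^2) <= (\<integral>\<^sup>+y. ennreal (\<mu> y * (w y)^2) \<partial>M)"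
proof -
 have "ennreal \<bar>\<integral>y. \<mu> y * w y \<partial>M\<bar> <= (\<integral>\<^sup>+y. ennreal (norm (\<mu> y * w y)) \<partial>M)"
 proof (cases "integrable M (%y. \<mu> y * w y)")
 case True
 then show ?thesis using integral_norm_bound_ennreal[OF True] by simp
 qed (simp add: not_integrable_integral_eq)
 also have "\<dots> = (\<integral>\<^sup>+y. ennreal (sqrt (\<mu> y)) * ennreal (sqrt (\<mu> y) * \<bar>w y\<bar>) \<partial>M)"
 using \<mu>(1) by (intro nn_integral_cong) (simp add: abs_mult ennreal_mult[symmetric] mult.assoc[symmetric])
 finally have "ennreal \<bar>\<integral>y. \<mu> y * w y \<partial>M\<bar> ^ 2 <= (\<integral>\<^sup>+y. ennreal (sqrt (\<mu> y)) * ennreal (sqrt (\<mu> y) * \<bar>w y\<bar>) \<partial>M)^2"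
 by (rule power_mono) simp
 also have "\<dots> <= (\<integral>\<^sup>+y. ennreal (sqrt (\<mu> y)) ^ 2 \<partial>M) * (\<integral>\<^sup>+y. ennreal (sqrt (\<mu> y) * \<bar>w y\<bar>) ^ 2 \<partial>M)"
 by (rule Cauchy_Schwarz_nn_integral) auto
 also have "\<dots> = (\<integral>\<^sup>+y. ennreal (\<mu> y * (w y)^2) \<partial>M)"
 using \<mu> by (simp add: ennreal_power power_mult_distrib)
 finally show ?thesis by (simp add: ennreal_power)
qed

lemma conv_density:
 fixes \<mu> :: "real^'n => real"
 assumes [measurable]: "\<mu> \<in> BM" and "(NN z. ennreal (\<mu> z)) = 1"
 shows "(NN y. ennreal (\<mu> (x - y))) = 1"
 using mp_nn[OF mp_reflect, of "%z. ennreal (\<mu> z)" x] assms by simp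

text \<open>Jensen pointwise in x, then Fubini and the unit mass of \<mu>.\<close>

lemma conv_contraction:
 assumes g: "locint g" and [measurable]: "\<mu> \<in> BM"
 and \<mu>: "!!z. \<mu> z >= 0" "(NN z. ennreal (\<mu> z)) = 1"
 shows "(NN x. ennreal ((conv \<mu> g x)^2)) <= (NN x. ennreal ((g x)^2))"
proof -
 have [measurable]: "g \<in> BM" using g by (rule locint_measurable)
 have "(NN x. ennreal ((conv \<mu> g x)^2))
 <= (NN x. \<integral>\<^sup>+y. ennreal (\<mu> (x - y) * (g y)^2) \<partial>lborel)"
 unfolding conv_def
 by (intro nn_integral_mono integral_square_le) (auto simp: \<mu> conv_density)
 also have "\<dots> = (NN y. \<integral>\<^sup>+x. ennreal (\<mu> (x - y) * (g y)^2) \<partial>lborel)"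
 by (rule lborel_pair.Fubini') measurable
 also have "\<dots> = (NN y. ennreal ((g y)^2))"
 proof (rule nn_integral_cong)
 fix y
 have "(NN x. ennreal (\<mu> (x - y) * (g y)^2)) = (NN x. ennreal (\<mu> x * (g y)^2))"
 using mp_nn[OF mp_translate, of "%x. ennreal (\<mu> x * (g y)^2)" "- y"] by simp
 also have "\<dots> = ennreal ((g y)^2)"
 using \<mu> by (simp add: ennreal_mult nn_integral_multc)
 finally show "(NN x. ennreal (\<mu> (x - y) * (g y)^2)) = ennreal ((g y)^2)" .
 qed
 finally show ?thesis .
qed

text \<open>Jensen applied to the increments u(y) - u(x), then Fubini: the error is at most the
  \<mu>-mean over |z| \<le> r of the squared L^2 norms of translation differences. For functions
  with a gradient in L^2 these are O(|z|^2), see \<open>Dlim_translation\<close>.\<close>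

lemma conv_error:
 assumes u: "locint u" and k: "\<mu> \<in> test_functions \<Omega>"
 and \<mu>: "!!z. \<mu> z >= 0" "(NN z. ennreal (\<mu> z)) = 1" "!!z. norm z > r ==> \<mu> z = 0"
 and C: "!!z. (NN x. ennreal ((u (x + z) - u x)^2)) <= ennreal (C * (norm z)^2)" and "C >= 0"
 shows "(NN x. ennreal ((conv \<mu> u x - u x)^2)) <= ennreal (C * r\<^sup>2)"
proof -
 have [measurable]: "u \<in> BM" using u by (rule locint_measurable)
 have [measurable]: "\<mu> \<in> BM" using k by (rule test_measurable)
 have eq: "conv \<mu> u x - u x = (LBINT y. \<mu> (x - y) * (u y - u x))" for x
 proof -
 have d: "(NN y. ennreal (\<mu> (x - y))) = 1" using conv_density[OF _ \<mu>(2)] by simp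
 have "integrable lborel (%y. \<mu> (x - y))"
 by (rule integrableI_nn_integral_finite[of _ _ 1]) (auto simp: \<mu> d)
 moreover have "(LBINT y. \<mu> (x - y)) = 1"
 by (subst integral_eq_nn_integral) (auto simp: \<mu> d)
 ultimately show ?thesis using conv_integrable_test(1)[OF u k, of x]
 by (simp add: right_diff_distrib conv_def)
 qed
 have "(NN x. ennreal ((conv \<mu> u x - u x)^2))
 <= (NN x. \<integral>\<^sup>+y. ennreal (\<mu> (x - y) * (u y - u x)^2) \<partial>lborel)"
 unfolding eq by (intro nn_integral_mono integral_square_le) (auto simp: \<mu> conv_density)
 also have "\<dots> = (NN x. \<integral>\<^sup>+z. ennreal (\<mu> z * (u (x - z) - u x)^2) \<partial>lborel)"
 proof (rule nn_integral_cong)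
 fix x
 show "(NN y. ennreal (\<mu> (x - y) * (u y - u x)^2)) = (NN z. ennreal (\<mu> z * (u (x - z) - u x)^2))"
 using mp_nn[OF mp_reflect, of "%z. ennreal (\<mu> z * (u (x - z) - u x)^2)" x] by simp
 qed
 also have "\<dots> = (NN z. \<integral>\<^sup>+x. ennreal (\<mu> z * (u (x - z) - u x)^2) \<partial>lborel)"
 by (rule lborel_pair.Fubini') measurable
 also have "\<dots> = (NN z. ennreal (\<mu> z) * (NN x. ennreal ((u (x + (- z)) - u x)^2)))"
 by (intro nn_integral_cong) (simp add: ennreal_mult \<mu> nn_integral_cmult)
 also have "\<dots> <= (NN z. ennreal (\<mu> z) * ennreal (C * r\<^sup>2))"
 proof (rule nn_integral_mono)
 fix z
 show "ennreal (\<mu> z) * (NN x. ennreal ((u (x + (- z)) - u x)^2)) <= ennreal (\<mu> z) * ennreal (C * r\<^sup>2)"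
 proof (cases "norm z <= r")
 case True
 then have "C * (norm z)^2 <= C * r\<^sup>2" using \<open>C >= 0\<close> by (intro mult_left_mono power_mono) auto
 then show ?thesis using C[of "- z"] by (intro mult_left_mono) (auto intro: order_trans ennreal_leI)
 qed (simp add: \<mu>(3))
 qed
 also have "\<dots> = ennreal (C * r\<^sup>2)" using \<mu>(2) by (simp add: nn_integral_multc)
 finally show ?thesis .
qed

definition moll :: "real => real^'n => real" where
 "moll r x = bump r x / (LBINT z. bump r (z::real^'n))"

lemma moll_props:
 fixes r :: real
 assumes "r > 0"
 shows "(moll r :: real^'n => real) \<in> test_functions UNIV" "moll r (z::real^'n) >= 0"
 "(NN z. ennreal (moll r (z::real^'n))) = 1" "norm z > r ==> moll r z = 0"
 "orthogonal_matrix g ==> moll r (g *v z) = moll r z" "moll r (- z) = moll r z"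
proof -
 have i: "integrable lborel (bump r :: real^'n => real)"
 using integrable_continuous_support[of "bump r" r] smooth_continuous[OF bump_smooth] bump_zero assms by force
 have b0: "(LBINT z. bump r (z::real^'n)) ~= 0"
 proof
 assume "(LBINT z. bump r (z::real^'n)) = 0"
 then have "AE z in lborel. bump r (z::real^'n) = 0"
 using integral_nonneg_eq_0_iff_AE[OF i] bump_nonneg by auto
 then have "AE z in lborel. z \<notin> (ball 0 r :: (real^'n) set)"
 proof (rule eventually_mono)
 fix z :: "real^'n" assume "bump r z = 0"
 then show "z \<notin> ball 0 r" using bump_pos[OF assms, of z] by auto
 qed
 then have "emeasure lborel (ball 0 r :: (real^'n) set) = 0"
 by (subst (asm) AE_iff_measurable[of "ball 0 r" lborel]) auto
 then show False using content_ball_pos[of r "0::real^'n"] assms by (simp add: measure_def)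
 qed
 moreover have "(LBINT z. bump r (z::real^'n)) >= 0"
 by (rule integral_nonneg_AE) (simp add: bump_nonneg)
 ultimately have bp: "(LBINT z. bump r (z::real^'n)) > 0" by simp
 show "(moll r :: real^'n => real) \<in> test_functions UNIV"
 using test_functions_mult[OF bump_test[OF assms] smooth_const[of "1 / (LBINT z. bump r (z::real^'n))"]]
 by (simp add: moll_def[abs_def])
 have m0: "moll r (z::real^'n) >= 0" for z unfolding moll_def
 by (rule divide_nonneg_nonneg) (use bp bump_nonneg[of r z] in auto)
 then show "moll r (z::real^'n) >= 0" .
 have "integrable lborel (moll r :: real^'n => real)" unfolding moll_def[abs_def] using i by simp
 then have "(NN z. ennreal (moll r (z::real^'n))) = ennreal (LBINT z. moll r (z::real^'n))"
 by (rule nn_integral_eq_integral) (simp add: m0)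
 also have "(LBINT z. moll r (z::real^'n)) = 1" using b0 by (simp add: moll_def)
 finally show "(NN z. ennreal (moll r (z::real^'n))) = 1" by simp
 show "moll r z = 0" if "norm z > r" using that assms bump_zero[of r z] by (simp add: moll_def)
 show "moll r (g *v z) = moll r z" if "orthogonal_matrix g" using that by (simp add: moll_def bump_orthogonal)
 show "moll r (- z) = moll r z" by (simp add: moll_def bump_def)
qed

section \<open>The space of weak gradients\<close>

lemma cball_borel [measurable]: "cball (a::real^'n) r \<in> sets borel"
 and ball_borel [measurable]: "ball (a::real^'n) r \<in> sets borel"
 by auto

lemma tendsto_zero_ennrealI:
 fixes X :: "nat => ennreal"
 assumes "!!e. e > 0 ==> eventually (%k. X k <= ennreal e) sequentially"
 shows "X ~> 0"
proof (rule order_tendstoI)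
 fix a :: ennreal assume "0 < a"
 have "\<exists>e>0. ennreal e < a"
 proof (cases a)
 case (real r)
 then show ?thesis using \<open>0 < a\<close> by (intro exI[of _ "r / 2"]) (auto simp: ennreal_less_iff)
 next
 case top
 then show ?thesis by (intro exI[of _ 1]) auto
 qed
 then obtain e where e: "e > 0" "ennreal e < a" by blast
 show "eventually (%k. X k < a) sequentially"
 using assms[OF e(1)] e(2) by (auto elim!: eventually_mono)
qed auto

lemma tendsto_zero_ennrealD:
 fixes X :: "nat => ennreal"
 assumes "X ~> 0" "e > 0"
 shows "eventually (%k. X k <= ennreal e) sequentially"
 using order_tendstoD(2)[OF assms(1), of "ennreal e"] assms(2) by (auto elim!: eventually_mono)

lemma tendsto_zero_ennreal_le:
 fixes X Y :: "nat => ennreal"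
 assumes "Y ~> 0" "!!k. X k <= Y k"
 shows "X ~> 0"
 by (rule tendsto_sandwich[OF _ _ tendsto_const assms(1)]) (auto simp: assms(2))

lemma tendsto_zero_ennreal_cmult:
 fixes X :: "nat => ennreal"
 assumes "X ~> 0" "c < \<infinity>"
 shows "(%k. c * X k) ~> 0"
 using ennreal_tendsto_cmult[OF _ assms(1), of c] assms(2) by simp

lemma tendsto_zero_ennreal_add:
 fixes X Y :: "nat => ennreal"
 assumes "X ~> 0" "Y ~> 0"
 shows "(%k. X k + Y k) ~> 0"
 using tendsto_add[OF assms] by simp

lemma powr_add_le:
 fixes a b q :: real
 assumes "q > 0"
 shows "\<bar>a + b\<bar> powr q <= 2 powr q * (\<bar>a\<bar> powr q + \<bar>b\<bar> powr q)"
proof -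
 have "\<bar>a + b\<bar> <= 2 * max \<bar>a\<bar> \<bar>b\<bar>" by linarith
 then have "\<bar>a + b\<bar> powr q <= (2 * max \<bar>a\<bar> \<bar>b\<bar>) powr q" using assms by (intro powr_mono2) auto
 also have "\<dots> = 2 powr q * (max \<bar>a\<bar> \<bar>b\<bar>) powr q" by (simp add: powr_mult)
 also have "(max \<bar>a\<bar> \<bar>b\<bar>) powr q <= \<bar>a\<bar> powr q + \<bar>b\<bar> powr q" by (auto simp: max_def)
 finally show ?thesis by simp
qed

lemma norm_add_sq_le: "(norm (a + b))^2 <= 2 * ((norm a)^2 + (norm (b::'a::real_normed_vector))^2)"
proof -
 have "(norm (a + b))^2 <= (norm a + norm b)^2" by (intro power_mono norm_triangle_ineq) simp
 also have "\<dots> <= 2 * ((norm a)^2 + (norm b)^2)" using sum_squares_bound[of "norm a" "norm b"]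
 by (simp add: power2_eq_square algebra_simps)
 finally show ?thesis .
qed

text \<open>The integral itself, not its root. Extended values let convergence in norm be stated as
  \<open>~> 0\<close> before any integrability is known.\<close>

definition Nq :: "(real^'n => real) => ennreal" where
 "Nq u = (NN x. ennreal (\<bar>u x\<bar> powr crit_exp CARD('n)))"

definition N2 :: "(real^'n => 'b::real_normed_vector) => ennreal" where
 "N2 g = (NN x. ennreal ((norm (g x))^2))"

lemma Nq_add:
 fixes u v :: "real^'n => real"
 assumes [measurable]: "u \<in> BM" "v \<in> BM"
 and q: "crit_exp CARD('n) > 0"
 shows "Nq (%x. u x + v x) <= ennreal (2 powr crit_exp CARD('n)) * (Nq u + Nq v)"
proof -
 have "Nq (%x. u x + v x) <= (NN x. ennreal (2 powr crit_exp CARD('n)) *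
 (ennreal (\<bar>u x\<bar> powr crit_exp CARD('n)) + ennreal (\<bar>v x\<bar> powr crit_exp CARD('n))))"
 unfolding Nq_def using powr_add_le[OF q]
 by (intro nn_integral_mono) (simp add: ennreal_plus[symmetric] ennreal_mult[symmetric] ennreal_leI del: ennreal_plus)
 also have "\<dots> = ennreal (2 powr crit_exp CARD('n)) * (Nq u + Nq v)"
 by (simp add: Nq_def nn_integral_cmult nn_integral_add)
 finally show ?thesis .
qed

lemma N2_add:
 fixes g h :: "real^'n => 'b::euclidean_space"
 assumes [measurable]: "g \<in> BM" "h \<in> BM"
 shows "N2 (%x. g x + h x) <= 2 * (N2 g + N2 h)"
proof -
 have "N2 (%x. g x + h x) <= (NN x. 2 * (ennreal ((norm (g x))^2) + ennreal ((norm (h x))^2)))"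
 unfolding N2_def
 proof (intro nn_integral_mono)
 fix x
 have "ennreal ((norm (g x + h x))^2) <= ennreal (2 * ((norm (g x))^2 + (norm (h x))^2))"
 by (rule ennreal_leI[OF norm_add_sq_le])
 then show "ennreal ((norm (g x + h x))^2) <= 2 * (ennreal ((norm (g x))^2) + ennreal ((norm (h x))^2))"
 by (simp add: ennreal_mult)
 qed
 also have "\<dots> = 2 * (N2 g + N2 h)"
 by (simp add: N2_def nn_integral_cmult nn_integral_add)
 finally show ?thesis .
qed

lemma Nq_cmult:
 fixes u :: "real^'n => real"
 assumes [measurable]: "u \<in> BM"
 shows "Nq (%x. c * u x) = ennreal (\<bar>c\<bar> powr crit_exp CARD('n)) * Nq u"
 by (simp add: Nq_def abs_mult powr_mult ennreal_mult nn_integral_cmult)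

lemma N2_cmult:
 fixes g :: "real^'n => 'b::euclidean_space"
 assumes [measurable]: "g \<in> BM"
 shows "N2 (%x. c *\<^sub>R g x) = ennreal (c\<^sup>2) * N2 g"
 by (simp add: N2_def power_mult_distrib ennreal_mult nn_integral_cmult)

text \<open>\<open>D12_limit\<close> transferred to Borel functions on the whole space. Functions on
  \<open>\<Omega>\<close> appear extended by zero, so enlarging \<open>\<Omega>\<close> costs
  nothing (\<open>Dlim_mono\<close>) and all later integrals are over \<open>lborel\<close>.\<close>

definition Dlim :: "(real^'n) set => (real^'n => real) => (real^'n => real^'n) => bool" where
 "Dlim \<Omega> u g \<longleftrightarrow> u \<in> BM \<and> g \<in> BM \<and>
 (\<exists>f. (\<forall>k::nat. f k \<in> test_functions \<Omega>) \<and> (%k. Nq (%x. f k x - u x)) ~> 0 \<and>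
 (%k. N2 (%x. grad (f k) x - g x)) ~> 0)"

lemma DlimI:
 assumes "u \<in> BM" "g \<in> BM" "!!k. f k \<in> test_functions \<Omega>"
 "(%k. Nq (%x. f k x - u x)) ~> 0" "(%k. N2 (%x. grad (f k) x - g x)) ~> 0"
 shows "Dlim \<Omega> u g"
 using assms by (auto simp: Dlim_def)

lemma DlimE:
 assumes "Dlim \<Omega> u g"
 obtains f where "!!k. f k \<in> test_functions \<Omega>" "(%k. Nq (%x. f k x - u x)) ~> 0"
 "(%k. N2 (%x. grad (f k) x - g x)) ~> 0"
 "!!k. f k \<in> BM" "!!k. grad (f k) \<in> BM"
 using assms test_measurable test_grad_measurable unfolding Dlim_def by blast

lemma Dlim_measurable:
 assumes "Dlim \<Omega> u g"
 shows "u \<in> BM" "g \<in> BM"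
 using assms by (auto simp: Dlim_def)

lemma Dlim_mono: "Dlim \<Omega> u g ==> \<Omega> \<subseteq> \<Omega>' ==> Dlim \<Omega>' u g"
 unfolding Dlim_def using test_functions_mono by blast

lemma test_Nq_finite:
 fixes f :: "real^'n => real"
 assumes f: "f \<in> test_functions \<Omega>" and q: "crit_exp CARD('n) > 0"
 shows "Nq f < \<infinity>" "N2 (grad f) < \<infinity>"
proof -
 obtain r M where r: "!!z. norm z > r ==> f z = 0 \<and> grad f z = 0"
 and M: "!!z. \<bar>f z\<bar> <= M \<and> norm (grad f z) <= M" using test_bounds[OF f] by metis
 have [measurable]: "f \<in> BM" "grad f \<in> BM"
 using test_measurable[OF f] test_grad_measurable[OF f] by auto
 have "integrable lborel (%x. \<bar>f x\<bar> powr crit_exp CARD('n))"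
 by (rule integrable_bounded_support[of _ "M powr crit_exp CARD('n)" r])
 (use r M q in \<open>auto intro!: powr_mono2\<close>)
 then show "Nq f < \<infinity>" unfolding Nq_def integrable_iff_bounded by simp
 have "integrable lborel (%x. (norm (grad f x))^2)"
 by (rule integrable_bounded_support[of _ "M\<^sup>2" r])
 (use r M in \<open>auto intro!: power_mono\<close>)
 then show "N2 (grad f) < \<infinity>" unfolding N2_def integrable_iff_bounded by simp
qed

lemma Dlim_finite:
 fixes u :: "real^'n => real"
 assumes D: "Dlim \<Omega> u g" and q: "crit_exp CARD('n) > 0"
 shows "Nq u < \<infinity>" "N2 g < \<infinity>"
proof -
 obtain f where f: "!!k. f k \<in> test_functions \<Omega>" "(%k. Nq (%x. f k x - u x)) ~> 0"
 "(%k. N2 (%x. grad (f k) x - g x)) ~> 0"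
 "!!k. f k \<in> BM" "!!k. grad (f k) \<in> BM"
 using D by (rule DlimE) auto
 note [measurable] = Dlim_measurable[OF D] f(4,5)
 obtain k where k: "Nq (%x. f k x - u x) <= ennreal 1" "N2 (%x. grad (f k) x - g x) <= ennreal 1"
 using eventually_conj[OF tendsto_zero_ennrealD[OF f(2), of 1] tendsto_zero_ennrealD[OF f(3), of 1]]
 by (auto dest: eventually_happens)
 have "Nq u = Nq (%x. f k x + (-1) * (f k x - u x))" by simp
 also have "\<dots> <= ennreal (2 powr crit_exp CARD('n)) * (Nq (f k) + Nq (%x. (-1) * (f k x - u x)))"
 by (rule Nq_add[OF _ _ q]) measurable
 also have "Nq (%x. (-1) * (f k x - u x)) = Nq (%x. f k x - u x)"
 by (subst Nq_cmult) auto
 also have "ennreal (2 powr crit_exp CARD('n)) * (Nq (f k) + Nq (%x. f k x - u x)) < \<infinity>"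
 using test_Nq_finite(1)[OF f(1) q, of k] order.strict_trans1[OF k(1)]
 by (simp add: ennreal_mult_less_top)
 finally show "Nq u < \<infinity>" .
 have "N2 g = N2 (%x. grad (f k) x + (-1) *\<^sub>R (grad (f k) x - g x))" by simp
 also have "\<dots> <= 2 * (N2 (grad (f k)) + N2 (%x. (-1) *\<^sub>R (grad (f k) x - g x)))"
 by (rule N2_add) measurable
 also have "N2 (%x. (-1) *\<^sub>R (grad (f k) x - g x)) = N2 (%x. grad (f k) x - g x)"
 by (subst N2_cmult) auto
 also have "2 * (N2 (grad (f k)) + N2 (%x. grad (f k) x - g x)) < \<infinity>"
 using test_Nq_finite(2)[OF f(1) q, of k] order.strict_trans1[OF k(2)]
 by (simp add: ennreal_mult_less_top)
 finally show "N2 g < \<infinity>" .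
qed

text \<open>If a^t exceeds d, write a^t = a^s (a^t)^(1 - s/t), where the last exponent is
  nonpositive. The additive d is affordable on sets of finite measure; there this replaces Hoelder's
  inequality.\<close>

lemma powr_le_delta:
 fixes a s t d :: real
 assumes "0 < t" "t <= s" "d > 0" "a >= 0"
 shows "a powr t <= d + d powr (1 - s / t) * a powr s"
proof (cases "a powr t <= d")
 case True
 then show ?thesis by (simp add: add_increasing2)
next
 case False
 then have a: "a > 0" "a powr t > d" using assms by (auto simp: less_le powr_def)
 have "a powr s = a powr t * a powr (s - t)" by (simp add: powr_add[symmetric])
 also have "a powr (s - t) = (a powr t) powr (s / t - 1)"
 proof -
 have "t * (s / t - 1) = s - t" using assms by (simp add: right_diff_distrib)
 then show ?thesis by (simp add: powr_powr)
 qed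
 also have "a powr t * (a powr t) powr (s / t - 1) >= a powr t * d powr (s / t - 1)"
 using a assms by (intro mult_left_mono powr_mono2) (auto simp: field_simps)
 finally have "d powr (1 - s / t) * (a powr t * d powr (s / t - 1)) <= d powr (1 - s / t) * a powr s"
 by (intro mult_left_mono) auto
 moreover have "d powr (1 - s / t) * d powr (s / t - 1) = 1"
 using assms by (simp flip: powr_add)
 ultimately have "a powr t <= d powr (1 - s / t) * a powr s" by (simp add: mult_ac)
 then show ?thesis using assms by simp
qed

lemma nn_ball_powr_le:
 fixes h :: "real^'n => real"
 assumes "0 < t" "t <= s" "d > 0" and [measurable]: "h \<in> BM"
 shows "(NN x. indicator (cball 0 R) x * ennreal (\<bar>h x\<bar> powr t))
 <= ennreal d * emeasure lborel (cball (0::real^'n) R)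
 + ennreal (d powr (1 - s / t)) * (NN x. ennreal (\<bar>h x\<bar> powr s))"
proof -
 have "(NN x. indicator (cball 0 R) x * ennreal (\<bar>h x\<bar> powr t))
 <= (NN x. ennreal d * indicator (cball 0 R) x + ennreal (d powr (1 - s / t)) * ennreal (\<bar>h x\<bar> powr s))"
 proof (rule nn_integral_mono)
 fix x
 have "ennreal (\<bar>h x\<bar> powr t) <= ennreal (d + d powr (1 - s / t) * \<bar>h x\<bar> powr s)"
 using powr_le_delta[OF assms(1-3), of "\<bar>h x\<bar>"] by (intro ennreal_leI) simp
 also have "\<dots> = ennreal d + ennreal (d powr (1 - s / t)) * ennreal (\<bar>h x\<bar> powr s)"
 using assms(3) by (simp add: ennreal_mult)
 finally show "indicator (cball 0 R) x * ennreal (\<bar>h x\<bar> powr t)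
 <= ennreal d * indicator (cball 0 R) x + ennreal (d powr (1 - s / t)) * ennreal (\<bar>h x\<bar> powr s)"
 by (cases "x \<in> cball 0 R") auto
 qed
 also have "\<dots> = ennreal d * emeasure lborel (cball (0::real^'n) R)
 + ennreal (d powr (1 - s / t)) * (NN x. ennreal (\<bar>h x\<bar> powr s))"
 by (subst nn_integral_add) (auto simp: nn_integral_cmult nn_integral_cmult_indicator)
 finally show ?thesis .
qed

lemma nn_ball_powr_tendsto:
 fixes h :: "nat => real^'n => real"
 assumes ts: "0 < t" "t <= s" and [measurable]: "!!k. h k \<in> BM"
 and lim: "(%k. (NN x. ennreal (\<bar>h k x\<bar> powr s))) ~> 0"
 shows "(%k. (NN x. indicator (cball 0 R) x * ennreal (\<bar>h k x\<bar> powr t))) ~> 0"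
proof (rule tendsto_zero_ennrealI)
 fix e :: real assume "e > 0"
 obtain V where V: "emeasure lborel (cball (0::real^'n) R) = ennreal V" "V >= 0"
 using emeasure_cball_finite[of "0::real^'n" R] by (cases "emeasure lborel (cball (0::real^'n) R)") auto
 \<comment> \<open>Half of e is spent on d times the volume V of the ball, half on the L^s term; V +
   1 keeps the denominator positive.\<close>
 define d where "d = e / (2 * (V + 1))"
 have d: "d > 0" using \<open>e > 0\<close> V by (simp add: d_def)
 have dV: "d * V <= e / 2" using \<open>e > 0\<close> V by (simp add: d_def field_simps)
 define c where "c = d powr (1 - s / t)"
 have c: "c > 0" using d by (simp add: c_def)
 have ev: "eventually (%k. (NN x. ennreal (\<bar>h k x\<bar> powr s)) <= ennreal (e / (2 * c))) sequentially"
 using \<open>e > 0\<close> c by (intro tendsto_zero_ennrealD[OF lim]) simp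
 show "eventually (%k. (NN x. indicator (cball 0 R) x * ennreal (\<bar>h k x\<bar> powr t)) <= ennreal e) sequentially"
 using ev
 proof (rule eventually_mono)
 fix k assume k: "(NN x. ennreal (\<bar>h k x\<bar> powr s)) <= ennreal (e / (2 * c))"
 have "(NN x. indicator (cball 0 R) x * ennreal (\<bar>h k x\<bar> powr t))
 <= ennreal d * ennreal V + ennreal c * (NN x. ennreal (\<bar>h k x\<bar> powr s))"
 using nn_ball_powr_le[OF ts d, of "h k" R] V(1) by (simp add: c_def)
 also have "\<dots> <= ennreal (d * V) + ennreal c * ennreal (e / (2 * c))"
 using d V by (intro add_mono mult_left_mono k) (auto simp: ennreal_mult)
 also have "\<dots> = ennreal (d * V + e / 2)"
 using c d V \<open>e > 0\<close> by (simp add: ennreal_mult[symmetric] ennreal_plus[symmetric] del: ennreal_plus)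
 also have "\<dots> <= ennreal e" using dV by (intro ennreal_leI) simp
 finally show "(NN x. indicator (cball 0 R) x * ennreal (\<bar>h k x\<bar> powr t)) <= ennreal e" .
 qed
qed

lemma locint_powr:
 fixes u :: "real^'n => real"
 assumes [measurable]: "u \<in> BM" and "s >= 1"
 and fin: "(NN x. ennreal (\<bar>u x\<bar> powr s)) < \<infinity>"
 shows "locint u"
 unfolding locint_def
proof (intro conjI allI)
 fix R
 show "integrable lborel (%y. indicator (cball 0 R) y * u y)"
 proof (rule integrableI_bounded)
 have "(NN x. ennreal (norm (indicator (cball 0 R) x * u x)))
 = (NN x. indicator (cball 0 R) x * ennreal (\<bar>u x\<bar> powr 1))"
 by (intro nn_integral_cong) (auto simp: indicator_def)
 also have "\<dots> < \<infinity>"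
 by (rule order.strict_trans1[OF nn_ball_powr_le[of 1 s 1]])
 (use assms(2) fin emeasure_cball_finite[of "0::real^'n" R] in \<open>auto simp: ennreal_mult_less_top\<close>)
 finally show "(NN x. ennreal (norm (indicator (cball 0 R) x * u x))) < \<infinity>" .
 qed measurable
qed fact

lemma crit_exp_gt:
 assumes "N >= 3"
 shows "crit_exp N > 2" "crit_exp N = 2 * (real N / (real N - 2))"
 using assms by (auto simp: crit_exp_def field_simps)

lemma Dlim_locint:
 fixes u :: "real^'n => real"
 assumes D: "Dlim \<Omega> u g" and N: "CARD('n) >= 3"
 shows "locint u" "locint (%x. g x \<bullet> v)"
proof -
 have q: "crit_exp CARD('n) > 2" using crit_exp_gt[OF N] by simp
 note [measurable] = Dlim_measurable[OF D]
 note fin = Dlim_finite[OF D]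
 show "locint u"
 by (rule locint_powr[of _ "crit_exp CARD('n)"]) (use q fin(1) in \<open>auto simp: Nq_def\<close>)
 show "locint (%x. g x \<bullet> v)"
 proof (rule locint_powr[of _ 2])
 have "(NN x. ennreal (\<bar>g x \<bullet> v\<bar> powr 2)) <= (NN x. ennreal ((norm v)^2) * ennreal ((norm (g x))^2))"
 proof (rule nn_integral_mono)
 fix x
 have "\<bar>g x \<bullet> v\<bar>\<^sup>2 <= (norm (g x) * norm v)^2" by (intro power_mono Cauchy_Schwarz_ineq2) simp
 then show "ennreal (\<bar>g x \<bullet> v\<bar> powr 2) <= ennreal ((norm v)^2) * ennreal ((norm (g x))^2)"
 by (simp add: ennreal_mult[symmetric] ennreal_leI power_mult_distrib mult.commute)
 qed
 also have "\<dots> = ennreal ((norm v)^2) * N2 g" by (simp add: nn_integral_cmult N2_def)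
 also have "\<dots> < \<infinity>" using fin(2) q by (simp add: ennreal_mult_less_top)
 finally show "(NN x. ennreal (\<bar>g x \<bullet> v\<bar> powr 2)) < \<infinity>" .
 qed auto
qed

lemma integral_local_tendsto:
 fixes h :: "nat => real^'n => real"
 assumes s: "s >= 1" and [measurable]: "!!k. h k \<in> BM" "u \<in> BM"
 and lim: "(%k. (NN x. ennreal (\<bar>h k x - u x\<bar> powr s))) ~> 0"
 and int: "!!k. integrable lborel (%x. h k x * w x)" "integrable lborel (%x. u x * w x)"
 and [measurable]: "w \<in> BM"
 and w: "!!x. \<bar>w x\<bar> <= M" "!!x. norm x > R ==> w x = 0"
 shows "(%k. \<integral>x. h k x * w x \<partial>lborel) ~> (LBINT x. u x * w x)"
proof -
 have M: "M >= 0" using w(1)[of 0] by linarith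
 have "(%k. ennreal \<bar>(LBINT x. h k x * w x) - (LBINT x. u x * w x)\<bar>) ~> 0"
 proof (rule tendsto_zero_ennreal_le)
 show "(%k. ennreal M * (NN x. indicator (cball 0 R) x * ennreal (\<bar>h k x - u x\<bar> powr 1))) ~> 0"
 by (intro tendsto_zero_ennreal_cmult nn_ball_powr_tendsto[OF _ s _ lim]) auto
 fix k
 have "ennreal \<bar>(LBINT x. h k x * w x) - (LBINT x. u x * w x)\<bar>
 = ennreal (norm (LBINT x. h k x * w x - u x * w x))" using int by simp
 also have "\<dots> <= (NN x. norm (h k x * w x - u x * w x))"
 using int by (intro integral_norm_bound_ennreal) auto
 also have "\<dots> <= (NN x. ennreal M * (indicator (cball 0 R) x * ennreal (\<bar>h k x - u x\<bar> powr 1)))"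
 proof (rule nn_integral_mono)
 fix x
 have "norm (h k x * w x - u x * w x) <= M * \<bar>h k x - u x\<bar>"
 using mult_right_mono[OF w(1)[of x], of "\<bar>h k x - u x\<bar>"] by (simp add: abs_mult[symmetric] algebra_simps)
 then show "ennreal (norm (h k x * w x - u x * w x)) <= ennreal M * (indicator (cball 0 R) x * ennreal (\<bar>h k x - u x\<bar> powr 1))"
 using w(2)[of x] M by (cases "norm x <= R") (auto simp: ennreal_mult[symmetric] ennreal_leI)
 qed
 finally show "ennreal \<bar>(LBINT x. h k x * w x) - (LBINT x. u x * w x)\<bar>
 <= ennreal M * (NN x. indicator (cball 0 R) x * ennreal (\<bar>h k x - u x\<bar> powr 1))"
 by (subst nn_integral_cmult[symmetric]) auto
 qed
 then have "(%k. \<bar>(LBINT x. h k x * w x) - (LBINT x. u x * w x)\<bar>) ~> 0"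
 using tendsto_ennreal_iff[of "%k. \<bar>(LBINT x. h k x * w x) - (LBINT x. u x * w x)\<bar>" sequentially 0] by simp
 then show ?thesis by (rule LIM_zero_cancel[OF tendsto_rabs_zero_cancel])
qed

lemma test_mult_derivative:
 assumes "f \<in> test_functions \<Omega>" "g \<in> test_functions \<Omega>'"
 shows "((%x. f x * g x) has_derivative (%h. f x * (grad g x \<bullet> h) + (grad f x \<bullet> h) * g x)) (at x)"
 by (rule has_derivative_mult[OF smooth_has_grad[OF test_functionsD(1)[OF assms(1)]]
 smooth_has_grad[OF test_functionsD(1)[OF assms(2)]]])

lemma test_by_parts:
 assumes f: "f \<in> test_functions \<Omega>" and g: "g \<in> test_functions \<Omega>'"
 shows "(LBINT x. f x * (grad g x \<bullet> v)) = - (LBINT x. (grad f x \<bullet> v) * g x)"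
proof -
 obtain r where r: "!!z. norm z > r ==> f z = 0 \<and> grad f z = 0" using test_support[OF f] by metis
 have c: "continuous_on UNIV f" "continuous_on UNIV g"
 "continuous_on UNIV (%x. grad f x \<bullet> v)" "continuous_on UNIV (%x. grad g x \<bullet> v)"
 by (rule smooth_continuous, rule test_functionsD(1)[OF f])
 (rule smooth_continuous, rule test_functionsD(1)[OF g],
 rule smooth_continuous, rule smooth_deriv, rule test_functionsD(1)[OF f],
 rule smooth_continuous, rule smooth_deriv, rule test_functionsD(1)[OF g])
 have "(LBINT x. f x * (grad g x \<bullet> v) + (grad f x \<bullet> v) * g x) = 0"
 by (rule integral_directional_derivative[OF test_mult_derivative[OF f g], of v r])
 (auto intro!: continuous_intros c simp: r)
 moreover have "integrable lborel (%x. f x * (grad g x \<bullet> v))" "integrable lborel (%x. (grad f x \<bullet> v) * g x)"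
 by (auto intro!: integrable_continuous_support[of _ r] continuous_intros c simp: r)
 ultimately show ?thesis by simp
qed

text \<open>Both sides pass to the limit from \<open>test_by_parts\<close>, because a bounded weight
  of compact support sees only local L^1 convergence.\<close>

lemma Dlim_weak_derivative:
 fixes u :: "real^'n => real"
 assumes D: "Dlim \<Omega> u g" and N: "CARD('n) >= 3" and w: "w \<in> test_functions \<Omega>'"
 shows "(LBINT x. u x * (grad w x \<bullet> v)) = - (LBINT x. (g x \<bullet> v) * w x)"
 "integrable lborel (%x. u x * (grad w x \<bullet> v))" "integrable lborel (%x. (g x \<bullet> v) * w x)"
proof -
 obtain f where f: "!!k. f k \<in> test_functions \<Omega>" "(%k. Nq (%x. f k x - u x)) ~> 0"
 "(%k. N2 (%x. grad (f k) x - g x)) ~> 0"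
 "!!k. f k \<in> BM" "!!k. grad (f k) \<in> BM"
 using D by (rule DlimE) auto
 note [measurable] = Dlim_measurable[OF D] f(4,5) test_measurable[OF w] test_grad_measurable[OF w]
 have w': "(%x. grad w x \<bullet> v) \<in> test_functions \<Omega>'" using w by (rule deriv_test_functions)
 obtain r M where r: "!!z. norm z > r ==> w z = 0" "!!z. \<bar>w z\<bar> <= M" using test_bounds[OF w] by metis
 obtain r' M' where r': "!!z. norm z > r' ==> grad w z \<bullet> v = 0" "!!z. \<bar>grad w z \<bullet> v\<bar> <= M'"
 using test_bounds[OF w'] by metis
 have int: "integrable lborel (%x. a x * (grad w x \<bullet> v))" "integrable lborel (%x. a x * w x)" if "locint a" for a
 using locint_integrable_mult[OF that _ r'(2) r'(1)] locint_integrable_mult[OF that _ r(2) r(1)]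
 by (auto simp: mult.commute)
 show i: "integrable lborel (%x. u x * (grad w x \<bullet> v))" "integrable lborel (%x. (g x \<bullet> v) * w x)"
 using int Dlim_locint[OF D N] by auto
 have fl: "locint (f k)" "locint (%x. grad (f k) x \<bullet> v)" for k
 using integrable_continuous_support[of "f k"] integrable_continuous_support[of "%x. grad (f k) x \<bullet> v"]
 test_support[OF f(1)[of k]] smooth_continuous smooth_deriv test_functionsD(1)[OF f(1)[of k]] locint_integrable
 by (metis, metis inner_zero_left)
 have q: "crit_exp CARD('n) >= 1" using crit_exp_gt[OF N] by simp
 have L1: "(%k. \<integral>x. f k x * (grad w x \<bullet> v) \<partial>lborel) ~> (LBINT x. u x * (grad w x \<bullet> v))"
 by (rule integral_local_tendsto[OF q _ _ _ _ _ _ r'(2) r'(1)])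
 (use f(2) i int fl in \<open>auto simp: Nq_def\<close>)
 have L2: "(%k. \<integral>x. (grad (f k) x \<bullet> v) * w x \<partial>lborel) ~> (LBINT x. (g x \<bullet> v) * w x)"
 proof (rule integral_local_tendsto[of 2, OF _ _ _ _ _ _ _ r(2) r(1)])
 show "(%k. \<integral>\<^sup>+x. ennreal (\<bar>grad (f k) x \<bullet> v - g x \<bullet> v\<bar> powr 2) \<partial>lborel) ~> 0"
 proof (rule tendsto_zero_ennreal_le[OF tendsto_zero_ennreal_cmult[OF f(3), of "ennreal ((norm v)^2)"]])
 fix k
 have "(NN x. ennreal (\<bar>grad (f k) x \<bullet> v - g x \<bullet> v\<bar> powr 2))
 <= (NN x. ennreal ((norm v)^2) * ennreal ((norm (grad (f k) x - g x))^2))"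
 proof (rule nn_integral_mono)
 fix x
 have "\<bar>(grad (f k) x - g x) \<bullet> v\<bar>\<^sup>2 <= (norm (grad (f k) x - g x) * norm v)^2"
 by (intro power_mono Cauchy_Schwarz_ineq2) simp
 then show "ennreal (\<bar>grad (f k) x \<bullet> v - g x \<bullet> v\<bar> powr 2) <= ennreal ((norm v)^2) * ennreal ((norm (grad (f k) x - g x))^2)"
 by (simp add: ennreal_mult[symmetric] ennreal_leI power_mult_distrib mult.commute inner_diff_left)
 qed
 then show "(NN x. ennreal (\<bar>grad (f k) x \<bullet> v - g x \<bullet> v\<bar> powr 2))
 <= ennreal ((norm v)^2) * N2 (%x. grad (f k) x - g x)"
 by (simp add: N2_def nn_integral_cmult)
 qed simp
 qed (use i int fl in auto)
 have "(LBINT x. f k x * (grad w x \<bullet> v)) = - (LBINT x. (grad (f k) x \<bullet> v) * w x)" for k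
 by (rule test_by_parts[OF f(1) w])
 then have "(%k. \<integral>x. f k x * (grad w x \<bullet> v) \<partial>lborel) ~> - (LBINT x. (g x \<bullet> v) * w x)"
 using tendsto_minus[OF L2] by simp
 then show "(LBINT x. u x * (grad w x \<bullet> v)) = - (LBINT x. (g x \<bullet> v) * w x)"
 using L1 LIMSEQ_unique by blast
qed

lemma Dlim_lincomb:
 fixes u :: "real^'n => real"
 assumes D: "Dlim \<Omega> u g" and D': "Dlim \<Omega> v h" and N: "CARD('n) >= 3"
 shows "Dlim \<Omega> (%x. u x + c * v x) (%x. g x + c *\<^sub>R h x)"
proof -
 have q: "crit_exp CARD('n) > 0" using crit_exp_gt[OF N] by simp
 obtain f where f: "!!k. f k \<in> test_functions \<Omega>" "(%k. Nq (%x. f k x - u x)) ~> 0"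
 "(%k. N2 (%x. grad (f k) x - g x)) ~> 0"
 "!!k. f k \<in> BM" "!!k. grad (f k) \<in> BM"
 using D by (rule DlimE) auto
 obtain e where e: "!!k. e k \<in> test_functions \<Omega>" "(%k. Nq (%x. e k x - v x)) ~> 0"
 "(%k. N2 (%x. grad (e k) x - h x)) ~> 0"
 "!!k. e k \<in> BM" "!!k. grad (e k) \<in> BM"
 using D' by (rule DlimE) auto
 note [measurable] = Dlim_measurable[OF D] Dlim_measurable[OF D'] f(4,5) e(4,5)
 have gr: "grad (%x. f k x + c * e k x) x = grad (f k) x + c *\<^sub>R grad (e k) x" for k x
 by (rule grad_eqI)
 (auto intro!: derivative_eq_intros smooth_has_grad[OF test_functionsD(1)] f(1) e(1) simp: inner_add_left)
 show ?thesis
 proof (rule DlimI[where f = "%k x. f k x + c * e k x"])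
 show "(%x. f k x + c * e k x) \<in> test_functions \<Omega>" for k by (rule test_functions_add[OF f(1) e(1)])
 have "Nq (%x. f k x + c * e k x - (u x + c * v x)) <= ennreal (2 powr crit_exp CARD('n)) *
 (Nq (%x. f k x - u x) + ennreal (\<bar>c\<bar> powr crit_exp CARD('n)) * Nq (%x. e k x - v x))" for k
 using Nq_add[OF _ _ q, of "%x. f k x - u x" "%x. c * (e k x - v x)"]
 by (simp add: algebra_simps Nq_cmult[symmetric])
 then show "(%k. Nq (%x. f k x + c * e k x - (u x + c * v x))) ~> 0"
 by (rule tendsto_zero_ennreal_le[rotated])
 (intro tendsto_zero_ennreal_cmult tendsto_zero_ennreal_add f e, auto)
 have "N2 (%x. grad (%x. f k x + c * e k x) x - (g x + c *\<^sub>R h x)) <= 2 *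
 (N2 (%x. grad (f k) x - g x) + ennreal (c\<^sup>2) * N2 (%x. grad (e k) x - h x))" for k
 using N2_add[of "%x. grad (f k) x - g x" "%x. c *\<^sub>R (grad (e k) x - h x)"]
 by (simp add: algebra_simps N2_cmult[symmetric] gr)
 then show "(%k. N2 (%x. grad (%x. f k x + c * e k x) x - (g x + c *\<^sub>R h x))) ~> 0"
 by (rule tendsto_zero_ennreal_le[rotated])
 (intro tendsto_zero_ennreal_cmult tendsto_zero_ennreal_add f e, auto)
 qed measurable
qed

lemma Dlim_cong_AE:
 assumes D: "Dlim \<Omega> u g" and AE: "AE x in lborel. u x = u' x" "AE x in lborel. g x = g' x"
 and m: "u' \<in> BM" "g' \<in> BM"
 shows "Dlim \<Omega> u' g'"
proof -
 obtain f where f: "!!k. f k \<in> test_functions \<Omega>" "(%k. Nq (%x. f k x - u x)) ~> 0"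
 "(%k. N2 (%x. grad (f k) x - g x)) ~> 0"
 using D by (rule DlimE) auto
 have "Nq (%x. f k x - u' x) = Nq (%x. f k x - u x)" for k
 unfolding Nq_def by (rule nn_integral_cong_AE) (use AE(1) in \<open>auto elim!: eventually_mono\<close>)
 moreover have "N2 (%x. grad (f k) x - g' x) = N2 (%x. grad (f k) x - g x)" for k
 unfolding N2_def by (rule nn_integral_cong_AE) (use AE(2) in \<open>auto elim!: eventually_mono\<close>)
 ultimately show ?thesis using f m by (intro DlimI[where f = f]) auto
qed

lemma Dlim_test:
 assumes f: "f \<in> test_functions \<Omega>"
 shows "Dlim \<Omega> f (grad f)"
proof (rule DlimI[where f = "%_. f"])
 show "f \<in> BM" "grad f \<in> BM"
 using test_measurable[OF f] test_grad_measurable[OF f] by auto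
qed (use f in \<open>auto simp: Nq_def N2_def\<close>)

lemma N2_eq_0:
 fixes G :: "real^'n => 'b::euclidean_space"
 assumes [measurable]: "G \<in> BM" and "N2 G = 0"
 shows "AE x in lborel. G x = 0"
 using assms(2) unfolding N2_def by (subst (asm) nn_integral_0_iff_AE) auto

lemma N2_integrable:
 fixes G :: "real^'n => 'b::euclidean_space"
 assumes [measurable]: "G \<in> BM" and "N2 G < \<infinity>"
 shows "integrable lborel (%x. (norm (G x))^2)" "N2 G = ennreal (LBINT x. (norm (G x))^2)"
proof -
 show i: "integrable lborel (%x. (norm (G x))^2)"
 using assms(2) by (intro integrableI_bounded) (auto simp: N2_def)
 show "N2 G = ennreal (LBINT x. (norm (G x))^2)"
 unfolding N2_def by (rule nn_integral_eq_integral[OF i]) simp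
qed

lemma N2_inner_integrable:
 fixes G H :: "real^'n => 'b::euclidean_space"
 assumes [measurable]: "G \<in> BM" "H \<in> BM"
 and "N2 G < \<infinity>" "N2 H < \<infinity>"
 shows "integrable lborel (%x. G x \<bullet> H x)"
proof (rule integrable_dom)
 show "integrable lborel (%x. (norm (G x))^2 + (norm (H x))^2)"
 by (intro integrable_plus N2_integrable(1) assms)
 have "\<bar>G x \<bullet> H x\<bar> <= (norm (G x))^2 + (norm (H x))^2" for x
 proof -
 have "\<bar>G x \<bullet> H x\<bar> <= norm (G x) * norm (H x)" by (rule Cauchy_Schwarz_ineq2)
 also have "\<dots> <= (norm (G x))^2 + (norm (H x))^2"
 using sum_squares_bound[of "norm (G x)" "norm (H x)"] mult_nonneg_nonneg[OF norm_ge_zero norm_ge_zero, of "G x" "H x"]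
 by linarith
 finally show ?thesis .
 qed
 then show "AE x in lborel. norm (G x \<bullet> H x) <= norm ((norm (G x))^2 + (norm (H x))^2)" by simp
qed measurable

text \<open>If \<open>G\<close> is a gradient of \<open>0\<close>, it is orthogonal to all gradients of test functions, in particular
 to its own approximants.\<close>

lemma Dlim_unique:
 fixes u :: "real^'n => real"
 assumes D: "Dlim \<Omega> u g" and D': "Dlim \<Omega>' u' g'" and AE: "AE x in lborel. u x = u' x"
 and N: "CARD('n) >= 3"
 shows "AE x in lborel. g x = g' x"
proof -
 have q: "crit_exp CARD('n) > 0" using crit_exp_gt[OF N] by simp
 define G where "G x = g x + (-1) *\<^sub>R g' x" for x
 note [measurable] = Dlim_measurable[OF D] Dlim_measurable[OF D']
 have Gm [measurable]: "G \<in> BM" unfolding G_def[abs_def] by measurable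
 have "Dlim UNIV (%x. u x + (-1) * u' x) G"
 unfolding G_def[abs_def] by (rule Dlim_lincomb[OF Dlim_mono[OF D] Dlim_mono[OF D'] N]) auto
 then have D0: "Dlim UNIV (%x. 0) G"
 by (rule Dlim_cong_AE) (use AE in \<open>auto elim!: eventually_mono\<close>)
 obtain f where f: "!!k. f k \<in> test_functions UNIV" "(%k. N2 (%x. grad (f k) x - G x)) ~> 0"
 "!!k. grad (f k) \<in> BM"
 using D0 by (rule DlimE) auto
 note [measurable] = f(3)
 have GN: "N2 G < \<infinity>" using Dlim_finite(2)[OF D0 q] .
 have fN: "N2 (grad (f k)) < \<infinity>" for k using test_Nq_finite(2)[OF f(1) q] .
 \<comment> \<open>The zero function is differentiated weakly in direction b and tested with the
   partial derivative of \<open>f k\<close> in the same direction; summation over b gives the inner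
   product.\<close>
 have orth: "(LBINT x. G x \<bullet> grad (f k) x) = 0" for k
 proof -
 have *: "integrable lborel (%x. (G x \<bullet> b) * (grad (f k) x \<bullet> b))" "(LBINT x. (G x \<bullet> b) * (grad (f k) x \<bullet> b)) = 0" for b
 using Dlim_weak_derivative[OF D0 N deriv_test_functions[OF f(1)[of k], of b], where v = b] by auto
 have "(LBINT x. G x \<bullet> grad (f k) x) = (LBINT x. (\<Sum>b\<in>Basis. (G x \<bullet> b) * (grad (f k) x \<bullet> b)))"
 by (subst euclidean_inner) simp
 also have "\<dots> = 0" by (subst Bochner_Integration.integral_sum) (auto simp: *)
 finally show ?thesis .
 qed
 \<comment> \<open>By orthogonality the squared distance from G to \<open>grad (f k)\<close> is the
   sum of both squared norms.\<close>
 have le: "N2 G <= N2 (%x. grad (f k) x - G x)" for k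
 proof -
 have i: "integrable lborel (%x. (norm (grad (f k) x))^2)" "integrable lborel (%x. (norm (G x))^2)"
 "integrable lborel (%x. G x \<bullet> grad (f k) x)"
 using N2_integrable(1)[OF f(3) fN] N2_integrable(1)[OF Gm GN] N2_inner_integrable[OF Gm f(3) GN fN] by auto
 have e: "(norm (grad (f k) x - G x))^2 = (norm (grad (f k) x))^2 + (norm (G x))^2 - 2 * (G x \<bullet> grad (f k) x)" for x
 by (simp add: power2_norm_eq_inner inner_diff_left inner_diff_right inner_commute)
 have "(LBINT x. (norm (G x))^2) <= (LBINT x. (norm (grad (f k) x))^2) + (LBINT x. (norm (G x))^2)"
 by simp
 also have "\<dots> = (LBINT x. (norm (grad (f k) x - G x))^2)"
 unfolding e using i orth[of k] by simp
 finally have "ennreal (LBINT x. (norm (G x))^2) <= ennreal (LBINT x. (norm (grad (f k) x - G x))^2)"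
 by (rule ennreal_leI)
 also have "\<dots> = N2 (%x. grad (f k) x - G x)"
 proof -
 have "integrable lborel (%x. (norm (grad (f k) x - G x))^2)" unfolding e using i by simp
 then show ?thesis unfolding N2_def by (rule nn_integral_eq_integral[symmetric]) simp
 qed
 finally show ?thesis using N2_integrable(2)[OF Gm GN] by simp
 qed
 have "N2 G <= 0" by (rule LIMSEQ_le_const[OF f(2)]) (use le in auto)
 then have "AE x in lborel. G x = 0" by (intro N2_eq_0 Gm) simp
 then show ?thesis by (auto simp: G_def elim!: eventually_mono)
qed

section \<open>Transfer between \<open>\<Omega>\<close> and the whole space\<close>

lemma nn_lebesgue_on:
 assumes "open \<Omega>"
 shows "(\<integral>\<^sup>+x. F x \<partial>lebesgue_on \<Omega>) = (NN x. F x * indicator \<Omega> x)"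
 using assms by (subst nn_integral_restrict_space) (auto simp: nn_integral_completion)

lemma AE_lebesgue_on:
 assumes "open \<Omega>"
 shows "(AE x in lebesgue_on \<Omega>. P x) \<longleftrightarrow> (AE x in lborel. x \<in> \<Omega> --> P x)"
 using assms by (subst AE_restrict_space_iff) (auto simp: AE_completion_iff)

lemma borel_lebesgue_on: "u \<in> BM ==> u \<in> borel_measurable (lebesgue_on \<Omega>)"
 by (intro measurable_restrict_space1 measurable_completion) simp

lemma borel_version_real:
 fixes u :: "real^'n => real"
 assumes "open \<Omega>" "u \<in> borel_measurable (lebesgue_on \<Omega>)"
 shows "\<exists>u'\<in>BM. (\<forall>x. x \<notin> \<Omega> --> u' x = 0) \<and> (AE x in lborel. x \<in> \<Omega> --> u x = u' x)"
proof -
 have "(%x. indicator \<Omega> x *\<^sub>R u x) \<in> borel_measurable lebesgue"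
 using assms by (subst (asm) borel_measurable_restrict_space_iff) auto
 then obtain h where h: "h \<in> borel_measurable lborel" "AE x in lborel. indicator \<Omega> x *\<^sub>R u x = h x"
 using completion_ex_borel_measurable_real[of "%x. indicator \<Omega> x *\<^sub>R u x" lborel] by auto
 have [measurable]: "\<Omega> \<in> sets borel" using assms(1) by simp
 show ?thesis
 proof (intro bexI[of _ "%x. indicator \<Omega> x * h x"] conjI)
 show "AE x in lborel. x \<in> \<Omega> --> u x = indicator \<Omega> x * h x"
 using h(2) by (auto elim!: eventually_mono)
 show "(%x. indicator \<Omega> x * h x) \<in> BM" using h(1) by measurable
 qed auto
qed

lemma borel_version_vec:
 fixes g :: "real^'n => real^'n"
 assumes "open \<Omega>" "g \<in> borel_measurable (lebesgue_on \<Omega>)"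
 shows "\<exists>g'\<in>BM. (\<forall>x. x \<notin> \<Omega> --> g' x = 0) \<and> (AE x in lborel. x \<in> \<Omega> --> g x = g' x)"
proof -
 have "\<forall>b::real^'n. \<exists>u'\<in>BM. (\<forall>x. x \<notin> \<Omega> --> u' x = 0) \<and>
 (AE x in lborel. x \<in> \<Omega> --> g x \<bullet> b = u' x)"
 using assms by (intro allI borel_version_real) auto
 from choice[OF this[unfolded Bex_def]]
 obtain h where h: "!!b. h b \<in> BM" "!!b x. x \<notin> \<Omega> ==> h b x = 0"
 "!!b::real^'n. AE x in lborel. x \<in> \<Omega> --> g x \<bullet> b = h b x" by blast
 note [measurable] = h(1)
 have "AE x in lborel. \<forall>b\<in>(Basis :: (real^'n) set). x \<in> \<Omega> --> g x \<bullet> b = h b x"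
 by (subst AE_finite_all) (auto simp: h(3))
 then have "AE x in lborel. x \<in> \<Omega> --> g x = (\<Sum>b\<in>Basis. h b x *\<^sub>R b)"
 proof (rule eventually_mono, intro impI)
 fix x assume "\<forall>b\<in>Basis. x \<in> \<Omega> --> g x \<bullet> b = h b x" "x \<in> \<Omega>"
 then have "(\<Sum>b\<in>Basis. h b x *\<^sub>R b) = (\<Sum>b\<in>Basis. (g x \<bullet> b) *\<^sub>R b)" by (intro sum.cong) auto
 then show "g x = (\<Sum>b\<in>Basis. h b x *\<^sub>R b)" by (simp add: euclidean_representation)
 qed
 then show ?thesis by (intro bexI[of _ "%x. \<Sum>b\<in>Basis. h b x *\<^sub>R b"]) (auto simp: h(2))
qed

text \<open>Borel versions vanishing off \<open>\<Omega>\<close> turn integrals over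
  \<open>lebesgue_on \<Omega>\<close> into integrals over the whole space, because the approximating
  test functions vanish off \<open>\<Omega>\<close> as well.\<close>

lemma D12_limit_Dlim:
 fixes u :: "real^'n => real"
 assumes \<Omega>: "open \<Omega>" and D: "D12_limit \<Omega> u g" and N: "CARD('n) >= 3"
 shows "\<exists>u' g'. Dlim \<Omega> u' g' \<and> (AE x in lborel. x \<in> \<Omega> --> u x = u' x) \<and>
 (AE x in lborel. x \<in> \<Omega> --> g x = g' x) \<and> (\<forall>x. x \<notin> \<Omega> --> u' x = 0 \<and> g' x = 0)"
proof -
 have q: "crit_exp CARD('n) > 0" using crit_exp_gt[OF N] by simp
 obtain u' where u': "u' \<in> BM" "!!x. x \<notin> \<Omega> ==> u' x = 0"
 "AE x in lborel. x \<in> \<Omega> --> u x = u' x"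
 using borel_version_real[OF \<Omega>] D unfolding D12_limit_def by blast
 obtain g' where g': "g' \<in> BM" "!!x. x \<notin> \<Omega> ==> g' x = 0"
 "AE x in lborel. x \<in> \<Omega> --> g x = g' x"
 using borel_version_vec[OF \<Omega>] D unfolding D12_limit_def by blast
 obtain f where f: "!!k. f k \<in> test_functions \<Omega>"
 "(%k. \<integral>\<^sup>+x. ennreal (\<bar>f k x - u x\<bar> powr crit_exp CARD('n)) \<partial>lebesgue_on \<Omega>) ~> 0"
 "(%k. \<integral>\<^sup>+x. ennreal ((norm (grad (f k) x - g x))^2) \<partial>lebesgue_on \<Omega>) ~> 0"
 using D unfolding D12_limit_def by blast
 have off: "f k x = 0" "grad (f k) x = 0" if "x \<notin> \<Omega>" for k x
 using zero_notin_closure_grad[of x "f k"] test_functionsD(3)[OF f(1)[of k]] that by auto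
 have e1: "Nq (%x. f k x - u' x) = (\<integral>\<^sup>+x. ennreal (\<bar>f k x - u x\<bar> powr crit_exp CARD('n)) \<partial>lebesgue_on \<Omega>)" for k
 unfolding Nq_def nn_lebesgue_on[OF \<Omega>]
 proof (rule nn_integral_cong_AE, rule eventually_mono[OF u'(3)])
 fix x assume "x \<in> \<Omega> --> u x = u' x"
 then show "ennreal (\<bar>f k x - u' x\<bar> powr crit_exp CARD('n)) = ennreal (\<bar>f k x - u x\<bar> powr crit_exp CARD('n)) * indicator \<Omega> x"
 using u'(2)[of x] off[of x k] q by (cases "x \<in> \<Omega>") auto
 qed
 have e2: "N2 (%x. grad (f k) x - g' x) = (\<integral>\<^sup>+x. ennreal ((norm (grad (f k) x - g x))^2) \<partial>lebesgue_on \<Omega>)" for k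
 unfolding N2_def nn_lebesgue_on[OF \<Omega>]
 proof (rule nn_integral_cong_AE, rule eventually_mono[OF g'(3)])
 fix x assume "x \<in> \<Omega> --> g x = g' x"
 then show "ennreal ((norm (grad (f k) x - g' x))^2) = ennreal ((norm (grad (f k) x - g x))^2) * indicator \<Omega> x"
 using g'(2)[of x] off[of x k] by (cases "x \<in> \<Omega>") auto
 qed
 have "Dlim \<Omega> u' g'" by (rule DlimI[where f = f]) (use u' g' f e1 e2 in auto)
 then show ?thesis using u' g' by blast
qed

lemma Dlim_D12_limit:
 fixes u :: "real^'n => real"
 assumes \<Omega>: "open \<Omega>" and D: "Dlim \<Omega> u g"
 shows "D12_limit \<Omega> u g"
proof -
 obtain f where f: "!!k. f k \<in> test_functions \<Omega>" "(%k. Nq (%x. f k x - u x)) ~> 0"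
 "(%k. N2 (%x. grad (f k) x - g x)) ~> 0"
 using D by (rule DlimE) auto
 show ?thesis unfolding D12_limit_def
 proof (intro conjI exI[of _ f] allI)
 show "u \<in> borel_measurable (lebesgue_on \<Omega>)" "g \<in> borel_measurable (lebesgue_on \<Omega>)"
 using Dlim_measurable[OF D] by (auto intro: borel_lebesgue_on)
 show "(%k. \<integral>\<^sup>+x. ennreal (\<bar>f k x - u x\<bar> powr crit_exp CARD('n)) \<partial>lebesgue_on \<Omega>) ~> 0"
 by (rule tendsto_zero_ennreal_le[OF f(2)])
 (auto simp: nn_lebesgue_on[OF \<Omega>] Nq_def indicator_def intro!: nn_integral_mono)
 show "(%k. \<integral>\<^sup>+x. ennreal ((norm (grad (f k) x - g x))^2) \<partial>lebesgue_on \<Omega>) ~> 0"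
 by (rule tendsto_zero_ennreal_le[OF f(3)])
 (auto simp: nn_lebesgue_on[OF \<Omega>] N2_def indicator_def intro!: nn_integral_mono)
 qed (rule f(1))
qed

text \<open>The delicate term of the product rule is (f_k - u) grad c. It needs L^2 convergence,
  which the critical norm provides on the bounded support of grad c.\<close>

lemma Dlim_mult_test:
 fixes u :: "real^'n => real"
 assumes D: "Dlim UNIV u g" and c: "c \<in> test_functions \<Omega>" and N: "CARD('n) >= 3"
 shows "Dlim \<Omega> (%x. c x * u x) (%x. c x *\<^sub>R g x + u x *\<^sub>R grad c x)"
proof -
 have q: "crit_exp CARD('n) > 2" using crit_exp_gt[OF N] by simp
 obtain f where f: "!!k. f k \<in> test_functions UNIV" "(%k. Nq (%x. f k x - u x)) ~> 0"
 "(%k. N2 (%x. grad (f k) x - g x)) ~> 0"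
 "!!k. f k \<in> BM" "!!k. grad (f k) \<in> BM"
 using D by (rule DlimE) auto
 note [measurable] = Dlim_measurable[OF D] f(4,5) test_measurable[OF c] test_grad_measurable[OF c]
 obtain r M where r: "!!z. norm z > r ==> grad c z = 0" and M: "!!z. \<bar>c z\<bar> <= M" "!!z. norm (grad c z) <= M"
 using test_bounds[OF c] by metis
 have gr: "grad (%x. c x * f k x) x = c x *\<^sub>R grad (f k) x + f k x *\<^sub>R grad c x" for k x
 by (rule grad_eqI, rule has_derivative_eq_rhs[OF test_mult_derivative[OF c f(1)]])
 (auto simp: inner_add_left)
 show ?thesis
 proof (rule DlimI[where f = "%k x. c x * f k x"])
 show "(%x. c x * f k x) \<in> test_functions \<Omega>" for k
 using test_functions_mult[OF c test_functionsD(1)[OF f(1)], of k] by (simp add: mult.commute)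
 show "(%k. Nq (%x. c x * f k x - c x * u x)) ~> 0"
 proof (rule tendsto_zero_ennreal_le[OF tendsto_zero_ennreal_cmult[OF f(2)]])
 show "ennreal (M powr crit_exp CARD('n)) < \<infinity>" by simp
 fix k
 have "Nq (%x. c x * f k x - c x * u x) <= (NN x. ennreal (M powr crit_exp CARD('n)) *
 ennreal (\<bar>f k x - u x\<bar> powr crit_exp CARD('n)))"
 unfolding Nq_def
 proof (rule nn_integral_mono)
 fix x
 have "\<bar>c x * f k x - c x * u x\<bar> powr crit_exp CARD('n) = \<bar>c x\<bar> powr crit_exp CARD('n) * \<bar>f k x - u x\<bar> powr crit_exp CARD('n)"
 by (simp add: powr_mult[symmetric] abs_mult[symmetric] right_diff_distrib)
 also have "\<dots> <= M powr crit_exp CARD('n) * \<bar>f k x - u x\<bar> powr crit_exp CARD('n)"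
 using M(1) q by (intro mult_right_mono powr_mono2) auto
 finally show "ennreal (\<bar>c x * f k x - c x * u x\<bar> powr crit_exp CARD('n)) <= ennreal (M powr crit_exp CARD('n)) *
 ennreal (\<bar>f k x - u x\<bar> powr crit_exp CARD('n))"
 by (simp add: ennreal_mult[symmetric] ennreal_leI)
 qed
 then show "Nq (%x. c x * f k x - c x * u x) <= ennreal (M powr crit_exp CARD('n)) * Nq (%x. f k x - u x)"
 by (simp add: Nq_def nn_integral_cmult)
 qed
 have b1: "N2 (%x. c x *\<^sub>R (grad (f k) x - g x)) <= ennreal (M\<^sup>2) * N2 (%x. grad (f k) x - g x)" for k
 proof -
 have "N2 (%x. c x *\<^sub>R (grad (f k) x - g x)) <= (NN x. ennreal (M\<^sup>2) * ennreal ((norm (grad (f k) x - g x))^2))"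
 unfolding N2_def
 proof (rule nn_integral_mono)
 fix x
 have "(\<bar>c x\<bar> * norm (grad (f k) x - g x))^2 <= (M * norm (grad (f k) x - g x))^2"
 using M(1) by (intro power_mono mult_right_mono) auto
 then show "ennreal ((norm (c x *\<^sub>R (grad (f k) x - g x)))^2) <= ennreal (M\<^sup>2) * ennreal ((norm (grad (f k) x - g x))^2)"
 by (simp add: ennreal_mult[symmetric] ennreal_leI power_mult_distrib)
 qed
 then show ?thesis by (simp add: nn_integral_cmult N2_def)
 qed
 define L where "L k = (NN x. indicator (cball (0::real^'n) r) x * ennreal (\<bar>f k x - u x\<bar> powr 2))" for k
 have L: "L ~> 0"
 unfolding L_def[abs_def]
 by (rule nn_ball_powr_tendsto[where s = "crit_exp CARD('n)"]) (use q f(2) in \<open>auto simp: Nq_def\<close>)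
 have b2: "N2 (%x. (f k x - u x) *\<^sub>R grad c x) <= ennreal (M\<^sup>2) * L k" for k
 proof -
 have "N2 (%x. (f k x - u x) *\<^sub>R grad c x) <= (NN x. ennreal (M\<^sup>2) * (indicator (cball (0::real^'n) r) x * ennreal (\<bar>f k x - u x\<bar> powr 2)))"
 unfolding N2_def
 proof (rule nn_integral_mono)
 fix x
 show "ennreal ((norm ((f k x - u x) *\<^sub>R grad c x))^2)
 <= ennreal (M\<^sup>2) * (indicator (cball (0::real^'n) r) x * ennreal (\<bar>f k x - u x\<bar> powr 2))"
 proof (cases "norm x <= r")
 case True
 have "(\<bar>f k x - u x\<bar> * norm (grad c x))^2 <= (\<bar>f k x - u x\<bar> * M)^2"
 using M(2) by (intro power_mono mult_left_mono) auto
 then show ?thesis using True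
 by (simp add: ennreal_mult[symmetric] ennreal_leI power_mult_distrib mult.commute)
 next
 case False
 then show ?thesis using r[of x] by simp
 qed
 qed
 also have "\<dots> = ennreal (M\<^sup>2) * L k" unfolding L_def by (rule nn_integral_cmult) measurable
 finally show ?thesis .
 qed
 show "(%k. N2 (%x. grad (%x. c x * f k x) x - (c x *\<^sub>R g x + u x *\<^sub>R grad c x))) ~> 0"
 proof (rule tendsto_zero_ennreal_le)
 show "(%k. ennreal 2 * (ennreal (M\<^sup>2) * N2 (%x. grad (f k) x - g x) + ennreal (M\<^sup>2) * L k)) ~> 0"
 by (intro tendsto_zero_ennreal_cmult tendsto_zero_ennreal_add f(3) L) auto
 fix k
 have "N2 (%x. grad (%x. c x * f k x) x - (c x *\<^sub>R g x + u x *\<^sub>R grad c x))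
 = N2 (%x. c x *\<^sub>R (grad (f k) x - g x) + (f k x - u x) *\<^sub>R grad c x)"
 by (simp add: gr algebra_simps)
 also have "\<dots> <= 2 * (N2 (%x. c x *\<^sub>R (grad (f k) x - g x)) + N2 (%x. (f k x - u x) *\<^sub>R grad c x))"
 by (rule N2_add) measurable
 also have "\<dots> <= ennreal 2 * (ennreal (M\<^sup>2) * N2 (%x. grad (f k) x - g x) + ennreal (M\<^sup>2) * L k)"
 using b1[of k] b2[of k] by (auto intro!: mult_mono add_mono)
 finally show "N2 (%x. grad (%x. c x * f k x) x - (c x *\<^sub>R g x + u x *\<^sub>R grad c x))
 <= ennreal 2 * (ennreal (M\<^sup>2) * N2 (%x. grad (f k) x - g x) + ennreal (M\<^sup>2) * L k)" .
 qed
 qed measurable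
qed

lemma Nq_AE_subseq:
 fixes u :: "real^'n => real"
 assumes lim: "(%k. Nq (%x. f k x - u x)) ~> 0"
 and [measurable]: "!!k. f k \<in> BM" "u \<in> BM"
 and q: "crit_exp CARD('n) > 0"
 shows "\<exists>s. strict_mono s \<and> (AE x in lborel. (%k. f (s k) x) ~> u x)"
proof -
 obtain K where K: "!!k. k >= K ==> Nq (%x. f k x - u x) <= ennreal 1"
 using tendsto_zero_ennrealD[OF lim, of 1] by (auto simp: eventually_sequentially)
 define h where "h k x = \<bar>f (k + K) x - u x\<bar> powr crit_exp CARD('n)" for k x
 have [measurable]: "h k \<in> BM" for k unfolding h_def[abs_def] by measurable
 have hi: "integrable lborel (h k)" for k
 using order.strict_trans1[OF K[of "k + K"]] by (intro integrableI_bounded) (auto simp: h_def Nq_def)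
 have "(%k. \<integral>\<^sup>+x. norm (h k x) \<partial>lborel) ~> 0"
 using LIMSEQ_ignore_initial_segment[OF lim, of K] by (simp add: h_def Nq_def)
 then have "(%k. \<integral>x. norm (h k x) \<partial>lborel) ~> 0"
 using hi tendsto_ennreal_iff[of "%k. \<integral>x. norm (h k x) \<partial>lborel" sequentially 0]
 by (simp add: nn_integral_eq_integral)
 from tendsto_L1_AE_subseq[OF hi this] obtain s where s: "strict_mono s"
 "AE x in lborel. (%k. h (s k) x) ~> 0" by auto
 show ?thesis
 proof (intro exI[of _ "%k. s k + K"] conjI)
 show "strict_mono (%k. s k + K)" using s(1) by (simp add: strict_mono_def)
 show "AE x in lborel. (%k. f (s k + K) x) ~> u x"
 using s(2)
 proof (rule eventually_mono)
 fix x assume "(%k. h (s k) x) ~> 0"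
 then have "(%k. h (s k) x powr (1 / crit_exp CARD('n))) ~> 0 powr (1 / crit_exp CARD('n))"
 using q by (intro tendsto_powr2) (auto simp: h_def)
 then have "(%k. \<bar>f (s k + K) x - u x\<bar>) ~> 0"
 using q by (simp add: h_def powr_powr)
 then show "(%k. f (s k + K) x) ~> u x"
 by (rule LIM_zero_cancel[OF tendsto_rabs_zero_cancel])
 qed
 qed
qed

text \<open>The error term (T'(f_k) - T'(u)) g tends to 0 in L^2 by dominated convergence, after
  passing to an almost everywhere convergent subsequence of the approximants.\<close>

lemma Dlim_compose:
 fixes u :: "real^'n => real"
 assumes D: "Dlim \<Omega> u g" and N: "CARD('n) >= 3"
 and T: "!!k. Dk k T" "!!s. (T has_real_derivative T' s) (at s)" "T 0 = 0" "!!s. \<bar>T' s\<bar> <= 1"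
 and cT': "continuous_on UNIV T'"
 shows "Dlim \<Omega> (%x. T (u x)) (%x. T' (u x) *\<^sub>R g x)"
proof -
 have q: "crit_exp CARD('n) > 0" using crit_exp_gt[OF N] by simp
 obtain f0 where f0: "!!k. f0 k \<in> test_functions \<Omega>" "(%k. Nq (%x. f0 k x - u x)) ~> 0"
 "(%k. N2 (%x. grad (f0 k) x - g x)) ~> 0"
 "!!k. f0 k \<in> BM" "!!k. grad (f0 k) \<in> BM"
 using D by (rule DlimE) auto
 note um [measurable] = Dlim_measurable[OF D]
 obtain s where s: "strict_mono s" "AE x in lborel. (%k. f0 (s k) x) ~> u x"
 using Nq_AE_subseq[OF f0(2) f0(4) um(1) q] by blast
 define f where "f k = f0 (s k)" for k
 have f: "!!k. f k \<in> test_functions \<Omega>" "(%k. Nq (%x. f k x - u x)) ~> 0"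
 "(%k. N2 (%x. grad (f k) x - g x)) ~> 0"
 "!!k. f k \<in> BM" "!!k. grad (f k) \<in> BM"
 "AE x in lborel. (%k. f k x) ~> u x"
 using f0 s LIMSEQ_subseq_LIMSEQ[OF f0(2) s(1)] LIMSEQ_subseq_LIMSEQ[OF f0(3) s(1)]
 by (auto simp: f_def o_def)
 note [measurable] = f(4,5)
 have Tc: "continuous_on UNIV T" using T(2) DERIV_continuous_on by blast
 have [measurable]: "T \<in> BM" "T' \<in> BM"
 using Tc cT' by (auto intro: borel_measurable_continuous_onI)
 have gr: "grad (%x. T (f k x)) x = T' (f k x) *\<^sub>R grad (f k) x" for k x
 proof (rule grad_eqI)
 have "((%x. T (f k x)) has_derivative (%h. T' (f k x) * (grad (f k) x \<bullet> h))) (at x)"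
 using has_derivative_compose[OF smooth_has_grad[OF test_functionsD(1)[OF f(1)]] T(2)[unfolded has_field_derivative_def]] .
 then show "((%x. T (f k x)) has_derivative (\<bullet>) (T' (f k x) *\<^sub>R grad (f k) x)) (at x)"
 by (rule has_derivative_eq_rhs) auto
 qed
 have lip: "\<bar>T a - T b\<bar> <= \<bar>a - b\<bar>" for a b
 proof -
 have "norm (T a - T b) <= 1 * norm (a - b)"
 by (rule field_differentiable_bound[of UNIV T T' 1])
 (use T in \<open>auto intro: has_field_derivative_at_within\<close>)
 then show ?thesis by simp
 qed
 show ?thesis
 proof (rule DlimI[where f = "%k x. T (f k x)"])
 show "(%x. T (f k x)) \<in> test_functions \<Omega>" for k using test_functions_compose[OF f(1) T(1,3)] .
 show "(%k. Nq (%x. T (f k x) - T (u x))) ~> 0"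
 by (rule tendsto_zero_ennreal_le[OF f(2)])
 (unfold Nq_def, intro nn_integral_mono ennreal_leI powr_mono2, use q lip in auto)
 define E where "E k = (NN x. ennreal ((T' (f k x) - T' (u x))^2 * (norm (g x))^2))" for k
 have E: "E ~> 0"
 proof -
 have "E ~> (\<integral>\<^sup>+x. 0 \<partial>(lborel :: (real^'n) measure))"
 unfolding E_def[abs_def]
 proof (rule nn_integral_dominated_convergence[where w = "%x. ennreal 4 * ennreal ((norm (g x))^2)"])
 show "AE x in lborel. (%k. ennreal ((T' (f k x) - T' (u x))^2 * (norm (g x))^2)) ~> 0"
 using f(6)
 proof (rule eventually_mono)
 fix x assume "(%k. f k x) ~> u x"
 then have "(%k. T' (f k x)) ~> T' (u x)"
 using continuous_on_tendsto_compose[OF cT'] by auto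
 then have "(%k. (T' (f k x) - T' (u x))^2 * (norm (g x))^2) ~> (T' (u x) - T' (u x))\<^sup>2 * (norm (g x))^2"
 by (intro tendsto_intros)
 then show "(%k. ennreal ((T' (f k x) - T' (u x))^2 * (norm (g x))^2)) ~> 0"
 using tendsto_ennrealI by fastforce
 qed
 show "AE x in lborel. ennreal ((T' (f k x) - T' (u x))^2 * (norm (g x))^2) <= ennreal 4 * ennreal ((norm (g x))^2)" for k
 proof (rule AE_I2)
 fix x
 have "\<bar>T' (f k x) - T' (u x)\<bar> <= 2" using T(4)[of "f k x"] T(4)[of "u x"] by linarith
 then have "\<bar>T' (f k x) - T' (u x)\<bar>\<^sup>2 <= 2\<^sup>2" by (intro power_mono) auto
 then show "ennreal ((T' (f k x) - T' (u x))^2 * (norm (g x))^2) <= ennreal 4 * ennreal ((norm (g x))^2)"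
 by (subst ennreal_mult[symmetric]) (auto intro!: ennreal_leI mult_right_mono)
 qed
 show "(NN x. ennreal 4 * ennreal ((norm (g x))^2)) < \<infinity>"
 using Dlim_finite(2)[OF D q] by (subst nn_integral_cmult) (auto simp: N2_def ennreal_mult_less_top)
 qed measurable
 then show ?thesis by simp
 qed
 show "(%k. N2 (%x. grad (%x. T (f k x)) x - T' (u x) *\<^sub>R g x)) ~> 0"
 proof (rule tendsto_zero_ennreal_le)
 show "(%k. ennreal 2 * (N2 (%x. grad (f k) x - g x) + E k)) ~> 0"
 by (intro tendsto_zero_ennreal_cmult tendsto_zero_ennreal_add f(3) E) auto
 fix k
 have "N2 (%x. grad (%x. T (f k x)) x - T' (u x) *\<^sub>R g x)
 = N2 (%x. T' (f k x) *\<^sub>R (grad (f k) x - g x) + (T' (f k x) - T' (u x)) *\<^sub>R g x)"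
 by (simp add: gr algebra_simps)
 also have "\<dots> <= 2 * (N2 (%x. T' (f k x) *\<^sub>R (grad (f k) x - g x)) + N2 (%x. (T' (f k x) - T' (u x)) *\<^sub>R g x))"
 by (rule N2_add) measurable
 also have "N2 (%x. (T' (f k x) - T' (u x)) *\<^sub>R g x) = E k"
 by (simp add: N2_def E_def power_mult_distrib)
 also have "N2 (%x. T' (f k x) *\<^sub>R (grad (f k) x - g x)) <= N2 (%x. grad (f k) x - g x)"
 unfolding N2_def
 proof (intro nn_integral_mono ennreal_leI)
 fix x
 show "(norm (T' (f k x) *\<^sub>R (grad (f k) x - g x)))^2 <= (norm (grad (f k) x - g x))^2"
 using T(4) by (intro power_mono) (auto intro: mult_left_le_one_le)
 qed
 finally show "N2 (%x. grad (%x. T (f k x)) x - T' (u x) *\<^sub>R g x) <= ennreal 2 * (N2 (%x. grad (f k) x - g x) + E k)"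
 by (auto simp: mult_left_mono add_mono)
 qed
 qed measurable
qed

text \<open>One change of variables for rotations, translations and dilations: \<open>A'\<close> is
  the adjoint that acts on gradients, \<open>C\<close> the volume factor, \<open>c\<close> the
  amplitude of the critical scaling.\<close>

lemma Dlim_affine:
 fixes u :: "real^'n => real" and A B A' :: "real^'n => real^'n"
 assumes D: "Dlim \<Omega> u g" and N: "CARD('n) >= 3"
 and lin: "linear A" "linear B" "linear A'"
 and inv: "!!x. B (A x) = x" "!!x. A (B x) = x"
 and adj: "!!x y. A x \<bullet> y = x \<bullet> A' y"
 and \<Omega>: "!!x. A x + b \<in> \<Omega> ==> x \<in> \<Omega>'"
 and cv: "!!F. F \<in> BM ==>
 (NN x. F (A x + b)) = ennreal C * (NN x. F x)"
 shows "Dlim \<Omega>' (%x. c * u (A x + b)) (%x. c *\<^sub>R A' (g (A x + b)))"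
proof -
 obtain f where f: "!!k. f k \<in> test_functions \<Omega>" "(%k. Nq (%x. f k x - u x)) ~> 0"
 "(%k. N2 (%x. grad (f k) x - g x)) ~> 0"
 "!!k. f k \<in> BM" "!!k. grad (f k) \<in> BM"
 using D by (rule DlimE) auto
 note [measurable] = Dlim_measurable[OF D] f(4,5)
 have [measurable]: "A \<in> BM" "A' \<in> BM"
 using lin by (auto intro!: borel_measurable_continuous_onI linear_continuous_on simp: linear_linear)
 interpret A': linear A' by fact
 obtain K where K: "K > 0" "!!y. norm (A' y) <= K * norm y" using linear_bounded_pos[OF lin(3)] by blast
 have dA: "((%x. A x + b) has_derivative A) (at x)" for x
 using has_derivative_add_const bounded_linear_imp_has_derivative lin(1) linear_linear by blast
 have gr: "grad (%x. c * f k (A x + b)) x = c *\<^sub>R A' (grad (f k) (A x + b))" for k x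
 proof (rule grad_eqI)
 have "((%x. f k (A x + b)) has_derivative (%h. grad (f k) (A x + b) \<bullet> A h)) (at x)"
 by (rule has_derivative_compose[OF dA smooth_has_grad[OF test_functionsD(1)[OF f(1)]]])
 from has_derivative_mult_right[OF this, of c]
 show "((%x. c * f k (A x + b)) has_derivative (\<bullet>) (c *\<^sub>R A' (grad (f k) (A x + b)))) (at x)"
 by (rule has_derivative_eq_rhs) (auto simp: adj inner_commute)
 qed
 show ?thesis
 proof (rule DlimI[where f = "%k x. c * f k (A x + b)"])
 show "(%x. c * f k (A x + b)) \<in> test_functions \<Omega>'" for k
 using test_functions_mult[OF test_functions_affine[OF f(1)[of k] lin(1,2) inv \<Omega>] smooth_const[of c]] by simp
 have "Nq (%x. c * f k (A x + b) - c * u (A x + b)) = ennreal (\<bar>c\<bar> powr crit_exp CARD('n)) * (ennreal C * Nq (%x. f k x - u x))" for k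
 proof -
 have "Nq (%x. c * f k (A x + b) - c * u (A x + b)) = Nq (%x. c * (f k (A x + b) - u (A x + b)))"
 by (simp add: right_diff_distrib)
 also have "\<dots> = ennreal (\<bar>c\<bar> powr crit_exp CARD('n)) * Nq (%x. f k (A x + b) - u (A x + b))"
 by (rule Nq_cmult) measurable
 also have "Nq (%x. f k (A x + b) - u (A x + b)) = ennreal C * Nq (%x. f k x - u x)"
 unfolding Nq_def using cv[of "%x. ennreal (\<bar>f k x - u x\<bar> powr crit_exp CARD('n))"] by simp
 finally show ?thesis .
 qed
 then show "(%k. Nq (%x. c * f k (A x + b) - c * u (A x + b))) ~> 0"
 by (simp only:) (intro tendsto_zero_ennreal_cmult f(2), auto)
 have "N2 (%x. grad (%x. c * f k (A x + b)) x - c *\<^sub>R A' (g (A x + b))) <= ennreal (c\<^sup>2 * K\<^sup>2) * (ennreal C * N2 (%x. grad (f k) x - g x))" for k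
 proof -
 have "N2 (%x. grad (%x. c * f k (A x + b)) x - c *\<^sub>R A' (g (A x + b)))
 <= (NN x. ennreal (c\<^sup>2 * K\<^sup>2) * ennreal ((norm (grad (f k) (A x + b) - g (A x + b)))^2))"
 unfolding N2_def
 proof (rule nn_integral_mono)
 fix x
 let ?d = "grad (f k) (A x + b) - g (A x + b)"
 have "(norm (c *\<^sub>R A' ?d))^2 = c\<^sup>2 * (norm (A' ?d))^2" by (simp add: power_mult_distrib)
 also have "\<dots> <= c\<^sup>2 * (K * norm ?d)^2" by (intro mult_left_mono power_mono K(2)) auto
 finally have "(norm (c *\<^sub>R A' ?d))^2 <= (c\<^sup>2 * K\<^sup>2) * (norm ?d)^2" by (simp add: power_mult_distrib)
 then show "ennreal ((norm (grad (%x. c * f k (A x + b)) x - c *\<^sub>R A' (g (A x + b))))^2)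
 <= ennreal (c\<^sup>2 * K\<^sup>2) * ennreal ((norm ?d)^2)"
 by (simp add: gr A'.diff scaleR_diff_right[symmetric] ennreal_mult[symmetric] ennreal_leI)
 qed
 also have "\<dots> = ennreal (c\<^sup>2 * K\<^sup>2) * (NN x. ennreal ((norm (grad (f k) (A x + b) - g (A x + b)))^2))"
 by (rule nn_integral_cmult) measurable
 also have "\<dots> = ennreal (c\<^sup>2 * K\<^sup>2) * (ennreal C * N2 (%x. grad (f k) x - g x))"
 using cv[of "%x. ennreal ((norm (grad (f k) x - g x))^2)"] by (simp add: N2_def)
 finally show ?thesis .
 qed
 then show "(%k. N2 (%x. grad (%x. c * f k (A x + b)) x - c *\<^sub>R A' (g (A x + b)))) ~> 0"
 by (rule tendsto_zero_ennreal_le[rotated]) (intro tendsto_zero_ennreal_cmult f(3), auto)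
 qed measurable
qed

text \<open>The increment is the integral of the derivative along the segment; integrate its square
 over all base points.\<close>

lemma translation_diff_C1:
 fixes F :: "real^'n => real"
 assumes d: "!!x. (F has_derivative (%h. G x \<bullet> h)) (at x)" and c: "continuous_on UNIV G"
 shows "(NN x. ennreal ((F (x + z) - F x)^2)) <= ennreal ((norm z)^2) * N2 G"
proof -
 have [measurable]: "G \<in> BM" using c by (rule borel_measurable_continuous_onI)
 have "continuous_on UNIV F" using d by (meson has_derivative_continuous continuous_at_imp_continuous_on)
 then have [measurable]: "F \<in> BM" by (rule borel_measurable_continuous_onI)
 have FTC: "F (x + z) - F x = (LBINT t. indicator {0..1} t * (G (x + t *\<^sub>R z) \<bullet> z))" for x
 proof -
 have ct: "continuous_on {0..1} (%t. G (x + t *\<^sub>R z) \<bullet> z)"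
 by (intro continuous_intros continuous_on_compose2[OF c]) auto
 have "((%t. F (x + t *\<^sub>R z)) has_vector_derivative G (x + t *\<^sub>R z) \<bullet> z) (at t within {0..1})" for t
 proof -
 have "((%t. x + t *\<^sub>R z) has_derivative (%h. h *\<^sub>R z)) (at t within {0..1})"
 by (auto intro!: derivative_eq_intros)
 from has_derivative_compose[OF this d] show ?thesis
 by (simp add: has_vector_derivative_def)
 qed
 from integral_FTC_atLeastAtMost[OF zero_le_one this ct]
 show ?thesis by (simp add: set_lebesgue_integral_def)
 qed
 have "(NN x. ennreal ((F (x + z) - F x)^2))
 <= (NN x. \<integral>\<^sup>+t. ennreal (indicator {0..1} t * (G (x + t *\<^sub>R z) \<bullet> z)^2) \<partial>lborel)"
 unfolding FTC
 by (intro nn_integral_mono integral_square_le) (auto simp: ennreal_indicator)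
 also have "\<dots> <= (NN x. \<integral>\<^sup>+t. indicator {0..1} t * ennreal ((norm z)^2 * (norm (G (x + t *\<^sub>R z)))^2) \<partial>lborel)"
 proof (intro nn_integral_mono)
 fix x and t :: real
 have "\<bar>G (x + t *\<^sub>R z) \<bullet> z\<bar>\<^sup>2 <= (norm (G (x + t *\<^sub>R z)) * norm z)^2"
 by (intro power_mono Cauchy_Schwarz_ineq2) simp
 then show "ennreal (indicator {0..1} t * (G (x + t *\<^sub>R z) \<bullet> z)^2)
 <= indicator {0..1} t * ennreal ((norm z)^2 * (norm (G (x + t *\<^sub>R z)))^2)"
 by (auto simp: indicator_def power_mult_distrib mult.commute intro!: ennreal_leI)
 qed
 also have "\<dots> = (NN t. \<integral>\<^sup>+x. indicator {0..1} t * ennreal ((norm z)^2 * (norm (G (x + t *\<^sub>R z)))^2) \<partial>lborel)"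
 by (rule lborel_pair.Fubini'[symmetric]) measurable
 also have "\<dots> = (NN t. indicator {0..1::real} t * (ennreal ((norm z)^2) * N2 G))"
 proof (rule nn_integral_cong)
 fix t :: real
 have "(NN x. ennreal ((norm z)^2 * (norm (G (x + t *\<^sub>R z)))^2)) = ennreal ((norm z)^2) * N2 G"
 using mp_nn[OF mp_translate, of "%x. ennreal ((norm z)^2 * (norm (G x))^2)" "t *\<^sub>R z"]
 by (simp add: N2_def ennreal_mult nn_integral_cmult)
 then show "(NN x. indicator {0..1} t * ennreal ((norm z)^2 * (norm (G (x + t *\<^sub>R z)))^2))
 = indicator {0..1::real} t * (ennreal ((norm z)^2) * N2 G)"
 by (simp add: nn_integral_cmult)
 qed
 also have "\<dots> = ennreal ((norm z)^2) * N2 G" by (simp add: nn_integral_multc)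
 finally show ?thesis .
qed

section \<open>The Sobolev inequality\<close>

lemma nn_ball_exhaust:
 fixes F :: "real^'n => ennreal"
 assumes [measurable]: "F \<in> BM"
 and le: "!!n::nat. (NN x. indicator (cball 0 (real n)) x * F x) <= c"
 shows "(NN x. F x) <= c"
proof -
 have inc: "incseq (%(n::nat) x. indicator (cball 0 (real n)) x * F x)"
 by (auto simp: incseq_def le_fun_def indicator_def)
 have "(SUP n::nat. indicator (cball 0 (real n)) x * F x) = F x" for x
 proof (rule antisym)
 obtain n where "norm x <= real n" using real_arch_simple by blast
 then show "F x <= (SUP n::nat. indicator (cball 0 (real n)) x * F x)"
 by (intro SUP_upper2[of n]) auto
 qed (auto intro!: SUP_least simp: indicator_def)
 then have "(NN x. F x) = (NN x. (SUP n::nat. indicator (cball 0 (real n)) x * F x))" by simp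
 also have "\<dots> = (SUP n::nat. (NN x. indicator (cball 0 (real n)) x * F x))"
 by (rule nn_integral_monotone_convergence_SUP[OF inc]) measurable
 also have "\<dots> <= c" using le by (auto intro: SUP_least)
 finally show ?thesis .
qed

lemma nn_integral_cmult_add3:
 assumes [measurable]: "a \<in> borel_measurable M" "b \<in> borel_measurable M" "c \<in> borel_measurable M"
 shows "(\<integral>\<^sup>+x. d * (a x + (b x + c x)) \<partial>M)
 = d * ((\<integral>\<^sup>+x. a x \<partial>M) + ((\<integral>\<^sup>+x. b x \<partial>M) + (\<integral>\<^sup>+x. c x \<partial>M)))"
 by (simp add: nn_integral_cmult nn_integral_add)

text \<open>The approximants are close to u in L^2 only on balls, so the increment is estimated on a
  ball, and balls exhaust the space. The constant 6 is 3, from splitting the increment in three,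
  times 2, from comparing \<open>grad (f k)\<close> with \<open>g\<close>.\<close>

lemma Dlim_translation:
 fixes u :: "real^'n => real"
 assumes D: "Dlim \<Omega> u g" and N: "CARD('n) >= 3"
 shows "(NN x. ennreal ((u (x + z) - u x)^2)) <= ennreal (6 * enn2real (N2 g) * (norm z)^2)"
proof -
 have q: "crit_exp CARD('n) > 2" using crit_exp_gt[OF N] by simp
 obtain f where f: "!!k. f k \<in> test_functions \<Omega>" "(%k. Nq (%x. f k x - u x)) ~> 0"
 "(%k. N2 (%x. grad (f k) x - g x)) ~> 0"
 "!!k. f k \<in> BM" "!!k. grad (f k) \<in> BM"
 using D by (rule DlimE) auto
 note [measurable] = Dlim_measurable[OF D] f(4,5)
 have gfin: "N2 g < \<infinity>" using Dlim_finite(2)[OF D] q by simp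
 have gN: "N2 g = ennreal (enn2real (N2 g))" using gfin by simp
 have main: "(NN x. indicator (cball 0 R) x * ennreal ((u (x + z) - u x)^2))
 <= ennreal 3 * (ennreal ((norm z)^2) * (ennreal 2 * N2 g))" for R
 proof -
 define L where "L k = (NN x. indicator (cball (0::real^'n) (R + norm z)) x * ennreal (\<bar>f k x - u x\<bar> powr 2))" for k
 have L: "L ~> 0"
 unfolding L_def[abs_def]
 by (rule nn_ball_powr_tendsto[where s = "crit_exp CARD('n)"]) (use q f(2) in \<open>auto simp: Nq_def\<close>)
 have bound: "(NN x. indicator (cball 0 R) x * ennreal ((u (x + z) - u x)^2))
 <= ennreal 3 * ((ennreal ((norm z)^2) * (ennreal 2 * (N2 g + N2 (%x. grad (f k) x - g x)))) + (L k + L k))" for k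
 proof -
 have p: "indicator (cball 0 R) x * ennreal ((u (x + z) - u x)^2) <= ennreal 3 * (ennreal ((f k (x + z) - f k x)^2)
 + (indicator (cball 0 (R + norm z)) (x + z) * ennreal (\<bar>f k (x + z) - u (x + z)\<bar> powr 2)
 + indicator (cball 0 (R + norm z)) x * ennreal (\<bar>f k x - u x\<bar> powr 2)))" for x
 proof (cases "norm x <= R")
 case True
 then have 1: "norm (x + z) <= R + norm z" using norm_triangle_ineq[of x z] by linarith
 have 2: "norm x <= R + norm z" using True norm_ge_zero[of z] by linarith
 define a b c where "a = f k (x + z) - f k x" and "b = f k (x + z) - u (x + z)" and "c = f k x - u x"
 have "(u (x + z) - u x) = a - b + c" by (simp add: a_def b_def c_def)
 moreover have "(a - b + c)^2 <= 3 * (a\<^sup>2 + (b\<^sup>2 + c\<^sup>2))"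
 using zero_le_power2[of "a + b"] zero_le_power2[of "a - c"] zero_le_power2[of "b + c"]
 by (simp add: power2_eq_square algebra_simps)
 ultimately have "ennreal ((u (x + z) - u x)^2) <= ennreal (3 * (a\<^sup>2 + (b\<^sup>2 + c\<^sup>2)))"
 by (simp only: ennreal_leI)
 also have "\<dots> = ennreal 3 * (ennreal (a\<^sup>2) + (ennreal (b\<^sup>2) + ennreal (c\<^sup>2)))"
 by (subst ennreal_mult) auto
 finally show ?thesis using True 1 2 by (simp add: a_def b_def c_def)
 qed simp
 have "(NN x. indicator (cball 0 R) x * ennreal ((u (x + z) - u x)^2))
 <= (NN x. ennreal 3 * (ennreal ((f k (x + z) - f k x)^2)
 + (indicator (cball 0 (R + norm z)) (x + z) * ennreal (\<bar>f k (x + z) - u (x + z)\<bar> powr 2)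
 + indicator (cball 0 (R + norm z)) x * ennreal (\<bar>f k x - u x\<bar> powr 2))))"
 by (rule nn_integral_mono) (rule p)
 also have "\<dots> = ennreal 3 * ((NN x. ennreal ((f k (x + z) - f k x)^2))
 + ((NN x. indicator (cball 0 (R + norm z)) (x + z) * ennreal (\<bar>f k (x + z) - u (x + z)\<bar> powr 2)) + L k))"
 unfolding L_def by (rule nn_integral_cmult_add3) measurable
 also have "(NN x. indicator (cball 0 (R + norm z)) (x + z) * ennreal (\<bar>f k (x + z) - u (x + z)\<bar> powr 2)) = L k"
 unfolding L_def
 by (rule mp_nn[OF mp_translate, of "%x. indicator (cball 0 (R + norm z)) x * ennreal (\<bar>f k x - u x\<bar> powr 2)"]) measurable
 also have "(NN x. ennreal ((f k (x + z) - f k x)^2)) <= ennreal ((norm z)^2) * N2 (grad (f k))"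
 by (rule translation_diff_C1[OF smooth_has_grad grad_continuous]) (auto intro: test_functionsD(1)[OF f(1)])
 also have "N2 (grad (f k)) <= ennreal 2 * (N2 g + N2 (%x. grad (f k) x - g x))"
 using N2_add[of g "%x. grad (f k) x - g x"] by simp
 finally show ?thesis by (auto simp: mult_left_mono add_mono)
 qed
 have "(%k. ennreal 3 * ((ennreal ((norm z)^2) * (ennreal 2 * (N2 g + N2 (%x. grad (f k) x - g x)))) + (L k + L k)))
 ~> ennreal 3 * ((ennreal ((norm z)^2) * (ennreal 2 * (N2 g + 0))) + (0 + 0))"
 by (intro ennreal_tendsto_cmult tendsto_add tendsto_const f(3) L) auto
 from LIMSEQ_le_const[OF this] bound show ?thesis by auto
 qed
 have "(NN x. ennreal ((u (x + z) - u x)^2)) <= ennreal 3 * (ennreal ((norm z)^2) * (ennreal 2 * N2 g))"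
 by (rule nn_ball_exhaust[OF _ main]) measurable
 also have "\<dots> = ennreal (6 * enn2real (N2 g) * (norm z)^2)"
 by (subst gN) (simp add: ennreal_mult mult_ac del: ennreal_enn2real)
 finally show ?thesis .
qed

lemma emeasure_ball_scale:
 assumes "r > 0"
 shows "emeasure lborel (ball (0::real^'n) r) = ennreal (r ^ CARD('n) * measure lborel (ball (0::real^'n) 1))"
proof -
 have "emeasure lborel (ball (0::real^'n) r) = ennreal (measure lborel (ball (0::real^'n) r))"
 using emeasure_lborel_ball_finite[of "0::real^'n" r] by (simp add: emeasure_eq_ennreal_measure)
 also have "measure lborel (ball (0::real^'n) r) = r ^ CARD('n) * measure lborel (ball (0::real^'n) 1)"
 using content_ball_conv_unit_ball[of r "0::real^'n"] assms by simp
 finally show ?thesis .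
qed

text \<open>If \<open>\<bar>F x\<bar> > \<lambda>\<close>, then \<open>\<bar>F (x + z) - F x\<bar> \<ge> \<lambda> / 2\<close> for at least half of the \<open>z\<close> in a ball whose
 volume is twice the Chebyshev bound for the measure of the set where \<open>\<bar>F\<bar> > \<lambda> / 2\<close>.\<close>

lemma weak_type_aux:
 fixes F :: "real^'n => real"
 assumes d: "!!x. (F has_derivative (%h. G x \<bullet> h)) (at x)" and c: "continuous_on UNIV G"
 and q: "crit_exp CARD('n) > 0" and X: "Nq F <= ennreal X" "X > 0" and l: "l > 0" and r: "r > 0"
 and vol: "r ^ CARD('n) * measure lborel (ball (0::real^'n) 1) = 2 * ((2 / l) powr crit_exp CARD('n) * X)"
 shows "ennreal (l\<^sup>2) * emeasure lborel {x. \<bar>F x\<bar> > l} <= ennreal (8 * r\<^sup>2) * N2 G"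
proof -
 define q where "q = crit_exp CARD('n)"
 have "continuous_on UNIV F" using d by (meson has_derivative_continuous continuous_at_imp_continuous_on)
 then have Fm [measurable]: "F \<in> BM" by (rule borel_measurable_continuous_onI)
 \<comment> \<open>Chebyshev's bound for the measure of the set where |F| > l/2; by
   \<open>vol\<close> the ball of radius r has twice this volume.\<close>
 define m where "m = (2 / l) powr q * X"
 have m: "m > 0" using X l by (simp add: m_def)
 have Br: "emeasure lborel (ball (0::real^'n) r) = ennreal (2 * m)"
 using emeasure_ball_scale[OF r, where 'n = 'n] vol by (simp add: m_def q_def)
 have cheb: "emeasure lborel {y. \<bar>F y\<bar> > l / 2} <= ennreal m"
 proof -
 have "emeasure lborel {y. \<bar>F y\<bar> > l / 2} = (NN y. indicator {y. \<bar>F y\<bar> > l / 2} y)" by simp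
 also have "\<dots> <= (NN y. ennreal ((2 / l) powr q) * ennreal (\<bar>F y\<bar> powr q))"
 proof (rule nn_integral_mono)
 fix y
 show "indicator {y. \<bar>F y\<bar> > l / 2} y <= ennreal ((2 / l) powr q) * ennreal (\<bar>F y\<bar> powr q)"
 proof (cases "\<bar>F y\<bar> > l / 2")
 case True
 have "1 <= (2 / l * \<bar>F y\<bar>) powr q"
 using True l q by (intro ge_one_powr_ge_zero) (auto simp: field_simps q_def)
 then have "1 <= (2 / l) powr q * \<bar>F y\<bar> powr q" by (simp only: powr_mult)
 then show ?thesis using True l by (simp add: ennreal_mult[symmetric])
 qed simp
 qed
 also have "\<dots> = ennreal ((2 / l) powr q) * Nq F" by (simp add: nn_integral_cmult Nq_def q_def)
 also have "\<dots> <= ennreal ((2 / l) powr q) * ennreal X" by (intro mult_left_mono X(1)) simp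
 finally show ?thesis using X(2) by (simp add: m_def ennreal_mult)
 qed
 define I where "I x = (NN z. indicator (ball 0 r) z * ennreal ((F (x + z) - F x)^2))" for x
 have Im [measurable]: "I \<in> BM" unfolding I_def[abs_def] by measurable
 have low: "ennreal (l\<^sup>2 / 4 * m) <= I x" if "\<bar>F x\<bar> > l" for x
 proof -
 let ?A = "{z. z \<in> ball 0 r \<and> \<bar>F (x + z)\<bar> <= l / 2}" and ?B = "{z. \<bar>F (x + z)\<bar> > l / 2}"
 have Beq: "emeasure lborel ?B = emeasure lborel {y. \<bar>F y\<bar> > l / 2}"
 proof -
 have "(NN z. indicator {y. \<bar>F y\<bar> > l / 2} (z + x)) = (\<integral>\<^sup>+y. indicator {y. \<bar>F y\<bar> > l / 2} y \<partial>(lborel :: (real^'n) measure))"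
 by (rule mp_nn[OF mp_translate]) measurable
 moreover have "indicator {y. \<bar>F y\<bar> > l / 2} (z + x) = (indicator ?B z :: ennreal)" for z
 by (simp add: indicator_def add.commute)
 ultimately show ?thesis by simp
 qed
 have "ennreal (2 * m) <= emeasure lborel ?A + emeasure lborel ?B"
 proof -
 have "ennreal (2 * m) <= emeasure lborel (?A \<union> ?B)"
 unfolding Br[symmetric] by (rule emeasure_mono) (auto simp: not_le)
 also have "\<dots> <= emeasure lborel ?A + emeasure lborel ?B" by (rule emeasure_subadditive) measurable
 finally show ?thesis .
 qed
 also have "\<dots> <= emeasure lborel ?A + ennreal m" using cheb Beq by (intro add_left_mono) simp
 finally have A: "ennreal m <= emeasure lborel ?A"
 proof -
 assume *: "ennreal (2 * m) <= emeasure lborel ?A + ennreal m"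
 have "ennreal (2 * m) = ennreal m + ennreal m" using m by (simp add: ennreal_plus[symmetric] del: ennreal_plus)
 then have "ennreal m + ennreal m <= ennreal m + emeasure lborel ?A" using * by (simp add: add.commute)
 then show ?thesis using ennreal_add_left_cancel_le by auto
 qed
 have "ennreal (l\<^sup>2 / 4 * m) = ennreal (l\<^sup>2 / 4) * ennreal m" by (rule ennreal_mult) (use m in auto)
 also have "\<dots> <= ennreal (l\<^sup>2 / 4) * emeasure lborel ?A" by (intro mult_left_mono A) simp
 also have "\<dots> = (NN z. ennreal (l\<^sup>2 / 4) * indicator ?A z)" by (subst nn_integral_cmult_indicator) auto
 also have "\<dots> <= I x" unfolding I_def
 proof (rule nn_integral_mono)
 fix z
 show "ennreal (l\<^sup>2 / 4) * indicator ?A z <= indicator (ball 0 r) z * ennreal ((F (x + z) - F x)^2)"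
 proof (cases "z \<in> ?A")
 case True
 then have "\<bar>F (x + z)\<bar> <= l / 2" by simp
 then have "l / 2 <= \<bar>F (x + z) - F x\<bar>" using that by linarith
 then have "(l / 2)^2 <= \<bar>F (x + z) - F x\<bar>\<^sup>2" using l by (intro power_mono) auto
 then show ?thesis using True by (auto simp: power_divide intro!: ennreal_leI)
 qed simp
 qed
 finally show ?thesis .
 qed
 \<comment> \<open>The lower bound is integrated over the set where |F| > l; after Fubini each z in
   the ball contributes one translation difference, bounded by r^2 \<open>N2 G\<close>.\<close>
 have "ennreal (l\<^sup>2 / 4 * m) * emeasure lborel {x. \<bar>F x\<bar> > l} = (NN x. ennreal (l\<^sup>2 / 4 * m) * indicator {x. \<bar>F x\<bar> > l} x)"
 by (subst nn_integral_cmult_indicator) auto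
 also have "\<dots> <= (NN x. I x)"
 using low by (intro nn_integral_mono) (auto simp: indicator_def)
 also have "\<dots> = (NN z. \<integral>\<^sup>+x. indicator (ball 0 r) z * ennreal ((F (x + z) - F x)^2) \<partial>lborel)"
 unfolding I_def by (rule lborel_pair.Fubini'[symmetric]) measurable
 also have "\<dots> <= (NN z. indicator (ball (0::real^'n) r) z * (ennreal (r\<^sup>2) * N2 G))"
 proof (rule nn_integral_mono)
 fix z :: "real^'n"
 show "(NN x. indicator (ball 0 r) z * ennreal ((F (x + z) - F x)^2)) <= indicator (ball (0::real^'n) r) z * (ennreal (r\<^sup>2) * N2 G)"
 proof (cases "z \<in> ball 0 r")
 case True
 then have "(norm z)^2 <= r\<^sup>2" by (intro power_mono) auto
 then have "ennreal ((norm z)^2) * N2 G <= ennreal (r\<^sup>2) * N2 G" by (intro mult_right_mono ennreal_leI) auto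
 then show ?thesis using translation_diff_C1[OF d c, of z] True by simp
 qed simp
 qed
 also have "\<dots> = ennreal (2 * m) * (ennreal (r\<^sup>2) * N2 G)" using Br by (subst nn_integral_multc) auto
 finally have fin: "ennreal (l\<^sup>2 / 4 * m) * emeasure lborel {x. \<bar>F x\<bar> > l} <= ennreal (2 * m) * (ennreal (r\<^sup>2) * N2 G)" .
 have "ennreal (4 / m) * (ennreal (l\<^sup>2 / 4 * m) * emeasure lborel {x. \<bar>F x\<bar> > l}) <= ennreal (4 / m) * (ennreal (2 * m) * (ennreal (r\<^sup>2) * N2 G))"
 by (rule mult_left_mono[OF fin]) simp
 then show ?thesis using m
 by (simp add: mult.assoc[symmetric] ennreal_mult[symmetric])
qed

lemma crit_exp_identities:
 assumes "N >= 3"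
 shows "2 + 2 * crit_exp N / real N = crit_exp N" "1 - 2 / real N = 2 / crit_exp N"
 using assms by (auto simp: crit_exp_def field_simps)

text \<open>The radius is fixed by r^N ~ X l^-q, whence r^2 ~ X^(2/N) l^(-2q/N), and 2 + 2q/N = q
  turns l^2 into l^q. The factor X^(2/N) stays explicit, to be absorbed once the levels have been
  summed.\<close>

lemma weak_type:
 assumes N: "CARD('n) >= 3"
 shows "\<exists>K>0. \<forall>(F :: real^'n => real) G X l. (\<forall>x. (F has_derivative (%h. G x \<bullet> h)) (at x)) --> continuous_on UNIV G -->
 Nq F <= ennreal X --> X > 0 --> l > 0 -->
 ennreal (l powr crit_exp CARD('n)) * emeasure lborel {x. \<bar>F x\<bar> > l} <= ennreal (K * X powr (2 / CARD('n))) * N2 G"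
proof -
 define q where "q = crit_exp CARD('n)"
 have q: "q > 2" using crit_exp_gt[OF N] by (simp add: q_def)
 define V where "V = measure lborel (ball (0::real^'n) 1)"
 have V: "V > 0" using content_ball_pos[of 1 "0::real^'n"] by (simp add: V_def)
 define n where "n = real CARD('n)"
 have n: "n >= 3" using N by (simp add: n_def)
 define K where "K = 8 * (2 * 2 powr q / V) powr (2 / n)"
 have K: "K > 0" using V by (simp add: K_def)
 show ?thesis
 proof (intro exI[of _ K] conjI K allI impI)
 fix F :: "real^'n => real" and G X l
 assume d: "\<forall>x. (F has_derivative (%h. G x \<bullet> h)) (at x)" and c: "continuous_on UNIV G"
 and X: "Nq F <= ennreal X" "X > 0" and l: "(l::real) > 0"
 define m where "m = 2 * ((2 / l) powr q * X) / V"
 have m: "m > 0" using X l V by (simp add: m_def)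
 define r where "r = m powr (1 / n)"
 have r: "r > 0" using m by (simp add: r_def)
 have rn: "r ^ CARD('n) = m" using m n by (simp add: r_def powr_realpow[symmetric] powr_powr n_def)
 have aux: "ennreal (l\<^sup>2) * emeasure lborel {x. \<bar>F x\<bar> > l} <= ennreal (8 * r\<^sup>2) * N2 G"
 by (rule weak_type_aux[OF _ c _ X l r]) (use d q V in \<open>auto simp: rn m_def V_def[symmetric] q_def[symmetric]\<close>)
 have rr: "r\<^sup>2 = (2 * 2 powr q / V) powr (2 / n) * X powr (2 / n) * l powr (- (2 * q / n))"
 proof -
 have "m = (2 * 2 powr q / V) * X * l powr (- q)"
 using l by (simp add: m_def powr_divide powr_minus field_simps)
 then have "m powr (2 / n) = (2 * 2 powr q / V) powr (2 / n) * X powr (2 / n) * (l powr (- q)) powr (2 / n)"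
 by (simp only: powr_mult)
 moreover have "r\<^sup>2 = m powr (2 / n)" using r by (simp add: r_def powr_powr powr_realpow[symmetric])
 ultimately show ?thesis using l by (simp add: powr_powr mult.commute)
 qed
 have lq: "l powr q = l powr (2 * q / n) * l\<^sup>2"
 proof -
 have "q = 2 * q / n + 2" using crit_exp_identities(1)[OF N] by (simp add: q_def n_def)
 then have "l powr q = l powr (2 * q / n + 2)" by simp
 then show ?thesis using l by (simp add: powr_add)
 qed
 have "ennreal (l powr q) * emeasure lborel {x. \<bar>F x\<bar> > l}
 = ennreal (l powr (2 * q / n)) * (ennreal (l\<^sup>2) * emeasure lborel {x. \<bar>F x\<bar> > l})"
 using l by (simp add: lq ennreal_mult mult.assoc)
 also have "\<dots> <= ennreal (l powr (2 * q / n)) * (ennreal (8 * r\<^sup>2) * N2 G)"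
 by (rule mult_left_mono[OF aux]) simp
 also have "\<dots> = ennreal (l powr (2 * q / n) * (8 * r\<^sup>2)) * N2 G"
 by (simp add: ennreal_mult mult.assoc)
 also have "l powr (2 * q / n) * (8 * r\<^sup>2) = K * X powr (2 / n)"
 using l by (simp add: rr K_def powr_minus field_simps)
 finally show "ennreal (l powr crit_exp CARD('n)) * emeasure lborel {x. \<bar>F x\<bar> > l} <= ennreal (K * X powr (2 / CARD('n))) * N2 G"
 by (simp add: q_def n_def)
 qed
qed

section \<open>Truncation at dyadic levels\<close>

lemma pos_part_square_deriv:
 "((%t. (max 0 (t - a))^2) has_real_derivative 2 * max 0 (t - a)) (at (t::real))"
proof -
 consider "t > a" | "t < a" | "t = a" by linarith
 then show ?thesis
 proof cases
 case 1
 have "((%t. (t - a)^2) has_real_derivative 2 * (t - a)) (at t)"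
 by (auto intro!: derivative_eq_intros)
 moreover have "eventually (%s. (max 0 (s - a))^2 = (s - a)^2) (nhds t)"
 using eventually_nhds_in_open[of "{a<..}" t] 1 by (auto elim!: eventually_mono)
 ultimately show ?thesis using 1 by (subst DERIV_cong_ev[OF refl _ refl]) auto
 next
 case 2
 have "eventually (%s. (max 0 (s - a))^2 = 0) (nhds t)"
 using eventually_nhds_in_open[of "{..<a}" t] 2 by (auto elim!: eventually_mono)
 then show ?thesis using 2 by (subst DERIV_cong_ev[OF refl _ refl, of _ "%_. 0"]) auto
 next
 case 3
 have "((%h. (max 0 h)^2 / h) \<longlongrightarrow> 0) (at (0::real))"
 proof (rule Lim_null_comparison)
 show "eventually (%h. norm ((max 0 h)^2 / h) <= \<bar>h\<bar>) (at (0::real))"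
 by (rule always_eventually) (auto simp: max_def power2_eq_square)
 show "((%h::real. \<bar>h\<bar>) \<longlongrightarrow> 0) (at 0)" by (intro tendsto_eq_intros) auto
 qed
 then show ?thesis using 3 by (simp add: DERIV_def)
 qed
qed

text \<open>A C^1 step, 0 up to t = 1 and 1 from t = 2 on: a multiple of the second difference of
  the squared positive part with nodes 1, 3/2, 2. A continuous gradient is all that
  \<open>weak_type\<close> asks of a truncated function.\<close>

definition sstep :: "real => real" where
 "sstep t = 2 * ((max 0 (t - 1))^2 - 2 * (max 0 (t - 3/2))^2 + (max 0 (t - 2))^2)"

definition sstep' :: "real => real" where
 "sstep' t = 4 * (max 0 (t - 1) - 2 * max 0 (t - 3/2) + max 0 (t - 2))"

lemma sstep_props:
 "(sstep has_real_derivative sstep' t) (at t)" "continuous_on S sstep'"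
 "t <= 1 ==> sstep t = 0" "t >= 2 ==> sstep t = 1" "t >= 0 ==> 0 <= sstep t \<and> sstep t <= 1"
 "\<bar>sstep' t\<bar> <= 2" "t <= 1 \<or> t >= 2 ==> sstep' t = 0"
proof -
 show "(sstep has_real_derivative sstep' t) (at t)"
 unfolding sstep_def[abs_def] sstep'_def
 by (rule DERIV_cong, (rule DERIV_cmult DERIV_add DERIV_diff pos_part_square_deriv)+) simp
 show "continuous_on S sstep'" unfolding sstep'_def[abs_def] by (intro continuous_intros)
 show "t <= 1 ==> sstep t = 0" by (simp add: sstep_def)
 show "t >= 2 ==> sstep t = 1" by (simp add: sstep_def power2_eq_square algebra_simps)
 show "\<bar>sstep' t\<bar> <= 2" by (auto simp: sstep'_def max_def abs_if)
 show "t <= 1 \<or> t >= 2 ==> sstep' t = 0" by (auto simp: sstep'_def max_def)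
 show "0 <= sstep t \<and> sstep t <= 1"
 proof -
 consider "t <= 1" | "1 <= t" "t <= 3/2" | "3/2 <= t" "t <= 2" | "t >= 2" by linarith
 then show ?thesis
 proof cases
 case 2
 then have "(t - 1)^2 <= (1/2)^2" by (intro power_mono) auto
 then show ?thesis using 2 by (simp add: sstep_def power2_eq_square)
 next
 case 3
 have e: "sstep t = 1 - 2 * (2 - t)^2"
 using 3 by (simp add: sstep_def power2_eq_square algebra_simps)
 have "(2 - t)^2 <= (1/2)^2" using 3 by (intro power_mono) auto
 then have "(2 - t)^2 <= 1/4" by (simp add: power2_eq_square)
 then show ?thesis using e zero_le_power2[of "2 - t"] by linarith
 qed (auto simp: sstep_def power2_eq_square algebra_simps)
 qed
qed

text \<open>A truncation of |s| between the levels l and 2l; written through s^2 it is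
  differentiable at 0 as well. Its derivative lives on l < |s| < 2l, so dyadic levels have disjoint
  gradients.\<close>

definition lev :: "real => real => real" where
 "lev l s = l * sstep (s\<^sup>2 / l\<^sup>2)"

definition lev' :: "real => real => real" where
 "lev' l s = sstep' (s\<^sup>2 / l\<^sup>2) * (2 * s / l)"

lemma lev_props:
 assumes l: "l > 0"
 shows "(lev l has_real_derivative lev' l s) (at s)" "continuous_on S (lev' l)"
 "\<bar>lev l s\<bar> <= \<bar>s\<bar>" "\<bar>s\<bar> >= 2 * l ==> lev l s = l" "(lev' l s)^2 <= 32"
 "\<bar>s\<bar> <= l \<or> \<bar>s\<bar> >= 2 * l ==> lev' l s = 0"
proof -
 show "(lev l has_real_derivative lev' l s) (at s)"
 proof -
 have "((%s. s\<^sup>2) has_real_derivative 2 * s) (at s)"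
 by (auto intro!: derivative_eq_intros)
 then have "((%s. s\<^sup>2 / l\<^sup>2) has_real_derivative 2 * s / l\<^sup>2) (at s)" by (rule DERIV_cdivide)
 from DERIV_cmult[OF DERIV_chain2[OF sstep_props(1) this], of l]
 show ?thesis using l by (simp add: lev_def[abs_def] lev'_def power2_eq_square mult_ac)
 qed
 show "continuous_on S (lev' l)" unfolding lev'_def[abs_def] using l
 by (intro continuous_intros continuous_on_compose2[OF sstep_props(2)[of UNIV]]) auto
 have sq: "s\<^sup>2 / l\<^sup>2 <= 1 \<longleftrightarrow> \<bar>s\<bar> <= l" using l abs_le_square_iff[of s l] by (simp add: divide_le_eq)
 have sq2: "s\<^sup>2 / l\<^sup>2 >= 4" if "\<bar>s\<bar> >= 2 * l"
 proof -
 have "(2 * l)^2 <= \<bar>s\<bar>\<^sup>2" using that l by (intro power_mono) auto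
 then show ?thesis using l by (simp add: le_divide_eq power_mult_distrib)
 qed
 show "\<bar>lev l s\<bar> <= \<bar>s\<bar>"
 proof (cases "\<bar>s\<bar> <= l")
 case True
 then show ?thesis using sq sstep_props(3) by (simp add: lev_def)
 next
 case False
 have "0 <= sstep (s\<^sup>2 / l\<^sup>2) \<and> sstep (s\<^sup>2 / l\<^sup>2) <= 1" by (rule sstep_props(5)) simp
 then have "\<bar>lev l s\<bar> <= l" using l by (simp add: lev_def abs_mult mult_left_le)
 then show ?thesis using False by linarith
 qed
 show "\<bar>s\<bar> >= 2 * l ==> lev l s = l" using sq2 sstep_props(4)[of "s\<^sup>2 / l\<^sup>2"] by (auto simp: lev_def)
 show "\<bar>s\<bar> <= l \<or> \<bar>s\<bar> >= 2 * l ==> lev' l s = 0"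
 using sq sq2 sstep_props(7)[of "s\<^sup>2 / l\<^sup>2"] by (auto simp: lev'_def)
 show "(lev' l s)^2 <= 32"
 proof (cases "s\<^sup>2 / l\<^sup>2 >= 2")
 case True
 then show ?thesis using sstep_props(7) by (simp add: lev'_def)
 next
 case False
 have "(lev' l s)^2 = \<bar>sstep' (s\<^sup>2 / l\<^sup>2)\<bar>\<^sup>2 * (4 * (s\<^sup>2 / l\<^sup>2))"
 by (simp add: lev'_def power_mult_distrib power_divide)
 also have "\<dots> <= 2\<^sup>2 * (4 * 2)"
 using False sstep_props(6) by (intro mult_mono power_mono) auto
 finally show ?thesis by simp
 qed
qed

lemma dyadic_level:
 fixes a M :: real
 assumes "0 < a" "a <= M"
 shows "\<exists>j. M / 2 ^ Suc j < a \<and> a <= M / 2 ^ j"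
proof -
 have ex: "\<exists>j. M / 2 ^ Suc j < a"
 proof -
 obtain j where "(1 / 2) ^ j < a / M" using real_arch_pow_inv[of "a / M" "1 / 2"] assms by auto
 then have "M / 2 ^ j < a" using assms by (simp add: power_one_over field_simps)
 moreover have "M / 2 ^ Suc j <= M / 2 ^ j" using assms by (simp add: field_simps)
 ultimately show ?thesis by (intro exI[of _ j]) linarith
 qed
 define j where "j = (LEAST j. M / 2 ^ Suc j < a)"
 have "M / 2 ^ Suc j < a" unfolding j_def using ex by (rule LeastI_ex)
 moreover have "a <= M / 2 ^ j"
 proof (cases j)
 case 0
 then show ?thesis using assms by simp
 next
 case (Suc i)
 then have "\<not> M / 2 ^ Suc i < a" unfolding j_def using not_less_Least by (metis lessI)
 then show ?thesis using Suc by simp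
 qed
 ultimately show ?thesis by blast
qed

text \<open>Maz'ya's truncation argument: apply the weak type inequality on each dyadic level and sum.\<close>

lemma Sobolev_test:
 assumes N: "CARD('n) >= 3"
 shows "\<exists>C>0. \<forall>f \<in> test_functions (UNIV :: (real^'n) set).
 Nq f <= ennreal ((C * enn2real (N2 (grad f))) powr (crit_exp CARD('n) / 2))"
proof -
 define q where "q = crit_exp CARD('n)"
 have q: "q > 2" using crit_exp_gt[OF N] by (simp add: q_def)
 define n where "n = real CARD('n)"
 have n: "n >= 3" using N by (simp add: n_def)
 obtain K where K: "K > 0" "!!(F :: real^'n => real) G X l. (!!x. (F has_derivative (%h. G x \<bullet> h)) (at x)) ==> continuous_on UNIV G ==>
 Nq F <= ennreal X ==> X > 0 ==> l > 0 ==>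
 ennreal (l powr q) * emeasure lborel {x. \<bar>F x\<bar> > l} <= ennreal (K * X powr (2 / n)) * N2 G"
 using weak_type[OF N] unfolding q_def n_def by blast
 define C where "C = 8 powr q * K * 32"
 have C: "C > 0" using K by (simp add: C_def)
 show ?thesis
 proof (intro exI[of _ C] conjI C ballI)
 fix f :: "real^'n => real" assume f: "f \<in> test_functions UNIV"
 have q0: "crit_exp CARD('n) > 0" using q by (simp add: q_def)
 have fin: "Nq f < \<infinity>" "N2 (grad f) < \<infinity>" using test_Nq_finite[OF f q0] by auto
 define X where "X = enn2real (Nq f)"
 have NX: "Nq f = ennreal X" using fin by (simp add: X_def)
 define D where "D = enn2real (N2 (grad f))"
 have ND: "N2 (grad f) = ennreal D" "D >= 0" using fin by (auto simp: D_def)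
 note [measurable] = test_measurable[OF f] test_grad_measurable[OF f]
 show "Nq f <= ennreal ((C * enn2real (N2 (grad f))) powr (crit_exp CARD('n) / 2))"
 proof (cases "X > 0")
 case False
 moreover have "X >= 0" by (simp add: X_def)
 ultimately have "X = 0" by linarith
 then show ?thesis using NX by simp
 next
 case X: True
 obtain M0 where M0: "!!z. \<bar>f z\<bar> <= M0" using test_bounds[OF f] by metis
 define M where "M = M0 + 1"
 have M: "M > 0" "!!z. \<bar>f z\<bar> <= M"
 proof -
 show "M > 0" using M0[of 0] by (simp add: M_def)
 show "\<bar>f z\<bar> <= M" for z using M0[of z] by (simp add: M_def)
 qed
 \<comment> \<open>\<open>2 * lam i\<close> is the lower end of the dyadic shell M/2^(i+1) < |f|
   \<le> M/2^i, where the i-th truncation has already reached its top value; the upper end is 8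
   times half of \<open>lam i\<close>.\<close>
 define lam where "lam i = M / 2 ^ Suc (Suc i)" for i :: nat
 have lam: "lam i > 0" for i using M by (simp add: lam_def)
 define G where "G i x = lev' (lam i) (f x) *\<^sub>R grad f x" for i x
 have [measurable]: "lev' (lam i) \<in> BM" for i
 using lev_props(2)[OF lam] by (rule borel_measurable_continuous_onI)
 have [measurable]: "G i \<in> BM" for i unfolding G_def[abs_def] by measurable
 have wt: "ennreal ((lam i / 2) powr q) * emeasure lborel {x. \<bar>f x\<bar> >= 2 * lam i} <= ennreal (K * X powr (2 / n)) * N2 (G i)" for i
 proof -
 have d: "((%x. lev (lam i) (f x)) has_derivative (%h. G i x \<bullet> h)) (at x)" for x
 using has_derivative_compose[OF smooth_has_grad[OF test_functionsD(1)[OF f]] lev_props(1)[OF lam, unfolded has_field_derivative_def]]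
 by (rule has_derivative_eq_rhs) (simp add: G_def)
 have c: "continuous_on UNIV (G i)" unfolding G_def[abs_def]
 by (intro continuous_intros continuous_on_compose2[OF lev_props(2)[OF lam, of UNIV]] grad_continuous
 smooth_continuous test_functionsD(1)[OF f]) auto
 have "Nq (%x. lev (lam i) (f x)) <= Nq f"
 unfolding Nq_def using lev_props(3)[OF lam] q0 by (intro nn_integral_mono ennreal_leI powr_mono2) auto
 then have le: "Nq (%x. lev (lam i) (f x)) <= ennreal X" using NX by simp
 have cl: "continuous_on UNIV (%x. lev (lam i) (f x))"
 using d by (meson has_derivative_continuous continuous_at_imp_continuous_on)
 then have [measurable]: "(%x. lev (lam i) (f x)) \<in> BM" by (rule borel_measurable_continuous_onI)
 have sub: "{x. \<bar>f x\<bar> >= 2 * lam i} \<subseteq> {x. \<bar>lev (lam i) (f x)\<bar> > lam i / 2}"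
 using lev_props(4)[OF lam, of i] lam[of i] by auto
 have "emeasure lborel {x. \<bar>f x\<bar> >= 2 * lam i} <= emeasure lborel {x. \<bar>lev (lam i) (f x)\<bar> > lam i / 2}"
 by (rule emeasure_mono[OF sub]) measurable
 then have "ennreal ((lam i / 2) powr q) * emeasure lborel {x. \<bar>f x\<bar> >= 2 * lam i}
 <= ennreal ((lam i / 2) powr q) * emeasure lborel {x. \<bar>lev (lam i) (f x)\<bar> > lam i / 2}"
 by (rule mult_left_mono) simp
 also have "\<dots> <= ennreal (K * X powr (2 / n)) * N2 (G i)"
 by (rule K(2)[OF d c le X]) (use lam[of i] in simp)
 finally show ?thesis .
 qed
 have pw: "ennreal (\<bar>f x\<bar> powr q) <= (\<Sum>i. ennreal (8 powr q) * (ennreal ((lam i / 2) powr q) * indicator {x. \<bar>f x\<bar> >= 2 * lam i} x))" for x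
 proof (cases "f x = 0")
 case False
 then obtain j where j: "M / 2 ^ Suc j < \<bar>f x\<bar>" "\<bar>f x\<bar> <= M / 2 ^ j" using dyadic_level[of "\<bar>f x\<bar>" M] M(2) by auto
 have l: "2 * lam j = M / 2 ^ Suc j" "8 * (lam j / 2) = M / 2 ^ j" by (auto simp: lam_def)
 have "\<bar>f x\<bar> powr q <= (8 * (lam j / 2)) powr q" using j(2) q l by (intro powr_mono2) auto
 also have "\<dots> = 8 powr q * (lam j / 2) powr q" by (rule powr_mult)
 finally have "ennreal (\<bar>f x\<bar> powr q) <= ennreal (8 powr q) * (ennreal ((lam j / 2) powr q) * indicator {x. \<bar>f x\<bar> >= 2 * lam j} x)"
 using j(1) l(1) by (simp add: ennreal_mult[symmetric] ennreal_leI)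
 also have "\<dots> <= (\<Sum>i. ennreal (8 powr q) * (ennreal ((lam i / 2) powr q) * indicator {x. \<bar>f x\<bar> >= 2 * lam i} x))"
 using sum_le_suminf[of "%i. ennreal (8 powr q) * (ennreal ((lam i / 2) powr q) * indicator {x. \<bar>f x\<bar> >= 2 * lam i} x)" "{j}"] by simp
 finally show ?thesis .
 qed (use q in auto)
 \<comment> \<open>At each point at most one truncated gradient is nonzero, so the energies of all
   levels add up to at most 32 times the full one.\<close>
 have disj: "(\<Sum>i. ennreal ((norm (G i x))^2)) <= ennreal 32 * ennreal ((norm (grad f x))^2)" for x
 proof (cases "\<exists>i. G i x ~= 0")
 case False
 then show ?thesis by simp
 next
 case True
 then obtain i where i: "G i x ~= 0" by blast
 then have fi: "lam i < \<bar>f x\<bar>" "\<bar>f x\<bar> < 2 * lam i"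
 using lev_props(6)[OF lam[of i], of "f x"] by (force simp: G_def)+
 have "G k x = 0" if "k ~= i" for k
 proof (cases "k < i")
 case True
 then have "2 ^ Suc k <= (2::real) ^ i" by (intro power_increasing) auto
 then have "2 * lam i <= lam k" using M(1) by (simp add: lam_def field_simps)
 then show ?thesis using fi lev_props(6)[OF lam[of k], of "f x"] by (simp add: G_def)
 next
 case False
 then have "2 ^ Suc i <= (2::real) ^ k" using that by (intro power_increasing) auto
 then have "2 * lam k <= lam i" using M(1) by (simp add: lam_def field_simps)
 then show ?thesis using fi lev_props(6)[OF lam[of k], of "f x"] by (simp add: G_def)
 qed
 then have "(\<Sum>k. ennreal ((norm (G k x))^2)) = ennreal ((norm (G i x))^2)"
 by (subst suminf_finite[of "{i}"]) auto
 also have "(norm (G i x))^2 = (lev' (lam i) (f x))^2 * (norm (grad f x))^2" by (simp add: G_def power_mult_distrib)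
 also have "ennreal \<dots> <= ennreal (32 * (norm (grad f x))^2)"
 by (intro ennreal_leI mult_right_mono lev_props(5) lam) simp
 finally show ?thesis by (simp add: ennreal_mult)
 qed
 have sumN2: "(\<Sum>i. N2 (G i)) <= ennreal (32 * D)"
 proof -
 have "(\<Sum>i. N2 (G i)) = (NN x. (\<Sum>i. ennreal ((norm (G i x))^2)))"
 unfolding N2_def by (rule nn_integral_suminf[symmetric]) measurable
 also have "\<dots> <= (NN x. ennreal 32 * ennreal ((norm (grad f x))^2))"
 by (rule nn_integral_mono) (rule disj)
 also have "\<dots> = ennreal 32 * N2 (grad f)" unfolding N2_def by (rule nn_integral_cmult) measurable
 finally show ?thesis using ND by (simp add: ennreal_mult)
 qed
 have "ennreal X <= (NN x. (\<Sum>i. ennreal (8 powr q) * (ennreal ((lam i / 2) powr q) * indicator {x. \<bar>f x\<bar> >= 2 * lam i} x)))"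
 unfolding NX[symmetric] Nq_def q_def[symmetric] by (rule nn_integral_mono) (rule pw)
 also have "\<dots> = (\<Sum>i. ennreal (8 powr q) * (ennreal ((lam i / 2) powr q) * emeasure lborel {x. \<bar>f x\<bar> >= 2 * lam i}))"
 by (subst nn_integral_suminf, measurable) (simp add: nn_integral_cmult)
 also have "\<dots> <= (\<Sum>i. ennreal (8 powr q) * (ennreal (K * X powr (2 / n)) * N2 (G i)))"
 by (intro suminf_le mult_left_mono wt) auto
 also have "\<dots> = ennreal (8 powr q) * (ennreal (K * X powr (2 / n)) * (\<Sum>i. N2 (G i)))" by simp
 also have "\<dots> <= ennreal (8 powr q) * (ennreal (K * X powr (2 / n)) * ennreal (32 * D))"
 by (intro mult_left_mono sumN2) auto
 also have "\<dots> = ennreal (C * D * X powr (2 / n))"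
 using K(1) ND(2) by (simp add: ennreal_mult[symmetric] C_def mult_ac)
 finally have XX: "X <= C * D * X powr (2 / n)"
 using C ND(2) by (subst (asm) ennreal_le_iff) auto
 \<comment> \<open>X is finite and positive, so X^(2/n) can be divided out of \<open>XX\<close>; 1 -
   2/n = 2/q.\<close>
 have "X powr (2 / q) = X powr (1 - 2 / n)" using crit_exp_identities(2)[OF N] by (simp add: q_def n_def)
 also have "\<dots> = X / X powr (2 / n)" using X by (simp add: powr_diff)
 also have "\<dots> <= C * D" using XX X by (simp add: divide_le_eq)
 finally have "(X powr (2 / q)) powr (q / 2) <= (C * D) powr (q / 2)" using q by (intro powr_mono2) auto
 then have "X <= (C * D) powr (q / 2)" using q X by (simp add: powr_powr)
 then show ?thesis using NX by (simp add: D_def q_def ennreal_leI)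
 qed
 qed
qed

lemma Sobolev:
 assumes N: "CARD('n) >= 3"
 shows "\<exists>C>0. \<forall>\<Omega> u g. Dlim (\<Omega> :: (real^'n) set) u g -->
 Nq u <= ennreal ((C * enn2real (N2 g)) powr (crit_exp CARD('n) / 2))"
proof -
 define q where "q = crit_exp CARD('n)"
 have q: "q > 2" using crit_exp_gt[OF N] by (simp add: q_def)
 have q0: "crit_exp CARD('n) > 0" using q by (simp add: q_def)
 obtain C0 where C0: "C0 > 0" "!!f. f \<in> test_functions (UNIV :: (real^'n) set) ==>
 Nq f <= ennreal ((C0 * enn2real (N2 (grad f))) powr (q / 2))"
 using Sobolev_test[OF N] unfolding q_def by blast
 \<comment> \<open>The inner 2 comes from comparing the gradient of an approximant with g, the 4
   from the constant 2^q = 4^(q/2) in the quasi-triangle inequality for \<open>Nq\<close>.\<close>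
 define C where "C = 4 * (2 * C0)"
 show ?thesis
 proof (intro exI[of _ C] conjI allI impI)
 show "C > 0" using C0 by (simp add: C_def)
 fix \<Omega> and u :: "real^'n => real" and g assume D: "Dlim \<Omega> u g"
 obtain f where f: "!!k. f k \<in> test_functions \<Omega>" "(%k. Nq (%x. f k x - u x)) ~> 0"
 "(%k. N2 (%x. grad (f k) x - g x)) ~> 0"
 "!!k. f k \<in> BM" "!!k. grad (f k) \<in> BM"
 using D by (rule DlimE) auto
 note [measurable] = Dlim_measurable[OF D] f(4,5)
 have fin: "Nq u < \<infinity>" "N2 g < \<infinity>" using Dlim_finite[OF D q0] by auto
 define Dg where "Dg = enn2real (N2 g)"
 have Dg: "N2 g = ennreal Dg" "Dg >= 0" using fin by (auto simp: Dg_def)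
 have bd: "Nq u <= ennreal (2 powr q * ((C0 * (2 * (Dg + e))) powr (q / 2) + e))" if e: "e > 0" for e
 proof -
 obtain k where k: "Nq (%x. f k x - u x) <= ennreal e" "N2 (%x. grad (f k) x - g x) <= ennreal e"
 using eventually_conj[OF tendsto_zero_ennrealD[OF f(2) e] tendsto_zero_ennrealD[OF f(3) e]]
 by (auto dest: eventually_happens)
 have "N2 (grad (f k)) <= 2 * (N2 g + N2 (%x. grad (f k) x - g x))"
 using N2_add[of g "%x. grad (f k) x - g x"] by simp
 also have "\<dots> <= 2 * (ennreal Dg + ennreal e)" using Dg k(2) by (intro mult_left_mono add_mono) auto
 also have "\<dots> = ennreal (2 * (Dg + e))" using Dg e by (simp add: ennreal_mult)
 finally have "enn2real (N2 (grad (f k))) <= 2 * (Dg + e)" using Dg e by (intro enn2real_leI) auto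
 then have "(C0 * enn2real (N2 (grad (f k)))) powr (q / 2) <= (C0 * (2 * (Dg + e))) powr (q / 2)"
 using C0(1) q by (intro powr_mono2 mult_left_mono) auto
 then have Nf: "Nq (f k) <= ennreal ((C0 * (2 * (Dg + e))) powr (q / 2))"
 using C0(2)[OF test_functions_mono[OF _ f(1)]] by (meson ennreal_leI order_trans subset_UNIV)
 have "Nq u = Nq (%x. f k x + (-1) * (f k x - u x))" by simp
 also have "\<dots> <= ennreal (2 powr q) * (Nq (f k) + Nq (%x. (-1) * (f k x - u x)))"
 unfolding q_def by (rule Nq_add[OF _ _ q0]) measurable
 also have "Nq (%x. (-1) * (f k x - u x)) = Nq (%x. f k x - u x)" by (subst Nq_cmult) auto
 also have "ennreal (2 powr q) * (Nq (f k) + Nq (%x. f k x - u x))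
 <= ennreal (2 powr q) * (ennreal ((C0 * (2 * (Dg + e))) powr (q / 2)) + ennreal e)"
 by (intro mult_left_mono add_mono Nf k(1)) simp
 also have "\<dots> = ennreal (2 powr q * ((C0 * (2 * (Dg + e))) powr (q / 2) + e))"
 using e by (simp add: ennreal_mult)
 finally show ?thesis .
 qed
 have "((%e. 2 powr q * ((C0 * (2 * (Dg + e))) powr (q / 2) + e)) \<longlongrightarrow> 2 powr q * ((C0 * (2 * (Dg + 0))) powr (q / 2) + 0)) (at_right 0)"
 using C0(1) q Dg(2)
 by (intro tendsto_intros tendsto_powr2) (auto simp: eventually_at_filter)
 then have "((%e. ennreal (2 powr q * ((C0 * (2 * (Dg + e))) powr (q / 2) + e))) \<longlongrightarrow> ennreal (2 powr q * ((C0 * (2 * (Dg + 0))) powr (q / 2) + 0))) (at_right 0)"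
 by (rule tendsto_ennrealI)
 then have "Nq u <= ennreal (2 powr q * ((C0 * (2 * (Dg + 0))) powr (q / 2) + 0))"
 by (rule tendsto_lowerbound, intro eventually_mono[OF eventually_at_right_less[of 0]])
 (erule bd, simp)
 also have "2 powr q = 4 powr (q / 2)"
 proof -
 have "(4::real) powr (q / 2) = (2 powr 2) powr (q / 2)" by simp
 then show ?thesis by (simp only: powr_powr) simp
 qed
 also have "4 powr (q / 2) * ((C0 * (2 * (Dg + 0))) powr (q / 2) + 0) = (C * Dg) powr (q / 2)"
 by (simp only: C_def powr_mult add_0_right mult_ac)
 finally show "Nq u <= ennreal ((C * enn2real (N2 g)) powr (crit_exp CARD('n) / 2))" by (simp add: q_def Dg_def)
 qed
qed

section \<open>The Carleman estimate\<close>

text \<open>\<open>G\<close> is the gradient and \<open>A\<close> the Hessian as a symmetric linear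
  map. Carrying both explicitly makes the Laplacian the trace \<open>Lap A\<close> and lets the
  divergence identities be computed.\<close>

definition C2_on :: "(real^'n) set => (real^'n => real) => (real^'n => real^'n) =>
 (real^'n => real^'n => real^'n) => bool" where
 "C2_on S f G A \<longleftrightarrow> (\<forall>x\<in>S. (f has_derivative (%h. G x \<bullet> h)) (at x) \<and> (G has_derivative A x) (at x)
 \<and> (\<forall>h k. A x h \<bullet> k = h \<bullet> A x k)) \<and> (\<forall>h. continuous_on S (%x. A x h))"

definition Lap :: "(real^'n => real^'n => real^'n) => real^'n => real" where
 "Lap A x = (\<Sum>b\<in>Basis. A x b \<bullet> b)"

lemma C2_onD:
 assumes "C2_on S f G A" "x \<in> S"
 shows "(f has_derivative (%h. G x \<bullet> h)) (at x)" "(G has_derivative A x) (at x)"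
 "A x h \<bullet> k = h \<bullet> A x k" "linear (A x)"
 using assms has_derivative_linear by (auto simp: C2_on_def)

lemma C2_on_continuous:
 assumes "C2_on S f G A"
 shows "continuous_on S f" "continuous_on S G" "continuous_on S (%x. A x h)"
proof -
 show "continuous_on S f"
 by (rule continuous_at_imp_continuous_on) (use C2_onD(1)[OF assms] has_derivative_continuous in blast)
 show "continuous_on S G"
 by (rule continuous_at_imp_continuous_on) (use C2_onD(2)[OF assms] has_derivative_continuous in blast)
 show "continuous_on S (%x. A x h)" using assms by (auto simp: C2_on_def)
qed

lemma Lap_continuous: "C2_on S f G A ==> continuous_on S (Lap A)"
 unfolding Lap_def[abs_def] by (intro continuous_intros C2_on_continuous(3))

lemma C2_mult:
 assumes f: "C2_on S f G A" and g: "C2_on S g H B"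
 shows "C2_on S (%x. f x * g x) (%x. f x *\<^sub>R H x + g x *\<^sub>R G x)
 (%x h. (G x \<bullet> h) *\<^sub>R H x + f x *\<^sub>R B x h + ((H x \<bullet> h) *\<^sub>R G x + g x *\<^sub>R A x h))"
 unfolding C2_on_def
proof (intro conjI ballI allI)
 fix x assume x: "x \<in> S"
 note F = C2_onD[OF f x] and G = C2_onD[OF g x]
 show "((%x. f x * g x) has_derivative (%h. (f x *\<^sub>R H x + g x *\<^sub>R G x) \<bullet> h)) (at x)"
 by (rule has_derivative_eq_rhs[OF has_derivative_mult[OF F(1) G(1)]]) (auto simp: inner_add_left)
 show "((%x. f x *\<^sub>R H x + g x *\<^sub>R G x) has_derivative
 (%h. (G x \<bullet> h) *\<^sub>R H x + f x *\<^sub>R B x h + ((H x \<bullet> h) *\<^sub>R G x + g x *\<^sub>R A x h))) (at x)"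
 by (rule has_derivative_eq_rhs[OF has_derivative_add[OF has_derivative_scaleR[OF F(1) G(2)]
 has_derivative_scaleR[OF G(1) F(2)]]]) (auto simp: algebra_simps)
 fix h k
 show "((G x \<bullet> h) *\<^sub>R H x + f x *\<^sub>R B x h + ((H x \<bullet> h) *\<^sub>R G x + g x *\<^sub>R A x h)) \<bullet> k
 = h \<bullet> ((G x \<bullet> k) *\<^sub>R H x + f x *\<^sub>R B x k + ((H x \<bullet> k) *\<^sub>R G x + g x *\<^sub>R A x k))"
 by (simp add: inner_add_left inner_add_right F(3) G(3)) (simp add: inner_commute algebra_simps)
next
 fix h
 show "continuous_on S (%x. (G x \<bullet> h) *\<^sub>R H x + f x *\<^sub>R B x h + ((H x \<bullet> h) *\<^sub>R G x + g x *\<^sub>R A x h))"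
 by (intro continuous_intros C2_on_continuous[OF f] C2_on_continuous[OF g])
qed

lemma inner_sum_Basis: "(\<Sum>b\<in>Basis. (x \<bullet> b) * (y \<bullet> b)) = x \<bullet> (y::'a::euclidean_space)"
 using euclidean_inner[of x y] by simp

lemma Lap_mult:
 "Lap (%x h. (G x \<bullet> h) *\<^sub>R H x + f x *\<^sub>R B x h + ((H x \<bullet> h) *\<^sub>R G x + g x *\<^sub>R A x h)) x
 = f x * Lap B x + 2 * (G x \<bullet> H x) + g x * Lap A x"
proof -
 have "Lap (%x h. (G x \<bullet> h) *\<^sub>R H x + f x *\<^sub>R B x h + ((H x \<bullet> h) *\<^sub>R G x + g x *\<^sub>R A x h)) x
 = (\<Sum>b\<in>Basis. (G x \<bullet> b) * (H x \<bullet> b)) + f x * Lap B x + ((\<Sum>b\<in>Basis. (H x \<bullet> b) * (G x \<bullet> b)) + g x * Lap A x)"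
 by (simp only: Lap_def inner_add_left inner_scaleR_left sum.distrib sum_distrib_left)
 then show ?thesis by (simp only: inner_sum_Basis) (simp add: inner_commute)
qed

lemma inner_self_deriv: "((%x::real^'n. x \<bullet> x) has_derivative (%h. 2 * (x \<bullet> h))) (at x)"
 by (rule has_derivative_eq_rhs[OF has_derivative_inner[OF has_derivative_ident has_derivative_ident]])
 (auto simp: inner_commute)

lemma C2_radial:
 assumes "!!x. x \<in> S ==> (h0 has_real_derivative h1 (x \<bullet> x)) (at (x \<bullet> x))"
 "!!x. x \<in> S ==> (h1 has_real_derivative h2 (x \<bullet> x)) (at (x \<bullet> x))"
 and c: "continuous_on ((%x. x \<bullet> x) ` S) h2"
 shows "C2_on S (%x::real^'n. h0 (x \<bullet> x)) (%x. (2 * h1 (x \<bullet> x)) *\<^sub>R x)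
 (%x h. (2 * h1 (x \<bullet> x)) *\<^sub>R h + (4 * h2 (x \<bullet> x) * (x \<bullet> h)) *\<^sub>R x)"
 unfolding C2_on_def
proof (intro conjI ballI allI)
 fix x assume x: "x \<in> S"
 show "((%x. h0 (x \<bullet> x)) has_derivative (%h. ((2 * h1 (x \<bullet> x)) *\<^sub>R x) \<bullet> h)) (at x)"
 using has_derivative_compose[OF inner_self_deriv assms(1)[OF x, unfolded has_field_derivative_def]]
 by (rule has_derivative_eq_rhs) auto
 have d1: "((%x. 2 * h1 (x \<bullet> x)) has_derivative (%h. 2 * (h2 (x \<bullet> x) * (2 * (x \<bullet> h))))) (at x)"
 by (rule has_derivative_mult_right[OF has_derivative_compose[OF inner_self_deriv assms(2)[OF x, unfolded has_field_derivative_def]]])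
 show "((%x. (2 * h1 (x \<bullet> x)) *\<^sub>R x) has_derivative
 (%h. (2 * h1 (x \<bullet> x)) *\<^sub>R h + (4 * h2 (x \<bullet> x) * (x \<bullet> h)) *\<^sub>R x)) (at x)"
 by (rule has_derivative_eq_rhs[OF has_derivative_scaleR[OF d1 has_derivative_ident]]) (auto simp: mult_ac)
 fix h k
 show "((2 * h1 (x \<bullet> x)) *\<^sub>R h + (4 * h2 (x \<bullet> x) * (x \<bullet> h)) *\<^sub>R x) \<bullet> k =
 h \<bullet> ((2 * h1 (x \<bullet> x)) *\<^sub>R k + (4 * h2 (x \<bullet> x) * (x \<bullet> k)) *\<^sub>R x)"
 by (simp add: inner_add_left inner_add_right inner_commute)
next
 fix h
 have c1: "continuous_on S (%x. h1 (x \<bullet> x))"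
 proof (rule continuous_at_imp_continuous_on, rule ballI)
 fix x assume x: "x \<in> S"
 show "isCont (%x. h1 (x \<bullet> x)) x"
 using has_derivative_continuous[OF has_derivative_compose[OF inner_self_deriv assms(2)[OF x, unfolded has_field_derivative_def]]] .
 qed
 have c2: "continuous_on S (%x. h2 (x \<bullet> x))"
 by (rule continuous_on_compose2[OF c]) (auto intro!: continuous_intros)
 show "continuous_on S (%x. (2 * h1 (x \<bullet> x)) *\<^sub>R h + (4 * h2 (x \<bullet> x) * (x \<bullet> h)) *\<^sub>R x)"
 by (intro continuous_intros c1 c2)
qed

lemma Lap_radial:
 "Lap (%x h. (2 * h1 (x \<bullet> x)) *\<^sub>R h + (4 * h2 (x \<bullet> x) * (x \<bullet> h)) *\<^sub>R x) (x::real^'n)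
 = 2 * real CARD('n) * h1 (x \<bullet> x) + 4 * h2 (x \<bullet> x) * (x \<bullet> x)"
proof -
 have "Lap (%x h. (2 * h1 (x \<bullet> x)) *\<^sub>R h + (4 * h2 (x \<bullet> x) * (x \<bullet> h)) *\<^sub>R x) x
 = (\<Sum>b\<in>(Basis :: (real^'n) set). 2 * h1 (x \<bullet> x)) + 4 * h2 (x \<bullet> x) * (\<Sum>b\<in>Basis. (x \<bullet> b) * (x \<bullet> b))"
 by (simp add: Lap_def inner_add_left sum.distrib sum_distrib_left mult.assoc)
 then show ?thesis by (simp add: inner_sum_Basis)
qed

lemma deriv_zero_open:
 assumes "(f has_derivative D) (at x)" "open T" "x \<in> T" "!!y. y \<in> T ==> f y = 0"
 shows "D = (%h. 0)"
proof -
 have "(f has_derivative (%h. 0)) (at x)"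
 by (rule has_derivative_transform_within_open[OF has_derivative_const assms(2,3)]) (simp add: assms(4))
 then show ?thesis using assms(1) has_derivative_unique by blast
qed

lemma open_norm_gt: "open {x::real^'n. norm x > R}"
 by (intro open_Collect_less continuous_intros)

lemma annulus_continuous:
 fixes g :: "real^'n => 'b::real_normed_vector"
 assumes "continuous_on (- {0}) g" "\<rho> > 0" "!!x. norm x < \<rho> ==> g x = 0"
 shows "continuous_on UNIV g"
proof -
 have "continuous_on (ball 0 \<rho>) g"
 using assms(3) by (subst continuous_on_cong[OF refl, where g = "%_. 0"]) auto
 then have "continuous_on (- {0} \<union> ball 0 \<rho>) g"
 using assms(1) by (intro continuous_on_open_Un) auto
 moreover have "- {0} \<union> ball 0 \<rho> = (UNIV :: (real^'n) set)" using assms(2) by auto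
 ultimately show ?thesis by simp
qed

lemma annulus_integrable:
 fixes g :: "real^'n => real"
 assumes "continuous_on (- {0}) g" "\<rho> > 0" "!!x. norm x < \<rho> ==> g x = 0" "!!x. norm x > R ==> g x = 0"
 shows "integrable lborel g"
 by (rule integrable_continuous_support[OF annulus_continuous[OF assms(1-3)] assms(4)])

text \<open>The field vanishes near the origin, so its derivative extends by zero across the
  singularity of the weights, and every diagonal entry integrates to 0 as a directional
  derivative.\<close>

lemma divergence_annulus:
 fixes F :: "real^'n => real^'n"
 assumes d: "!!x. x ~= 0 ==> (F has_derivative F' x) (at x)"
 and c: "!!h. continuous_on (- {0}) (%x. F' x h)"
 and r: "\<rho> > 0" "!!x. norm x < \<rho> ==> F x = 0" "!!x. norm x > R ==> F x = 0"
 and e: "!!x. x ~= 0 ==> (\<Sum>b\<in>Basis. F' x b \<bullet> b) = d x" "d 0 = 0"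
 shows "(LBINT x. d x) = 0"
proof -
 define F'' where "F'' x = (if x = 0 then (%h. 0) else F' x)" for x
 have z: "F' x = (%h. 0)" if "x ~= 0" "norm x < \<rho> \<or> norm x > R" for x
 using that
 proof (elim disjE)
 show "norm x < \<rho> ==> ?thesis"
 by (rule deriv_zero_open[OF d[OF that(1)], of "ball 0 \<rho>"]) (auto simp: r)
 show "norm x > R ==> ?thesis"
 by (rule deriv_zero_open[OF d[OF that(1)], of "{x. norm x > R}"]) (auto simp: r intro: open_norm_gt)
 qed
 have d'': "(F has_derivative F'' x) (at x)" for x
 proof (cases "x = 0")
 case True
 have "(F has_derivative (%h. 0)) (at 0)"
 by (rule has_derivative_transform_within_open[OF has_derivative_const, of "ball 0 \<rho>"]) (use r in auto)
 then show ?thesis using True by (simp add: F''_def)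
 qed (use d in \<open>auto simp: F''_def\<close>)
 have c'': "continuous_on UNIV (%x. F'' x h)" for h
 proof (rule annulus_continuous[OF _ r(1)])
 show "continuous_on (- {0}) (%x. F'' x h)"
 using c[of h] by (subst continuous_on_cong[OF refl, where g = "%x. F' x h"]) (auto simp: F''_def)
 show "F'' x h = 0" if "norm x < \<rho>" for x using z[of x] that by (auto simp: F''_def)
 qed
 have s'': "F'' x h = 0" if "norm x > R" for x h
 proof (cases "x = 0")
 case False
 then show ?thesis using z[of x] that by (auto simp: F''_def)
 qed (simp add: F''_def)
 have i: "(LBINT x. F'' x b \<bullet> b) = 0" for b
 proof (rule integral_directional_derivative[where f = "%x. F x \<bullet> b" and f' = "%x h. F'' x h \<bullet> b" and R = R])
 show "((%x. F x \<bullet> b) has_derivative (%h. F'' x h \<bullet> b)) (at x)" for x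
 by (rule has_derivative_inner_left[OF d''])
 show "continuous_on UNIV (%x. F'' x b \<bullet> b)" by (intro continuous_intros c'')
 qed (auto simp: r s'')
 have int: "integrable lborel (%x. F'' x b \<bullet> b)" for b
 by (rule integrable_continuous_support[of _ R]) (auto intro!: continuous_intros c'' simp: s'')
 have "d x = (\<Sum>b\<in>Basis. F'' x b \<bullet> b)" for x using e by (cases "x = 0") (auto simp: F''_def)
 then have "(LBINT x. d x) = (\<Sum>b\<in>Basis. (LBINT x. F'' x b \<bullet> b))"
 using int by (simp add: Bochner_Integration.integral_sum)
 then show ?thesis using i by simp
qed

section \<open>Weighted identities away from the origin\<close>

lemma powr_radial_deriv:
 assumes "(x::real^'n) ~= 0"
 shows "((%x. (x \<bullet> x) powr a) has_derivative (%h. (2 * a * (x \<bullet> x) powr (a - 1)) * (x \<bullet> h))) (at x)"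
proof -
 have "((%s. s powr a) has_real_derivative a * (x \<bullet> x) powr (a - 1)) (at (x \<bullet> x))"
 using assms by (intro has_real_derivative_powr) auto
 from has_derivative_compose[OF inner_self_deriv this[unfolded has_field_derivative_def]]
 show ?thesis by (rule has_derivative_eq_rhs) (auto simp: mult_ac)
qed

lemma powr_radial_continuous: "continuous_on (- {0}) (%x::real^'n. (x \<bullet> x) powr a)"
 by (intro continuous_intros) auto

lemma powr_radial_shift: "(x::real^'n) ~= 0 ==> (x \<bullet> x) powr (a + 1) = (x \<bullet> x) powr a * (x \<bullet> x)"
 by (simp add: powr_add)

text \<open>\<open>div (f \<bar>x\<bar>\<^sup>-\<^sup>N x) = \<bar>x\<bar>\<^sup>-\<^sup>N x \<cdot> \<nabla>f\<close>.\<close>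

lemma integral_radial_derivative:
 fixes f :: "real^'n => real"
 assumes d: "!!x. x ~= 0 ==> (f has_derivative (%h. G x \<bullet> h)) (at x)"
 and c: "continuous_on (- {0}) G"
 and r: "\<rho> > 0" "!!x. norm x < \<rho> ==> f x = 0" "!!x. norm x > R ==> f x = 0"
 shows "(LBINT x. (x \<bullet> x) powr (- (real CARD('n) / 2)) * (G x \<bullet> x)) = 0"
proof -
 define m where "m x = (x \<bullet> x) powr (- (real CARD('n) / 2))" for x :: "real^'n"
 define m' where "m' x = - real CARD('n) * (x \<bullet> x) powr (- (real CARD('n) / 2) - 1)" for x :: "real^'n"
 have m: "(m has_derivative (%h. m' x * (x \<bullet> h))) (at x)" if "x ~= 0" for x
 using powr_radial_deriv[OF that, of "- (real CARD('n) / 2)"] by (simp add: m_def[abs_def] m'_def)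
 have mm: "m' x * (x \<bullet> x) = - real CARD('n) * m x" if "x ~= 0" for x
 using powr_radial_shift[OF that, of "- (real CARD('n) / 2) - 1"] by (simp add: m_def m'_def)
 have cm: "continuous_on (- {0}) m" "continuous_on (- {0}) m'"
 unfolding m_def[abs_def] m'_def[abs_def] by (intro continuous_intros powr_radial_continuous)+
 have cf: "continuous_on (- {0}) f"
 by (rule continuous_at_imp_continuous_on) (use d has_derivative_continuous in blast)
 have "(LBINT x. m x * (G x \<bullet> x)) = 0"
 proof (rule divergence_annulus[where F = "%x. (f x * m x) *\<^sub>R x" and \<rho> = \<rho> and R = R and
 F' = "%x h. (f x * m x) *\<^sub>R h + (f x * (m' x * (x \<bullet> h)) + (G x \<bullet> h) * m x) *\<^sub>R x"])
 fix x :: "real^'n" assume x: "x ~= 0"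
 show "((%x. (f x * m x) *\<^sub>R x) has_derivative
 (%h. (f x * m x) *\<^sub>R h + (f x * (m' x * (x \<bullet> h)) + (G x \<bullet> h) * m x) *\<^sub>R x)) (at x)"
 by (rule has_derivative_scaleR[OF has_derivative_mult[OF d[OF x] m[OF x]] has_derivative_ident])
 have "(\<Sum>b\<in>Basis. ((f x * m x) *\<^sub>R b + (f x * (m' x * (x \<bullet> b)) + (G x \<bullet> b) * m x) *\<^sub>R x) \<bullet> b)
 = (\<Sum>b\<in>(Basis :: (real^'n) set). f x * m x) + f x * m' x * (\<Sum>b\<in>Basis. (x \<bullet> b) * (x \<bullet> b)) + m x * (\<Sum>b\<in>Basis. (G x \<bullet> b) * (x \<bullet> b))"
 by (simp add: inner_add_left sum.distrib sum_distrib_left algebra_simps)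
 also have "\<dots> = m x * (G x \<bullet> x)"
 using mm[OF x] by (simp add: inner_sum_Basis inner_commute[of x "G x"] algebra_simps)
 finally show "(\<Sum>b\<in>Basis. ((f x * m x) *\<^sub>R b + (f x * (m' x * (x \<bullet> b)) + (G x \<bullet> b) * m x) *\<^sub>R x) \<bullet> b) = m x * (G x \<bullet> x)" .
 next
 fix h :: "real^'n"
 show "continuous_on (- {0}) (%x. (f x * m x) *\<^sub>R h + (f x * (m' x * (x \<bullet> h)) + (G x \<bullet> h) * m x) *\<^sub>R x)"
 by (intro continuous_intros cf cm c)
 qed (use r in auto)
 then show ?thesis by (simp add: m_def)
qed

text \<open>The divergence of \<open>\<bar>x\<bar>\<^sup>2\<^sup>-\<^sup>N ((x \<cdot> \<nabla>v) \<nabla>v - \<bar>\<nabla>v\<bar>\<^sup>2 x / 2)\<close>.\<close>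

lemma Rellich_identity:
 fixes v :: "real^'n => real"
 assumes v: "C2_on (- {0}) v G A"
 and r: "\<rho> > 0" "!!x. norm x < \<rho> ==> v x = 0" "!!x. norm x > R ==> v x = 0"
 shows "(LBINT x. (x \<bullet> x) powr (- (real CARD('n) / 2)) *
 ((x \<bullet> x) * Lap A x * (G x \<bullet> x) - (real CARD('n) - 2) * (G x \<bullet> x)^2)) = 0"
proof -
 define N where "N = real CARD('n)"
 define m where "m x = (x \<bullet> x) powr (- (N / 2))" for x :: "real^'n"
 define k where "k x = (x \<bullet> x) powr (1 - N / 2)" for x :: "real^'n"
 have kd: "(k has_derivative (%h. (2 - N) * m x * (x \<bullet> h))) (at x)" if "x ~= 0" for x
 using powr_radial_deriv[OF that, of "1 - N / 2"] by (simp add: k_def[abs_def] m_def algebra_simps)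
 have km: "k x = m x * (x \<bullet> x)" if "x ~= 0" for x
 using powr_radial_shift[OF that, of "- (N / 2)"] by (simp add: k_def m_def)
 have ck: "continuous_on (- {0}) k" "continuous_on (- {0}) m"
 unfolding k_def[abs_def] m_def[abs_def] by (intro powr_radial_continuous)+
 note cv = C2_on_continuous[OF v]
 have Gz: "G x = 0" if "x ~= 0" "norm x < \<rho> \<or> norm x > R" for x
 proof -
 have dx: "(v has_derivative (%h. G x \<bullet> h)) (at x)" using C2_onD(1)[OF v] that by simp
 have "(%h. G x \<bullet> h) = (%h. 0)" using that(2)
 proof
 show "norm x < \<rho> ==> ?thesis" by (rule deriv_zero_open[OF dx, of "ball 0 \<rho>"]) (auto simp: r)
 show "norm x > R ==> ?thesis" by (rule deriv_zero_open[OF dx, of "{x. norm x > R}"]) (auto simp: r intro: open_norm_gt)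
 qed
 then show ?thesis by (metis inner_eq_zero_iff)
 qed
 define G' where "G' x = (if x = 0 then 0 else G x)" for x
 define W where "W x = (G x \<bullet> x) *\<^sub>R G x - (1/2 * (G x \<bullet> G x)) *\<^sub>R x" for x
 define W' where "W' x h = ((G x \<bullet> h + A x h \<bullet> x) *\<^sub>R G x + (G x \<bullet> x) *\<^sub>R A x h)
 - ((A x h \<bullet> G x) *\<^sub>R x + (1/2 * (G x \<bullet> G x)) *\<^sub>R h)" for x h
 have Wd: "(W has_derivative W' x) (at x)" if "x ~= 0" for x
 proof -
 have g: "(G has_derivative A x) (at x)" using C2_onD(2)[OF v] that by simp
 have a: "((%x. (G x \<bullet> x) *\<^sub>R G x) has_derivative (%h. (G x \<bullet> x) *\<^sub>R A x h + (G x \<bullet> h + A x h \<bullet> x) *\<^sub>R G x)) (at x)"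
 by (rule has_derivative_scaleR[OF has_derivative_inner[OF g has_derivative_ident] g])
 have b: "((%x. 1/2 * (G x \<bullet> G x)) has_derivative (%h. 1/2 * (G x \<bullet> A x h + A x h \<bullet> G x))) (at x)"
 by (rule has_derivative_mult_right[OF has_derivative_inner[OF g g]])
 show ?thesis unfolding W_def[abs_def]
 by (rule has_derivative_eq_rhs[OF has_derivative_diff[OF a has_derivative_scaleR[OF b has_derivative_ident]]])
 (auto simp: W'_def inner_commute algebra_simps)
 qed
 have "(LBINT x. (if x = 0 then 0 else m x * ((x \<bullet> x) * Lap A x * (G x \<bullet> x) - (N - 2) * (G x \<bullet> x)^2))) = 0"
 proof (rule divergence_annulus[where F = "%x. if x = 0 then 0 else k x *\<^sub>R W x" and \<rho> = \<rho> and R = R and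
 F' = "%x h. k x *\<^sub>R W' x h + ((2 - N) * m x * (x \<bullet> h)) *\<^sub>R W x"])
 fix x :: "real^'n" assume x: "x ~= 0"
 have "((%x. k x *\<^sub>R W x) has_derivative (%h. k x *\<^sub>R W' x h + ((2 - N) * m x * (x \<bullet> h)) *\<^sub>R W x)) (at x)"
 by (rule has_derivative_scaleR[OF kd[OF x] Wd[OF x]])
 then show "((%x. if x = 0 then 0 else k x *\<^sub>R W x) has_derivative (%h. k x *\<^sub>R W' x h + ((2 - N) * m x * (x \<bullet> h)) *\<^sub>R W x)) (at x)"
 by (rule has_derivative_transform_within_open[of _ _ _ _ "- {0}"]) (use x in auto)
 have sym: "A x h \<bullet> y = h \<bullet> A x y" for h y using C2_onD(3)[OF v] x by simp
 have c: "A x b \<bullet> y = A x y \<bullet> b" for b y by (metis sym inner_commute)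
 \<comment> \<open>By symmetry of the Hessian both cross terms equal the same quantity and cancel in
   the trace, which leaves the Laplacian as the only second-order term.\<close>
 have t1: "(\<Sum>b\<in>Basis. (A x b \<bullet> x) * (G x \<bullet> b)) = A x x \<bullet> G x"
 unfolding c[of _ x] by (rule inner_sum_Basis)
 have t2: "(\<Sum>b\<in>Basis. (A x b \<bullet> G x) * (x \<bullet> b)) = A x x \<bullet> G x"
 unfolding c[of _ "G x"] by (rule inner_sum_Basis)
 have tr: "(\<Sum>b\<in>Basis. W' x b \<bullet> b) = G x \<bullet> G x + (G x \<bullet> x) * Lap A x - 1/2 * (G x \<bullet> G x) * N"
 proof -
 have "(\<Sum>b\<in>Basis. W' x b \<bullet> b) = (\<Sum>b\<in>Basis. (G x \<bullet> b) * (G x \<bullet> b)) + (\<Sum>b\<in>Basis. (A x b \<bullet> x) * (G x \<bullet> b))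
 + (G x \<bullet> x) * Lap A x - ((\<Sum>b\<in>Basis. (A x b \<bullet> G x) * (x \<bullet> b)) + (\<Sum>b\<in>(Basis :: (real^'n) set). 1/2 * (G x \<bullet> G x)))"
 by (simp add: W'_def inner_add_left inner_diff_left sum.distrib sum_subtractf sum_distrib_left Lap_def algebra_simps)
 then show ?thesis unfolding t1 t2 by (simp add: inner_sum_Basis N_def)
 qed
 have tw: "(\<Sum>b\<in>Basis. ((2 - N) * m x * (x \<bullet> b)) * (W x \<bullet> b)) = (2 - N) * m x * (x \<bullet> W x)"
 using inner_sum_Basis[of x "W x"] by (simp add: sum_distrib_left[symmetric] mult.assoc)
 have "(\<Sum>b\<in>Basis. (k x *\<^sub>R W' x b + ((2 - N) * m x * (x \<bullet> b)) *\<^sub>R W x) \<bullet> b)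
 = k x * (\<Sum>b\<in>Basis. W' x b \<bullet> b) + (\<Sum>b\<in>Basis. ((2 - N) * m x * (x \<bullet> b)) * (W x \<bullet> b))"
 by (simp add: inner_add_left sum.distrib sum_distrib_left)
 also have "\<dots> = k x * (G x \<bullet> G x + (G x \<bullet> x) * Lap A x - 1/2 * (G x \<bullet> G x) * N) + (2 - N) * m x * (x \<bullet> W x)"
 unfolding tr tw ..
 also have "\<dots> = m x * ((x \<bullet> x) * Lap A x * (G x \<bullet> x) - (N - 2) * (G x \<bullet> x)^2)"
 unfolding km[OF x] W_def by (simp add: inner_diff_right inner_commute power2_eq_square field_simps)
 finally show "(\<Sum>b\<in>Basis. (k x *\<^sub>R W' x b + ((2 - N) * m x * (x \<bullet> b)) *\<^sub>R W x) \<bullet> b)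
 = (if x = 0 then 0 else m x * ((x \<bullet> x) * Lap A x * (G x \<bullet> x) - (N - 2) * (G x \<bullet> x)^2))" using x by simp
 next
 fix h :: "real^'n"
 show "continuous_on (- {0}) (%x. k x *\<^sub>R W' x h + ((2 - N) * m x * (x \<bullet> h)) *\<^sub>R W x)"
 unfolding W'_def W_def by (intro continuous_intros ck cv)
 qed (use r Gz in \<open>auto simp: W_def\<close>)
 moreover have "(if x = 0 then 0 else m x * ((x \<bullet> x) * Lap A x * (G x \<bullet> x) - (N - 2) * (G x \<bullet> x)^2))
 = m x * ((x \<bullet> x) * Lap A x * (G x \<bullet> x) - (N - 2) * (G x \<bullet> x)^2)" for x
 by (simp add: m_def)
 ultimately show ?thesis by (simp add: m_def N_def)
qed

text \<open>The operator is split as B + (2s + N - 2) E with E = x . grad v.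
  \<open>Rellich_identity\<close> and the vanishing integral of v E make B orthogonal to E in the
  weighted space, so the square keeps (2s + N - 2)^2 E^2 in full, for every s > 0 alike. A Hardy
  inequality along rays then bounds v by E; its constant is the logarithmic thickness of the
  annulus, finite because v vanishes near the origin.\<close>

lemma Carleman_core:
 fixes v :: "real^'n => real"
 assumes v: "C2_on (- {0}) v G A" and r: "0 < \<rho>" "\<rho> < R"
 and z: "!!x. norm x < \<rho> ==> v x = 0" "!!x. norm x > R ==> v x = 0" and s: "s > 0" and N: "CARD('n) >= 3"
 defines "m \<equiv> %x::real^'n. (x \<bullet> x) powr (- (real CARD('n) / 2))"
 shows "(s / ln (R / \<rho>))^2 * (LBINT x. m x * (v x)^2) <=
 (LBINT x. m x * ((x \<bullet> x) * Lap A x + 2 * s * (G x \<bullet> x) + s * (s + real CARD('n) - 2) * v x)^2)"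
proof -
 define n where "n = real CARD('n)"
 have n: "n >= 3" using N by (simp add: n_def)
 have dv: "(v has_derivative (%h. G x \<bullet> h)) (at x)" if "x ~= 0" for x using C2_onD(1)[OF v] that by simp
 have dG: "(G has_derivative A x) (at x)" if "x ~= 0" for x using C2_onD(2)[OF v] that by simp
 note cv = C2_on_continuous[OF v] Lap_continuous[OF v]
 have cm: "continuous_on (- {0}) m" unfolding m_def by (rule powr_radial_continuous)
 define out where "out x \<longleftrightarrow> x ~= 0 \<and> (norm x < \<rho> \<or> norm x > R)" for x :: "real^'n"
 have Gz: "G x = 0" if "out x" for x
 proof -
 have "(%h. G x \<bullet> h) = (%h. 0)"
 using deriv_zero_open[OF dv, of x "ball 0 \<rho>"] deriv_zero_open[OF dv open_norm_gt, of x R] that z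
 by (auto simp: out_def)
 then show ?thesis by (metis inner_eq_zero_iff)
 qed
 have Az: "A x = (%h. 0)" if "out x" for x
 proof -
 have "open {x. out x}"
 proof -
 have "{x. out x} = - {0} \<inter> (ball 0 \<rho> \<union> {x. norm x > R})" by (auto simp: out_def)
 then show ?thesis using open_norm_gt by (simp only:) (intro open_Int open_Un, auto)
 qed
 then show ?thesis using deriv_zero_open[OF dG, of x "{x. out x}"] that Gz by (auto simp: out_def)
 qed
 have vz: "v x = 0" if "out x" for x using that z by (auto simp: out_def)
 define E where "E x = G x \<bullet> x" for x
 define B where "B x = (x \<bullet> x) * Lap A x - (n - 2) * E x + s * (s + n - 2) * v x" for x
 have m0: "m x >= 0" "m 0 = 0" for x by (auto simp: m_def)
 have int: "integrable lborel (%x. m x * g x)" if "continuous_on (- {0}) g" "!!x. out x ==> g x = 0" for g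
 proof (rule annulus_integrable[OF _ r(1), where R = R])
 show "continuous_on (- {0}) (%x. m x * g x)" by (intro continuous_intros cm that)
 show "norm x < \<rho> ==> m x * g x = 0" "norm x > R ==> m x * g x = 0" for x
 using that(2)[of x] m0(2) by (cases "x = 0"; auto simp: out_def)+
 qed
 have cE: "continuous_on (- {0}) E" unfolding E_def[abs_def] by (intro continuous_intros cv)
 have cB: "continuous_on (- {0}) B" unfolding B_def[abs_def] by (intro continuous_intros cv cE)
 have z0: "E x = 0" "B x = 0" "v x = 0" "Lap A x = 0" if "out x" for x
 using that Gz Az vz by (auto simp: E_def B_def Lap_def)
 have i: "integrable lborel (%x. m x * (v x)^2)" "integrable lborel (%x. m x * (E x)^2)"
 "integrable lborel (%x. m x * (B x)^2)" "integrable lborel (%x. m x * (B x * E x))"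
 "integrable lborel (%x. m x * (v x * E x))"
 "integrable lborel (%x. m x * ((x \<bullet> x) * Lap A x * E x - (n - 2) * (E x)^2))"
 by (rule int; (intro continuous_intros cv cE cB)?; simp add: z0)+
 have vE: "(LBINT x. m x * (v x * E x)) = 0"
 proof -
 have "((%x. (v x)^2) has_derivative (%h. (2 * v x) *\<^sub>R G x \<bullet> h)) (at x)" if "x ~= 0" for x
 using has_derivative_power[OF dv[OF that], of 2] by (rule has_derivative_eq_rhs) auto
 from integral_radial_derivative[OF this _ r(1), where R = R]
 have "(LBINT x. m x * ((2 * v x) *\<^sub>R G x \<bullet> x)) = 0"
 using z by (simp add: m_def continuous_intros cv)
 then have "(LBINT x. 2 * (m x * (v x * E x))) = 0" by (simp add: E_def mult_ac)
 then show ?thesis by simp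
 qed
 have BE: "(LBINT x. m x * (B x * E x)) = 0"
 proof -
 have "(LBINT x. m x * ((x \<bullet> x) * Lap A x * E x - (n - 2) * (E x)^2)) = 0"
 using Rellich_identity[OF v r(1) z] by (simp add: m_def n_def E_def)
 moreover have "m x * (B x * E x) = m x * ((x \<bullet> x) * Lap A x * E x - (n - 2) * (E x)^2) + s * (s + n - 2) * (m x * (v x * E x))" for x
 by (simp add: B_def power2_eq_square algebra_simps)
 ultimately show ?thesis using vE i by simp
 qed
 have low: "(LBINT x. m x * (v x)^2) <= (2 * ln (R / \<rho>))^2 * (LBINT x. m x * (E x)^2)"
 proof -
 define L where "L = ln (R / \<rho>)"
 have L: "L > 0" using r by (simp add: L_def)
 \<comment> \<open>h = ln(|x|/R) has radial derivative x . grad h = 1 and is bounded by L on the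
   annulus.\<close>
 define h where "h x = ln (x \<bullet> x) / 2 - ln R" for x :: "real^'n"
 have hd: "(h has_derivative (%k. (x \<bullet> k) / (x \<bullet> x))) (at x)" if "x ~= 0" for x
 proof -
 have "(ln has_real_derivative 1 / (x \<bullet> x)) (at (x \<bullet> x))" using that by (intro DERIV_ln_divide) simp
 from has_derivative_compose[OF inner_self_deriv this[unfolded has_field_derivative_def]]
 have "((%x. ln (x \<bullet> x)) has_derivative (%k. 1 / (x \<bullet> x) * (2 * (x \<bullet> k)))) (at x)" .
 from has_derivative_diff[OF has_derivative_mult_right[OF this, of "1/2"] has_derivative_const, of "ln R"]
 show ?thesis unfolding h_def[abs_def] by (simp add: field_simps)
 qed
 have hc: "continuous_on (- {0}) h" unfolding h_def[abs_def] by (intro continuous_intros) auto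
 have hb: "\<bar>h x\<bar> <= L" if "\<rho> <= norm x" "norm x <= R" for x
 proof -
 have x: "norm x > 0" using that r by linarith
 have "ln (x \<bullet> x) = 2 * ln (norm x)" using x by (simp add: power2_norm_eq_inner[symmetric] ln_realpow)
 then have "h x = ln (norm x) - ln R" by (simp add: h_def)
 moreover have "ln \<rho> <= ln (norm x)" "ln (norm x) <= ln R" using that r x by auto
 ultimately show ?thesis using r by (simp add: L_def ln_div)
 qed
 have d2: "((%x. (v x)^2 * h x) has_derivative (%k. ((2 * v x * h x) *\<^sub>R G x + ((v x)^2 / (x \<bullet> x)) *\<^sub>R x) \<bullet> k)) (at x)" if "x ~= 0" for x
 using has_derivative_mult[OF has_derivative_power[OF dv[OF that], of 2] hd[OF that]]
 by (rule has_derivative_eq_rhs) (auto simp: inner_add_left algebra_simps)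
 have c2: "continuous_on (- {0}) (%x. (2 * v x * h x) *\<^sub>R G x + ((v x)^2 / (x \<bullet> x)) *\<^sub>R x)"
 by (intro continuous_intros cv hc) auto
 from integral_radial_derivative[OF d2 c2 r(1), where R = R]
 have "(LBINT x. m x * (((2 * v x * h x) *\<^sub>R G x + ((v x)^2 / (x \<bullet> x)) *\<^sub>R x) \<bullet> x)) = 0"
 using z by (simp add: m_def)
 moreover have "m x * (((2 * v x * h x) *\<^sub>R G x + ((v x)^2 / (x \<bullet> x)) *\<^sub>R x) \<bullet> x) = m x * (2 * v x * h x * E x) + m x * (v x)^2" for x
 using m0(2) by (cases "x = 0") (auto simp: inner_add_left E_def algebra_simps)
 moreover have ih: "integrable lborel (%x. m x * (2 * v x * h x * E x))"
 by (rule int) (intro continuous_intros cv hc cE, simp add: z0)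
 ultimately have eq: "(LBINT x. m x * (v x)^2) = - (LBINT x. m x * (2 * v x * h x * E x))"
 using i(1) by simp
 also have "\<dots> = (LBINT x. - (m x * (2 * v x * h x * E x)))" by simp
 also have "\<dots> <= (LBINT x. 1/2 * (m x * (v x)^2) + 2 * L\<^sup>2 * (m x * (E x)^2))"
 proof (rule integral_mono)
 fix x
 show "- (m x * (2 * v x * h x * E x)) <= 1/2 * (m x * (v x)^2) + 2 * L\<^sup>2 * (m x * (E x)^2)"
 proof (cases "x = 0 \<or> out x")
 case True
 then show ?thesis using m0(2) z0 by auto
 next
 case False
 then have "\<bar>h x\<bar> <= L" using hb by (auto simp: out_def not_less)
 then have h2: "(h x)^2 <= L\<^sup>2" using L abs_le_square_iff[of "h x" L] by simp
 \<comment> \<open>The weights 1/2 and 2 of this Young inequality allow half of the left side to be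
   absorbed.\<close>
 have "0 <= (v x / 1 + 2 * (h x * E x))^2" by simp
 then have "- (2 * v x * h x * E x) <= 1/2 * (v x)^2 + 2 * ((h x)^2 * (E x)^2)"
 by (simp add: power2_eq_square algebra_simps)
 also have "\<dots> <= 1/2 * (v x)^2 + 2 * (L\<^sup>2 * (E x)^2)" using h2 by (simp add: mult_right_mono)
 finally have "m x * (- (2 * v x * h x * E x)) <= m x * (1/2 * (v x)^2 + 2 * (L\<^sup>2 * (E x)^2))"
 by (rule mult_left_mono[OF _ m0(1)])
 then show ?thesis by (simp add: algebra_simps)
 qed
 qed (use i ih in auto)
 also have "\<dots> = 1/2 * (LBINT x. m x * (v x)^2) + 2 * L\<^sup>2 * (LBINT x. m x * (E x)^2)"
 using i by simp
 finally show ?thesis by (simp add: L_def power_mult_distrib)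
 qed
 have "(s / ln (R / \<rho>))^2 * (LBINT x. m x * (v x)^2) <= (2 * s)^2 * (LBINT x. m x * (E x)^2)"
 proof -
 have L: "ln (R / \<rho>) > 0" using r by simp
 from mult_left_mono[OF low, of "(s / ln (R / \<rho>))^2"]
 show ?thesis using L by (simp add: power_mult_distrib power_divide)
 qed
 also have "\<dots> <= (2 * s + n - 2)^2 * (LBINT x. m x * (E x)^2)"
 using s n m0(1) by (intro mult_right_mono power_mono integral_nonneg_AE) auto
 \<comment> \<open>The cross term is zero by \<open>BE\<close> and the B^2 term is nonnegative;
   adding both completes the square.\<close>
 also have "\<dots> <= (LBINT x. m x * (B x)^2) + 2 * (2 * s + n - 2) * (LBINT x. m x * (B x * E x))
 + (2 * s + n - 2)^2 * (LBINT x. m x * (E x)^2)"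
 using BE m0(1) by (simp add: integral_nonneg_AE)
 also have "\<dots> = (LBINT x. m x * (B x)^2 + 2 * (2 * s + n - 2) * (m x * (B x * E x)) + (2 * s + n - 2)^2 * (m x * (E x)^2))"
 using i by simp
 also have "\<dots> = (LBINT x. m x * ((x \<bullet> x) * Lap A x + 2 * s * (G x \<bullet> x) + s * (s + n - 2) * v x)^2)"
 proof (rule Bochner_Integration.integral_cong[OF refl])
 fix x
 have "m x * (B x)^2 + 2 * (2 * s + n - 2) * (m x * (B x * E x)) + (2 * s + n - 2)^2 * (m x * (E x)^2)
 = m x * (B x + (2 * s + n - 2) * E x)^2" by (simp add: power2_eq_square algebra_simps)
 also have "B x + (2 * s + n - 2) * E x = (x \<bullet> x) * Lap A x + 2 * s * (G x \<bullet> x) + s * (s + n - 2) * v x"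
 by (simp add: B_def E_def algebra_simps)
 finally show "m x * (B x)^2 + 2 * (2 * s + n - 2) * (m x * (B x * E x)) + (2 * s + n - 2)^2 * (m x * (E x)^2)
 = m x * ((x \<bullet> x) * Lap A x + 2 * s * (G x \<bullet> x) + s * (s + n - 2) * v x)^2" .
 qed
 finally show ?thesis by (simp add: n_def)
qed

lemma C2_powr:
 "C2_on (- {0}) (%x::real^'n. (x \<bullet> x) powr a) (%x. (2 * (a * (x \<bullet> x) powr (a - 1))) *\<^sub>R x)
 (%x h. (2 * (a * (x \<bullet> x) powr (a - 1))) *\<^sub>R h + (4 * (a * ((a - 1) * (x \<bullet> x) powr (a - 2))) * (x \<bullet> h)) *\<^sub>R x)"
proof (rule C2_radial)
 fix x :: "real^'n" assume "x \<in> - {0}"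
 then have p: "x \<bullet> x > 0" by simp
 show "((%s. s powr a) has_real_derivative a * (x \<bullet> x) powr (a - 1)) (at (x \<bullet> x))"
 using p by (rule has_real_derivative_powr)
 show "((%s. a * s powr (a - 1)) has_real_derivative a * ((a - 1) * (x \<bullet> x) powr (a - 2))) (at (x \<bullet> x))"
 using DERIV_cmult[OF has_real_derivative_powr[OF p, of "a - 1"], of a] by simp
next
 show "continuous_on ((%x::real^'n. x \<bullet> x) ` (- {0})) (%s. a * ((a - 1) * s powr (a - 2)))"
 by (intro continuous_intros) auto
qed

text \<open>Substitute v = |x|^-s w. Since the Laplacian of |x|^-s is s (s + 2 - N) |x|^(-s-2), the
  operator of \<open>Carleman_core\<close> applied to v collapses to |x|^-s |x|^2 times the
  Laplacian of w, and v^2 |x|^-N becomes w^2 with the weight |x|^(-N-2s).\<close>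

lemma Carleman:
 fixes w :: "real^'n => real"
 assumes w: "C2_on (- {0}) w G A" and r: "0 < \<rho>" "\<rho> < R"
 and z: "!!x. norm x < \<rho> ==> w x = 0" "!!x. norm x > R ==> w x = 0" and s: "s > 0" and N: "CARD('n) >= 3"
 defines "m \<equiv> %x::real^'n. (x \<bullet> x) powr (- (real CARD('n) / 2) - s)"
 shows "(s / ln (R / \<rho>))^2 * (LBINT x. m x * (w x)^2) <= (LBINT x. m x * ((x \<bullet> x) * Lap A x)^2)"
proof -
 define n where "n = real CARD('n)"
 define p where "p x = (x \<bullet> x) powr (- (s / 2))" for x :: "real^'n"
 let ?P = "%x::real^'n. (2 * (- (s / 2) * (x \<bullet> x) powr (- (s / 2) - 1))) *\<^sub>R x"
 let ?Q = "%(x::real^'n) h. (2 * (- (s / 2) * (x \<bullet> x) powr (- (s / 2) - 1))) *\<^sub>R h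
 + (4 * (- (s / 2) * ((- (s / 2) - 1) * (x \<bullet> x) powr (- (s / 2) - 2))) * (x \<bullet> h)) *\<^sub>R x"
 have C: "C2_on (- {0}) p ?P ?Q" unfolding p_def[abs_def] by (rule C2_powr)
 let ?G = "%x. p x *\<^sub>R G x + w x *\<^sub>R ?P x"
 let ?A = "%x h. (?P x \<bullet> h) *\<^sub>R G x + p x *\<^sub>R A x h + ((G x \<bullet> h) *\<^sub>R ?P x + w x *\<^sub>R ?Q x h)"
 note V = C2_mult[OF C w]
 have "(s / ln (R / \<rho>))^2 * (LBINT x. (x \<bullet> x) powr (- (n / 2)) * (p x * w x)^2)
 <= (LBINT x. (x \<bullet> x) powr (- (n / 2)) * ((x \<bullet> x) * Lap ?A x + 2 * s * (?G x \<bullet> x) + s * (s + n - 2) * (p x * w x))^2)"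
 unfolding n_def by (rule Carleman_core[OF V r _ _ s N]) (simp_all add: z)
 moreover have mp: "(x \<bullet> x) powr (- (n / 2)) * (p x * y)^2 = m x * y\<^sup>2" for x y
 proof -
 have "(p x)^2 = (x \<bullet> x) powr (- s)" by (simp add: p_def power2_eq_square powr_add[symmetric])
 then show ?thesis by (simp add: m_def n_def power_mult_distrib powr_add[symmetric])
 qed
 moreover have "(x \<bullet> x) powr (- (n / 2)) * ((x \<bullet> x) * Lap ?A x + 2 * s * (?G x \<bullet> x) + s * (s + n - 2) * (p x * w x))^2
 = m x * ((x \<bullet> x) * Lap A x)^2" for x
 proof (cases "x = 0")
 case False
 define t where "t = x \<bullet> x"
 have "- (s / 2) = - (s / 2) - 1 + 1" "- (s / 2) - 1 = - (s / 2) - 2 + (1::real)" by auto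
 then have "p x = t powr (- (s / 2) - 1) * t" "t powr (- (s / 2) - 1) = t powr (- (s / 2) - 2) * t"
 unfolding p_def t_def using powr_radial_shift[OF False] by metis+
 then have p1: "t * t powr (- (s / 2) - 1) = p x" and p2: "t * (t * t powr (- (s / 2) - 2)) = p x"
 by (simp_all add: mult_ac)
 have LQ: "Lap ?Q x = 2 * n * (- (s / 2) * t powr (- (s / 2) - 1)) + 4 * (- (s / 2) * ((- (s / 2) - 1) * t powr (- (s / 2) - 2))) * t"
 unfolding t_def n_def by (rule Lap_radial)
 have tQ: "t * Lap ?Q x = s * (s + 2 - n) * p x"
 proof -
 have "t * Lap ?Q x = - n * s * (t * t powr (- (s / 2) - 1)) + s * (s + 2) * (t * (t * t powr (- (s / 2) - 2)))"
 unfolding LQ by (simp add: algebra_simps)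
 then show ?thesis unfolding p1 p2 by (simp add: algebra_simps)
 qed
 have PG: "t * (?P x \<bullet> G x) = - s * p x * (G x \<bullet> x)"
 using p1 by (simp add: inner_commute t_def)
 have Px: "?P x \<bullet> x = - s * p x" using p1 by (simp add: t_def[symmetric] mult.commute)
 have "t * Lap ?A x + 2 * s * (?G x \<bullet> x) + s * (s + n - 2) * (p x * w x)
 = t * (p x * Lap A x + 2 * (?P x \<bullet> G x) + w x * Lap ?Q x) + 2 * s * (p x * (G x \<bullet> x) + w x * (?P x \<bullet> x)) + s * (s + n - 2) * (p x * w x)"
 unfolding Lap_mult by (simp only: inner_add_left inner_scaleR_left)
 also have "\<dots> = p x * (t * Lap A x) + 2 * (t * (?P x \<bullet> G x)) + w x * (t * Lap ?Q x)
 + 2 * s * (p x * (G x \<bullet> x) + w x * (?P x \<bullet> x)) + s * (s + n - 2) * (p x * w x)"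
 by (simp only: algebra_simps)
 also have "\<dots> = p x * (t * Lap A x)" unfolding PG Px tQ by (simp add: algebra_simps)
 finally show ?thesis using mp[of x "t * Lap A x"] by (simp add: t_def)
 qed (simp add: m_def)
 ultimately show ?thesis by simp
qed

section \<open>Unique continuation\<close>

text \<open>The Hessian of the convolution is assembled from convolutions with the entries of
  \<open>B\<close>. Its trace is convolution with the Laplacian of the kernel, which is the form in
  which the equation enters.\<close>

lemma conv_C2:
 fixes k :: "real^'n => real"
 assumes u: "locint u" and k: "k \<in> test_functions \<Omega>" and C: "C2_on UNIV k H B"
 shows "C2_on UNIV (conv k u) (grad (conv k u)) (%x h. \<Sum>b\<in>Basis. conv (%z. B z h \<bullet> b) u x *\<^sub>R b)"
 "Lap (%x h. \<Sum>b\<in>Basis. conv (%z. B z h \<bullet> b) u x *\<^sub>R b) x = conv (Lap B) u x"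
 "grad (conv k u) x \<bullet> h = conv (%z. grad k z \<bullet> h) u x"
 "Lap B \<in> test_functions \<Omega>"
proof -
 have H: "H = grad k" using grad_eqI[OF C2_onD(1)[OF C]] by auto
 have dk: "(%z. grad k z \<bullet> b) \<in> test_functions \<Omega>" for b using k by (rule deriv_test_functions)
 have gB: "grad (%z. grad k z \<bullet> b) z \<bullet> h = B z h \<bullet> b" for z b h
 proof -
 have "((%z. grad k z \<bullet> b) has_derivative (%h. B z h \<bullet> b)) (at z)"
 using has_derivative_inner_left[OF C2_onD(2)[OF C, of z]] H by simp
 from has_derivative_unique[OF this smooth_has_grad[OF test_functionsD(1)[OF dk]]] show ?thesis by metis
 qed
 have tB: "(%z. B z h \<bullet> b) \<in> test_functions \<Omega>" for h b
 using deriv_test_functions[OF dk[of b], of h] gB by simp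
 have sm: "smooth_on UNIV (conv k u)" by (rule conv_smooth[OF u k])
 show G: "grad (conv k u) x \<bullet> h = conv (%z. grad k z \<bullet> h) u x" for x h
 using has_derivative_unique[OF smooth_has_grad[OF sm] conv_has_derivative[OF u k]] by metis
 have dG: "((%x. grad (conv k u) x \<bullet> b) has_derivative (%h. conv (%z. B z h \<bullet> b) u x)) (at x)" for x b
 unfolding G using conv_has_derivative[OF u dk, of b x] gB by simp
 have ib: "(\<Sum>b\<in>Basis. c b *\<^sub>R b) \<bullet> k' = (\<Sum>b\<in>Basis. c b * (k' \<bullet> b))" for c and k' :: "real^'n"
 by (simp only: inner_sum_left inner_scaleR_left inner_commute[of k'])
 have lin: "(\<Sum>b\<in>Basis. conv (%z. B z h \<bullet> b) u x *\<^sub>R b) \<bullet> k' = conv (%z. B z h \<bullet> k') u x" for x h k'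
 proof -
 have "conv (%z. B z h \<bullet> k') u x = conv (%z. grad (%z. grad k z \<bullet> h) z \<bullet> k') u x"
 using gB[of h _ k'] C2_onD(3)[OF C] by (simp add: inner_commute)
 also have "\<dots> = (LBINT y. u y *\<^sub>R grad (%z. grad k z \<bullet> h) (x - y)) \<bullet> k'"
 by (rule conv_linear[OF u dk])
 also have "\<dots> = (\<Sum>b\<in>Basis. ((LBINT y. u y *\<^sub>R grad (%z. grad k z \<bullet> h) (x - y)) \<bullet> b) * (k' \<bullet> b))"
 by (simp add: inner_sum_Basis)
 also have "\<dots> = (\<Sum>b\<in>Basis. conv (%z. B z h \<bullet> b) u x * (k' \<bullet> b))"
 unfolding conv_linear[OF u dk, symmetric] gB using C2_onD(3)[OF C] by (simp add: inner_commute)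
 finally show ?thesis by (simp add: ib)
 qed
 show "C2_on UNIV (conv k u) (grad (conv k u)) (%x h. \<Sum>b\<in>Basis. conv (%z. B z h \<bullet> b) u x *\<^sub>R b)"
 unfolding C2_on_def
 proof (intro conjI ballI allI)
 fix x
 show "(conv k u has_derivative (%h. grad (conv k u) x \<bullet> h)) (at x)" by (rule smooth_has_grad[OF sm])
 have "((%x. \<Sum>b\<in>Basis. (grad (conv k u) x \<bullet> b) *\<^sub>R b) has_derivative (%h. \<Sum>b\<in>Basis. conv (%z. B z h \<bullet> b) u x *\<^sub>R b)) (at x)"
 by (intro has_derivative_sum has_derivative_scaleR_left dG)
 then show "(grad (conv k u) has_derivative (%h. \<Sum>b\<in>Basis. conv (%z. B z h \<bullet> b) u x *\<^sub>R b)) (at x)"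
 by (simp add: euclidean_representation)
 fix h k'
 show "(\<Sum>b\<in>Basis. conv (%z. B z h \<bullet> b) u x *\<^sub>R b) \<bullet> k' = h \<bullet> (\<Sum>b\<in>Basis. conv (%z. B z k' \<bullet> b) u x *\<^sub>R b)"
 unfolding lin inner_commute[of h] using C2_onD(3)[OF C] by (simp add: inner_commute)
 next
 fix h
 show "continuous_on UNIV (%x. \<Sum>b\<in>Basis. conv (%z. B z h \<bullet> b) u x *\<^sub>R b)"
 by (intro continuous_intros smooth_continuous conv_smooth[OF u tB])
 qed
 have "conv (Lap B) u x = (\<Sum>b\<in>Basis. conv (%z. B z b \<bullet> b) u x)"
 unfolding conv_def Lap_def sum_distrib_right
 by (rule Bochner_Integration.integral_sum) (rule conv_integrable_test[OF u tB])
 moreover have "Lap (%x h. \<Sum>b\<in>Basis. conv (%z. B z h \<bullet> b) u x *\<^sub>R b) x = (\<Sum>b\<in>Basis. conv (%z. B z b \<bullet> b) u x)"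
 by (simp add: Lap_def lin)
 ultimately show "Lap (%x h. \<Sum>b\<in>Basis. conv (%z. B z h \<bullet> b) u x *\<^sub>R b) x = conv (Lap B) u x" by simp
 have "(%z. \<Sum>b\<in>S. B z b \<bullet> b) \<in> test_functions \<Omega>" if "finite S" for S
 using that
 proof (induction S rule: finite_induct)
 case empty
 show ?case by (auto simp: test_functions_def smooth_const)
 next
 case (insert b S)
 then show ?case using test_functions_add[OF tB insert.IH, of b b 1] by simp
 qed
 then show "Lap B \<in> test_functions \<Omega>" unfolding Lap_def[abs_def] by simp
qed

text \<open>The Hessian of \<open>moll r\<close> in the form of \<open>C2_radial\<close>, with two
  derivatives of \<open>expm 0\<close> written out. Naming it makes \<open>Lap (mollh r)\<close> the
  kernel that represents the Laplacian of a mollified function.\<close>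

definition mollh :: "real => real^'n => real^'n => real^'n" where
 "mollh r z h = (2 * (expm 2 (1 - (z \<bullet> z) / r\<^sup>2) * (- 1 / r\<^sup>2) / (LBINT z. bump r (z::real^'n)))) *\<^sub>R h
 + (4 * ((expm 4 (1 - (z \<bullet> z) / r\<^sup>2) - 2 * expm 3 (1 - (z \<bullet> z) / r\<^sup>2)) * (- 1 / r\<^sup>2) * (- 1 / r\<^sup>2) / (LBINT z. bump r (z::real^'n))) * (z \<bullet> h)) *\<^sub>R z"

lemma moll_C2:
 "\<exists>H. C2_on UNIV (moll r :: real^'n => real) H (mollh r)"
proof -
 define c where "c = (LBINT z. bump r (z::real^'n))"
 have aff: "((%s. 1 - s / r\<^sup>2) has_real_derivative - 1 / r\<^sup>2) (at s)" for s
 using DERIV_diff[OF DERIV_const DERIV_cdivide[OF DERIV_ident]] by simp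
 have d: "((%s. expm k (1 - s / r\<^sup>2)) has_real_derivative
 (expm (k + 2) (1 - s / r\<^sup>2) - real k * expm (k + 1) (1 - s / r\<^sup>2)) * (- 1 / r\<^sup>2)) (at s)" for k s
 by (rule DERIV_chain2[OF expm_deriv aff])
 have ec: "continuous_on UNIV (expm k)" for k
 by (rule DERIV_continuous_on, rule has_field_derivative_at_within, rule expm_deriv)
 have "C2_on UNIV (%x::real^'n. expm 0 (1 - (x \<bullet> x) / r\<^sup>2) / c)
 (%x. (2 * (expm 2 (1 - (x \<bullet> x) / r\<^sup>2) * (- 1 / r\<^sup>2) / c)) *\<^sub>R x)
 (%x h. (2 * (expm 2 (1 - (x \<bullet> x) / r\<^sup>2) * (- 1 / r\<^sup>2) / c)) *\<^sub>R h + (4 * ((expm 4 (1 - (x \<bullet> x) / r\<^sup>2)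
 - 2 * expm 3 (1 - (x \<bullet> x) / r\<^sup>2)) * (- 1 / r\<^sup>2) * (- 1 / r\<^sup>2) / c) * (x \<bullet> h)) *\<^sub>R x)"
 proof (rule C2_radial)
 fix x :: "real^'n"
 show "((%s. expm 0 (1 - s / r\<^sup>2) / c) has_real_derivative expm 2 (1 - x \<bullet> x / r\<^sup>2) * (- 1 / r\<^sup>2) / c) (at (x \<bullet> x))"
 using DERIV_cdivide[OF d[of 0 "x \<bullet> x"], of c] by (simp add: numeral_2_eq_2)
 show "((%s. expm 2 (1 - s / r\<^sup>2) * (- 1 / r\<^sup>2) / c) has_real_derivative
 (expm 4 (1 - x \<bullet> x / r\<^sup>2) - 2 * expm 3 (1 - x \<bullet> x / r\<^sup>2)) * (- 1 / r\<^sup>2) * (- 1 / r\<^sup>2) / c) (at (x \<bullet> x))"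
 using DERIV_cdivide[OF DERIV_cmult_right[OF d[of 2 "x \<bullet> x"], of "- 1 / r\<^sup>2"], of c] by simp
 next
 have e: "continuous_on S (%s. expm k (1 - s / r\<^sup>2))" for S k
 unfolding divide_inverse by (intro continuous_on_compose2[OF ec[of k], of S] continuous_intros) auto
 show "continuous_on ((%x::real^'n. x \<bullet> x) ` UNIV) (%s. (expm 4 (1 - s / r\<^sup>2) - 2 * expm 3 (1 - s / r\<^sup>2)) * (- 1 / r\<^sup>2) * (- 1 / r\<^sup>2) / c)"
 unfolding divide_inverse[of _ c] by (intro continuous_on_mult continuous_on_diff continuous_on_const e)
 qed
 then show ?thesis
 unfolding mollh_def[abs_def] moll_def[abs_def] bump_def[abs_def] power2_norm_eq_inner c_def by blast
qed

lemma nn_to_int: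
 assumes "f \<in> borel_measurable M" "!!x. f x >= 0" "(\<integral>\<^sup>+x. ennreal (f x) \<partial>M) <= ennreal c" "c >= 0"
 shows "integrable M f" "(\<integral>x. f x \<partial>M) <= c"
proof -
 show i: "integrable M f"
 using le_less_trans[OF assms(3) ennreal_less_top] by (intro integrableI_nonneg) (auto simp: assms)
 have "ennreal (\<integral>x. f x \<partial>M) <= ennreal c"
 using assms by (subst nn_integral_eq_integral[OF i, symmetric]) auto
 then show "(\<integral>x. f x \<partial>M) <= c" using assms(4) by (simp add: ennreal_le_iff)
qed

lemma Dlim_square_locint:
 fixes u :: "real^'n => real"
 assumes D: "Dlim \<Omega> u g" and N: "CARD('n) >= 3"
 shows "locint (%x. (u x)^2)"
proof -
 have q: "crit_exp CARD('n) > 2" using crit_exp_gt[OF N] by simp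
 note [measurable] = Dlim_measurable[OF D]
 have fin: "Nq u < \<infinity>" using Dlim_finite(1)[OF D] q by simp
 show ?thesis unfolding locint_def
 proof (intro conjI allI)
 fix R
 have "(NN x. ennreal (norm (indicator (cball 0 R) x * (u x)^2)))
 = (NN x. indicator (cball 0 R) x * ennreal (\<bar>u x\<bar> powr 2))"
 by (intro nn_integral_cong) (auto simp: indicator_def)
 also have "\<dots> < \<infinity>"
 by (rule order.strict_trans1[OF nn_ball_powr_le[of 2 "crit_exp CARD('n)" 1]])
 (use q fin emeasure_cball_finite[of "0::real^'n" R] in \<open>auto simp: ennreal_mult_less_top Nq_def\<close>)
 finally show "integrable lborel (%y. indicator (cball 0 R) y * (u y)^2)"
 by (intro integrableI_bounded) auto
 qed measurable
qed

lemma conv_integral_const: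
 fixes x :: "real^'n"
 assumes r: "r > 0" and "!!y. norm (x - y) <= r ==> u y = c" and [measurable]: "u \<in> BM"
 shows "conv (moll r) u x = c"
proof -
 have [measurable]: "(moll r :: real^'n => real) \<in> BM" by (rule test_measurable[OF moll_props(1)[OF r]])
 have d: "(NN y. ennreal (moll r (x - y))) = 1"
 by (rule conv_density[OF test_measurable[OF moll_props(1)[OF r]] moll_props(3)[OF r]])
 have "moll r (x - y) * u y = moll r (x - y) * c" for y
 using assms(2)[of y] moll_props(4)[OF r, of "x - y"] by (cases "norm (x - y) <= r") auto
 then have "conv (moll r) u x = (LBINT y. moll r (x - y) * c)"
 unfolding conv_def by (intro Bochner_Integration.integral_cong refl)
 also have "\<dots> = (LBINT y. moll r (x - y)) * c" by simp
 also have "(LBINT y. moll r (x - y)) = 1"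
 by (subst integral_eq_nn_integral) (auto simp: moll_props(2)[OF r] d)
 finally show ?thesis by simp
qed

text \<open>The indicator of the ball of radius R + 1, mollified at scale 1, is 1 inside radius R
  and 0 beyond R + 2.\<close>

lemma cutoff_exists:
 assumes "R > 0"
 shows "\<exists>z H B. z \<in> test_functions (UNIV :: (real^'n) set) \<and> C2_on UNIV z H B \<and> Lap B \<in> BM \<and>
 (\<forall>x. norm x < R --> z x = 1 \<and> H x = 0 \<and> Lap B x = 0) \<and> (\<forall>x. norm x > R + 2 --> z x = 0)
 \<and> (\<exists>M. \<forall>x. \<bar>z x\<bar> <= M \<and> norm (H x) <= M \<and> \<bar>Lap B x\<bar> <= M) \<and> (\<forall>x. norm x > R + 2 --> H x = 0 \<and> Lap B x = 0)"
proof -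
 define i where "i = (indicator (cball 0 (R + 1)) :: real^'n => real)"
 have [measurable]: "i \<in> BM" by (simp add: i_def)
 have li: "locint i"
 by (rule locint_integrable, rule integrable_bounded_support[of _ 1 "R + 1"]) (auto simp: i_def)
 obtain H0 where C0: "C2_on UNIV (moll 1 :: real^'n => real) H0 (mollh 1)" using moll_C2 by blast
 note m = moll_props(1)[OF zero_less_one, where 'n = 'n]
 define z where "z = conv (moll 1) i"
 define H where "H = grad z"
 define B where "B = (%x h. \<Sum>b\<in>Basis. conv (%z. mollh 1 z h \<bullet> b) i x *\<^sub>R b)"
 have C: "C2_on UNIV z H B" unfolding z_def H_def B_def by (rule conv_C2(1)[OF li m C0])
 have LB: "Lap B = conv (Lap (mollh 1)) i" unfolding B_def using conv_C2(2)[OF li m C0] by blast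
 have out: "!!y. norm y > R + 1 ==> i y = 0" by (simp add: i_def)
 have zt: "z \<in> test_functions UNIV" unfolding z_def by (rule conv_test_functions[OF li m out])
 have Lt: "Lap B \<in> test_functions UNIV"
 unfolding LB by (rule conv_test_functions[OF li conv_C2(4)[OF li m C0] out])
 have z1: "z x = 1" if "norm x < R" for x
 unfolding z_def
 proof (rule conv_integral_const)
 fix y assume "norm (x - y) <= 1"
 then have "norm y <= R + 1" using that norm_triangle_ineq2[of y x] by (simp add: norm_minus_commute)
 then show "i y = 1" by (simp add: i_def)
 qed auto
 have H0: "H x = 0" if "norm x < R" for x
 proof -
 have "(z has_derivative (%h. 0)) (at x)"
 by (rule has_derivative_transform_within_open[OF has_derivative_const[of 1], of "ball 0 R"]) (use that z1 in auto)
 then show ?thesis unfolding H_def using grad_eqI[of z 0 x] by simp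
 qed
 have L0: "Lap B x = 0" if "norm x < R" for x
 proof -
 have "B x = (%h. 0)"
 by (rule deriv_zero_open[OF C2_onD(2)[OF C], of x "ball 0 R"]) (use that H0 in auto)
 then show ?thesis by (simp add: Lap_def)
 qed
 have z0: "z x = 0" if "norm x > R + 2" for x unfolding z_def
 proof (rule conv_zero[of _ 1])
 fix y assume "norm (x - y) <= 1"
 then have "norm y > R + 1" using that norm_triangle_ineq2[of x y] by linarith
 then show "i y = 0" by (rule out)
 qed (simp add: moll_props(4))
 have Hz: "H x = 0" if "norm x > R + 2" for x
 using deriv_zero_open[OF C2_onD(1)[OF C] open_norm_gt, of x "R + 2"] that z0 by (metis UNIV_I inner_eq_zero_iff mem_Collect_eq)
 have Bz: "Lap B x = 0" if "norm x > R + 2" for x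
 using deriv_zero_open[OF C2_onD(2)[OF C] open_norm_gt, of x "R + 2"] that Hz by (simp add: Lap_def)
 obtain M1 where M1: "!!x. \<bar>z x\<bar> <= M1 \<and> norm (H x) <= M1" using test_bounds[OF zt] unfolding H_def by metis
 obtain M2 where M2: "!!x. \<bar>Lap B x\<bar> <= M2" using test_bounds[OF Lt] by metis
 have "\<bar>z x\<bar> <= max M1 M2 \<and> norm (H x) <= max M1 M2 \<and> \<bar>Lap B x\<bar> <= max M1 M2" for x
 using M1[of x] M2[of x] by auto
 then show ?thesis using zt C z1 H0 L0 z0 Hz Bz test_measurable[OF Lt] by blast
qed

lemma sq_sum3: "(a + b + c)^2 <= 3 * (a\<^sup>2 + b\<^sup>2 + (c::real)^2)"
 using zero_le_power2[of "a - b"] zero_le_power2[of "a - c"] zero_le_power2[of "b - c"]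
 by (simp add: power2_eq_square algebra_simps)

lemma wint_triangle:
 fixes W f g :: "real^'n => real"
 assumes "!!x. W x >= 0" "integrable lborel (%x. W x * (f x)^2)" "integrable lborel (%x. W x * (g x)^2)"
 "integrable lborel (%x. W x * (f x - g x)^2)"
 shows "(LBINT x. W x * (f x)^2) <= 2 * (LBINT x. W x * (g x)^2) + 2 * (LBINT x. W x * (f x - g x)^2)"
proof -
 have "(LBINT x. W x * (f x)^2) <= (LBINT x. 2 * (W x * (g x)^2) + 2 * (W x * (f x - g x)^2))"
 proof (rule integral_mono)
 fix x
 have "(f x)^2 <= 2 * (g x)^2 + 2 * (f x - g x)^2"
 using zero_le_power2[of "f x - 2 * g x"] by (simp add: power2_eq_square algebra_simps)
 from mult_left_mono[OF this assms(1)[of x]]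
 show "W x * (f x)^2 <= 2 * (W x * (g x)^2) + 2 * (W x * (f x - g x)^2)" by (simp add: algebra_simps)
 qed (use assms in auto)
 then show ?thesis using assms by simp
qed

lemma wint_le:
 fixes W f :: "real^'n => real"
 assumes W: "!!x. 0 <= W x \<and> W x <= w0" and [measurable]: "W \<in> BM" "f \<in> BM"
 and nn: "(NN x. ennreal ((f x)^2)) <= ennreal c" "c >= 0"
 shows "integrable lborel (%x. W x * (f x)^2)" "(LBINT x. W x * (f x)^2) <= w0 * c"
proof -
 have f: "integrable lborel (%x. (f x)^2)" "(LBINT x. (f x)^2) <= c"
 by (rule nn_to_int[OF _ _ nn]; simp)+
 have w0: "w0 >= 0" using W[of 0] by linarith
 have le: "W x * (f x)^2 <= w0 * (f x)^2" for x using W[of x] by (intro mult_right_mono) auto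
 show i: "integrable lborel (%x. W x * (f x)^2)"
 by (rule integrable_dom[OF integrable_mult_right[OF f(1), of w0]])
 (use le W in \<open>auto simp: abs_mult w0\<close>)
 have "(LBINT x. W x * (f x)^2) <= (LBINT x. w0 * (f x)^2)"
 by (rule integral_mono[OF i _ le]) (use f in auto)
 also have "\<dots> <= w0 * c" using f(2) w0 by (simp add: mult_left_mono)
 finally show "(LBINT x. W x * (f x)^2) <= w0 * c" .
qed

lemma C2_on_subset: "C2_on S f G A ==> T \<subseteq> S ==> C2_on T f G A"
 by (auto simp: C2_on_def intro: continuous_on_subset)

lemma norm_sq_sum: "ennreal ((norm (v::real^'n))^2) = (\<Sum>b\<in>Basis. ennreal ((v \<bullet> b)^2))"
 unfolding power2_norm_eq_inner using inner_sum_Basis[of v v] by (simp add: power2_eq_square)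

text \<open>The Carleman estimate is applied to a cutoff times the mollified functions. The reaction
  terms are absorbed on the left once s is large; the commutator terms live where |x| \<ge> R1 and
  carry at most the weight R1^(-n-2s). On the ball of radius R0 < R1 the weight is at least
  R0^(-n-2s), so s -> infinity forces u = 0 there. The mollification errors have constants depending
  on s, hence r -> 0 is taken first.\<close>

lemma unique_continuation:
 fixes u F :: "'i => real^'n => real"
 assumes N: "CARD('n) >= 3" and I: "finite I"
 and D: "!!i. i \<in> I ==> Dlim UNIV (u i) (g i)"
 and Fm: "!!i. i \<in> I ==> F i \<in> BM"
 and Fb: "!!i x. i \<in> I ==> \<bar>F i x\<bar> <= M * (\<Sum>j\<in>I. \<bar>u j x\<bar>)" and M: "M >= 0"
 and pde: "!!r i x. r > 0 ==> i \<in> I ==> conv (Lap (mollh r)) (u i) x = - conv (moll r) (F i) x"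
 and z: "\<rho> > 0" "!!i x. i \<in> I ==> norm x < \<rho> ==> u i x = 0"
 shows "\<forall>i\<in>I. AE x in lborel. u i x = 0"
proof -
 define n where "n = real CARD('n)"
 define \<Gamma> where "\<Gamma> i = enn2real (N2 (g i))" for i
 have \<Gamma>0: "\<Gamma> i >= 0" for i by (simp add: \<Gamma>_def)
 have q: "crit_exp CARD('n) > 0" using crit_exp_gt[OF N] by simp
 have um: "u i \<in> BM" "g i \<in> BM" if "i \<in> I" for i using Dlim_measurable[OF D[OF that]] by auto
 have ul: "locint (u i)" if "i \<in> I" for i using Dlim_locint(1)[OF D[OF that] N] .
 have al: "locint (%x. \<bar>u i x\<bar>)" if "i \<in> I" for i
 proof -
 have "indicator (cball 0 R) y * \<bar>u i y\<bar> = \<bar>indicator (cball 0 R) y * u i y\<bar>" for R y by (simp add: abs_mult)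
 then show ?thesis using ul[OF that] um(1)[OF that] by (simp add: locint_def integrable_abs)
 qed
 have Fl: "locint (F i)" if i: "i \<in> I" for i
 unfolding locint_def
 proof (intro conjI allI Fm[OF i])
 fix R
 have "integrable lborel (%y. M * (\<Sum>j\<in>I. indicator (cball 0 R) y * \<bar>u j y\<bar>))"
 using al by (auto simp: locint_def)
 then show "integrable lborel (%y. indicator (cball 0 R) y * F i y)"
 proof (rule integrable_dom)
 show "AE y in lborel. norm (indicator (cball 0 R) y * F i y) <= norm (M * (\<Sum>j\<in>I. indicator (cball 0 R) y * \<bar>u j y\<bar>))"
 using Fb[OF i] M by (auto simp: indicator_def abs_mult intro: order_trans)
 have [measurable]: "F i \<in> BM" by (rule Fm[OF i])
 show "(%y. indicator (cball 0 R) y * F i y) \<in> borel_measurable lborel" by measurable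
 qed
 qed
 have main: "(LBINT x. indicator (cball 0 R0) x * (u i x)^2) = 0" if i: "i \<in> I" and R0: "R0 > 0" for i R0
 proof -
 \<comment> \<open>The gap between the target radius R0 and R1 drives the decay in s; the cutoff
   ends at R2; halving \<rho> leaves room for mollification radii below
   \<open>\<rho>'\<close>.\<close>
 define R1 where "R1 = R0 + \<rho> + 1"
 define R2 where "R2 = R1 + 2"
 define \<rho>' where "\<rho>' = \<rho> / 2"
 have R: "0 < \<rho>'" "\<rho>' < R1" "R0 < R1" "R1 < R2" "\<rho>' < \<rho>" "0 < R1" "\<rho>' < R2" using z(1) R0 by (auto simp: R1_def R2_def \<rho>'_def)
 obtain \<zeta> H B Z where \<zeta>t: "\<zeta> \<in> test_functions (UNIV :: (real^'n) set)" and \<zeta>C: "C2_on UNIV \<zeta> H B" and LBm: "Lap B \<in> BM"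
 and \<zeta>1: "!!x. norm x < R1 ==> \<zeta> x = 1 \<and> H x = 0 \<and> Lap B x = 0"
 and \<zeta>0: "!!x. norm x > R2 ==> \<zeta> x = 0 \<and> H x = 0 \<and> Lap B x = 0"
 and Z: "!!x. \<bar>\<zeta> x\<bar> <= Z \<and> norm (H x) <= Z \<and> \<bar>Lap B x\<bar> <= Z"
 using cutoff_exists[OF R(6), where 'n = 'n] unfolding R2_def by blast
 have Z0: "Z >= 0" using Z[of 0] by linarith
 have \<zeta>m [measurable]: "\<zeta> \<in> BM" by (rule test_measurable[OF \<zeta>t])
 define L where "L = ln (R2 / \<rho>')"
 have L: "L > 0" using R by (simp add: L_def)
 define \<beta> where "\<beta> i = (LBINT x. indicator (cball 0 R2) x * (u i x)^2)" for i
 \<comment> \<open>A bound, uniform in r \<le> 1, for the integral of 4 Z^2 |grad U|^2 + Z^2 U^2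
   over the ball of radius R2. Here \<open>\<beta> i\<close> is the L^2 mass of \<open>u i\<close>
   on that ball, and 12 is twice the 6 of \<open>Dlim_translation\<close>.\<close>
 define K where "K i = 4 * Z\<^sup>2 * \<Gamma> i + Z\<^sup>2 * (2 * \<beta> i + 12 * \<Gamma> i)" for i
 define T where "T = 3 * (R2\<^sup>2)^2"
 have T: "T > 0" using R by (simp add: T_def)
 \<comment> \<open>The 4 collects two factors 2, one from replacing u by its mollification and one
   from replacing the mollified |u_j| by |u_j|; the factor with M and the cardinality of I comes
   from the bound on the reaction terms.\<close>
 define c1 where "c1 = 4 * T * (M\<^sup>2 * (real (card I))^2)"
 define c2 where "c2 = 2 * T * (\<Sum>i\<in>I. K i)"
 define m where "m s x = (x \<bullet> x) powr (- (n / 2) - s)" for s and x :: "real^'n"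
 \<comment> \<open>The Carleman weight, restricted to where the mollified functions can be nonzero
   and with the squared cutoff included. In this form it is bounded, so it can be integrated against
   any locally integrable square.\<close>
 define W where "W s x = m s x * (indicator {x. \<rho>' <= norm x} x * (\<zeta> x)^2)" for s x
 define Y where "Y s = (\<Sum>i\<in>I. (LBINT x. W s x * (u i x)^2))" for s
 define e where "e s = (R1\<^sup>2) powr (- (n / 2) - s)" for s
 have mm: "m s x >= 0" "m s \<in> BM" for s x
 proof -
 show "m s \<in> BM" unfolding m_def by measurable
 qed (simp add: m_def)
 note [measurable] = mm(2)
 have mle: "m s x <= (a\<^sup>2) powr (- (n / 2) - s)" if "0 < a" "a <= norm x" "s > 0" for a s x
 unfolding m_def power2_norm_eq_inner[symmetric]
 by (rule powr_mono2') (use that in \<open>auto simp: n_def intro!: power_mono\<close>)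
 have Wm [measurable]: "W s \<in> BM" for s unfolding W_def[abs_def] by measurable
 have Wb: "0 <= W s x \<and> W s x <= (\<rho>'\<^sup>2) powr (- (n / 2) - s) * Z\<^sup>2" if "s > 0" for s x
 proof (cases "\<rho>' <= norm x")
 case True
 have "(\<zeta> x)^2 <= Z\<^sup>2" using Z[of x] Z0 abs_le_square_iff[of "\<zeta> x" Z] by simp
 then show ?thesis using True mle[OF R(1) True that] mm(1)[of s x] by (auto simp: W_def intro!: mult_mono)
 qed (simp add: W_def)
 have Wz: "W s x = 0" if "norm x > R2" for s x using \<zeta>0[OF that] by (simp add: W_def)
 have Wi: "integrable lborel (%x. W s x * (f x)^2)" if "s > 0" "locint (%x. (f x)^2)" for s f
 proof (rule locint_integrable_mult[OF that(2) Wm])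
 show "\<bar>W s z\<bar> <= (\<rho>'\<^sup>2) powr (- (n / 2) - s) * Z\<^sup>2" for z using Wb[OF that(1), of z] by simp
 show "norm z > R2 ==> W s z = 0" for z by (rule Wz)
 qed
 have step: "(s / L)^2 * Y s <= c1 * Y s + c2 * e s" if s: "s > 0" for s
 proof -
 define w0 where "w0 = (\<rho>'\<^sup>2) powr (- (n / 2) - s) * Z\<^sup>2"
 \<comment> \<open>Collects the mollification errors. It depends on s, which is harmless since s is
   fixed while r -> 0.\<close>
 define c3 where "c3 = (s / L)^2 * 12 * w0 * (\<Sum>i\<in>I. \<Gamma> i) + 2 * T * M\<^sup>2 * (real (card I))^2 * 12 * w0 * (\<Sum>i\<in>I. \<Gamma> i)"
 have bd: "(s / L)^2 * Y s <= c1 * Y s + c2 * e s + c3 * r\<^sup>2" if r: "0 < r" "r < \<rho>'" "r <= 1" for r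
 proof -
 note mt = moll_props(1)[OF r(1), where 'n = 'n]
 have mM [measurable]: "(moll r :: real^'n => real) \<in> BM" by (rule test_measurable[OF mt])
 define U where "U i = conv (moll r) (u i)" for i
 define P where "P i = conv (moll r) (F i)" for i
 \<comment> \<open>F is controlled pointwise by the sum of the |u_j|, so its mollification is
   controlled by the mollified absolute values \<open>a j\<close> rather than by |U_j|.\<close>
 define a where "a i = conv (moll r) (%x. \<bar>u i x\<bar>)" for i
 have cc: "continuous_on UNIV (U i)" "continuous_on UNIV (P i)" "continuous_on UNIV (a i)" "continuous_on UNIV (grad (U i))" if "i \<in> I" for i
 unfolding U_def P_def a_def
 by (rule smooth_continuous, rule conv_smooth[OF ul[OF that] mt], rule smooth_continuous, rule conv_smooth[OF Fl[OF that] mt],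
 rule smooth_continuous, rule conv_smooth[OF al[OF that] mt], rule grad_continuous, rule conv_smooth[OF ul[OF that] mt])
 have sl: "locint (%x. (f x)^2)" if "continuous_on UNIV f" for f :: "real^'n => real"
 proof -
 have fm [measurable]: "f \<in> BM" by (rule borel_measurable_continuous_onI[OF that])
 have "integrable lborel (%y. indicator (cball 0 R) y * (f y)^2)" for R
 proof -
 have "compact ((%y. (f y)^2) ` cball 0 R)" by (intro compact_continuous_image continuous_intros continuous_on_subset[OF that]) auto
 then obtain b where "\<forall>y\<in>cball 0 R. norm ((f y)^2) <= b" using compact_imp_bounded bounded_iff by (metis imageI)
 then show ?thesis by (intro integrable_bounded_support[of _ "\<bar>b\<bar>" R]) (auto simp: indicator_def intro!: order_trans[OF _ abs_ge_self])
 qed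
 then show ?thesis by (simp add: locint_def)
 qed
 have us: "locint (%x. (u i x)^2)" if "i \<in> I" for i by (rule Dlim_square_locint[OF D[OF that] N])
 have trans: "(NN x. ennreal ((u i (x + h) - u i x)^2)) <= ennreal (6 * \<Gamma> i * (norm h)^2)" if "i \<in> I" for i h
 using Dlim_translation[OF D[OF that] N] by (simp add: \<Gamma>_def)
 have err: "(NN x. ennreal ((U i x - u i x)^2)) <= ennreal (6 * \<Gamma> i * r\<^sup>2)"
 "(NN x. ennreal ((a i x - \<bar>u i x\<bar>)^2)) <= ennreal (6 * \<Gamma> i * r\<^sup>2)" if i: "i \<in> I" for i
 proof -
 show "(NN x. ennreal ((U i x - u i x)^2)) <= ennreal (6 * \<Gamma> i * r\<^sup>2)"
 unfolding U_def by (rule conv_error[OF ul[OF i] mt moll_props(2)[OF r(1)] moll_props(3)[OF r(1)] moll_props(4)[OF r(1)] trans[OF i]]) (use \<Gamma>0 in auto)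
 have tr: "(NN x. ennreal ((\<bar>u i (x + h)\<bar> - \<bar>u i x\<bar>)^2)) <= ennreal (6 * \<Gamma> i * (norm h)^2)" for h
 proof (rule order_trans[OF nn_integral_mono trans[OF i]], rule ennreal_leI)
 fix x
 show "(\<bar>u i (x + h)\<bar> - \<bar>u i x\<bar>)^2 <= (u i (x + h) - u i x)^2"
 by (subst abs_le_square_iff[symmetric]) (rule abs_triangle_ineq3)
 qed
 show "(NN x. ennreal ((a i x - \<bar>u i x\<bar>)^2)) <= ennreal (6 * \<Gamma> i * r\<^sup>2)"
 unfolding a_def by (rule conv_error[OF al[OF i] mt moll_props(2)[OF r(1)] moll_props(3)[OF r(1)] moll_props(4)[OF r(1)] tr]) (use \<Gamma>0 in auto)
 qed
 have Q1: "(s / L)^2 * (LBINT x. W s x * (U i x)^2) <= T * ((LBINT x. W s x * (P i x)^2) + e s * K i)" if i: "i \<in> I" for i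
 proof -
 obtain H0 where C0: "C2_on UNIV (moll r :: real^'n => real) H0 (mollh r)" using moll_C2 by blast
 define AU where "AU = (%x h. \<Sum>b\<in>Basis. conv (%z. mollh r z h \<bullet> b) (u i) x *\<^sub>R b)"
 have CU: "C2_on UNIV (U i) (grad (U i)) AU" unfolding U_def AU_def by (rule conv_C2(1)[OF ul[OF i] mt C0])
 have LU: "Lap AU x = - P i x" for x
 unfolding AU_def P_def using conv_C2(2)[OF ul[OF i] mt C0] pde[OF r(1) i] by simp
 have ballz: "norm y < \<rho>" if "norm x < \<rho>'" "norm (x - y) <= r" for x y :: "real^'n"
 using that norm_triangle_ineq2[of y x] r(2) by (simp add: norm_minus_commute \<rho>'_def)
 have Uz: "U i x = 0" if "norm x < \<rho>'" for x
 unfolding U_def by (rule conv_zero[of _ r]) (use ballz[OF that] z(2)[OF i] moll_props(4)[OF r(1)] in auto)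
 have Fz: "F i x = 0" if "norm x < \<rho>" for x using Fb[OF i, of x] z(2)[OF _ that] by simp
 have Pz: "P i x = 0" if "norm x < \<rho>'" for x
 unfolding P_def by (rule conv_zero[of _ r]) (use ballz[OF that] Fz moll_props(4)[OF r(1)] in auto)
 have GUz: "grad (U i) x = 0" if "norm x < \<rho>'" for x
 proof -
 have dz: "(%h. grad (U i) x \<bullet> h) = (%h. 0)"
 by (rule deriv_zero_open[OF C2_onD(1)[OF CU] open_ball[of 0 "\<rho>'"]]) (use that Uz in auto)
 show ?thesis using fun_cong[OF dz, of "grad (U i) x"] by simp
 qed
 let ?w = "%x. \<zeta> x * U i x"
 let ?A = "%x h. (H x \<bullet> h) *\<^sub>R grad (U i) x + \<zeta> x *\<^sub>R AU x h + ((grad (U i) x \<bullet> h) *\<^sub>R H x + U i x *\<^sub>R B x h)"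
 have Cw': "C2_on UNIV ?w (%x. \<zeta> x *\<^sub>R grad (U i) x + U i x *\<^sub>R H x) ?A" by (rule C2_mult[OF \<zeta>C CU])
 then have Cw: "C2_on (- {0}) ?w (%x. \<zeta> x *\<^sub>R grad (U i) x + U i x *\<^sub>R H x) ?A"
 by (rule C2_on_subset) simp
 have LA: "Lap ?A x = - (\<zeta> x * P i x) + 2 * (H x \<bullet> grad (U i) x) + U i x * Lap B x" for x
 unfolding Lap_mult LU by simp
 have car: "(s / L)^2 * (LBINT x. m s x * (?w x)^2) <= (LBINT x. m s x * ((x \<bullet> x) * Lap ?A x)^2)"
 unfolding m_def L_def n_def by (rule Carleman[OF Cw R(1,7) _ _ s N]) (use Uz \<zeta>0 in auto)
 have eqW: "m s x * (?w x)^2 = W s x * (U i x)^2" for x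
 using Uz[of x] by (cases "norm x < \<rho>'") (auto simp: W_def power_mult_distrib not_less)
 define V where "V x = indicator (cball 0 R2) x * (4 * Z\<^sup>2 * (norm (grad (U i) x))^2 + Z\<^sup>2 * (U i x)^2)" for x
 have pw: "m s x * ((x \<bullet> x) * Lap ?A x)^2 <= T * (W s x * (P i x)^2 + e s * V x)" for x
 proof -
 have V0: "V x >= 0" "e s >= 0" "W s x >= 0" using Wb[OF s] by (auto simp: V_def e_def indicator_def)
 consider "norm x < \<rho>'" | "norm x > R2" | "\<rho>' <= norm x" "norm x <= R2" by linarith
 then show ?thesis
 proof cases
 case 3
 have xx: "((x \<bullet> x))^2 <= (R2\<^sup>2)^2"
 unfolding power2_norm_eq_inner[symmetric] using 3(2) by (intro power_mono) auto
 define c d where "c = (H x \<bullet> grad (U i) x)" and "d = U i x * Lap B x"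
 have L2: "(Lap ?A x)^2 <= 3 * ((\<zeta> x)^2 * (P i x)^2 + 4 * c\<^sup>2 + d\<^sup>2)"
 unfolding LA using sq_sum3[of "- (\<zeta> x * P i x)" "2 * c" d] by (simp add: c_def d_def power_mult_distrib)
 \<comment> \<open>The derivatives of the cutoff vanish for |x| < R1; from there on the weight is at
   most \<open>e s\<close>.\<close>
 have cd: "m s x * (4 * c\<^sup>2 + d\<^sup>2) <= e s * V x"
 proof (cases "norm x < R1")
 case True
 then show ?thesis using \<zeta>1[OF True] V0 by (simp add: c_def d_def)
 next
 case False
 have "c\<^sup>2 <= (Z * norm (grad (U i) x))^2"
 proof (subst abs_le_square_iff[symmetric])
 have "\<bar>c\<bar> <= norm (H x) * norm (grad (U i) x)" unfolding c_def by (rule Cauchy_Schwarz_ineq2)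
 also have "\<dots> <= Z * norm (grad (U i) x)" using Z[of x] by (intro mult_right_mono) auto
 finally show "\<bar>c\<bar> <= \<bar>Z * norm (grad (U i) x)\<bar>" using Z0 by simp
 qed
 moreover have "d\<^sup>2 <= (U i x * Z)^2"
 using Z[of x] Z0 by (subst abs_le_square_iff[symmetric]) (auto simp: d_def abs_mult intro: mult_left_mono)
 ultimately have "4 * c\<^sup>2 + d\<^sup>2 <= V x" using 3(2) by (simp add: V_def power_mult_distrib mult_ac)
 then show ?thesis using mle[of R1 x s] R(6) False s mm(1)[of s x] V0
 unfolding e_def by (intro mult_mono) auto
 qed
 have "m s x * ((x \<bullet> x) * Lap ?A x)^2 = (x \<bullet> x)^2 * (m s x * (Lap ?A x)^2)" by (simp add: power_mult_distrib mult_ac)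
 also have "\<dots> <= (R2\<^sup>2)^2 * (m s x * (3 * ((\<zeta> x)^2 * (P i x)^2 + 4 * c\<^sup>2 + d\<^sup>2)))"
 using xx L2 mm(1)[of s x] by (intro mult_mono mult_left_mono) auto
 also have "\<dots> = T * (W s x * (P i x)^2 + m s x * (4 * c\<^sup>2 + d\<^sup>2))"
 using 3(1) by (simp add: T_def W_def algebra_simps)
 also have "\<dots> <= T * (W s x * (P i x)^2 + e s * V x)" using cd T by (intro mult_left_mono add_left_mono) auto
 finally show ?thesis .
 qed (use T V0 Uz[of x] Pz[of x] GUz[of x] \<zeta>0[of x] in \<open>simp_all add: LA\<close>)
 qed
 have Vi: "integrable lborel V" "(LBINT x. V x) <= K i"
 proof -
 have [measurable]: "U i \<in> BM" "grad (U i) \<in> BM"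
 using cc[OF i] by (auto intro: borel_measurable_continuous_onI)
 have g1: "integrable lborel (%x. (norm (grad (U i) x))^2)" "(LBINT x. (norm (grad (U i) x))^2) <= \<Gamma> i"
 proof -
 have gl: "locint (%x. g i x \<bullet> b)" for b by (rule Dlim_locint(2)[OF D[OF i] N])
 \<comment> \<open>The weak derivative of \<open>u i\<close> is tested with the reflected mollifier
   y -> moll r (x - y): mollifying commutes with differentiating.\<close>
 have eqg: "grad (U i) x \<bullet> b = conv (moll r) (%x. g i x \<bullet> b) x" for x b
 proof -
 have t: "(%y. moll r (x - y)) \<in> test_functions UNIV"
 using test_functions_affine[OF mt, of uminus uminus x UNIV] by (simp add: linear_uminus)
 have gr: "grad (%y. moll r (x - y)) y \<bullet> b = - (grad (moll r) (x - y) \<bullet> b)" for y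
 proof -
 have "((%y. moll r (x - y)) has_derivative (%h. grad (moll r) (x - y) \<bullet> (- h))) (at y)"
 by (rule has_derivative_compose[OF _ smooth_has_grad[OF test_functionsD(1)[OF mt]]]) (auto intro!: derivative_eq_intros)
 from has_derivative_unique[OF smooth_has_grad[OF test_functionsD(1)[OF t]] this] show ?thesis by (metis inner_minus_right)
 qed
 have "grad (U i) x \<bullet> b = conv (%z. grad (moll r) z \<bullet> b) (u i) x"
 unfolding U_def by (rule conv_C2(3)[OF ul[OF i] mt C0])
 also have "\<dots> = - (LBINT y. u i y * (grad (%y. moll r (x - y)) y \<bullet> b))"
 unfolding conv_def gr by (simp add: mult.commute)
 also have "\<dots> = (LBINT y. (g i y \<bullet> b) * moll r (x - y))"
 using Dlim_weak_derivative(1)[OF D[OF i] N t, of b] by simp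
 finally show ?thesis by (simp add: conv_def mult.commute)
 qed
 have "(NN x. ennreal ((norm (grad (U i) x))^2)) = (NN x. (\<Sum>b\<in>Basis. ennreal ((grad (U i) x \<bullet> b)^2)))"
 unfolding norm_sq_sum ..
 also have "\<dots> = (\<Sum>b\<in>Basis. (NN x. ennreal ((conv (moll r) (%x. g i x \<bullet> b) x)^2)))"
 unfolding eqg[symmetric] by (rule nn_integral_sum) measurable
 also have "\<dots> <= (\<Sum>b\<in>Basis. (NN x. ennreal ((g i x \<bullet> b)^2)))"
 by (intro sum_mono conv_contraction gl) (auto simp: moll_props(2,3)[OF r(1)])
 also have "\<dots> = (NN x. (\<Sum>b\<in>Basis. ennreal ((g i x \<bullet> b)^2)))"
 by (rule nn_integral_sum[symmetric]) (use um(2)[OF i] in measurable)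
 also have "\<dots> = N2 (g i)" unfolding N2_def
 unfolding norm_sq_sum ..
 finally have nn: "(NN x. ennreal ((norm (grad (U i) x))^2)) <= ennreal (\<Gamma> i)"
 using Dlim_finite(2)[OF D[OF i] q] by (simp add: \<Gamma>_def)
 show "integrable lborel (%x. (norm (grad (U i) x))^2)" "(LBINT x. (norm (grad (U i) x))^2) <= \<Gamma> i"
 by (rule nn_to_int[OF _ _ nn \<Gamma>0]; simp)+
 qed
 have i1: "integrable lborel (%x. indicator (cball 0 R2) x * (norm (grad (U i) x))^2)"
 by (rule integrable_dom[OF g1(1)]) (auto simp: indicator_def)
 have b1: "(LBINT x. indicator (cball 0 R2) x * (norm (grad (U i) x))^2) <= \<Gamma> i"
 by (rule order_trans[OF integral_mono[OF i1 g1(1)] g1(2)]) (auto simp: indicator_def)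
 have loc: "integrable lborel (%x. indicator (cball 0 R2) x * (U i x)^2)" "integrable lborel (%x. indicator (cball 0 R2) x * (u i x)^2)"
 using sl[OF cc(1)[OF i]] us[OF i] by (auto simp: locint_def)
 have [measurable]: "u i \<in> BM" by (rule um(1)[OF i])
 have d: "integrable lborel (%x. indicator (cball 0 R2) x * (U i x - u i x)^2)"
 "(LBINT x. indicator (cball 0 R2) x * (U i x - u i x)^2) <= 1 * (6 * \<Gamma> i * r\<^sup>2)"
 by (rule wint_le[OF _ _ _ err(1)[OF i]]; use \<Gamma>0 in \<open>auto simp: indicator_def\<close>)+
 have "r\<^sup>2 <= 1" using r by (simp add: power_le_one)
 then have "6 * \<Gamma> i * r\<^sup>2 <= 6 * \<Gamma> i" using \<Gamma>0[of i] by (simp add: mult_left_le)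
 then have b2: "(LBINT x. indicator (cball 0 R2) x * (U i x)^2) <= 2 * \<beta> i + 12 * \<Gamma> i"
 using wint_triangle[OF _ loc d(1)] d(2) by (simp add: \<beta>_def)
 have Veq: "V = (%x. 4 * Z\<^sup>2 * (indicator (cball 0 R2) x * (norm (grad (U i) x))^2) + Z\<^sup>2 * (indicator (cball 0 R2) x * (U i x)^2))"
 by (auto simp: V_def algebra_simps)
 show "integrable lborel V" unfolding Veq using i1 loc by simp
 show "(LBINT x. V x) <= K i" unfolding Veq K_def
 using i1 loc b1 b2 by (simp add: add_mono mult_left_mono)
 qed
 have WP: "integrable lborel (%x. W s x * (P i x)^2)" by (rule Wi[OF s sl[OF cc(2)[OF i]]])
 have li: "integrable lborel (%x. m s x * ((x \<bullet> x) * Lap ?A x)^2)"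
 proof (rule annulus_integrable[OF _ R(1), where R = R2])
 show "continuous_on (- {0}) (%x. m s x * ((x \<bullet> x) * Lap ?A x)^2)"
 unfolding m_def by (intro continuous_intros powr_radial_continuous Lap_continuous[OF Cw])
 qed (use Uz Pz GUz \<zeta>0 in \<open>simp_all add: LA\<close>)
 have "(s / L)^2 * (LBINT x. W s x * (U i x)^2) <= (LBINT x. m s x * ((x \<bullet> x) * Lap ?A x)^2)"
 using car by (simp only: eqW)
 also have "\<dots> <= (LBINT x. T * (W s x * (P i x)^2 + e s * V x))"
 by (rule integral_mono[OF li _ pw]) (use WP Vi in auto)
 also have "\<dots> = T * ((LBINT x. W s x * (P i x)^2) + e s * (LBINT x. V x))" using WP Vi by simp
 also have "\<dots> <= T * ((LBINT x. W s x * (P i x)^2) + e s * K i)"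
 using Vi T by (intro mult_left_mono add_left_mono) (auto simp: e_def)
 finally show ?thesis .
 qed
 have Q2: "(LBINT x. W s x * (u i x)^2) <= 2 * (LBINT x. W s x * (U i x)^2) + 12 * w0 * \<Gamma> i * r\<^sup>2"
 and Q3: "(LBINT x. W s x * (a i x)^2) <= 2 * (LBINT x. W s x * (u i x)^2) + 12 * w0 * \<Gamma> i * r\<^sup>2" if i: "i \<in> I" for i
 proof -
 have [measurable]: "u i \<in> BM" "U i \<in> BM" "a i \<in> BM"
 using um(1)[OF i] cc[OF i] by (auto intro: borel_measurable_continuous_onI)
 have d: "integrable lborel (%x. W s x * (U i x - u i x)^2)" "(LBINT x. W s x * (U i x - u i x)^2) <= w0 * (6 * \<Gamma> i * r\<^sup>2)"
 unfolding w0_def by (rule wint_le[OF Wb[OF s] _ _ err(1)[OF i]]; use \<Gamma>0 in simp)+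
 have d': "integrable lborel (%x. W s x * (a i x - \<bar>u i x\<bar>)^2)" "(LBINT x. W s x * (a i x - \<bar>u i x\<bar>)^2) <= w0 * (6 * \<Gamma> i * r\<^sup>2)"
 unfolding w0_def by (rule wint_le[OF Wb[OF s] _ _ err(2)[OF i]]; use \<Gamma>0 in simp)+
 note i1 = Wi[OF s us[OF i]] Wi[OF s sl[OF cc(1)[OF i]]] Wi[OF s sl[OF cc(3)[OF i]]]
 have W0: "0 <= W s x" for x using Wb[OF s] by blast
 show "(LBINT x. W s x * (u i x)^2) <= 2 * (LBINT x. W s x * (U i x)^2) + 12 * w0 * \<Gamma> i * r\<^sup>2"
 using wint_triangle[of "W s" "u i" "U i"] W0 i1 d by (simp add: power2_commute[of "u i _"])
 show "(LBINT x. W s x * (a i x)^2) <= 2 * (LBINT x. W s x * (u i x)^2) + 12 * w0 * \<Gamma> i * r\<^sup>2"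
 using wint_triangle[of "W s" "a i" "%x. \<bar>u i x\<bar>"] W0 i1 d' by simp
 qed
 have Q4: "(LBINT x. W s x * (P i x)^2) <= M\<^sup>2 * real (card I) * (\<Sum>j\<in>I. (LBINT x. W s x * (a j x)^2))" if i: "i \<in> I" for i
 proof -
 have ia: "integrable lborel (%x. W s x * (a j x)^2)" if "j \<in> I" for j by (rule Wi[OF s sl[OF cc(3)[OF that]]])
 have pa: "\<bar>P i x\<bar> <= M * (\<Sum>j\<in>I. a j x)" for x
 proof -
 have ij: "integrable lborel (%y. moll r (x - y) * \<bar>u j y\<bar>)" if "j \<in> I" for j by (rule conv_integrable_test(1)[OF al[OF that] mt])
 have eq: "moll r (x - y) * (M * (\<Sum>j\<in>I. \<bar>u j y\<bar>)) = M * (\<Sum>j\<in>I. moll r (x - y) * \<bar>u j y\<bar>)" for y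
 by (simp add: sum_distrib_left mult_ac)
 have "\<bar>P i x\<bar> <= (LBINT y. norm (moll r (x - y) * F i y))"
 unfolding P_def conv_def using integral_norm_bound[of lborel "%y. moll r (x - y) * F i y"] by simp
 also have "\<dots> <= (LBINT y. moll r (x - y) * (M * (\<Sum>j\<in>I. \<bar>u j y\<bar>)))"
 proof (rule integral_mono)
 show "integrable lborel (%y. norm (moll r (x - y) * F i y))"
 by (rule integrable_norm[OF conv_integrable_test(1)[OF Fl[OF i] mt]])
 show "integrable lborel (%y. moll r (x - y) * (M * (\<Sum>j\<in>I. \<bar>u j y\<bar>)))" unfolding eq using ij by simp
 show "norm (moll r (x - y) * F i y) <= moll r (x - y) * (M * (\<Sum>j\<in>I. \<bar>u j y\<bar>))" for y
 using Fb[OF i, of y] moll_props(2)[OF r(1), of "x - y"] by (simp add: abs_mult mult_left_mono)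
 qed
 also have "\<dots> = M * (\<Sum>j\<in>I. a j x)" unfolding eq a_def conv_def using ij by simp
 finally show ?thesis .
 qed
 have "(P i x)^2 <= M\<^sup>2 * real (card I) * (\<Sum>j\<in>I. (a j x)^2)" for x
 proof -
 have "(P i x)^2 <= (M * (\<Sum>j\<in>I. a j x))^2" using pa[of x] by (subst abs_le_square_iff[symmetric]) simp
 also have "\<dots> <= M\<^sup>2 * (real (card I) * (\<Sum>j\<in>I. (a j x)^2))"
 using Cauchy_Schwarz_ineq_sum[of "%_. 1" "%j. a j x" I] by (simp add: power_mult_distrib mult_left_mono)
 finally show ?thesis by (simp add: mult.assoc)
 qed
 from mult_left_mono[OF this, of "W s _"] have pt: "W s x * (P i x)^2 <= M\<^sup>2 * real (card I) * (\<Sum>j\<in>I. W s x * (a j x)^2)" for x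
 using Wb[OF s, of x] by (simp add: sum_distrib_left mult_ac)
 show ?thesis
 by (rule order_trans[OF integral_mono[OF Wi[OF s sl[OF cc(2)[OF i]]] _ pt]]) (use ia in auto)
 qed
 define E where "E = 12 * w0 * (\<Sum>i\<in>I. \<Gamma> i) * r\<^sup>2"
 have S2: "Y s <= 2 * (\<Sum>i\<in>I. (LBINT x. W s x * (U i x)^2)) + E"
 using sum_mono[of I, OF Q2] by (simp add: Y_def E_def sum.distrib sum_distrib_left sum_distrib_right)
 have S3: "(\<Sum>i\<in>I. (LBINT x. W s x * (a i x)^2)) <= 2 * Y s + E"
 using sum_mono[of I, OF Q3] by (simp add: Y_def E_def sum.distrib sum_distrib_left sum_distrib_right)
 have S4: "(\<Sum>i\<in>I. (LBINT x. W s x * (P i x)^2)) <= M\<^sup>2 * (real (card I))^2 * (\<Sum>j\<in>I. (LBINT x. W s x * (a j x)^2))"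
 proof -
 have "(\<Sum>i\<in>I. (LBINT x. W s x * (P i x)^2)) <= (\<Sum>i\<in>I. M\<^sup>2 * real (card I) * (\<Sum>j\<in>I. (LBINT x. W s x * (a j x)^2)))"
 by (intro sum_mono Q4)
 then show ?thesis by (simp add: power2_eq_square[of "real (card I)"] mult_ac)
 qed
 also have "\<dots> <= M\<^sup>2 * (real (card I))^2 * (2 * Y s + E)" by (rule mult_left_mono[OF S3]) simp
 finally have S5: "T * (\<Sum>i\<in>I. (LBINT x. W s x * (P i x)^2)) <= T * (M\<^sup>2 * (real (card I))^2 * (2 * Y s + E))"
 using T by (intro mult_left_mono) auto
 have S1: "(s / L)^2 * (\<Sum>i\<in>I. (LBINT x. W s x * (U i x)^2)) <= T * (\<Sum>i\<in>I. (LBINT x. W s x * (P i x)^2)) + T * (e s * (\<Sum>i\<in>I. K i))"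
 using sum_mono[of I, OF Q1] by (simp add: sum.distrib sum_distrib_left distrib_left)
 have "(s / L)^2 * Y s <= (s / L)^2 * (2 * (\<Sum>i\<in>I. (LBINT x. W s x * (U i x)^2)) + E)"
 by (rule mult_left_mono[OF S2]) simp
 also have "\<dots> = 2 * ((s / L)^2 * (\<Sum>i\<in>I. (LBINT x. W s x * (U i x)^2))) + (s / L)^2 * E" by (simp add: algebra_simps)
 also have "\<dots> <= 2 * (T * (M\<^sup>2 * (real (card I))^2 * (2 * Y s + E)) + T * (e s * (\<Sum>i\<in>I. K i))) + (s / L)^2 * E"
 by (intro add_right_mono mult_left_mono order_trans[OF S1 add_right_mono[OF S5]]) simp
 also have "\<dots> = c1 * Y s + c2 * e s + c3 * r\<^sup>2" unfolding c1_def c2_def c3_def E_def by algebra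
 finally show ?thesis .
 qed
 \<comment> \<open>\<open>bd\<close> holds for all small r with constants independent of r; the
   limit r -> 0 removes the error term.\<close>
 have L1: "((%r. c1 * Y s + c2 * e s + c3 * r\<^sup>2) \<longlongrightarrow> c1 * Y s + c2 * e s + c3 * 0\<^sup>2) (at_right 0)" by (intro tendsto_intros)
 have L2: "eventually (%r. (s / L)^2 * Y s <= c1 * Y s + c2 * e s + c3 * r\<^sup>2) (at_right 0)"
 using eventually_at_right_real[of 0 "min \<rho>' 1"] R(1) by (auto elim!: eventually_mono intro: bd)
 show ?thesis using tendsto_lowerbound[OF L1 L2 trivial_limit_at_right_real] by simp
 qed
 have u0: "(LBINT x. indicator (cball 0 R0) x * (u i x)^2) * (R0\<^sup>2) powr (- (n / 2) - s) <= Y s" if s: "s > 0" for s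
 proof -
 have us: "locint (%x. (u i x)^2)" if "i \<in> I" for i by (rule Dlim_square_locint[OF D[OF that] N])
 have "(LBINT x. indicator (cball 0 R0) x * (u i x)^2) * (R0\<^sup>2) powr (- (n / 2) - s)
 = (LBINT x. indicator (cball 0 R0) x * (u i x)^2 * (R0\<^sup>2) powr (- (n / 2) - s))" by simp
 also have "\<dots> <= (LBINT x. W s x * (u i x)^2)"
 proof (rule integral_mono[OF _ Wi[OF s us[OF i]]])
 show "integrable lborel (%x. indicator (cball 0 R0) x * (u i x)^2 * (R0\<^sup>2) powr (- (n / 2) - s))"
 using us[OF i] by (simp add: locint_def)
 fix x
 show "indicator (cball 0 R0) x * (u i x)^2 * (R0\<^sup>2) powr (- (n / 2) - s) <= W s x * (u i x)^2"
 proof (cases "norm x <= R0 \<and> \<rho>' <= norm x")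
 case True
 have "(R0\<^sup>2) powr (- (n / 2) - s) <= m s x"
 unfolding m_def power2_norm_eq_inner[symmetric]
 by (rule powr_mono2') (use True R(1) s in \<open>auto simp: n_def intro!: power_mono\<close>)
 from mult_right_mono[OF this, of "(u i x)^2"]
 have "(u i x)^2 * (R0\<^sup>2) powr (- (n / 2) - s) <= m s x * (u i x)^2" by (simp add: mult.commute)
 moreover have "W s x = m s x" using True \<zeta>1[of x] R(3) by (simp add: W_def)
 ultimately show ?thesis using True by simp
 next
 case False
 then show ?thesis using z(2)[OF i, of x] R(5) Wb[OF s, of x] by (cases "norm x <= R0") auto
 qed
 qed
 also have "\<dots> <= Y s" unfolding Y_def
 by (rule member_le_sum[OF i _ I]) (use Wb[OF s] in \<open>auto intro!: integral_nonneg_AE\<close>)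
 finally show ?thesis .
 qed
 define X where "X = (LBINT x. indicator (cball 0 R0) x * (u i x)^2)"
 have X0: "X >= 0" unfolding X_def by (rule integral_nonneg_AE) auto
 \<comment> \<open>For s \<ge> s0 one has s/L \<ge> c1 + 1 \<ge> 1, hence (s/L)^2 \<ge> c1 + 1, and
   the reaction terms are absorbed.\<close>
 define s0 where "s0 = L * (c1 + 1) + 1"
 have c10: "c1 >= 0" using T by (simp add: c1_def)
 have fin: "X <= c2 * (R0\<^sup>2 / R1\<^sup>2) powr (n / 2 + s)" if s: "s >= s0" for s
 proof -
 have "L * (c1 + 1) >= 0" using L c10 by simp
 then have sp: "s > 0" using s by (simp add: s0_def)
 have "c1 + 1 <= s / L" using s L by (simp add: s0_def le_divide_eq mult.commute)
 then have "(c1 + 1) * 1 <= (s / L) * (s / L)" using c10 by (intro mult_mono) auto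
 then have "c1 + 1 <= (s / L)^2" by (simp add: power2_eq_square)
 moreover have Y0: "Y s >= 0" unfolding Y_def using Wb[OF sp] by (intro sum_nonneg integral_nonneg_AE) auto
 ultimately have "(c1 + 1) * Y s <= (s / L)^2 * Y s" by (intro mult_right_mono)
 then have "Y s <= c2 * e s" using step[OF sp] by (simp add: algebra_simps)
 then have "X * (R0\<^sup>2) powr (- (n / 2) - s) <= c2 * e s" using u0[OF sp] by (simp add: X_def)
 then have "X * (R0\<^sup>2) powr (- (n / 2) - s) * (R0\<^sup>2) powr (n / 2 + s) <= c2 * e s * (R0\<^sup>2) powr (n / 2 + s)"
 by (rule mult_right_mono) simp
 moreover have "(R0\<^sup>2) powr (- (n / 2) - s) * (R0\<^sup>2) powr (n / 2 + s) = 1" using R0 by (simp flip: powr_add)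
 moreover have "e s * (R0\<^sup>2) powr (n / 2 + s) = (R0\<^sup>2 / R1\<^sup>2) powr (n / 2 + s)"
 proof -
 have "e s = 1 / (R1\<^sup>2) powr (n / 2 + s)" unfolding e_def by (simp add: powr_minus_divide[symmetric])
 then show ?thesis by (simp add: powr_divide)
 qed
 ultimately show ?thesis by (simp add: mult.assoc)
 qed
 have base: "0 < R0\<^sup>2 / R1\<^sup>2" "R0\<^sup>2 / R1\<^sup>2 < 1"
 using R0 R(3) by (auto simp: divide_less_eq intro!: power_strict_mono)
 have "((%s. c2 * (R0\<^sup>2 / R1\<^sup>2) powr (n / 2 + s)) \<longlongrightarrow> c2 * 0) at_top"
 proof (intro tendsto_mult tendsto_const)
 have "((%s. exp ((n / 2 + s) * ln (R0\<^sup>2 / R1\<^sup>2))) \<longlongrightarrow> 0) at_top"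
 proof (rule filterlim_compose[OF exp_at_bot])
 have "ln (R0\<^sup>2 / R1\<^sup>2) < 0" using base by (simp only: ln_less_zero)
 from filterlim_tendsto_neg_mult_at_bot[OF tendsto_const this filterlim_tendsto_add_at_top[OF tendsto_const filterlim_ident]]
 have "LIM s at_top. ln (R0\<^sup>2 / R1\<^sup>2) * (n / 2 + s) :> at_bot" .
 then show "filterlim (%s. (n / 2 + s) * ln (R0\<^sup>2 / R1\<^sup>2)) at_bot at_top" by (simp only: mult.commute)
 qed
 then show "((%s. (R0\<^sup>2 / R1\<^sup>2) powr (n / 2 + s)) \<longlongrightarrow> 0) at_top" using R0 R(6) by (simp add: powr_def)
 qed
 moreover have "eventually (%s. X <= c2 * (R0\<^sup>2 / R1\<^sup>2) powr (n / 2 + s)) at_top"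
 using eventually_ge_at_top[of s0] by (rule eventually_mono) (rule fin)
 ultimately have "X <= c2 * 0" by (rule tendsto_lowerbound) simp
 then have "X = 0" using X0 by linarith
 then show ?thesis by (simp add: X_def)
 qed
 show ?thesis
 proof
 fix i assume i: "i \<in> I"
 have "AE x in lborel. indicator (cball 0 (real (Suc k))) x * (u i x)^2 = 0" for k
 proof -
 have "integrable lborel (%x. indicator (cball 0 (real (Suc k))) x * (u i x)^2)"
 using Dlim_square_locint[OF D[OF i] N] unfolding locint_def by blast
 from integral_nonneg_eq_0_iff_AE[OF this] show ?thesis using main[OF i, of "real (Suc k)"] by simp
 qed
 then have "AE x in lborel. \<forall>k. indicator (cball 0 (real (Suc k))) x * (u i x)^2 = 0" by (simp only: AE_all_countable) simp
 then show "AE x in lborel. u i x = 0"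
 proof (rule eventually_mono)
 fix x assume a: "\<forall>k. indicator (cball 0 (real (Suc k))) x * (u i x)^2 = 0"
 obtain k where "norm x <= real k" using real_arch_simple by blast
 then show "u i x = 0" using a[rule_format, of k] by (simp add: indicator_def split: if_splits)
 qed
 qed
qed

section \<open>The Nehari set\<close>

text \<open>The Nehari equation of (t_1 u_1, ..., t_l u_l) divided by t_i^p, with \<kappa> =
  -\<beta>. After the division the other t_j enter the i-th equation only through increasing terms,
  which makes the system cooperative.\<close>

definition NF :: "'i set => real => real => ('i => real) => ('i => real) => ('i => 'i => real) => ('i => real) => 'i => real" where
 "NF I p \<kappa> a b d t i = a i * t i powr (2 - p) - b i * t i powr p + \<kappa> * (\<Sum>j\<in>I - {i}. d i j * t j powr p)"

text \<open>The system \<open>NF t = 0\<close> is cooperative. If it points inwards on the faces of the box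
 \<open>[1 - \<delta>, 1 + \<delta>]\<^sup>I\<close>, then the componentwise supremum of the points of the box where all \<open>NF \<ge> 0\<close> is a
 zero, and it inherits all symmetries of the coefficients.\<close>

lemma NF_zero:
 assumes I: "finite I" and p: "p > 1" and k: "\<kappa> >= 0" and d: "!!i j. d i j >= 0" and \<delta>: "0 < \<delta>" "\<delta> < 1"
 and up: "!!i. i \<in> I ==> a i * (1 + \<delta>) powr (2 - p) < (b i - \<kappa> * (\<Sum>j\<in>I - {i}. d i j)) * (1 + \<delta>) powr p"
 and lo: "!!i. i \<in> I ==> a i * (1 - \<delta>) powr (2 - p) > (b i - \<kappa> * (\<Sum>j\<in>I - {i}. d i j)) * (1 - \<delta>) powr p"
 shows "\<exists>t. (\<forall>i\<in>I. 1 - \<delta> <= t i \<and> t i <= 1 + \<delta> \<and> NF I p \<kappa> a b d t i = 0) \<and>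
 (\<forall>\<sigma>. bij_betw \<sigma> I I --> (\<forall>i\<in>I. a (\<sigma> i) = a i \<and> b (\<sigma> i) = b i \<and> (\<forall>j\<in>I. d (\<sigma> i) (\<sigma> j) = d i j)) -->
 (\<forall>i\<in>I. t (\<sigma> i) = t i))"
proof -
 define S where "S = {t. \<forall>i\<in>I. 1 - \<delta> <= t i \<and> t i <= 1 + \<delta> \<and> NF I p \<kappa> a b d t i >= 0}"
 define T where "T i = Sup ((%t. t i) ` S)" for i
 \<comment> \<open>\<open>NF\<close> as a function of the i-th variable alone, with the others
   frozen at the supremum \<open>T\<close>; by monotonicity it dominates \<open>NF\<close> on
   \<open>S\<close>.\<close>
 define \<phi> where "\<phi> i s = a i * s powr (2 - p) - b i * s powr p + \<kappa> * (\<Sum>j\<in>I - {i}. d i j * T j powr p)" for i s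
 have c: "(%_. 1 - \<delta>) \<in> S"
 using lo \<delta> by (auto simp: S_def NF_def sum_distrib_right[symmetric] algebra_simps less_imp_le)
 have bdd: "bdd_above ((%t. t i) ` S)" if "i \<in> I" for i
 by (rule bdd_aboveI[of _ "1 + \<delta>"]) (use that in \<open>auto simp: S_def\<close>)
 have TU: "t i <= T i" if "t \<in> S" "i \<in> I" for t i
 unfolding T_def by (rule cSUP_upper[OF that(1) bdd[OF that(2)]])
 have TL: "T i <= y" if "!!t. t \<in> S ==> t i <= y" for i y
 unfolding T_def by (rule cSUP_least) (use c that in auto)
 have Tb: "1 - \<delta> <= T i" "T i <= 1 + \<delta>" if "i \<in> I" for i
 using TU[OF c that] TL[of i "1 + \<delta>"] that by (auto simp: S_def)
 have mono: "(\<Sum>j\<in>I - {i}. d i j * t j powr p) <= (\<Sum>j\<in>I - {i}. d i j * t' j powr p)"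
 if "!!j. j \<in> I ==> 0 <= t j \<and> t j <= t' j" for t t' i
 using that p d by (intro sum_mono mult_left_mono powr_mono2) auto
 have \<phi>c: "isCont (\<phi> i) s" if "s > 0" for i s
 unfolding \<phi>_def using that by (intro continuous_intros) auto
 have \<phi>S: "\<phi> i (t i) >= 0" if "t \<in> S" "i \<in> I" for t i
 proof -
 have "NF I p \<kappa> a b d t i <= \<phi> i (t i)" unfolding NF_def \<phi>_def
 using that TU \<delta> k by (intro add_left_mono mult_left_mono mono) (auto simp: S_def intro: order_trans[of 0 "1 - \<delta>"])
 then show ?thesis using that by (auto simp: S_def)
 qed
 have ge: "NF I p \<kappa> a b d T i >= 0" if i: "i \<in> I" for i
 proof (rule ccontr)
 assume "\<not> NF I p \<kappa> a b d T i >= 0"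
 then have n: "\<phi> i (T i) < 0" by (simp add: NF_def \<phi>_def)
 have "T i > 0" using Tb[OF i] \<delta> by linarith
 then obtain e where e: "e > 0" "!!s. \<bar>s - T i\<bar> < e ==> \<phi> i s < 0"
 using order_tendstoD(2)[OF \<phi>c[of "T i" i, unfolded isCont_def] n] n
 unfolding eventually_at dist_real_def by (metis UNIV_I)
 have "\<exists>t\<in>S. T i - e < t i"
 using TL[of i "T i - e"] e(1) by (meson not_le diff_less_eq less_add_same_cancel1 linorder_not_less)
 then obtain t where t: "t \<in> S" "T i - e < t i" by blast
 have "\<phi> i (t i) < 0" by (rule e(2)) (use t(2) TU[OF t(1) i] e(1) in auto)
 then show False using \<phi>S[OF t(1) i] by simp
 qed
 \<comment> \<open>Otherwise the i-th coordinate of \<open>T\<close> could be raised a little: its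
   own function stays positive, the others only increase, and \<open>S\<close> would exceed its
   supremum. The upper face is excluded by \<open>up\<close>.\<close>
 have le: "NF I p \<kappa> a b d T i <= 0" if i: "i \<in> I" for i
 proof (rule ccontr)
 assume "\<not> NF I p \<kappa> a b d T i <= 0"
 then have n: "\<phi> i (T i) > 0" by (simp add: NF_def \<phi>_def)
 have Tp: "T i > 0" using Tb[OF i] \<delta> by linarith
 have "T i ~= 1 + \<delta>"
 proof
 assume eq: "T i = 1 + \<delta>"
 have "(\<Sum>j\<in>I - {i}. d i j * T j powr p) <= (\<Sum>j\<in>I - {i}. d i j * (1 + \<delta>) powr p)"
 proof (rule mono)
 fix j assume "j \<in> I"
 then show "0 <= T j \<and> T j <= 1 + \<delta>" using Tb[of j] \<delta> by auto
 qed
 then have "\<kappa> * (\<Sum>j\<in>I - {i}. d i j * T j powr p) <= \<kappa> * (\<Sum>j\<in>I - {i}. d i j) * (1 + \<delta>) powr p"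
 using k by (simp add: sum_distrib_right[symmetric] mult_left_mono mult.assoc)
 then have "\<phi> i (T i) < 0" using up[OF i] by (simp add: \<phi>_def eq algebra_simps)
 then show False using n by simp
 qed
 then have lt: "T i < 1 + \<delta>" using Tb[OF i] by simp
 obtain e where e: "e > 0" "!!s. \<bar>s - T i\<bar> < e ==> \<phi> i s > 0"
 using order_tendstoD(1)[OF \<phi>c[OF Tp, of i, unfolded isCont_def] n] n
 unfolding eventually_at dist_real_def by (metis UNIV_I)
 define s where "s = min (T i + e / 2) (1 + \<delta>)"
 have s: "T i < s" "s <= 1 + \<delta>" "\<phi> i s > 0"
 using lt e(1) by (auto simp: s_def min_def intro!: e(2))
 have "T(i := s) \<in> S"
 unfolding S_def
 proof (intro CollectI ballI conjI)
 fix j assume j: "j \<in> I"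
 show "1 - \<delta> <= (T(i := s)) j" "(T(i := s)) j <= 1 + \<delta>" using Tb[OF j] Tb[OF i] s by auto
 show "NF I p \<kappa> a b d (T(i := s)) j >= 0"
 proof (cases "j = i")
 case True
 then show ?thesis using s(3) by (simp add: NF_def \<phi>_def)
 next
 case False
 have "NF I p \<kappa> a b d T j <= NF I p \<kappa> a b d (T(i := s)) j"
 unfolding NF_def using False Tb \<delta> s k
 by (simp only: fun_upd_other[OF False]) (intro add_left_mono mult_left_mono mono, auto intro: order_trans[of 0 "1 - \<delta>"])
 then show ?thesis using ge[OF j] by simp
 qed
 qed
 then show False using TU[of "T(i := s)" i] i s(1) by simp
 qed
 \<comment> \<open>\<open>S\<close> is invariant under composition with \<sigma>, so the permuted
   supremum is at most \<open>T\<close> in every coordinate; both have the same sum over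
   \<open>I\<close>, which forces equality.\<close>
 have sym: "T (\<sigma> i) = T i" if \<sigma>: "bij_betw \<sigma> I I" and i: "i \<in> I"
 and inv: "\<forall>i\<in>I. a (\<sigma> i) = a i \<and> b (\<sigma> i) = b i \<and> (\<forall>j\<in>I. d (\<sigma> i) (\<sigma> j) = d i j)" for \<sigma> i
 proof -
 have m: "\<sigma> j \<in> I" if "j \<in> I" for j using \<sigma> that by (auto simp: bij_betw_def)
 have "t \<circ> \<sigma> \<in> S" if t: "t \<in> S" for t
 proof -
 have "NF I p \<kappa> a b d (t \<circ> \<sigma>) j = NF I p \<kappa> a b d t (\<sigma> j)" if j: "j \<in> I" for j
 proof -
 have "bij_betw \<sigma> (I - {j}) (I - {\<sigma> j})"
 using \<sigma> j by (auto simp: bij_betw_def inj_on_def)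
 from sum.reindex_bij_betw[OF this, of "%k. d (\<sigma> j) k * t k powr p"]
 have "(\<Sum>k\<in>I - {j}. d (\<sigma> j) (\<sigma> k) * t (\<sigma> k) powr p) = (\<Sum>k\<in>I - {\<sigma> j}. d (\<sigma> j) k * t k powr p)" .
 moreover have "(\<Sum>k\<in>I - {j}. d (\<sigma> j) (\<sigma> k) * t (\<sigma> k) powr p) = (\<Sum>k\<in>I - {j}. d j k * t (\<sigma> k) powr p)"
 by (rule sum.cong) (use inv j in auto)
 ultimately show ?thesis using inv j by (simp add: NF_def)
 qed
 then show ?thesis using t m by (auto simp: S_def)
 qed
 then have "T (\<sigma> j) <= T j" if "j \<in> I" for j using TL[of "\<sigma> j" "T j"] TU[of "_ \<circ> \<sigma>" j] that by fastforce
 moreover have "(\<Sum>j\<in>I. T (\<sigma> j)) = (\<Sum>j\<in>I. T j)" by (rule sum.reindex_bij_betw[OF \<sigma>])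
 ultimately show ?thesis using sum_mono_inv[of "%j. T (\<sigma> j)" I T i] i I by blast
 qed
 show ?thesis
 by (intro exI[of _ T] conjI ballI allI impI) (use Tb ge le sym in \<open>force intro: antisym\<close>)+
qed

text \<open>For the limit coefficients t = (1, ..., 1) is a zero, and the face conditions reduce to
  comparing s^(2-p) with s^p at s = 1 + \<delta> and s = 1 - \<delta>. These comparisons are strict,
  so they persist near the limit.\<close>

lemma NF_perturb:
 assumes I: "finite I" and p: "p > 1" and k: "\<kappa> >= 0" and \<delta>: "0 < \<delta>" "\<delta> < 1"
 and d: "!!i j k. d k i j >= 0"
 and lim: "!!i. i \<in> I ==> ((%k. a k i) \<longlongrightarrow> A i) F" "!!i. i \<in> I ==> ((%k. b k i) \<longlongrightarrow> B i) F"
 "!!i j. i \<in> I ==> j \<in> I ==> ((%k. d k i j) \<longlongrightarrow> D i j) F"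
 and N: "!!i. i \<in> I ==> A i > 0" "!!i. i \<in> I ==> B i - \<kappa> * (\<Sum>j\<in>I - {i}. D i j) = A i"
 shows "eventually (%k. \<exists>t. (\<forall>i\<in>I. 1 - \<delta> <= t i \<and> t i <= 1 + \<delta> \<and> NF I p \<kappa> (a k) (b k) (d k) t i = 0) \<and>
 (\<forall>\<sigma>. bij_betw \<sigma> I I --> (\<forall>i\<in>I. a k (\<sigma> i) = a k i \<and> b k (\<sigma> i) = b k i \<and> (\<forall>j\<in>I. d k (\<sigma> i) (\<sigma> j) = d k i j)) -->
 (\<forall>i\<in>I. t (\<sigma> i) = t i))) F"
proof -
 have lim2: "((%k. a k i * s powr (2 - p) - (b k i - \<kappa> * (\<Sum>j\<in>I - {i}. d k i j)) * s powr p) \<longlongrightarrow> A i * (s powr (2 - p) - s powr p)) F"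
 if i: "i \<in> I" for i s
 proof -
 have "((%k. a k i * s powr (2 - p) - (b k i - \<kappa> * (\<Sum>j\<in>I - {i}. d k i j)) * s powr p) \<longlongrightarrow>
 A i * s powr (2 - p) - (B i - \<kappa> * (\<Sum>j\<in>I - {i}. D i j)) * s powr p) F"
 using i by (intro tendsto_intros lim) auto
 then show ?thesis using N(2)[OF i] by (simp add: algebra_simps)
 qed
 have "eventually (%k. \<forall>i\<in>I. a k i * (1 + \<delta>) powr (2 - p) - (b k i - \<kappa> * (\<Sum>j\<in>I - {i}. d k i j)) * (1 + \<delta>) powr p < 0) F"
 proof (intro eventually_ball_finite[OF I] ballI order_tendstoD(2)[OF lim2])
 fix i assume "i \<in> I"
 moreover have "(1 + \<delta>) powr (2 - p) < (1 + \<delta>) powr p" using \<delta> p by (intro powr_less_mono) auto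
 ultimately show "A i * ((1 + \<delta>) powr (2 - p) - (1 + \<delta>) powr p) < 0" using N(1) by (simp add: mult_less_0_iff)
 qed
 moreover have "eventually (%k. \<forall>i\<in>I. a k i * (1 - \<delta>) powr (2 - p) - (b k i - \<kappa> * (\<Sum>j\<in>I - {i}. d k i j)) * (1 - \<delta>) powr p > 0) F"
 proof (intro eventually_ball_finite[OF I] ballI order_tendstoD(1)[OF lim2])
 fix i assume "i \<in> I"
 moreover have "(1 - \<delta>) powr p < (1 - \<delta>) powr (2 - p)" using \<delta> p by (intro powr_less_mono') auto
 ultimately show "A i * ((1 - \<delta>) powr (2 - p) - (1 - \<delta>) powr p) > 0" using N(1) by simp
 qed
 ultimately show ?thesis
 by eventually_elim (rule NF_zero[OF I p k d \<delta>], auto)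
qed

text \<open>Whole-space counterparts of \<open>grad_term\<close>, \<open>power_term\<close> and
  \<open>coupling_term\<close>, for functions extended by zero and with an explicit gradient in
  place of the chosen \<open>D12_grad\<close>.\<close>

definition aa :: "('i => real^'n => real^'n) => 'i => real" where
 "aa Gr i = (LBINT x. (norm (Gr i x))^2)"
definition bb :: "('i => real^'n => real) => 'i => real" where
 "bb U i = (LBINT x. \<bar>U i x\<bar> powr crit_exp CARD('n))"
definition dd :: "('i => real^'n => real) => 'i => 'i => real" where
 "dd U i j = (LBINT x. \<bar>U i x\<bar> powr (crit_exp CARD('n) / 2) * \<bar>U j x\<bar> powr (crit_exp CARD('n) / 2))"

text \<open>Borel representatives of an element of \<open>H_space\<close>, with their gradients.
  Equivariance is required on the whole space, which extension by zero grants when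
  \<open>\<Omega>\<close> is invariant.\<close>

definition adm :: "(real^'n^'n) set => (real^'n^'n => nat => nat) => nat => (real^'n) set =>
 (nat => real^'n => real) => (nat => real^'n => real^'n) => bool" where
 "adm G \<phi> l \<Omega> U Gr \<longleftrightarrow> (\<forall>i\<in>{1..l}. Dlim \<Omega> (U i) (Gr i)) \<and>
 (\<forall>g\<in>G. AE x in lborel. \<forall>i\<in>{1..l}. U i (g *v x) = U (\<phi> g i) x)"

section \<open>The Nehari set in terms of whole-space integrals\<close>

lemma lint_lebesgue_on:
 fixes f f' :: "real^'n => real"
 assumes \<Omega>: "open \<Omega>" and f: "f \<in> borel_measurable (lebesgue_on \<Omega>)" and f': "f' \<in> BM"
 and AE: "AE x in lborel. x \<in> \<Omega> --> f x = f' x" and z: "AE x in lborel. x \<notin> \<Omega> --> f' x = 0"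
 shows "(LINT x|lebesgue_on \<Omega>. f x) = (LINT x|lborel. f' x)"
proof -
 have "(LINT x|lebesgue_on \<Omega>. f x) = (LINT x|lebesgue. indicator \<Omega> x *\<^sub>R f x)"
 using \<Omega> by (intro integral_restrict_space) auto
 also have "\<dots> = (LINT x|lebesgue. f' x)"
 proof (rule integral_cong_AE)
 show "(%x. indicator \<Omega> x *\<^sub>R f x) \<in> borel_measurable lebesgue"
 using f \<Omega> by (subst (asm) borel_measurable_restrict_space_iff) auto
 show "f' \<in> borel_measurable lebesgue" using f' by (intro measurable_completion) simp
 have "AE x in lborel. indicator \<Omega> x *\<^sub>R f x = f' x" using AE z by eventually_elim (auto simp: indicator_def)
 then show "AE x in lebesgue. indicator \<Omega> x *\<^sub>R f x = f' x" by (rule AE_completion)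
 qed
 also have "\<dots> = (LINT x|lborel. f' x)" using f' by (intro integral_completion) simp
 finally show ?thesis .
qed

text \<open>Off \<open>\<Omega>\<close> the approximants vanish, so there the error integrals are
  those of u and g themselves.\<close>

lemma Dlim_off:
 fixes u :: "real^'n => real"
 assumes \<Omega>: "open \<Omega>" and D: "Dlim \<Omega> u g" and N: "CARD('n) >= 3"
 shows "AE x in lborel. x \<notin> \<Omega> --> u x = 0" "AE x in lborel. x \<notin> \<Omega> --> g x = 0"
proof -
 have q: "crit_exp CARD('n) > 0" using crit_exp_gt[OF N] by simp
 obtain f where f: "!!k. f k \<in> test_functions \<Omega>" "(%k. Nq (%x. f k x - u x)) ~> 0"
 "(%k. N2 (%x. grad (f k) x - g x)) ~> 0"
 using D by (rule DlimE) auto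
 note [measurable] = Dlim_measurable[OF D]
 have [measurable]: "\<Omega> \<in> sets borel" using \<Omega> by simp
 have off: "f k x = 0" "grad (f k) x = 0" if "x \<notin> \<Omega>" for k x
 using zero_notin_closure_grad[of x "f k"] test_functionsD(3)[OF f(1)[of k]] that by auto
 have "(NN x. indicator (- \<Omega>) x * ennreal (\<bar>u x\<bar> powr crit_exp CARD('n))) <= Nq (%x. f k x - u x)" for k
 unfolding Nq_def using off by (intro nn_integral_mono) (auto simp: indicator_def)
 then have "(NN x. indicator (- \<Omega>) x * ennreal (\<bar>u x\<bar> powr crit_exp CARD('n))) <= 0"
 by (intro LIMSEQ_le_const[OF f(2)]) auto
 then have "AE x in lborel. indicator (- \<Omega>) x * ennreal (\<bar>u x\<bar> powr crit_exp CARD('n)) = 0"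
 by (subst nn_integral_0_iff_AE[symmetric]) auto
 then show "AE x in lborel. x \<notin> \<Omega> --> u x = 0" by (rule eventually_mono) (auto simp: indicator_def split: if_splits)
 have "(NN x. indicator (- \<Omega>) x * ennreal ((norm (g x))^2)) <= N2 (%x. grad (f k) x - g x)" for k
 unfolding N2_def using off by (intro nn_integral_mono) (auto simp: indicator_def)
 then have "(NN x. indicator (- \<Omega>) x * ennreal ((norm (g x))^2)) <= 0"
 by (intro LIMSEQ_le_const[OF f(3)]) auto
 then have "AE x in lborel. indicator (- \<Omega>) x * ennreal ((norm (g x))^2) = 0"
 by (subst nn_integral_0_iff_AE[symmetric]) auto
 then show "AE x in lborel. x \<notin> \<Omega> --> g x = 0" by (rule eventually_mono) (auto simp: indicator_def split: if_splits)
qed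

lemma terms_bridge:
 fixes u :: "real^'n => nat => real"
 assumes \<Omega>: "open \<Omega>" and N: "CARD('n) >= 3"
 and D: "!!i. i \<in> {1..l} ==> Dlim \<Omega> (U i) (Gr i)"
 and um: "!!i. i \<in> {1..l} ==> (%x. u x i) \<in> borel_measurable (lebesgue_on \<Omega>)"
 and uU: "!!i. i \<in> {1..l} ==> AE x in lborel. x \<in> \<Omega> --> u x i = U i x"
 and uD: "!!i. i \<in> {1..l} ==> (%x. u x i) \<in> D12_0 \<Omega>"
 and i: "i \<in> {1..l}"
 shows "grad_term \<Omega> u i = aa Gr i" "power_term \<Omega> u i = bb U i" "j \<in> {1..l} ==> coupling_term \<Omega> u i j = dd U i j"
 "(AE x in lebesgue_on \<Omega>. u x i = 0) \<longleftrightarrow> (AE x in lborel. U i x = 0)"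
proof -
 have q: "crit_exp CARD('n) > 0" using crit_exp_gt[OF N] by simp
 have Um: "U k \<in> BM" "Gr k \<in> BM" if "k \<in> {1..l}" for k
 using Dlim_measurable[OF D[OF that]] by auto
 have off: "AE x in lborel. x \<notin> \<Omega> --> U k x = 0" if "k \<in> {1..l}" for k by (rule Dlim_off(1)[OF \<Omega> D[OF that] N])
 note m [measurable] = um[OF i] Um[OF i]
 show "power_term \<Omega> u i = bb U i" unfolding power_term_def bb_def
 proof (rule lint_lebesgue_on[OF \<Omega>])
 show "AE x in lborel. x \<in> \<Omega> --> \<bar>u x i\<bar> powr crit_exp CARD('n) = \<bar>U i x\<bar> powr crit_exp CARD('n)"
 using uU[OF i] by eventually_elim auto
 show "AE x in lborel. x \<notin> \<Omega> --> \<bar>U i x\<bar> powr crit_exp CARD('n) = 0" using off[OF i] by eventually_elim auto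
 qed measurable
 show "coupling_term \<Omega> u i j = dd U i j" if j: "j \<in> {1..l}" unfolding coupling_term_def dd_def
 proof (rule lint_lebesgue_on[OF \<Omega>])
 note [measurable] = um[OF j] Um[OF j]
 show "(%x. \<bar>u x i\<bar> powr (crit_exp CARD('n) / 2) * \<bar>u x j\<bar> powr (crit_exp CARD('n) / 2)) \<in> borel_measurable (lebesgue_on \<Omega>)"
 "(%x. \<bar>U i x\<bar> powr (crit_exp CARD('n) / 2) * \<bar>U j x\<bar> powr (crit_exp CARD('n) / 2)) \<in> BM" by measurable
 show "AE x in lborel. x \<in> \<Omega> --> \<bar>u x i\<bar> powr (crit_exp CARD('n) / 2) * \<bar>u x j\<bar> powr (crit_exp CARD('n) / 2)
 = \<bar>U i x\<bar> powr (crit_exp CARD('n) / 2) * \<bar>U j x\<bar> powr (crit_exp CARD('n) / 2)"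
 using uU[OF i] uU[OF j] by eventually_elim auto
 show "AE x in lborel. x \<notin> \<Omega> --> \<bar>U i x\<bar> powr (crit_exp CARD('n) / 2) * \<bar>U j x\<bar> powr (crit_exp CARD('n) / 2) = 0"
 using off[OF i] by eventually_elim auto
 qed
 show "grad_term \<Omega> u i = aa Gr i"
 proof -
 define g where "g = D12_grad \<Omega> (%y. u y i)"
 have gl: "D12_limit \<Omega> (%y. u y i) g"
 unfolding g_def D12_grad_def using uD[OF i] unfolding D12_0_def mem_Collect_eq by (rule someI_ex)
 obtain u' g' where u': "Dlim \<Omega> u' g'" "AE x in lborel. x \<in> \<Omega> --> u x i = u' x" "AE x in lborel. x \<in> \<Omega> --> g x = g' x"
 "!!x. x \<notin> \<Omega> ==> u' x = 0 \<and> g' x = 0"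
 using D12_limit_Dlim[OF \<Omega> gl N] by blast
 \<comment> \<open>\<open>D12_grad\<close> is an arbitrary choice, but by \<open>Dlim_unique\<close>
   it agrees with \<open>Gr i\<close> almost everywhere.\<close>
 have "AE x in lborel. u' x = U i x" using u'(2) uU[OF i] off[OF i] by eventually_elim (use u'(4) in force)
 from Dlim_unique[OF u'(1) D[OF i] this N] have gg: "AE x in lborel. g' x = Gr i x" .
 have [measurable]: "g \<in> borel_measurable (lebesgue_on \<Omega>)" using gl by (simp add: D12_limit_def)
 have "(LINT x|lebesgue_on \<Omega>. (norm (g x))\<^sup>2) = (LINT x|lborel. (norm (Gr i x))^2)"
 proof (rule lint_lebesgue_on[OF \<Omega>])
 show "AE x in lborel. x \<in> \<Omega> --> (norm (g x))\<^sup>2 = (norm (Gr i x))^2" using u'(3) gg by eventually_elim auto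
 show "AE x in lborel. x \<notin> \<Omega> --> (norm (Gr i x))\<^sup>2 = 0" using gg by eventually_elim (use u'(4) in force)
 qed measurable
 then show ?thesis by (simp add: grad_term_def aa_def g_def)
 qed
 show "(AE x in lebesgue_on \<Omega>. u x i = 0) \<longleftrightarrow> (AE x in lborel. U i x = 0)"
 unfolding AE_lebesgue_on[OF \<Omega>]
 proof
 assume "AE x in lborel. x \<in> \<Omega> --> u x i = 0"
 with off[OF i] uU[OF i] show "AE x in lborel. U i x = 0" by eventually_elim auto
 next
 assume "AE x in lborel. U i x = 0"
 with uU[OF i] show "AE x in lborel. x \<in> \<Omega> --> u x i = 0" by eventually_elim auto
 qed
qed

text \<open>J as a function of its three families of integrals. It is linear in them, so a
  difference quotient of J is the same expression in the difference quotients of the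
  integrals.\<close>

definition Jc :: "nat => real => real => (nat => real) => (nat => real) => (nat => nat => real) => real" where
 "Jc l \<beta> q a b d = 1 / 2 * (\<Sum>i\<in>{1..l}. a i) - 1 / q * (\<Sum>i\<in>{1..l}. b i)
 - \<beta> / q * (\<Sum>i\<in>{1..l}. \<Sum>j\<in>{1..l} - {i}. d i j)"

definition orth_closed :: "(real^'n^'n) set => bool" where
 "orth_closed G \<longleftrightarrow> (\<forall>g\<in>G. orthogonal_matrix g \<and> transpose g \<in> G)"

lemma orthD: "orth_closed G ==> g \<in> G ==> orthogonal_matrix g" by (simp add: orth_closed_def)

lemma transpose_cancel: "orthogonal_matrix g ==> transpose g *v (g *v x) = (x::real^'n)"
 unfolding matrix_vector_mul_assoc by (simp add: orthogonal_matrix_def)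

definition perms :: "(real^'n^'n) set => (real^'n^'n => nat => nat) => nat => bool" where
 "perms G \<phi> l \<longleftrightarrow> (\<forall>g\<in>G. bij_betw (\<phi> g) {1..l} {1..l})"

lemma permsD: "perms G \<phi> l ==> g \<in> G ==> i \<in> {1..l} ==> \<phi> g i \<in> {1..l}"
 unfolding perms_def bij_betw_def by blast

lemma H_space_adm:
 fixes u :: "real^'n => nat => real"
 assumes \<Omega>: "open \<Omega>" and N: "CARD('n) >= 3" and inv: "G_invariant G \<Omega>" and G: "orth_closed G" and P: "perms G \<phi> l"
 and u: "u \<in> H_space G \<phi> l \<Omega>"
 shows "\<exists>U Gr. adm G \<phi> l \<Omega> U Gr \<and> (\<forall>i\<in>{1..l}. \<forall>x. x \<notin> \<Omega> --> U i x = 0) \<and>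
 (\<forall>i\<in>{1..l}. AE x in lborel. x \<in> \<Omega> --> u x i = U i x) \<and> (\<forall>i\<in>{1..l}. (%x. u x i) \<in> borel_measurable (lebesgue_on \<Omega>))"
proof -
 have uD: "\<forall>i\<in>{1..l}. \<exists>g. D12_limit \<Omega> (%x. u x i) g" using u by (auto simp: H_space_def D12_0_def)
 have "\<forall>i. \<exists>V. i \<in> {1..l} --> Dlim \<Omega> (fst V) (snd V) \<and> (AE x in lborel. x \<in> \<Omega> --> u x i = fst V x) \<and> (\<forall>x. x \<notin> \<Omega> --> fst V x = 0)"
 proof
 fix i
 show "\<exists>V. i \<in> {1..l} --> Dlim \<Omega> (fst V) (snd V) \<and> (AE x in lborel. x \<in> \<Omega> --> u x i = fst V x) \<and> (\<forall>x. x \<notin> \<Omega> --> fst V x = 0)"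
 proof (cases "i \<in> {1..l}")
 case True
 then obtain g where "D12_limit \<Omega> (%x. u x i) g" using uD by blast
 from D12_limit_Dlim[OF \<Omega> this N] obtain u' g' where "Dlim \<Omega> u' g'" "AE x in lborel. x \<in> \<Omega> --> u x i = u' x" "\<forall>x. x \<notin> \<Omega> --> u' x = 0" by blast
 then show ?thesis by (intro exI[of _ "(u', g')"]) simp
 qed blast
 qed
 from choice[OF this] obtain V where V: "!!i. i \<in> {1..l} ==> Dlim \<Omega> (fst (V i)) (snd (V i))"
 "!!i. i \<in> {1..l} ==> AE x in lborel. x \<in> \<Omega> --> u x i = fst (V i) x" "!!i x. i \<in> {1..l} ==> x \<notin> \<Omega> ==> fst (V i) x = 0" by blast
 have eq: "AE x in lborel. \<forall>i\<in>{1..l}. fst (V i) (g *v x) = fst (V (\<phi> g i)) x" if g: "g \<in> G" for g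
 proof -
 have og: "orthogonal_matrix g" using G g by (rule orthD)
 have all: "AE x in lborel. \<forall>i\<in>{1..l}. x \<in> \<Omega> --> u x i = fst (V i) x" by (subst AE_finite_all) (auto simp: V(2))
 have "AE x in lebesgue_on \<Omega>. \<forall>i\<in>{1..l}. u (g *v x) i = perm_act (\<phi> g) (u x) i"
 using u g by (auto simp: H_space_def equivariant_def)
 then have e: "AE x in lborel. x \<in> \<Omega> --> (\<forall>i\<in>{1..l}. u (g *v x) i = u x (\<phi> g i))"
 by (simp add: AE_lebesgue_on[OF \<Omega>] perm_act_def)
 show ?thesis using all mp_AE[OF mp_orthogonal[OF og] all] e
 proof eventually_elim
 fix x assume h: "\<forall>i\<in>{1..l}. x \<in> \<Omega> --> u x i = fst (V i) x" "\<forall>i\<in>{1..l}. g *v x \<in> \<Omega> --> u (g *v x) i = fst (V i) (g *v x)"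
 "x \<in> \<Omega> --> (\<forall>i\<in>{1..l}. u (g *v x) i = u x (\<phi> g i))"
 \<comment> \<open>The transpose is the inverse and lies in G, so the complement of
   \<open>\<Omega>\<close> is invariant too.\<close>
 have "g *v x \<in> \<Omega> \<longleftrightarrow> x \<in> \<Omega>"
 proof
 have "transpose g \<in> G" using G g by (simp add: orth_closed_def)
 then show "g *v x \<in> \<Omega> ==> x \<in> \<Omega>" using inv transpose_cancel[OF og, of x] unfolding G_invariant_def by metis
 qed (use inv g in \<open>auto simp: G_invariant_def\<close>)
 then show "\<forall>i\<in>{1..l}. fst (V i) (g *v x) = fst (V (\<phi> g i)) x"
 using h V(3) permsD[OF P g] by (cases "x \<in> \<Omega>") (force, metis)
 qed
 qed
 have "(%x. u x i) \<in> borel_measurable (lebesgue_on \<Omega>)" if "i \<in> {1..l}" for i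
 using uD that by (auto simp: D12_limit_def)
 then show ?thesis using V eq by (intro exI[of _ "%i. fst (V i)"] exI[of _ "%i. snd (V i)"]) (auto simp: adm_def)
qed

lemma Nehari_adm:
 fixes u :: "real^'n => nat => real"
 assumes \<Omega>: "open \<Omega>" and N: "CARD('n) >= 3" and inv: "G_invariant G \<Omega>" and G: "orth_closed G" and P: "perms G \<phi> l"
 and u: "u \<in> Nehari G \<phi> l \<beta> \<Omega>"
 shows "\<exists>U Gr. adm G \<phi> l \<Omega> U Gr \<and> (\<forall>i\<in>{1..l}. (\<forall>x. x \<notin> \<Omega> --> U i x = 0) \<and> \<not> (AE x in lborel. U i x = 0) \<and>
 aa Gr i - bb U i - \<beta> * (\<Sum>j\<in>{1..l} - {i}. dd U i j) = 0) \<and>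
 J \<beta> l \<Omega> u = Jc l \<beta> (crit_exp CARD('n)) (aa Gr) (bb U) (dd U)"
proof -
 have uH: "u \<in> H_space G \<phi> l \<Omega>" using u by (simp add: Nehari_def)
 obtain U Gr where U: "adm G \<phi> l \<Omega> U Gr" "!!i x. i \<in> {1..l} ==> x \<notin> \<Omega> ==> U i x = 0"
 "!!i. i \<in> {1..l} ==> AE x in lborel. x \<in> \<Omega> --> u x i = U i x" "!!i. i \<in> {1..l} ==> (%x. u x i) \<in> borel_measurable (lebesgue_on \<Omega>)"
 using H_space_adm[OF \<Omega> N inv G P uH] by blast
 have D: "Dlim \<Omega> (U i) (Gr i)" if "i \<in> {1..l}" for i using U(1) that by (auto simp: adm_def)
 have uD: "(%x. u x i) \<in> D12_0 \<Omega>" if "i \<in> {1..l}" for i using uH that by (auto simp: H_space_def)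
 have t: "grad_term \<Omega> u i = aa Gr i" "power_term \<Omega> u i = bb U i" "(AE x in lebesgue_on \<Omega>. u x i = 0) \<longleftrightarrow> (AE x in lborel. U i x = 0)"
 if "i \<in> {1..l}" for i
 by (rule terms_bridge[where u = u and U = U and Gr = Gr and l = l, OF \<Omega> N D U(4) U(3) uD that]; assumption)+
 have tc: "coupling_term \<Omega> u i j = dd U i j" if "i \<in> {1..l}" "j \<in> {1..l}" for i j
 by (rule terms_bridge(3)[where u = u and U = U and Gr = Gr and l = l, OF \<Omega> N D U(4) U(3) uD that])
 have s: "(\<Sum>j\<in>{1..l} - {i}. coupling_term \<Omega> u i j) = (\<Sum>j\<in>{1..l} - {i}. dd U i j)" if "i \<in> {1..l}" for i
 by (rule sum.cong) (use tc that in auto)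
 have "J \<beta> l \<Omega> u = Jc l \<beta> (crit_exp CARD('n)) (aa Gr) (bb U) (dd U)"
 proof -
 have "(\<Sum>i\<in>{1..l}. grad_term \<Omega> u i) = (\<Sum>i\<in>{1..l}. aa Gr i)" "(\<Sum>i\<in>{1..l}. power_term \<Omega> u i) = (\<Sum>i\<in>{1..l}. bb U i)"
 "(\<Sum>i\<in>{1..l}. \<Sum>j\<in>{1..l} - {i}. coupling_term \<Omega> u i j) = (\<Sum>i\<in>{1..l}. \<Sum>j\<in>{1..l} - {i}. dd U i j)"
 by (rule sum.cong[OF refl], rule t(1), assumption, rule sum.cong[OF refl], rule t(2), assumption, rule sum.cong[OF refl], rule s, assumption)
 then show ?thesis unfolding J_def Jc_def by (simp only:)
 qed
 moreover have "\<not> (AE x in lborel. U i x = 0)" "aa Gr i - bb U i - \<beta> * (\<Sum>j\<in>{1..l} - {i}. dd U i j) = 0" if "i \<in> {1..l}" for i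
 proof -
 have "dJ \<beta> l \<Omega> u i = 0" "\<not> (AE x in lebesgue_on \<Omega>. u x i = 0)" using u that by (auto simp: Nehari_def)
 then show "\<not> (AE x in lborel. U i x = 0)" "aa Gr i - bb U i - \<beta> * (\<Sum>j\<in>{1..l} - {i}. dd U i j) = 0"
 unfolding dJ_def t[OF that] s[OF that] by auto
 qed
 ultimately show ?thesis using U(1,2) by blast
qed

lemma adm_Nehari:
 fixes U :: "nat => real^'n => real"
 assumes \<Omega>: "open \<Omega>" and N: "CARD('n) >= 3" and U: "adm G \<phi> l \<Omega> U Gr"
 and nz: "!!i. i \<in> {1..l} ==> \<not> (AE x in lborel. U i x = 0)"
 and eq: "!!i. i \<in> {1..l} ==> aa Gr i - bb U i - \<beta> * (\<Sum>j\<in>{1..l} - {i}. dd U i j) = 0"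
 shows "(%x i. U i x) \<in> Nehari G \<phi> l \<beta> \<Omega>"
 "J \<beta> l \<Omega> (%x i. U i x) = Jc l \<beta> (crit_exp CARD('n)) (aa Gr) (bb U) (dd U)"
proof -
 let ?u = "%x i. U i x"
 have D: "Dlim \<Omega> (U i) (Gr i)" if "i \<in> {1..l}" for i using U that by (auto simp: adm_def)
 have um: "(%x. ?u x i) \<in> borel_measurable (lebesgue_on \<Omega>)" if "i \<in> {1..l}" for i
 using Dlim_measurable[OF D[OF that]] by (auto intro: borel_lebesgue_on)
 have uD: "(%x. ?u x i) \<in> D12_0 \<Omega>" if "i \<in> {1..l}" for i
 using Dlim_D12_limit[OF \<Omega> D[OF that]] by (auto simp: D12_0_def)
 have t: "grad_term \<Omega> ?u i = aa Gr i" "power_term \<Omega> ?u i = bb U i" "(AE x in lebesgue_on \<Omega>. ?u x i = 0) \<longleftrightarrow> (AE x in lborel. U i x = 0)"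
 if "i \<in> {1..l}" for i
 by (rule terms_bridge[where u = ?u and U = U and Gr = Gr and l = l, OF \<Omega> N D um _ uD that]; simp)+
 have tc: "coupling_term \<Omega> ?u i j = dd U i j" if "i \<in> {1..l}" "j \<in> {1..l}" for i j
 by (rule terms_bridge(3)[where u = ?u and U = U and Gr = Gr and l = l, OF \<Omega> N D um _ uD that]; simp)
 have s: "(\<Sum>j\<in>{1..l} - {i}. coupling_term \<Omega> ?u i j) = (\<Sum>j\<in>{1..l} - {i}. dd U i j)" if "i \<in> {1..l}" for i
 by (rule sum.cong) (use tc that in auto)
 have "AE x in lebesgue_on \<Omega>. \<forall>i\<in>{1..l}. U i (g *v x) = perm_act (\<phi> g) (?u x) i" if "g \<in> G" for g
 using U that unfolding AE_lebesgue_on[OF \<Omega>] adm_def perm_act_def by (auto elim!: eventually_mono)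
 then have "?u \<in> H_space G \<phi> l \<Omega>" using uD by (auto simp: H_space_def equivariant_def)
 then show "?u \<in> Nehari G \<phi> l \<beta> \<Omega>" using t s nz eq by (auto simp: Nehari_def dJ_def)
 show "J \<beta> l \<Omega> ?u = Jc l \<beta> (crit_exp CARD('n)) (aa Gr) (bb U) (dd U)"
 proof -
 have "(\<Sum>i\<in>{1..l}. grad_term \<Omega> ?u i) = (\<Sum>i\<in>{1..l}. aa Gr i)" "(\<Sum>i\<in>{1..l}. power_term \<Omega> ?u i) = (\<Sum>i\<in>{1..l}. bb U i)"
 "(\<Sum>i\<in>{1..l}. \<Sum>j\<in>{1..l} - {i}. coupling_term \<Omega> ?u i j) = (\<Sum>i\<in>{1..l}. \<Sum>j\<in>{1..l} - {i}. dd U i j)"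
 by (rule sum.cong[OF refl], rule t(1), assumption, rule sum.cong[OF refl], rule t(2), assumption, rule sum.cong[OF refl], rule s, assumption)
 then show ?thesis unfolding J_def Jc_def by (simp only:)
 qed
qed

lemma Dlim_integrable_q:
 fixes u :: "real^'n => real"
 assumes D: "Dlim \<Omega> u g" and N: "CARD('n) >= 3"
 shows "integrable lborel (%x. \<bar>u x\<bar> powr crit_exp CARD('n))" "integrable lborel (%x. (norm (g x))^2)"
 "Nq u = ennreal (LBINT x. \<bar>u x\<bar> powr crit_exp CARD('n))"
proof -
 have q: "crit_exp CARD('n) > 0" using crit_exp_gt[OF N] by simp
 note [measurable] = Dlim_measurable[OF D]
 show i: "integrable lborel (%x. \<bar>u x\<bar> powr crit_exp CARD('n))"
 using Dlim_finite(1)[OF D q] by (intro integrableI_bounded) (auto simp: Nq_def)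
 show "integrable lborel (%x. (norm (g x))^2)" by (rule N2_integrable(1)[OF Dlim_measurable(2)[OF D] Dlim_finite(2)[OF D q]])
 show "Nq u = ennreal (LBINT x. \<bar>u x\<bar> powr crit_exp CARD('n))" unfolding Nq_def by (rule nn_integral_eq_integral[OF i]) simp
qed

lemma powr_half_prod: "a >= 0 ==> b >= 0 ==> a powr (q / 2) * b powr (q / 2) <= a powr q + (b::real) powr q"
proof -
 assume ab: "a >= 0" "b >= 0"
 have "2 * (a powr (q / 2) * b powr (q / 2)) <= (a powr (q / 2))^2 + (b powr (q / 2))^2"
 using sum_squares_bound[of "a powr (q / 2)" "b powr (q / 2)"] by (simp add: mult.assoc)
 moreover have "0 <= a powr (q / 2) * b powr (q / 2)" by simp
 moreover have "(a powr (q / 2))^2 = a powr q" "(b powr (q / 2))^2 = b powr q"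
 by (simp_all add: power2_eq_square powr_add[symmetric])
 ultimately show ?thesis by linarith
qed

lemma coupling_integrable:
 fixes u v :: "real^'n => real"
 assumes D: "Dlim \<Omega> u g" "Dlim \<Omega>' v h" and N: "CARD('n) >= 3"
 shows "integrable lborel (%x. \<bar>u x\<bar> powr (crit_exp CARD('n) / 2) * \<bar>v x\<bar> powr (crit_exp CARD('n) / 2))"
proof (rule integrable_dom[OF integrable_plus[OF Dlim_integrable_q(1)[OF D(1) N] Dlim_integrable_q(1)[OF D(2) N]]])
 note [measurable] = Dlim_measurable[OF D(1)] Dlim_measurable[OF D(2)]
 show "(%x. \<bar>u x\<bar> powr (crit_exp CARD('n) / 2) * \<bar>v x\<bar> powr (crit_exp CARD('n) / 2)) \<in> borel_measurable lborel" by measurable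
qed (auto intro!: AE_I2 powr_half_prod)

lemma Dlim_orth:
 fixes u :: "real^'n => real"
 assumes D: "Dlim UNIV u g" and N: "CARD('n) >= 3" and o: "orthogonal_matrix k"
 shows "Dlim UNIV (%x. u (k *v x)) (%x. transpose k *v g (k *v x))"
proof -
 have o': "orthogonal_matrix (transpose k)" using o by (simp add: orthogonal_matrix_transpose)
 have "Dlim UNIV (%x. 1 * u (k *v x + 0)) (%x. 1 *\<^sub>R (transpose k *v g (k *v x + 0)))"
 proof (rule Dlim_affine[where A = "(*v) k" and B = "(*v) (transpose k)" and A' = "(*v) (transpose k)" and C = 1, OF D N matrix_vector_mul_linear matrix_vector_mul_linear matrix_vector_mul_linear])
 show "transpose k *v (k *v x) = x" for x by (rule transpose_cancel[OF o])
 show "k *v (transpose k *v x) = x" for x using transpose_cancel[OF o', of x] by simp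
 show "(k *v x) \<bullet> y = x \<bullet> (transpose k *v y)" for x y using dot_lmul_matrix[of y k x] by (simp add: inner_commute)
 show "(NN x. F (k *v x + 0)) = ennreal 1 * (NN x. F x)" if "F \<in> BM" for F
 using mp_nn[OF mp_orthogonal[OF o] that] by simp
 qed auto
 then show ?thesis by simp
qed

text \<open>The component with index \<phi> g i is u_i composed with g; orthogonal maps preserve
  integrals, and the gradient of the composition is a rotated gradient of the same length.\<close>

lemma adm_sym:
 fixes U :: "nat => real^'n => real"
 assumes N: "CARD('n) >= 3" and G: "orth_closed G" and P: "perms G \<phi> l" and U: "adm G \<phi> l \<Omega> U Gr"
 and g: "g \<in> G" and i: "i \<in> {1..l}"
 shows "aa Gr (\<phi> g i) = aa Gr i" "bb U (\<phi> g i) = bb U i" "j \<in> {1..l} ==> dd U (\<phi> g i) (\<phi> g j) = dd U i j"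
proof -
 have og: "orthogonal_matrix g" using G g by (rule orthD)
 have D: "Dlim UNIV (U k) (Gr k)" if "k \<in> {1..l}" for k using U that by (auto simp: adm_def intro: Dlim_mono[OF _ subset_UNIV])
 have m: "U k \<in> BM" "Gr k \<in> BM" if "k \<in> {1..l}" for k using Dlim_measurable[OF D[OF that]] by auto
 have gi: "\<phi> g k \<in> {1..l}" if "k \<in> {1..l}" for k using permsD[OF P g that] .
 have e: "AE x in lborel. \<forall>i\<in>{1..l}. U i (g *v x) = U (\<phi> g i) x" using U g by (auto simp: adm_def)
 have "AE x in lborel. U i (g *v x) = U (\<phi> g i) x" using e i by (auto elim!: eventually_mono)
 from Dlim_unique[OF Dlim_orth[OF D[OF i] N og] D[OF gi[OF i]] this N]
 have eg: "AE x in lborel. transpose g *v Gr i (g *v x) = Gr (\<phi> g i) x" .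
 note [measurable] = m(1)[OF i] m(2)[OF i] m(1)[OF gi[OF i]] m(2)[OF gi[OF i]]
 have og': "orthogonal_matrix (transpose g)" using og by (simp add: orthogonal_matrix_transpose)
 have "aa Gr (\<phi> g i) = (LBINT x. (norm (Gr i (g *v x)))^2)" unfolding aa_def
 proof (rule integral_cong_AE)
 show "AE x in lborel. (norm (Gr (\<phi> g i) x))^2 = (norm (Gr i (g *v x)))^2"
 using eg by eventually_elim (metis norm_orthogonal_matrix_mult[OF og'])
 qed measurable
 then show "aa Gr (\<phi> g i) = aa Gr i"
 using mp_integral[OF mp_orthogonal[OF og], of "%x. (norm (Gr i x))^2"] by (simp add: aa_def)
 have "bb U (\<phi> g i) = (LBINT x. \<bar>U i (g *v x)\<bar> powr crit_exp CARD('n))" unfolding bb_def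
 by (rule integral_cong_AE) (use e i in \<open>auto elim!: eventually_mono\<close>)
 then show "bb U (\<phi> g i) = bb U i"
 using mp_integral[OF mp_orthogonal[OF og], of "%x. \<bar>U i x\<bar> powr crit_exp CARD('n)"] by (simp add: bb_def)
 assume j: "j \<in> {1..l}"
 note [measurable] = m(1)[OF j] m(1)[OF gi[OF j]]
 have "dd U (\<phi> g i) (\<phi> g j) = (LBINT x. \<bar>U i (g *v x)\<bar> powr (crit_exp CARD('n) / 2) * \<bar>U j (g *v x)\<bar> powr (crit_exp CARD('n) / 2))"
 unfolding dd_def by (rule integral_cong_AE) (use e i j in \<open>auto elim!: eventually_mono\<close>)
 then show "dd U (\<phi> g i) (\<phi> g j) = dd U i j"
 using mp_integral[OF mp_orthogonal[OF og], of "%x. \<bar>U i x\<bar> powr (crit_exp CARD('n) / 2) * \<bar>U j x\<bar> powr (crit_exp CARD('n) / 2)"]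
 by (simp add: dd_def)
qed

section \<open>Projection onto the Nehari set\<close>

lemma aa_scale: "aa (%i x. t i *\<^sub>R Gr i x) i = (t i)^2 * aa Gr i"
 by (simp add: aa_def power_mult_distrib)

lemma bb_scale:
 fixes U :: "'i => real^'n => real"
 shows "t i > 0 ==> bb (%i x. t i * U i x) i = t i powr crit_exp CARD('n) * bb U i"
 by (simp add: bb_def abs_mult powr_mult)

lemma dd_scale:
 fixes U :: "'i => real^'n => real"
 assumes "t i > 0" "t j > 0"
 shows "dd (%i x. t i * U i x) i j = (t i powr (crit_exp CARD('n) / 2) * t j powr (crit_exp CARD('n) / 2)) * dd U i j"
proof -
 have "dd (%i x. t i * U i x) i j = (LBINT x. (t i powr (crit_exp CARD('n) / 2) * t j powr (crit_exp CARD('n) / 2)) *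
 (\<bar>U i x\<bar> powr (crit_exp CARD('n) / 2) * \<bar>U j x\<bar> powr (crit_exp CARD('n) / 2)))"
 unfolding dd_def using assms by (intro Bochner_Integration.integral_cong refl) (simp add: abs_mult powr_mult)
 then show ?thesis by (simp add: dd_def)
qed

lemma Dlim_zero: "Dlim \<Omega> (%x::real^'n. 0) (%x. 0)"
proof -
 have t: "(%x::real^'n. 0::real) \<in> test_functions \<Omega>" by (auto simp: test_functions_def smooth_const)
 have "grad (%x::real^'n. 0::real) = (%x. 0)" by (rule ext, rule grad_eqI) simp
 then show ?thesis using Dlim_test[OF t] by simp
qed

lemma Dlim_cmult:
 fixes u :: "real^'n => real"
 assumes "Dlim \<Omega> u g" "CARD('n) >= 3" shows "Dlim \<Omega> (%x. c * u x) (%x. c *\<^sub>R g x)"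
 using Dlim_lincomb[OF Dlim_zero assms, of c] by simp

lemma dd_nonneg: "dd U i j >= 0" unfolding dd_def by (rule integral_nonneg_AE) simp

lemma Jc_Nehari:
 assumes "!!i. i \<in> {1..l} ==> a i - b i - \<beta> * (\<Sum>j\<in>{1..l} - {i}. d i j) = 0"
 shows "Jc l \<beta> q a b d = (1 / 2 - 1 / q) * (\<Sum>i\<in>{1..l}. a i)"
proof -
 have "(\<Sum>i\<in>{1..l}. a i) = (\<Sum>i\<in>{1..l}. b i + \<beta> * (\<Sum>j\<in>{1..l} - {i}. d i j))"
 by (rule sum.cong) (use assms in force)+
 then have "(\<Sum>i\<in>{1..l}. a i) = (\<Sum>i\<in>{1..l}. b i) + \<beta> * (\<Sum>i\<in>{1..l}. \<Sum>j\<in>{1..l} - {i}. d i j)"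
 by (simp add: sum.distrib sum_distrib_left)
 then show ?thesis unfolding Jc_def by (simp add: field_simps)
qed

text \<open>The factors from \<open>NF_perturb\<close> rescale each component onto the Nehari set.
  By \<open>adm_sym\<close> the coefficients are invariant under the permutations \<phi> g, so t is
  constant along their orbits and the rescaled function stays equivariant. The energy is recorded
  twice: the first form serves the comparison of infima, the second the Euler-Lagrange
  argument.\<close>

lemma project_Nehari:
 fixes U :: "'k => nat => real^'n => real"
 assumes \<Omega>: "open \<Omega>" and N: "CARD('n) >= 3" and G: "orth_closed G" and P: "perms G \<phi> l" and \<beta>: "\<beta> < 0"
 and U: "!!k. adm G \<phi> l \<Omega> (U k) (Gr k)" and \<delta>: "0 < \<delta>" "\<delta> < 1"
 and lim: "!!i. i \<in> {1..l} ==> ((%k. aa (Gr k) i) \<longlongrightarrow> A i) F" "!!i. i \<in> {1..l} ==> ((%k. bb (U k) i) \<longlongrightarrow> B i) F"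
 "!!i j. i \<in> {1..l} ==> j \<in> {1..l} ==> ((%k. dd (U k) i j) \<longlongrightarrow> D i j) F"
 and A: "!!i. i \<in> {1..l} ==> A i > 0" "!!i. i \<in> {1..l} ==> B i > 0" "!!i. i \<in> {1..l} ==> A i - B i - \<beta> * (\<Sum>j\<in>{1..l} - {i}. D i j) = 0"
 shows "eventually (%k. \<exists>t. (\<forall>i\<in>{1..l}. 1 - \<delta> <= t i \<and> t i <= 1 + \<delta>) \<and>
 (\<exists>u\<in>Nehari G \<phi> l \<beta> \<Omega>. J \<beta> l \<Omega> u = (1 / 2 - 1 / crit_exp CARD('n)) * (\<Sum>i\<in>{1..l}. (t i)\<^sup>2 * aa (Gr k) i) \<and>
 J \<beta> l \<Omega> u = Jc l \<beta> (crit_exp CARD('n)) (%i. (t i)^2 * aa (Gr k) i) (%i. t i powr crit_exp CARD('n) * bb (U k) i)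
 (%i j. (t i powr (crit_exp CARD('n) / 2) * t j powr (crit_exp CARD('n) / 2)) * dd (U k) i j))) F"
proof -
 define p where "p = crit_exp CARD('n) / 2"
 have p: "p > 1" "crit_exp CARD('n) = p + p" using crit_exp_gt(1)[OF N] by (auto simp: p_def)
 have ev: "eventually (%k. \<exists>t. (\<forall>i\<in>{1..l}. 1 - \<delta> <= t i \<and> t i <= 1 + \<delta> \<and> NF {1..l} p (- \<beta>) (aa (Gr k)) (bb (U k)) (dd (U k)) t i = 0) \<and>
 (\<forall>\<sigma>. bij_betw \<sigma> {1..l} {1..l} --> (\<forall>i\<in>{1..l}. aa (Gr k) (\<sigma> i) = aa (Gr k) i \<and> bb (U k) (\<sigma> i) = bb (U k) i \<and> (\<forall>j\<in>{1..l}. dd (U k) (\<sigma> i) (\<sigma> j) = dd (U k) i j)) -->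
 (\<forall>i\<in>{1..l}. t (\<sigma> i) = t i))) F"
 by (rule NF_perturb[OF _ p(1) _ \<delta> _ lim A(1)]) (use \<beta> A(3) in \<open>auto simp: dd_nonneg algebra_simps\<close>)
 moreover have "eventually (%k. \<forall>i\<in>{1..l}. bb (U k) i > 0) F"
 by (intro eventually_ball_finite ballI order_tendstoD(1)[OF lim(2)] A(2)) auto
 ultimately show ?thesis
 proof eventually_elim
 case (elim k)
 then obtain t where t: "!!i. i \<in> {1..l} ==> 1 - \<delta> <= t i \<and> t i <= 1 + \<delta>" "!!i. i \<in> {1..l} ==> NF {1..l} p (- \<beta>) (aa (Gr k)) (bb (U k)) (dd (U k)) t i = 0"
 "!!\<sigma> i. bij_betw \<sigma> {1..l} {1..l} ==> (\<forall>i\<in>{1..l}. aa (Gr k) (\<sigma> i) = aa (Gr k) i \<and> bb (U k) (\<sigma> i) = bb (U k) i \<and> (\<forall>j\<in>{1..l}. dd (U k) (\<sigma> i) (\<sigma> j) = dd (U k) i j)) ==>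
 i \<in> {1..l} ==> t (\<sigma> i) = t i" by blast
 have tp: "t i > 0" if "i \<in> {1..l}" for i using t(1)[OF that] \<delta> by linarith
 have ts: "t (\<phi> g i) = t i" if "g \<in> G" "i \<in> {1..l}" for g i
 using t(3)[of "\<phi> g" i] adm_sym[OF N G P U that(1)] P that by (auto simp: perms_def)
 let ?V = "%i x. t i * U k i x" and ?H = "%i x. t i *\<^sub>R Gr k i x"
 have V: "adm G \<phi> l \<Omega> ?V ?H"
 using U[of k] ts by (auto simp: adm_def Dlim_cmult N elim!: eventually_mono)
 have va: "aa ?H i = (t i)^2 * aa (Gr k) i" for i by (rule aa_scale)
 have vb: "bb ?V i = t i powr crit_exp CARD('n) * bb (U k) i" if "i \<in> {1..l}" for i by (rule bb_scale[of t i "U k", OF tp[OF that]])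
 have vd: "dd ?V i j = (t i powr p * t j powr p) * dd (U k) i j" if "i \<in> {1..l}" "j \<in> {1..l}" for i j
 unfolding p_def by (rule dd_scale[of t i j "U k", OF tp[OF that(1)] tp[OF that(2)]])
 have sd: "(\<Sum>j\<in>{1..l} - {i}. dd ?V i j) = (\<Sum>j\<in>{1..l} - {i}. (t i powr p * t j powr p) * dd (U k) i j)" if "i \<in> {1..l}" for i
 by (rule sum.cong) (use vd that in auto)
 have eq: "aa ?H i - bb ?V i - \<beta> * (\<Sum>j\<in>{1..l} - {i}. dd ?V i j) = 0" if i: "i \<in> {1..l}" for i
 proof -
 \<comment> \<open>Multiplying back by t_i^p recovers the Nehari equation from
   \<open>NF\<close>.\<close>
 have "0 = t i powr p * NF {1..l} p (- \<beta>) (aa (Gr k)) (bb (U k)) (dd (U k)) t i" using t(2)[OF i] by simp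
 also have "\<dots> = (t i powr p * t i powr (2 - p)) * aa (Gr k) i - (t i powr p * t i powr p) * bb (U k) i - \<beta> * (\<Sum>j\<in>{1..l} - {i}. (t i powr p * t j powr p) * dd (U k) i j)"
 proof -
 have "t i powr p * (\<Sum>j\<in>{1..l} - {i}. dd (U k) i j * t j powr p) = (\<Sum>j\<in>{1..l} - {i}. (t i powr p * t j powr p) * dd (U k) i j)"
 unfolding sum_distrib_left by (intro sum.cong refl) (simp add: mult_ac)
 then show ?thesis unfolding NF_def by (simp add: algebra_simps)
 qed
 also have "t i powr p * t i powr (2 - p) = (t i)^2" using tp[OF i] by (simp flip: powr_add)
 also have "t i powr p * t i powr p = t i powr crit_exp CARD('n)" unfolding p(2) by (rule powr_add[symmetric])
 finally show ?thesis using va vb[OF i] sd[OF i] by simp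
 qed
 have nz: "\<not> (AE x in lborel. ?V i x = 0)" if i: "i \<in> {1..l}" for i
 proof
 assume "AE x in lborel. ?V i x = 0"
 then have "AE x in lborel. \<bar>U k i x\<bar> powr crit_exp CARD('n) = 0" using tp[OF i] by (auto elim!: eventually_mono)
 then have "bb (U k) i = 0" unfolding bb_def by (rule integral_eq_zero_AE)
 then show False using elim(2) i by force
 qed
 note M = adm_Nehari[OF \<Omega> N V nz eq]
 have "J \<beta> l \<Omega> (%x i. ?V i x) = (1 / 2 - 1 / crit_exp CARD('n)) * (\<Sum>i\<in>{1..l}. (t i)\<^sup>2 * aa (Gr k) i)"
 proof -
 have "aa ?H = (%i. (t i)^2 * aa (Gr k) i)" by (rule ext, rule va)
 then show ?thesis using trans[OF M(2) Jc_Nehari[OF eq, of "crit_exp CARD('n)"]] by (simp only:)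
 qed
 moreover have "J \<beta> l \<Omega> (%x i. ?V i x) = Jc l \<beta> (crit_exp CARD('n)) (%i. (t i)^2 * aa (Gr k) i) (%i. t i powr crit_exp CARD('n) * bb (U k) i)
 (%i j. (t i powr p * t j powr p) * dd (U k) i j)"
 proof (rule trans[OF M(2)])
 have e: "(\<Sum>i\<in>{1..l}. bb ?V i) = (\<Sum>i\<in>{1..l}. t i powr crit_exp CARD('n) * bb (U k) i)"
 "(\<Sum>i\<in>{1..l}. \<Sum>j\<in>{1..l} - {i}. dd ?V i j) = (\<Sum>i\<in>{1..l}. \<Sum>j\<in>{1..l} - {i}. (t i powr p * t j powr p) * dd (U k) i j)"
 by (rule sum.cong[OF refl], rule vb, assumption, rule sum.cong[OF refl], rule sd, assumption)
 have h: "(\<Sum>i\<in>{1..l}. aa ?H i) = (\<Sum>i\<in>{1..l}. (t i)\<^sup>2 * aa (Gr k) i)" by (rule sum.cong[OF refl], rule va)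
 show "Jc l \<beta> (crit_exp CARD('n)) (aa ?H) (bb ?V) (dd ?V) = Jc l \<beta> (crit_exp CARD('n)) (%i. (t i)^2 * aa (Gr k) i) (%i. t i powr crit_exp CARD('n) * bb (U k) i)
 (%i j. (t i powr p * t j powr p) * dd (U k) i j)" by (simp only: Jc_def h e)
 qed
 ultimately show ?case using t(1) M(1) unfolding p_def by blast
 qed
qed

text \<open>For the gradient integral this is the Sobolev inequality: zero energy would force a zero
  critical norm.\<close>

lemma adm_positive:
 fixes U :: "nat => real^'n => real"
 assumes N: "CARD('n) >= 3" and U: "adm G \<phi> l \<Omega> U Gr" and i: "i \<in> {1..l}" and nz: "\<not> (AE x in lborel. U i x = 0)"
 shows "aa Gr i > 0" "bb U i > 0"
proof -
 have q: "crit_exp CARD('n) > 0" using crit_exp_gt[OF N] by simp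
 have D: "Dlim \<Omega> (U i) (Gr i)" using U i by (auto simp: adm_def)
 note [measurable] = Dlim_measurable[OF D]
 have b: "bb U i ~= 0"
 proof
 assume "bb U i = 0"
 then have "AE x in lborel. \<bar>U i x\<bar> powr crit_exp CARD('n) = 0"
 unfolding bb_def using integral_nonneg_eq_0_iff_AE[OF Dlim_integrable_q(1)[OF D N]] by simp
 then show False using nz by (auto elim!: eventually_mono)
 qed
 moreover have b0: "bb U i >= 0" unfolding bb_def by (rule integral_nonneg_AE) simp
 ultimately show bp: "bb U i > 0" by simp
 obtain C where C: "!!\<Omega> u g. Dlim (\<Omega> :: (real^'n) set) u g ==> Nq u <= ennreal ((C * enn2real (N2 g)) powr (crit_exp CARD('n) / 2))"
 using Sobolev[OF N] by blast
 have "aa Gr i ~= 0"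
 proof
 assume a: "aa Gr i = 0"
 have "N2 (Gr i) = ennreal (aa Gr i)" unfolding aa_def by (rule N2_integrable(2)[OF Dlim_measurable(2)[OF D] Dlim_finite(2)[OF D q]])
 then have "Nq (U i) <= 0" using C[OF D] q a by simp
 then show False using Dlim_integrable_q(3)[OF D N] bp by (simp add: bb_def)
 qed
 moreover have "aa Gr i >= 0" unfolding aa_def by (rule integral_nonneg_AE) simp
 ultimately show "aa Gr i > 0" by simp
qed

section \<open>Cutoff and scaling\<close>

text \<open>\<open>exp 1\<close> normalises the value at the centre to 1. All cutoffs are dilations
  of one radial profile, hence they preserve equivariance and their gradients are O(1/k).\<close>

definition cutoff :: "nat => real^'n => real" where
 "cutoff k x = exp 1 * bump (real k + 1) x"

lemma cutoff_props:
 fixes x :: "real^'n"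
 shows "cutoff k \<in> test_functions (ball (0::real^'n) (real k + 2))" "0 <= cutoff k x" "cutoff k x <= 1"
 "orthogonal_matrix g ==> cutoff k (g *v x) = cutoff k x" "(%k. cutoff k x) ~> 1"
 "norm x > real k + 1 ==> grad (cutoff k) x = 0"
proof -
 have r: "real k + 1 > 0" by simp
 have s: "smooth_on UNIV (cutoff k :: real^'n => real)" unfolding cutoff_def[abs_def] by (intro smooth_cmult bump_smooth)
 show t: "cutoff k \<in> test_functions (ball (0::real^'n) (real k + 2))"
 by (rule test_functionsI[OF s compact_cball[of 0 "real k + 1"]]) (auto simp: cutoff_def intro!: bump_zero)
 show "0 <= cutoff k x" by (simp add: cutoff_def bump_nonneg)
 have "expm 0 s <= exp (- 1)" if "s <= 1" for s using that by (auto simp: expm_def)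
 from mult_left_mono[OF this[of "1 - (norm x)^2 / (real k + 1)^2"], of "exp 1"] show "cutoff k x <= 1"
 by (simp add: cutoff_def bump_def exp_minus)
 show "orthogonal_matrix g ==> cutoff k (g *v x) = cutoff k x" by (simp add: cutoff_def bump_orthogonal)
 have "(%k. 1 - (norm x)^2 / (real k + 1)^2) ~> 1" by real_asymp
 from isCont_tendsto_compose[OF DERIV_isCont[OF expm_deriv] this, of 0]
 have "(%k. exp 1 * expm 0 (1 - (norm x)^2 / (real k + 1)^2)) ~> exp 1 * expm 0 1" by (intro tendsto_intros)
 then show "(%k. cutoff k x) ~> 1" by (simp add: cutoff_def bump_def expm_def exp_minus)
 assume n: "norm x > real k + 1"
 have "closure {x::real^'n. cutoff k x ~= 0} \<subseteq> cball 0 (real k + 1)"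
 proof (rule closure_minimal, safe)
 fix x :: "real^'n" assume "cutoff k x ~= 0"
 then show "x \<in> cball 0 (real k + 1)" using bump_zero[OF r, of x] by (force simp: cutoff_def)
 qed
 then show "grad (cutoff k) x = 0" using n by (intro zero_notin_closure_grad) auto
qed

lemma cutoff_grad_bound: "\<exists>M\<ge>0. \<forall>k (x::real^'n). norm (grad (cutoff k) x) <= M / (real k + 1)"
proof -
 obtain M where M: "M >= 0" "!!z::real^'n. norm (grad (bump 1) z) <= M"
 using test_bounds[OF bump_test[of 1]] by force
 have "norm (grad (cutoff k) x) <= (exp 1 * M) / (real k + 1)" for k and x :: "real^'n"
 proof -
 let ?r = "real k + 1"
 have e: "cutoff k = (%y::real^'n. exp 1 * bump 1 ((1 / ?r) *\<^sub>R y))"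
 by (auto simp: cutoff_def bump_def fun_eq_iff power_divide power2_norm_eq_inner)
 have "grad (cutoff k) x = (exp 1 / ?r) *\<^sub>R grad (bump 1) ((1 / ?r) *\<^sub>R x)"
 unfolding e by (rule grad_eqI) (auto intro!: derivative_eq_intros has_derivative_compose[OF _ smooth_has_grad[OF bump_smooth]] simp: algebra_simps)
 then show ?thesis using M(2)[of "(1 / ?r) *\<^sub>R x"] by (simp add: divide_right_mono)
 qed
 then show ?thesis using M(1) by (intro exI[of _ "exp 1 * M"]) auto
qed

text \<open>Where u^2 \<le> \<eta> (k+1)^(2-N), the integrand is at most \<eta> M^2 (k+1)^-N on a
  ball of volume ~ (k+1)^N, a contribution of order \<eta>. Elsewhere u^2 / (k+1)^2 is at most a
  constant times |u|^q, and dominated convergence applies. The splitting stands in for Hoelder's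
  inequality.\<close>

lemma cutoff_grad_tendsto:
 fixes u :: "real^'n => real"
 assumes D: "Dlim \<Omega> u g" and N: "CARD('n) >= 3"
 shows "integrable lborel (%x. (u x)^2 * (norm (grad (cutoff k) x))^2)"
 "(%k. \<integral>x. (u x)^2 * (norm (grad (cutoff k) x))^2 \<partial>lborel) ~> 0"
proof -
 note [measurable] = Dlim_measurable[OF D]
 have [measurable]: "grad (cutoff k) \<in> BM" for k by (rule test_grad_measurable[OF cutoff_props(1)])
 obtain M where M: "M >= 0" "!!k (x::real^'n). norm (grad (cutoff k) x) <= M / (real k + 1)" using cutoff_grad_bound by blast
 define q where "q = crit_exp CARD('n)"
 define f where "f k x = (u x)^2 * (norm (grad (cutoff k) x))^2" for k x
 define h where "h \<eta> k x = (if (u x)\<^sup>2 > \<eta> * (real k + 1) powr (2 - real CARD('n)) then f k x else 0)" for \<eta> k x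
 have [measurable]: "f k \<in> BM" "h \<eta> k \<in> BM" for k \<eta> unfolding f_def[abs_def] h_def[abs_def] by measurable
 have q: "q > 2" "(2 - real CARD('n)) * ((2 - q) / 2) = 2" using crit_exp_gt(1)[OF N] N by (auto simp: q_def crit_exp_def field_simps)
 have iq: "integrable lborel (%x. \<bar>u x\<bar> powr q)" unfolding q_def by (rule Dlim_integrable_q(1)[OF D N])
 have g2: "(norm (grad (cutoff k) x))^2 <= M\<^sup>2 / (real k + 1)^2" for k and x :: "real^'n"
 using power_mono[OF M(2), of k x 2] by (simp add: power_divide)
 have f0: "f k x >= 0" for k x by (simp add: f_def)
 have hb: "norm (h \<eta> k x) <= M\<^sup>2 * \<eta> powr ((2 - q) / 2) * \<bar>u x\<bar> powr q" if \<eta>: "\<eta> > 0" for \<eta> k x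
 proof (cases "(u x)^2 > \<eta> * (real k + 1) powr (2 - real CARD('n))")
 case True
 let ?d = "\<eta> * (real k + 1) powr (2 - real CARD('n))"
 have d: "?d > 0" using \<eta> by simp
 then have u: "\<bar>u x\<bar> > 0" using True by auto
 have "((u x)^2) powr ((2 - q) / 2) <= ?d powr ((2 - q) / 2)" using q True d by (intro powr_mono2') auto
 also have "\<dots> = \<eta> powr ((2 - q) / 2) * (real k + 1)^2" using \<eta> q(2) by (simp add: powr_mult powr_powr)
 also have "((u x)^2) powr ((2 - q) / 2) = (\<bar>u x\<bar> powr 2) powr ((2 - q) / 2)" by simp
 also have "\<dots> = \<bar>u x\<bar> powr (2 - q)" proof -
 have "2 * ((2 - q) / 2) = 2 - q" by simp
 then show ?thesis unfolding powr_powr by (simp only:)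
 qed
 finally have *: "\<bar>u x\<bar> powr (2 - q) <= \<eta> powr ((2 - q) / 2) * (real k + 1)^2" .
 have "(u x)^2 = \<bar>u x\<bar> powr (2 - q + q)" using u by simp
 also have "\<dots> = \<bar>u x\<bar> powr (2 - q) * \<bar>u x\<bar> powr q" by (rule powr_add)
 also have "\<dots> <= (\<eta> powr ((2 - q) / 2) * (real k + 1)^2) * \<bar>u x\<bar> powr q" using * by (intro mult_right_mono) auto
 finally have "f k x <= ((\<eta> powr ((2 - q) / 2) * (real k + 1)^2) * \<bar>u x\<bar> powr q) * (M\<^sup>2 / (real k + 1)^2)"
 unfolding f_def by (intro mult_mono g2) auto
 also have "\<dots> = M\<^sup>2 * \<eta> powr ((2 - q) / 2) * \<bar>u x\<bar> powr q" by (simp add: field_simps)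
 finally show ?thesis using True f0 by (simp add: h_def)
 qed (simp add: h_def)
 have hi: "integrable lborel (h \<eta> k)" if "\<eta> > 0" for \<eta> k
 by (rule integrable_dom[OF integrable_mult_right[OF iq, of "M\<^sup>2 * \<eta> powr ((2 - q) / 2)"]]) (use hb[OF that, of k] in auto)
 have ht: "(%k. \<integral>x. h \<eta> k x \<partial>lborel) ~> (\<integral>x. 0 \<partial>(lborel :: (real^'n) measure))" if \<eta>: "\<eta> > 0" for \<eta>
 proof (rule integral_dominated_convergence[where w = "%x. M\<^sup>2 * \<eta> powr ((2 - q) / 2) * \<bar>u x\<bar> powr q"])
 show "AE x in lborel. (%k. h \<eta> k x) ~> 0"
 proof (rule AE_I2, rule tendsto_0_le[where K = 1])
 fix x :: "real^'n"
 show "(%k. (u x)^2 * (M\<^sup>2 / (real k + 1)^2)) ~> 0" by real_asymp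
 show "\<forall>\<^sub>F k in sequentially. norm (h \<eta> k x) <= norm ((u x)^2 * (M\<^sup>2 / (real k + 1)^2)) * 1"
 using mult_left_mono[OF g2[of _ x], of "(u x)^2"] by (intro always_eventually) (auto simp: h_def f_def)
 qed
 qed (use hb[OF \<eta>] iq in auto)
 have vol: "measure lborel (cball (0::real^'n) (real k + 1)) = unit_ball_vol (real CARD('n)) * (real k + 1) ^ CARD('n)" for k
 by (subst content_cball) auto
 define E where "E \<eta> k x = \<eta> * M\<^sup>2 * (real k + 1) powr (- real CARD('n)) * indicator (cball 0 (real k + 1)) x" for \<eta> :: real and k and x :: "real^'n"
 have Ei: "integrable lborel (E \<eta> k)" for \<eta> k
 unfolding E_def[abs_def] using emeasure_cball_finite[of 0 "real k + 1"] by (intro integrable_mult_right integrable_real_indicator) auto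
 have EI: "(LBINT x. E \<eta> k x) = \<eta> * (M\<^sup>2 * unit_ball_vol (real CARD('n)))" for \<eta> k
 proof -
 have "(real k + 1) powr (- real CARD('n)) * (real k + 1) ^ CARD('n) = 1"
 by (simp add: powr_minus powr_realpow)
 then show ?thesis unfolding E_def by (simp add: vol mult_ac)
 qed
 have fle: "f k x <= E \<eta> k x + h \<eta> k x" if \<eta>: "\<eta> > 0" for \<eta> k x
 proof (cases "(u x)^2 > \<eta> * (real k + 1) powr (2 - real CARD('n)) \<or> norm x > real k + 1")
 case True
 then show ?thesis using \<eta> f0[of k x] cutoff_props(6)[of k x] by (auto simp: h_def E_def f_def)
 next
 case False
 have "f k x <= (\<eta> * (real k + 1) powr (2 - real CARD('n))) * (M\<^sup>2 / (real k + 1)^2)"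
 unfolding f_def using False \<eta> by (intro mult_mono g2) auto
 also have "(real k + 1) powr (2 - real CARD('n)) = (real k + 1)^2 * (real k + 1) powr (- real CARD('n))"
 by (simp add: powr_diff powr_minus field_simps)
 finally show ?thesis using False by (simp add: h_def E_def mult_ac)
 qed
 have fi: "integrable lborel (f k)" for k
 by (rule integrable_dom[OF integrable_plus[OF Ei[of 1 k] hi[of 1 k]]])
 (use fle[of 1 k] f0[of k] in \<open>auto intro: order_trans[OF _ abs_ge_self]\<close>)
 then show "integrable lborel (%x. (u x)^2 * (norm (grad (cutoff k) x))^2)" unfolding f_def[abs_def] .
 have "(%k. \<integral>x. f k x \<partial>lborel) ~> 0"
 proof (rule order_tendstoI)
 fix e :: real assume e: "0 < e"
 define K where "K = M\<^sup>2 * unit_ball_vol (real CARD('n))"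
 have K: "K >= 0" unfolding K_def by simp
 define \<eta> where "\<eta> = e / (2 * (K + 1))"
 have \<eta>: "\<eta> > 0" using e K by (auto simp: \<eta>_def field_simps)
 have \<eta>2: "\<eta> * K <= e / 2" using e K by (auto simp: \<eta>_def field_simps)
 have "eventually (%k. (LBINT x. h \<eta> k x) < e / 2) sequentially" using order_tendstoD(2)[OF ht[OF \<eta>], of "e / 2"] e by simp
 then show "eventually (%k. (LBINT x. f k x) < e) sequentially"
 proof eventually_elim
 case (elim k)
 have "(LBINT x. f k x) <= (LBINT x. E \<eta> k x + h \<eta> k x)"
 by (intro integral_mono fi fle \<eta> integrable_plus Ei hi)
 also have "\<dots> = \<eta> * K + (LBINT x. h \<eta> k x)"
 using Ei hi \<eta> by (subst integral_plus) (auto simp: EI K_def)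
 finally show ?case using elim \<eta>2 by linarith
 qed
 next
 fix e :: real assume "e < 0"
 moreover have "0 <= (LBINT x. f k x)" for k by (rule integral_nonneg_AE) (simp add: f0)
 ultimately show "eventually (%k. e < (LBINT x. f k x)) sequentially"
 by (intro always_eventually allI) (rule order.strict_trans2)
 qed
 then show "(%k. \<integral>x. (u x)^2 * (norm (grad (cutoff k) x))^2 \<partial>lborel) ~> 0" by (simp only: f_def[abs_def])
qed

lemma cutoff_energy_tendsto:
 fixes u :: "real^'n => real"
 assumes D: "Dlim \<Omega> u g" and N: "CARD('n) >= 3"
 shows "(%k. \<integral>x. (norm (cutoff k x *\<^sub>R g x + u x *\<^sub>R grad (cutoff k) x))^2 \<partial>lborel) ~> (LBINT x. (norm (g x))^2)"
proof -
 note [measurable] = Dlim_measurable[OF D]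
 have [measurable]: "grad (cutoff k) \<in> BM" "cutoff k \<in> BM" for k :: nat
 by (rule test_grad_measurable[OF cutoff_props(1)], rule test_measurable[OF cutoff_props(1)])
 have gi: "integrable lborel (%x. (norm (g x))^2)" by (rule Dlim_integrable_q(2)[OF D N])
 have c2: "(cutoff k x)^2 <= 1" for k and x :: "real^'n" using cutoff_props(2,3)[of k x] by (simp add: power_le_one)
 let ?y = "%k x. (u x)^2 * (norm (grad (cutoff k) x))^2" and ?c = "%k x. (cutoff k x)^2 * (norm (g x))^2"
 and ?t = "%k x. 2 * ((cutoff k x *\<^sub>R g x) \<bullet> (u x *\<^sub>R grad (cutoff k) x))"
 define Y where "Y k = (LBINT x. ?y k x)" for k
 note yi = cutoff_grad_tendsto(1)[OF D N]
 have Y: "Y ~> 0" "Y k >= 0" for k unfolding Y_def by (rule cutoff_grad_tendsto(2)[OF D N], rule integral_nonneg_AE) auto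
 have ci: "integrable lborel (?c k)" for k
 by (rule integrable_dom[OF gi]) (auto intro!: mult_left_le_one_le c2)
 have ct: "(%k. \<integral>x. ?c k x \<partial>lborel) ~> (LBINT x. (norm (g x))^2)"
 proof (rule integral_dominated_convergence[where w = "%x. (norm (g x))^2"])
 show "AE x in lborel. (%k. ?c k x) ~> (norm (g x))\<^sup>2"
 proof (rule AE_I2)
 fix x
 have "(%k. ?c k x) ~> 1\<^sup>2 * (norm (g x))^2" by (intro tendsto_intros cutoff_props(5))
 then show "(%k. ?c k x) ~> (norm (g x))\<^sup>2" by simp
 qed
 qed (auto intro!: mult_left_le_one_le c2 gi)
 have tb: "\<bar>?t k x\<bar> <= s * (norm (g x))^2 + ?y k x / s" if s: "s > 0" for k x s
 proof -
 have "\<bar>?t k x\<bar> = 2 * (cutoff k x * \<bar>u x\<bar> * \<bar>g x \<bullet> grad (cutoff k) x\<bar>)"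
 using cutoff_props(2)[of k x] by (simp add: abs_mult mult_ac)
 also have "\<dots> <= 2 * (1 * \<bar>u x\<bar> * (norm (g x) * norm (grad (cutoff k) x)))"
 by (intro mult_left_mono mult_mono Cauchy_Schwarz_ineq2 cutoff_props) auto
 also have "\<dots> = 2 * (sqrt s * norm (g x)) * (\<bar>u x\<bar> * norm (grad (cutoff k) x) / sqrt s)" using s by simp
 also have "\<dots> <= (sqrt s * norm (g x))^2 + (\<bar>u x\<bar> * norm (grad (cutoff k) x) / sqrt s)^2" by (rule sum_squares_bound)
 also have "\<dots> = s * (norm (g x))^2 + ?y k x / s" using s by (simp add: power_mult_distrib power_divide)
 finally show ?thesis .
 qed
 have ti: "integrable lborel (?t k)" for k
 by (rule integrable_dom[OF integrable_plus[OF gi yi[of k]]])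
 (use tb[of 1 k] in auto)
 have tt: "(%k. \<integral>x. ?t k x \<partial>lborel) ~> 0"
 proof (rule tendsto_0_le[where K = 1])
 \<comment> \<open>Balances the two terms of \<open>tb\<close>: for s about sqrt Y both s and Y/s
   tend to 0. The summand 1/(k+1) keeps s positive when Y vanishes.\<close>
 define s where "s k = sqrt (Y k) + 1 / (real k + 1)" for k
 have s: "s k > 0" for k unfolding s_def by (intro add_nonneg_pos) (auto simp: Y)
 have s0: "s ~> sqrt 0 + 0" unfolding s_def[abs_def] by (intro tendsto_intros Y) real_asymp
 have sA: "(%k. s k * (LBINT x. (norm (g x))^2) + sqrt (Y k)) ~> (sqrt 0 + 0) * (LBINT x. (norm (g x))^2) + sqrt 0"
 by (intro tendsto_intros s0 Y)
 then show "(%k. s k * (LBINT x. (norm (g x))^2) + sqrt (Y k)) ~> 0" by simp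
 have "\<bar>\<integral>x. ?t k x \<partial>lborel\<bar> <= s k * (LBINT x. (norm (g x))^2) + sqrt (Y k)" for k
 proof -
 have "\<bar>\<integral>x. ?t k x \<partial>lborel\<bar> <= (LBINT x. \<bar>?t k x\<bar>)" by (rule integral_abs_bound)
 also have "\<dots> <= (LBINT x. s k * (norm (g x))^2 + ?y k x / s k)"
 using ti yi gi s by (intro integral_mono tb) (auto simp: integrable_abs)
 also have "\<dots> = s k * (LBINT x. (norm (g x))^2) + Y k / s k"
 unfolding Y_def using yi gi by (subst integral_plus) auto
 also have "Y k / s k <= sqrt (Y k)"
 proof -
 have "Y k = sqrt (Y k) * sqrt (Y k)" using Y(2) by simp
 also have "\<dots> <= sqrt (Y k) * s k" unfolding s_def by (intro mult_left_mono) (auto simp: Y)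
 finally show ?thesis using s[of k] by (simp add: field_simps)
 qed
 finally show ?thesis by simp
 qed
 then show "\<forall>\<^sub>F k in sequentially. norm (LBINT x. ?t k x) <= norm (s k * (LBINT x. (norm (g x))^2) + sqrt (Y k)) * 1"
 by (intro always_eventually) (auto intro: order_trans[OF _ abs_ge_self])
 qed
 have "(LBINT x. (norm (cutoff k x *\<^sub>R g x + u x *\<^sub>R grad (cutoff k) x))^2)
 = (LBINT x. ?c k x) + (LBINT x. ?t k x) + Y k" for k
 proof -
 have "(norm (cutoff k x *\<^sub>R g x + u x *\<^sub>R grad (cutoff k) x))^2 = ?c k x + ?t k x + ?y k x" for x
 unfolding power2_norm_eq_inner by (simp add: power2_eq_square algebra_simps inner_commute)
 then show ?thesis unfolding Y_def using ci ti yi by (simp del: inner_scaleR_left inner_scaleR_right)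
 qed
 moreover have "(%k. (LBINT x. ?c k x) + (LBINT x. ?t k x) + Y k) ~> (LBINT x. (norm (g x))^2) + 0 + 0"
 by (intro tendsto_intros ct tt Y)
 ultimately show ?thesis by simp
qed

section \<open>The critical dilation\<close>

lemma integral_scale:
 fixes f :: "real^'n => real" and x0 :: "real^'n"
 assumes [measurable]: "f \<in> BM" and f0: "!!x. f x >= 0" and c: "\<kappa> > 0"
 shows "(LBINT x. f ((1 / \<kappa>) *\<^sub>R (x - x0))) = \<kappa> ^ CARD('n) * (LBINT x. f x)"
proof -
 have "(NN x. ennreal (f ((1 / \<kappa>) *\<^sub>R (x - x0)))) = ennreal (\<kappa> ^ CARD('n)) * (NN x. ennreal (f x))"
 using c by (subst nn_integral_scale[OF _ c, where t = x0]) auto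
 then show ?thesis using c f0 by (simp add: integral_eq_nn_integral enn2real_mult)
qed

text \<open>The exponent in c is the one for which, with q the critical exponent, c^q \<kappa>^N = 1
  and (c/\<kappa>)^2 \<kappa>^N = 1 hold at once, so all three kinds of integrals are preserved.
  Centring at a fixed point of G keeps equivariance.\<close>

lemma critical_scaling:
 fixes x0 :: "real^'n" and V :: "nat => real^'n => real"
 assumes N: "CARD('n) >= 3" and V: "adm G \<phi> l (ball 0 R) V H" and k: "\<kappa> > 0"
 and x0: "!!g. g \<in> G ==> g *v x0 = x0" and sub: "ball x0 (\<kappa> * R) \<subseteq> \<Omega>"
 defines "c \<equiv> \<kappa> powr (- (real CARD('n) - 2) / 2)"
 defines "W \<equiv> (%i x. c * V i ((1 / \<kappa>) *\<^sub>R (x - x0)))" and "K \<equiv> (%i x. (c / \<kappa>) *\<^sub>R H i ((1 / \<kappa>) *\<^sub>R (x - x0)))"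
 shows "adm G \<phi> l \<Omega> W K" "i \<in> {1..l} ==> aa K i = aa H i" "i \<in> {1..l} ==> bb W i = bb V i"
 "i \<in> {1..l} ==> j \<in> {1..l} ==> dd W i j = dd V i j"
proof -
 define p where "p = crit_exp CARD('n) / 2"
 have q: "crit_exp CARD('n) = p + p" by (simp add: p_def)
 have N0: "real CARD('n) - 2 > 0" using N by simp
 have c: "c > 0" using k by (simp add: c_def)
 have D: "Dlim (ball 0 R) (V i) (H i)" if "i \<in> {1..l}" for i using V that by (auto simp: adm_def)
 note m = Dlim_measurable[OF D]
 have cp: "c powr p * c powr p * \<kappa> ^ CARD('n) = 1"
 proof -
 have "c powr p * c powr p = \<kappa> powr (- (real CARD('n) - 2) / 2 * (p + p))"
 by (simp only: powr_add[symmetric] c_def powr_powr distrib_left)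
 also have "- (real CARD('n) - 2) / 2 * (p + p) = - real CARD('n)"
 proof -
 have "(real CARD('n) - 2) * (p + p) = 2 * real CARD('n)" unfolding q[symmetric] crit_exp_def using N0 by simp
 then show ?thesis by (simp add: algebra_simps)
 qed
 finally show ?thesis using k by (simp add: powr_minus powr_realpow)
 qed
 have c2: "(c / \<kappa>)^2 * \<kappa> ^ CARD('n) = 1"
 proof -
 have "c\<^sup>2 = c powr 2" using c by simp
 also have "\<dots> = \<kappa> powr (2 - real CARD('n))"
 proof -
 have "- (real CARD('n) - 2) / 2 * 2 = 2 - real CARD('n)" by simp
 then show ?thesis unfolding c_def powr_powr by (simp only:)
 qed
 also have "\<dots> = \<kappa>\<^sup>2 / \<kappa> ^ CARD('n)" using k by (simp add: powr_diff powr_realpow)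
 finally show ?thesis using k by (simp add: power_divide)
 qed
 have "Dlim \<Omega> (W i) (K i)" if i: "i \<in> {1..l}" for i
 proof -
 have "Dlim \<Omega> (%x. c * V i ((1 / \<kappa>) *\<^sub>R x + - ((1 / \<kappa>) *\<^sub>R x0))) (%x. c *\<^sub>R (1 / \<kappa>) *\<^sub>R H i ((1 / \<kappa>) *\<^sub>R x + - ((1 / \<kappa>) *\<^sub>R x0)))"
 proof (rule Dlim_affine[where A = "(*\<^sub>R) (1 / \<kappa>)" and B = "(*\<^sub>R) \<kappa>" and A' = "(*\<^sub>R) (1 / \<kappa>)" and C = "\<kappa> ^ CARD('n)", OF D[OF i] N])
 show "x \<in> \<Omega>" if "(1 / \<kappa>) *\<^sub>R x + - ((1 / \<kappa>) *\<^sub>R x0) \<in> ball 0 R" for x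
 proof -
 have "norm ((1 / \<kappa>) *\<^sub>R (x - x0)) < R" using that by (simp add: algebra_simps)
 then have "norm (x - x0) / \<kappa> < R" using k by simp
 then have "norm (x - x0) < \<kappa> * R" using k by (simp add: field_simps)
 then show ?thesis using sub by (auto simp: dist_norm norm_minus_commute)
 qed
 show "(NN x. F ((1 / \<kappa>) *\<^sub>R x + - ((1 / \<kappa>) *\<^sub>R x0))) = ennreal (\<kappa> ^ CARD('n)) * (NN x. F x)" if "F \<in> BM" for F
 using that k by (subst nn_integral_scale[OF _ k, where t = x0]) (auto simp: algebra_simps)
 qed (use k in \<open>auto intro!: linearI simp: algebra_simps\<close>)
 then show ?thesis by (simp add: W_def K_def algebra_simps)
 qed
 moreover have "AE x in lborel. \<forall>i\<in>{1..l}. W i (g *v x) = W (\<phi> g i) x" if g: "g \<in> G" for g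
 proof -
 have "AE x in lborel. \<forall>i\<in>{1..l}. V i (g *v x) = V (\<phi> g i) x" using V g by (auto simp: adm_def)
 from AE_scale[OF _ this, of "1 / \<kappa>" "- ((1 / \<kappa>) *\<^sub>R x0)"] k
 have "AE x in lborel. \<forall>i\<in>{1..l}. V i (g *v (- ((1 / \<kappa>) *\<^sub>R x0) + (1 / \<kappa>) *\<^sub>R x)) = V (\<phi> g i) (- ((1 / \<kappa>) *\<^sub>R x0) + (1 / \<kappa>) *\<^sub>R x)" by simp
 then show ?thesis
 proof eventually_elim
 case (elim x)
 have e: "- ((1 / \<kappa>) *\<^sub>R x0) + (1 / \<kappa>) *\<^sub>R x = (1 / \<kappa>) *\<^sub>R (x - x0)" by (simp add: algebra_simps)
 moreover have "g *v (- ((1 / \<kappa>) *\<^sub>R x0) + (1 / \<kappa>) *\<^sub>R x) = (1 / \<kappa>) *\<^sub>R (g *v x - x0)"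
 unfolding e using x0[OF g] by (simp only: matrix_vector_mult_scaleR matrix_vector_mult_diff_distrib)
 ultimately show ?case using elim by (simp add: W_def)
 qed
 qed
 ultimately show "adm G \<phi> l \<Omega> W K" by (simp add: adm_def)
 show "aa K i = aa H i" if i: "i \<in> {1..l}"
 proof -
 note [measurable] = m[OF i]
 show ?thesis using integral_scale[of "%x. (norm (H i x))^2" \<kappa> x0] k c2 c
 by (simp add: aa_def K_def power_mult_distrib power_divide)
 qed
 have dW: "dd W i j = dd V i j" if ij: "i \<in> {1..l}" "j \<in> {1..l}" for i j
 proof -
 note [measurable] = m[OF ij(1)] m[OF ij(2)]
 have "\<bar>W i x\<bar> powr p * \<bar>W j x\<bar> powr p = (c powr p * c powr p) *
 (\<bar>V i ((1 / \<kappa>) *\<^sub>R (x - x0))\<bar> powr p * \<bar>V j ((1 / \<kappa>) *\<^sub>R (x - x0))\<bar> powr p)" for x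
 unfolding W_def using c by (simp add: abs_mult powr_mult)
 then show ?thesis using integral_scale[of "%x. \<bar>V i x\<bar> powr p * \<bar>V j x\<bar> powr p" \<kappa> x0] k cp
 by (simp add: dd_def p_def[symmetric])
 qed
 then show "i \<in> {1..l} ==> j \<in> {1..l} ==> dd W i j = dd V i j" .
 have "bb U i = dd U i i" for U :: "nat => real^'n => real" and i
 unfolding bb_def dd_def by (simp add: powr_add[symmetric])
 then show "i \<in> {1..l} ==> bb W i = bb V i" using dW by simp
qed

lemma Nehari_localize:
 fixes u :: "real^'n => nat => real"
 assumes \<Omega>: "open \<Omega>" and N: "CARD('n) >= 3" and G: "orth_closed G" and P: "perms G \<phi> l" and \<beta>: "\<beta> < 0"
 and x0: "x0 \<in> \<Omega>" "!!g. g \<in> G ==> g *v x0 = x0" and u: "u \<in> Nehari G \<phi> l \<beta> UNIV" and e: "e > 0"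
 shows "\<exists>w\<in>Nehari G \<phi> l \<beta> \<Omega>. J \<beta> l \<Omega> w <= J \<beta> l UNIV u + e"
proof -
 define q where "q = crit_exp CARD('n)"
 have q: "q > 2" using crit_exp_gt(1)[OF N] by (simp add: q_def)
 obtain U Gr where U: "adm G \<phi> l UNIV U Gr" "!!i. i \<in> {1..l} ==> \<not> (AE x in lborel. U i x = 0)"
 "!!i. i \<in> {1..l} ==> aa Gr i - bb U i - \<beta> * (\<Sum>j\<in>{1..l} - {i}. dd U i j) = 0"
 "J \<beta> l UNIV u = Jc l \<beta> q (aa Gr) (bb U) (dd U)"
 using Nehari_adm[OF open_UNIV N _ G P u] by (auto simp: G_invariant_def q_def)
 have D: "Dlim UNIV (U i) (Gr i)" if "i \<in> {1..l}" for i using U(1) that by (auto simp: adm_def)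
 have [measurable]: "cutoff k \<in> BM" for k :: nat by (rule test_measurable[OF cutoff_props(1)])
 define V where "V k i x = cutoff k x * U i x" for k i x
 define H where "H k i x = cutoff k x *\<^sub>R Gr i x + U i x *\<^sub>R grad (cutoff k) x" for k i x
 have V: "adm G \<phi> l (ball 0 (real k + 2)) (V k) (H k)" for k
 unfolding adm_def
 proof (intro conjI ballI)
 show "Dlim (ball 0 (real k + 2)) (V k i) (H k i)" if "i \<in> {1..l}" for i
 using Dlim_mult_test[OF D[OF that] cutoff_props(1)[of k] N] by (simp add: V_def[abs_def] H_def[abs_def])
 show "AE x in lborel. \<forall>i\<in>{1..l}. V k i (g *v x) = V k (\<phi> g i) x" if g: "g \<in> G" for g
 proof -
 have "AE x in lborel. \<forall>i\<in>{1..l}. U i (g *v x) = U (\<phi> g i) x" using U(1) g by (auto simp: adm_def)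
 then show ?thesis by eventually_elim (simp add: V_def cutoff_props(4)[OF orthD[OF G g]])
 qed
 qed
 have la: "(%k. aa (H k) i) ~> aa Gr i" if "i \<in> {1..l}" for i
 unfolding aa_def H_def by (rule cutoff_energy_tendsto[OF D[OF that] N])
 have cc: "\<bar>cutoff k x\<bar> <= 1" "0 <= cutoff k x" for k and x :: "real^'n" using cutoff_props(2,3)[of k x] by auto
 have ld: "(%k. dd (V k) i j) ~> dd U i j" if ij: "i \<in> {1..l}" "j \<in> {1..l}" for i j
 proof -
 note [measurable] = Dlim_measurable[OF D[OF ij(1)]] Dlim_measurable[OF D[OF ij(2)]]
 let ?w = "%x. \<bar>U i x\<bar> powr (q / 2) * \<bar>U j x\<bar> powr (q / 2)"
 have e: "\<bar>V k i x\<bar> powr (q / 2) * \<bar>V k j x\<bar> powr (q / 2) = cutoff k x powr q * ?w x" for k x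
 using cutoff_props(2)[of k x] by (simp add: V_def abs_mult powr_mult mult_ac powr_add[symmetric])
 have "(%k. \<integral>x. cutoff k x powr q * ?w x \<partial>lborel) ~> (LBINT x. ?w x)"
 proof (rule integral_dominated_convergence[where w = ?w])
 show "AE x in lborel. (%k. cutoff k x powr q * ?w x) ~> ?w x"
 proof (rule AE_I2)
 fix x
 have "(%k. cutoff k x powr q * ?w x) ~> 1 powr q * ?w x" by (intro tendsto_intros cutoff_props(5)) auto
 then show "(%k. cutoff k x powr q * ?w x) ~> ?w x" by simp
 qed
 show "integrable lborel ?w" unfolding q_def by (rule coupling_integrable[OF D[OF ij(1)] D[OF ij(2)] N])
 show "AE x in lborel. norm (cutoff k x powr q * ?w x) <= ?w x" for k
 using cc q by (intro AE_I2) (auto simp: abs_mult intro!: mult_left_le_one_le powr_le1)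
 qed auto
 then show ?thesis unfolding dd_def e[unfolded q_def] unfolding q_def .
 qed
 have bd: "bb U i = dd U i i" for U :: "nat => real^'n => real" and i
 unfolding bb_def dd_def by (simp add: powr_add[symmetric])
 have lb: "(%k. bb (V k) i) ~> bb U i" if "i \<in> {1..l}" for i unfolding bd by (rule ld[OF that that])
 obtain r where r: "r > 0" "ball x0 r \<subseteq> \<Omega>" using \<Omega> x0(1) openE by blast
 \<comment> \<open>The cut-off functions live in the ball of radius k + 2; this factor shrinks it to
   the ball of radius r around x0.\<close>
 define \<kappa> where "\<kappa> k = r / (real k + 2)" for k
 have k: "\<kappa> k > 0" "ball x0 (\<kappa> k * (real k + 2)) \<subseteq> \<Omega>" for k using r by (auto simp: \<kappa>_def)
 define c where "c k = \<kappa> k powr (- (real CARD('n) - 2) / 2)" for k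
 define W where "W k = (%i x. c k * V k i ((1 / \<kappa> k) *\<^sub>R (x - x0)))" for k
 define K where "K k = (%i x. (c k / \<kappa> k) *\<^sub>R H k i ((1 / \<kappa> k) *\<^sub>R (x - x0)))" for k
 note Sc = critical_scaling[OF N V k(1) x0(2) k(2), folded c_def, folded W_def K_def]
 define S where "S = (\<Sum>i\<in>{1..l}. aa Gr i)"
 define C where "C = 1 / 2 - 1 / q"
 have C: "C > 0" using q by (simp add: C_def field_simps)
 have Ju: "J \<beta> l UNIV u = C * S" unfolding U(4) C_def S_def by (rule Jc_Nehari[OF U(3)])
 \<comment> \<open>\<delta> bounds both the deviation of the factors t_i from 1 and that of the
   total gradient integral from its limit S; as \<delta> -> 0 the resulting energy bound tends to C
   S.\<close>
 have "((%\<delta>. C * ((1 + \<delta>)^2 * (S + \<delta>))) \<longlongrightarrow> C * ((1 + 0)^2 * (S + 0))) (at_right 0)" by (intro tendsto_intros)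
 then have "eventually (%\<delta>. C * ((1 + \<delta>)^2 * (S + \<delta>)) < C * S + e) (at_right 0)"
 by (rule order_tendstoD(2)) (use e in simp)
 moreover have "eventually (%\<delta>::real. \<delta> < 1) (at_right 0)" by (rule order_tendstoD(2)[OF tendsto_ident_at]) simp
 moreover have "eventually (%\<delta>::real. \<delta> > 0) (at_right 0)" by (rule eventually_at_right_less)
 ultimately have "eventually (%\<delta>. 0 < \<delta> \<and> \<delta> < 1 \<and> C * ((1 + \<delta>)^2 * (S + \<delta>)) < C * S + e) (at_right 0)"
 by eventually_elim auto
 then obtain \<delta> where \<delta>: "0 < \<delta>" "\<delta> < 1" "C * ((1 + \<delta>)^2 * (S + \<delta>)) < C * S + e"
 using eventually_happens'[OF trivial_limit_at_right_real] by blast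
 have la': "(%k. aa (K k) i) ~> aa Gr i" if "i \<in> {1..l}" for i using la[OF that] Sc(2)[OF _ that] by simp
 have lb': "(%k. bb (W k) i) ~> bb U i" if "i \<in> {1..l}" for i using lb[OF that] Sc(3)[OF _ that] by simp
 have ld': "(%k. dd (W k) i j) ~> dd U i j" if "i \<in> {1..l}" "j \<in> {1..l}" for i j using ld[OF that] Sc(4)[OF _ that] by simp
 have "eventually (%k. (\<Sum>i\<in>{1..l}. aa (K k) i) < S + \<delta>) sequentially"
 by (rule order_tendstoD(2)[where y = S]) (use \<delta> la' in \<open>auto simp: S_def intro!: tendsto_sum\<close>)
 moreover have "\<forall>\<^sub>F k in sequentially. \<exists>t. (\<forall>i\<in>{1..l}. 1 - \<delta> <= t i \<and> t i <= 1 + \<delta>) \<and>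
 (\<exists>w\<in>Nehari G \<phi> l \<beta> \<Omega>. J \<beta> l \<Omega> w = C * (\<Sum>i\<in>{1..l}. (t i)\<^sup>2 * aa (K k) i))" unfolding C_def q_def
 by (rule eventually_mono, rule project_Nehari[where F = sequentially, OF \<Omega> N G P \<beta> Sc(1) \<delta>(1,2) la' lb' ld' adm_positive[OF N U(1) _ U(2)] U(3)], assumption+, blast)
 ultimately have "\<forall>\<^sub>F k in sequentially. \<exists>w\<in>Nehari G \<phi> l \<beta> \<Omega>. J \<beta> l \<Omega> w <= J \<beta> l UNIV u + e"
 proof eventually_elim
 case (elim k)
 then obtain t w where t: "!!i. i \<in> {1..l} ==> 1 - \<delta> <= t i \<and> t i <= 1 + \<delta>" and w: "w \<in> Nehari G \<phi> l \<beta> \<Omega>"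
 "J \<beta> l \<Omega> w = C * (\<Sum>i\<in>{1..l}. (t i)\<^sup>2 * aa (K k) i)" by blast
 have "(t i)^2 * aa (K k) i <= (1 + \<delta>)^2 * aa (K k) i" if "i \<in> {1..l}" for i
 proof -
 have "aa (K k) i >= 0" unfolding aa_def by (rule integral_nonneg_AE) simp
 moreover have "(t i)^2 <= (1 + \<delta>)^2" using t[OF that] \<delta> by (intro power_mono) auto
 ultimately show ?thesis by (rule mult_right_mono[rotated])
 qed
 then have "(\<Sum>i\<in>{1..l}. (t i)\<^sup>2 * aa (K k) i) <= (1 + \<delta>)^2 * (\<Sum>i\<in>{1..l}. aa (K k) i)"
 unfolding sum_distrib_left by (rule sum_mono)
 also have "\<dots> <= (1 + \<delta>)^2 * (S + \<delta>)" using elim(1) by (intro mult_left_mono) auto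
 finally have "J \<beta> l \<Omega> w <= C * ((1 + \<delta>)^2 * (S + \<delta>))" unfolding w(2) using C by (intro mult_left_mono) auto
 then show ?case using \<delta>(3) w(1) unfolding Ju by (intro bexI[of _ w]) auto
 qed
 then show ?thesis by simp
qed

section \<open>The Euler-Lagrange equation\<close>

lemma abs_powr_deriv:
 fixes p x :: real
 assumes p: "p > 1"
 shows "((%x. \<bar>x\<bar> powr p) has_real_derivative p * (sgn x * \<bar>x\<bar> powr (p - 1))) (at x)"
proof (cases "x = 0")
 case True
 have "((%h. \<bar>h\<bar> powr (p - 1)) \<longlongrightarrow> 0 powr (p - 1)) (at (0::real))"
 using p by (intro tendsto_powr') (use tendsto_rabs[OF tendsto_ident_at, of "0::real" UNIV] in auto)
 then have "((%h. \<bar>h\<bar> powr (p - 1)) \<longlongrightarrow> 0) (at (0::real))" by simp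
 from tendsto_0_le[OF this always_eventually, of "%h. sgn h * \<bar>h\<bar> powr (p - 1)" 1]
 have L: "((%h. sgn h * \<bar>h\<bar> powr (p - 1)) \<longlongrightarrow> 0) (at (0::real))"
 by (simp add: abs_mult sgn_if)
 have e: "(\<bar>h\<bar> powr p) / h = sgn h * \<bar>h\<bar> powr (p - 1)" if "h ~= 0" for h :: real
 using that by (auto simp: powr_diff sgn_if field_simps)
 have "((%h. (\<bar>h\<bar> powr p) / h) \<longlongrightarrow> 0) (at (0::real))"
 by (rule LIM_cong[OF refl e refl, THEN iffD2, OF _ L])
 then show ?thesis using True by (simp add: has_field_derivative_iff)
next
 case False
 have "((%x. \<bar>x\<bar>) has_real_derivative sgn x) (at x)"
 proof (cases "x > 0")
 case True
 have "((%x. x) has_real_derivative 1) (at x)" by (rule DERIV_ident)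
 then have "((%x. \<bar>x\<bar>) has_real_derivative 1) (at x)"
 by (rule has_field_derivative_transform_within_open[OF _ open_greaterThan[of 0]]) (use True in auto)
 then show ?thesis using True by simp
 next
 case F: False
 have "((%x. - x) has_real_derivative - 1) (at x)" by (rule DERIV_minus[OF DERIV_ident])
 then have "((%x. \<bar>x\<bar>) has_real_derivative - 1) (at x)"
 by (rule has_field_derivative_transform_within_open[OF _ open_lessThan[of 0]]) (use False F in auto)
 then show ?thesis using False F by simp
 qed
 from DERIV_chain2[OF has_real_derivative_powr this, of p] False show ?thesis by (simp add: mult_ac)
qed

text \<open>|a|^(p-2) a |b|^p with the sign split off: the exponent p - 1 is positive and the value
  at a = 0 is 0, as the convention for the system demands.\<close>

definition kk :: "real => real => real => real" where
 "kk p a b = sgn a * \<bar>a\<bar> powr (p - 1) * \<bar>b\<bar> powr p"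

lemma kk_measurable [measurable]:
 assumes [measurable]: "f \<in> borel_measurable M" "g \<in> borel_measurable M"
 shows "(%x. kk p (f x) (g x)) \<in> borel_measurable M"
 unfolding kk_def by measurable

lemma kk_le: "p > 1 ==> \<bar>a\<bar> <= s ==> \<bar>b\<bar> <= s ==> \<bar>kk p a b\<bar> <= s powr (2 * p - 1)"
proof -
 assume h: "p > 1" "\<bar>a\<bar> <= s" "\<bar>b\<bar> <= s"
 have "\<bar>kk p a b\<bar> <= s powr (p - 1) * s powr p"
 unfolding kk_def abs_mult using h
 by (cases "a = 0") (auto simp: abs_sgn_eq intro!: mult_mono powr_mono2)
 then show ?thesis by (simp add: powr_add[symmetric])
qed

lemma kk_mult_le:
 assumes p: "p > 1" and s: "\<bar>a\<bar> <= s" "\<bar>b\<bar> <= s" "\<bar>c\<bar> <= s"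
 shows "\<bar>kk p a b * c\<bar> <= s powr (2 * p)"
proof -
 have "\<bar>kk p a b * c\<bar> <= s powr (2 * p - 1) * s powr 1"
 unfolding abs_mult using kk_le[OF p s(1,2)] s by (intro mult_mono) auto
 then show ?thesis by (simp only: powr_add[symmetric]) simp
qed

lemma sum4_powr_le:
 fixes a b c d q :: real
 assumes "a >= 0" "b >= 0" "c >= 0" "d >= 0" "q > 0"
 shows "(a + b + (c + d)) powr q <= 4 powr q * (a powr q + b powr q + (c powr q + d powr q))"
proof -
 have "\<bar>a + b + (c + d)\<bar> powr q <= 2 powr q * (2 powr q * (\<bar>a\<bar> powr q + \<bar>b\<bar> powr q) + 2 powr q * (\<bar>c\<bar> powr q + \<bar>d\<bar> powr q))"
 by (rule order_trans[OF powr_add_le[OF assms(5)]]) (intro mult_left_mono add_mono powr_add_le assms, simp)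
 also have "\<dots> = (2 powr q * 2 powr q) * (a powr q + b powr q + (c powr q + d powr q))"
 using assms by (simp add: algebra_simps)
 also have "2 powr q * 2 powr q = (4::real) powr q" by (simp flip: powr_mult)
 finally show ?thesis using assms by simp
qed

lemma sum4_integrable:
 fixes u :: "real^'n => real"
 assumes N: "CARD('n) >= 3" and D: "Dlim \<Omega>1 u g1" "Dlim \<Omega>2 v g2" "Dlim \<Omega>3 \<psi> g3" "Dlim \<Omega>4 \<zeta> g4" and B: "B >= 0"
 shows "integrable lborel (%x. (\<bar>u x\<bar> + B * \<bar>\<psi> x\<bar> + (\<bar>v x\<bar> + B * \<bar>\<zeta> x\<bar>)) powr crit_exp CARD('n))"
proof (rule integrable_dom[where f = "%x. 4 powr crit_exp CARD('n) * (\<bar>u x\<bar> powr crit_exp CARD('n) + B powr crit_exp CARD('n) * \<bar>\<psi> x\<bar> powr crit_exp CARD('n)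
 + (\<bar>v x\<bar> powr crit_exp CARD('n) + B powr crit_exp CARD('n) * \<bar>\<zeta> x\<bar> powr crit_exp CARD('n)))"])
 note [measurable] = D[THEN Dlim_measurable(1)]
 show "(%x. (\<bar>u x\<bar> + B * \<bar>\<psi> x\<bar> + (\<bar>v x\<bar> + B * \<bar>\<zeta> x\<bar>)) powr crit_exp CARD('n)) \<in> borel_measurable lborel" by measurable
 show "AE x in lborel. norm ((\<bar>u x\<bar> + B * \<bar>\<psi> x\<bar> + (\<bar>v x\<bar> + B * \<bar>\<zeta> x\<bar>)) powr crit_exp CARD('n))
 <= norm (4 powr crit_exp CARD('n) * (\<bar>u x\<bar> powr crit_exp CARD('n) + B powr crit_exp CARD('n) * \<bar>\<psi> x\<bar> powr crit_exp CARD('n)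
 + (\<bar>v x\<bar> powr crit_exp CARD('n) + B powr crit_exp CARD('n) * \<bar>\<zeta> x\<bar> powr crit_exp CARD('n))))" (is "AE x in lborel. ?P x")
 proof (rule AE_I2)
 fix x
 have "crit_exp CARD('n) > 0" using crit_exp_gt(1)[OF N] by simp
 then show "?P x" using sum4_powr_le[of "\<bar>u x\<bar>" "B * \<bar>\<psi> x\<bar>" "\<bar>v x\<bar>" "B * \<bar>\<zeta> x\<bar>" "crit_exp CARD('n)"] B
 by (simp add: powr_mult)
 qed
qed (intro integrable_mult_right integrable_plus D[THEN Dlim_integrable_q(1)[OF _ N]])

lemma kk_integrable:
 fixes u :: "real^'n => real"
 assumes N: "CARD('n) >= 3" and D: "Dlim \<Omega>1 u g1" "Dlim \<Omega>2 v g2" "Dlim \<Omega>3 \<psi> g3"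
 shows "integrable lborel (%x. kk (crit_exp CARD('n) / 2) (u x) (v x) * \<psi> x)"
proof (rule integrable_dom[OF sum4_integrable[OF N D(1,2,3,3), of 1]])
 note [measurable] = D[THEN Dlim_measurable(1)]
 show "(%x. kk (crit_exp CARD('n) / 2) (u x) (v x) * \<psi> x) \<in> borel_measurable lborel" by measurable
 have p: "crit_exp CARD('n) / 2 > 1" using crit_exp_gt(1)[OF N] by simp
 show "AE x in lborel. norm (kk (crit_exp CARD('n) / 2) (u x) (v x) * \<psi> x) <= norm ((\<bar>u x\<bar> + 1 * \<bar>\<psi> x\<bar> + (\<bar>v x\<bar> + 1 * \<bar>\<psi> x\<bar>)) powr crit_exp CARD('n))"
 (is "AE x in lborel. ?P x")
 proof (rule AE_I2)
 fix x
 show "?P x" using kk_mult_le[OF p, of "u x" "\<bar>u x\<bar> + 1 * \<bar>\<psi> x\<bar> + (\<bar>v x\<bar> + 1 * \<bar>\<psi> x\<bar>)" "v x" "\<psi> x"] by simp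
 qed
qed simp

text \<open>Differentiation under the integral along sequences \<epsilon> -> 0. If B bounds the
  sequence, the derivative of the integrand is dominated by a multiple of s^q, where q is the
  critical exponent and s = |u| + B|\<psi>| + |v| + B|\<zeta>|. The diagonal case v = u gives the
  power terms.\<close>

lemma dd_deriv:
 fixes u :: "real^'n => real"
 assumes N: "CARD('n) >= 3" and D: "Dlim \<Omega>1 u g1" "Dlim \<Omega>2 v g2" "Dlim \<Omega>3 \<psi> g3" "Dlim \<Omega>4 \<zeta> g4"
 defines "p \<equiv> crit_exp CARD('n) / 2"
 shows "((%\<epsilon>. \<integral>x. \<bar>u x + \<epsilon> * \<psi> x\<bar> powr p * \<bar>v x + \<epsilon> * \<zeta> x\<bar> powr p \<partial>lborel) has_real_derivative
 p * ((LBINT x. kk p (u x) (v x) * \<psi> x) + (LBINT x. kk p (v x) (u x) * \<zeta> x))) (at 0)"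
proof -
 have p: "p > 1" "2 * p = crit_exp CARD('n)" using crit_exp_gt(1)[OF N] by (auto simp: p_def)
 note [measurable] = D[THEN Dlim_measurable(1)]
 define h where "h x \<epsilon> = \<bar>u x + \<epsilon> * \<psi> x\<bar> powr p * \<bar>v x + \<epsilon> * \<zeta> x\<bar> powr p" for x \<epsilon>
 define h' where "h' x \<epsilon> = p * (kk p (u x + \<epsilon> * \<psi> x) (v x + \<epsilon> * \<zeta> x) * \<psi> x + kk p (v x + \<epsilon> * \<zeta> x) (u x + \<epsilon> * \<psi> x) * \<zeta> x)" for x \<epsilon>
 have hd: "(h x has_real_derivative h' x \<epsilon>) (at \<epsilon>)" for x \<epsilon>
 proof -
 have c: "((%\<epsilon>. \<bar>a + \<epsilon> * b\<bar> powr p) has_real_derivative p * (sgn (a + \<epsilon> * b) * \<bar>a + \<epsilon> * b\<bar> powr (p - 1)) * b) (at \<epsilon>)" for a b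
 by (rule DERIV_chain2[OF abs_powr_deriv[OF p(1)]]) (auto intro!: derivative_eq_intros)
 show ?thesis unfolding h_def[abs_def] h'_def
 by (rule DERIV_cong[OF DERIV_mult[OF c c]]) (simp add: kk_def algebra_simps)
 qed
 have hm [measurable]: "(%x. h x \<epsilon>) \<in> BM" for \<epsilon> unfolding h_def by measurable
 have hi: "integrable lborel (%x. h x \<epsilon>)" for \<epsilon>
 proof -
 have "Dlim UNIV (%x. u x + \<epsilon> * \<psi> x) (%x. g1 x + \<epsilon> *\<^sub>R g3 x)" "Dlim UNIV (%x. v x + \<epsilon> * \<zeta> x) (%x. g2 x + \<epsilon> *\<^sub>R g4 x)"
 using D by (auto intro!: Dlim_lincomb N intro: Dlim_mono[OF _ subset_UNIV])
 from coupling_integrable[OF this N] show ?thesis by (simp add: h_def p_def)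
 qed
 have "((%\<epsilon>. ((LBINT x. h x \<epsilon>) - (LBINT x. h x 0)) / \<epsilon>) \<longlongrightarrow> (LBINT x. h' x 0)) (at 0)"
 unfolding tendsto_at_iff_sequentially comp_def
 proof (intro allI impI)
 fix X :: "nat => real" assume X0: "\<forall>i. X i \<in> UNIV - {0}" and X: "X ~> 0"
 obtain B' where B': "!!i. norm (X i) <= B'" using convergent_imp_Bseq[OF convergentI[OF X]] unfolding Bseq_def by blast
 \<comment> \<open>B \<ge> 1 makes |\<psi>| and |\<zeta>| themselves at most s.\<close>
 define B where "B = max 1 B'"
 have B: "B >= 1" "\<bar>X i\<bar> <= B" for i using B'[of i] by (auto simp: B_def)
 let ?s = "%x. \<bar>u x\<bar> + B * \<bar>\<psi> x\<bar> + (\<bar>v x\<bar> + B * \<bar>\<zeta> x\<bar>)"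
 have "(%i. \<integral>x. (h x (X i) - h x 0) / X i \<partial>lborel) ~> (LBINT x. h' x 0)"
 proof (rule integral_dominated_convergence[where w = "%x. 2 * p * ?s x powr crit_exp CARD('n)"])
 show "integrable lborel (%x. 2 * p * ?s x powr crit_exp CARD('n))"
 using B by (intro integrable_mult_right sum4_integrable[OF N D]) auto
 show "AE x in lborel. (%i. (h x (X i) - h x 0) / X i) ~> h' x 0"
 using hd[of _ 0, unfolded has_field_derivative_iff tendsto_at_iff_sequentially comp_def] X0 X by (intro AE_I2) simp
 show "(%x. h' x 0) \<in> borel_measurable lborel" unfolding h'_def by measurable
 show "AE x in lborel. norm ((h x (X i) - h x 0) / X i) <= 2 * p * ?s x powr crit_exp CARD('n)" for i
 proof (rule AE_I2)
 fix x
 have "norm (h' x e) <= 2 * p * ?s x powr crit_exp CARD('n)" if "e \<in> cball 0 \<bar>X i\<bar>" for e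
 proof -
 have e: "\<bar>e\<bar> <= B" using that B(2)[of i] by simp
 have s: "\<bar>u x + e * \<psi> x\<bar> <= ?s x" "\<bar>v x + e * \<zeta> x\<bar> <= ?s x" "\<bar>\<psi> x\<bar> <= ?s x" "\<bar>\<zeta> x\<bar> <= ?s x"
 proof -
 have m: "\<bar>e * z\<bar> <= B * \<bar>z\<bar>" "\<bar>z\<bar> <= B * \<bar>z\<bar>" "0 <= B * \<bar>z\<bar>" for z
 using e B(1) mult_right_mono[OF B(1), of "\<bar>z\<bar>"] by (auto simp: abs_mult intro: mult_right_mono)
 show "\<bar>u x + e * \<psi> x\<bar> <= ?s x" "\<bar>v x + e * \<zeta> x\<bar> <= ?s x" "\<bar>\<psi> x\<bar> <= ?s x" "\<bar>\<zeta> x\<bar> <= ?s x"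
 using m[of "\<psi> x"] m[of "\<zeta> x"] by linarith+
 qed
 have "\<bar>h' x e\<bar> = p * \<bar>kk p (u x + e * \<psi> x) (v x + e * \<zeta> x) * \<psi> x + kk p (v x + e * \<zeta> x) (u x + e * \<psi> x) * \<zeta> x\<bar>"
 using p unfolding h'_def by (subst abs_mult) simp
 also have "\<dots> <= p * (?s x powr (2 * p) + ?s x powr (2 * p))"
 using p by (intro mult_left_mono order_trans[OF abs_triangle_ineq] add_mono kk_mult_le s) auto
 finally show ?thesis unfolding p(2)[symmetric] by (simp add: mult_ac)
 qed
 then have "norm (h x (X i) - h x 0) <= 2 * p * ?s x powr crit_exp CARD('n) * norm (X i - 0)"
 by (rule field_differentiable_bound[OF convex_cball[of 0 "\<bar>X i\<bar>"] has_field_derivative_at_within[OF hd]]) auto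
 then show "norm ((h x (X i) - h x 0) / X i) <= 2 * p * ?s x powr crit_exp CARD('n)"
 using X0 by (simp add: field_simps)
 qed
 qed measurable
 moreover have "(LBINT x. (h x (X i) - h x 0) / X i) = ((LBINT x. h x (X i)) - (LBINT x. h x 0)) / X i" for i
 using hi by simp
 ultimately show "(%i. ((LBINT x. h x (X i)) - (LBINT x. h x 0)) / X i) ~> (LBINT x. h' x 0)" by (simp only:)
 qed
 moreover have "(LBINT x. h' x 0) = p * ((LBINT x. kk p (u x) (v x) * \<psi> x) + (LBINT x. kk p (v x) (u x) * \<zeta> x))"
 using kk_integrable[OF N D(1) D(2) D(3)] kk_integrable[OF N D(2) D(1) D(4)] by (simp add: h'_def p_def)
 ultimately show ?thesis unfolding h_def has_field_derivative_iff by simp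
qed

lemma offdiag_swap:
 fixes f :: "'i => 'i => real"
 assumes "finite I"
 shows "(\<Sum>i\<in>I. \<Sum>j\<in>I - {i}. f j i) = (\<Sum>i\<in>I. \<Sum>j\<in>I - {i}. f i j)"
proof -
 have e: "(\<Sum>j\<in>I - {i}. g j) = (\<Sum>j\<in>I. if i = j then 0 else g j)" if "i \<in> I" for i and g :: "'i => real"
 using assms by (intro sum.mono_neutral_cong_left) auto
 have "(\<Sum>i\<in>I. \<Sum>j\<in>I - {i}. f j i) = (\<Sum>i\<in>I. \<Sum>j\<in>I. if i = j then 0 else f j i)" by (intro sum.cong refl e)
 also have "\<dots> = (\<Sum>j\<in>I. \<Sum>i\<in>I. if i = j then 0 else f j i)" by (rule sum.swap)
 also have "\<dots> = (\<Sum>i\<in>I. \<Sum>j\<in>I. if i = j then 0 else f i j)" by (intro sum.cong refl) auto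
 also have "\<dots> = (\<Sum>i\<in>I. \<Sum>j\<in>I - {i}. f i j)" by (intro sum.cong refl e[symmetric])
 finally show ?thesis .
qed

text \<open>Along the rays \<open>t \<mapsto> (t\<^sub>1 u\<^sub>1, \<dots>, t\<^sub>l u\<^sub>l)\<close> the functional is maximal at a point of the Nehari set; this uses
 \<open>\<beta> < 0\<close> and \<open>2 t\<^sub>i\<^sup>p t\<^sub>j\<^sup>p \<le> t\<^sub>i\<^bsup>2p\<^esup> + t\<^sub>j\<^bsup>2p\<^esup>\<close>.\<close>

lemma Jc_ray_le:
 assumes a: "!!i. i \<in> {1..l} ==> a i >= 0" and d: "!!i j. d i j >= 0" "!!i j. d i j = d j i" and \<beta>: "\<beta> < 0" and p: "p > 1"
 and N: "!!i. i \<in> {1..l} ==> a i - b i - \<beta> * (\<Sum>j\<in>{1..l} - {i}. d i j) = 0" and t: "!!i. i \<in> {1..l} ==> t i > 0"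
 shows "Jc l \<beta> (2 * p) (%i. (t i)^2 * a i) (%i. t i powr (2 * p) * b i) (%i j. (t i powr p * t j powr p) * d i j) <= Jc l \<beta> (2 * p) a b d"
proof -
 let ?q = "2 * p"
 have "(\<Sum>i\<in>{1..l}. \<Sum>j\<in>{1..l} - {i}. (t i powr p * t j powr p) * d i j)
 <= (\<Sum>i\<in>{1..l}. \<Sum>j\<in>{1..l} - {i}. (t i powr ?q * d i j) / 2 + (t j powr ?q * d j i) / 2)"
 proof (intro sum_mono)
 fix i j
 have "2 * (t i powr p * t j powr p) <= (t i powr p)^2 + (t j powr p)^2"
 using sum_squares_bound[of "t i powr p" "t j powr p"] by (simp add: mult.assoc)
 also have "\<dots> = t i powr ?q + t j powr ?q" by (simp add: power2_eq_square powr_add[symmetric])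
 finally have "(t i powr p * t j powr p) * d i j <= ((t i powr ?q + t j powr ?q) / 2) * d i j" by (intro mult_right_mono d) simp
 then show "(t i powr p * t j powr p) * d i j <= (t i powr ?q * d i j) / 2 + (t j powr ?q * d j i) / 2"
 using d(2)[of j i] by (simp add: field_simps)
 qed
 also have "\<dots> = (\<Sum>i\<in>{1..l}. \<Sum>j\<in>{1..l} - {i}. (t i powr ?q * d i j) / 2) + (\<Sum>i\<in>{1..l}. \<Sum>j\<in>{1..l} - {i}. (t j powr ?q * d j i) / 2)"
 by (simp only: sum.distrib)
 also have "\<dots> = (\<Sum>i\<in>{1..l}. t i powr ?q * (\<Sum>j\<in>{1..l} - {i}. d i j))"
 unfolding offdiag_swap[where f = "%i j. (t i powr ?q * d i j) / 2", OF finite_atLeastAtMost]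
 by (simp only: sum_divide_distrib[symmetric] field_sum_of_halves sum_distrib_left)
 finally have s: "(\<Sum>i\<in>{1..l}. \<Sum>j\<in>{1..l} - {i}. (t i powr p * t j powr p) * d i j) <= (\<Sum>i\<in>{1..l}. t i powr ?q * (\<Sum>j\<in>{1..l} - {i}. d i j))" .
 have "Jc l \<beta> ?q (%i. (t i)^2 * a i) (%i. t i powr ?q * b i) (%i j. (t i powr p * t j powr p) * d i j)
 <= 1 / 2 * (\<Sum>i\<in>{1..l}. (t i)\<^sup>2 * a i) - 1 / ?q * (\<Sum>i\<in>{1..l}. t i powr ?q * b i) - \<beta> / ?q * (\<Sum>i\<in>{1..l}. t i powr ?q * (\<Sum>j\<in>{1..l} - {i}. d i j))"
 unfolding Jc_def using s \<beta> p by (intro diff_left_mono mult_left_mono_neg) (auto simp: divide_le_0_iff)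
 also have "\<dots> = (\<Sum>i\<in>{1..l}. 1 / 2 * ((t i)^2 * a i) - 1 / ?q * (t i powr ?q * b i) - \<beta> / ?q * (t i powr ?q * (\<Sum>j\<in>{1..l} - {i}. d i j)))"
 by (simp only: sum_distrib_left sum_subtractf)
 also have "\<dots> <= (\<Sum>i\<in>{1..l}. (1 / 2 - 1 / ?q) * a i)"
 proof (rule sum_mono)
 fix i assume i: "i \<in> {1..l}"
 have b: "b i = a i - \<beta> * (\<Sum>j\<in>{1..l} - {i}. d i j)" using N[OF i] by simp
 have "1 / 2 * ((t i)^2 * a i) - 1 / ?q * (t i powr ?q * b i) - \<beta> / ?q * (t i powr ?q * (\<Sum>j\<in>{1..l} - {i}. d i j))
 = ((t i)^2 / 2 - t i powr ?q / ?q) * a i" unfolding b using p by (simp add: field_simps)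
 also have "\<dots> <= (1 / 2 - 1 / ?q) * a i"
 proof (intro mult_right_mono a i)
 \<comment> \<open>Young's inequality with exponents p and p/(p-1): t^2 \<le> t^(2p)/p + 1 - 1/p,
   which says that t = 1 maximises t^2/2 - t^(2p)/(2p).\<close>
 have "(t i)^2 * 1 <= ((t i)^2) powr p / p + 1 powr (p / (p - 1)) / (p / (p - 1))"
 using p by (intro Youngs_inequality) (auto simp: field_simps)
 moreover have "((t i)^2) powr p = t i powr ?q"
 proof -
 have "((t i)^2) powr p = (t i powr 2) powr p" using t[OF i] by simp
 then show ?thesis unfolding powr_powr .
 qed
 moreover have "1 powr (p / (p - 1)) / (p / (p - 1)) = 1 - 1 / p" using p by (simp add: field_simps)
 ultimately show "(t i)^2 / 2 - t i powr ?q / ?q <= 1 / 2 - 1 / ?q" using p by (simp add: field_simps)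
 qed
 finally show "1 / 2 * ((t i)^2 * a i) - 1 / ?q * (t i powr ?q * b i) - \<beta> / ?q * (t i powr ?q * (\<Sum>j\<in>{1..l} - {i}. d i j)) <= (1 / 2 - 1 / ?q) * a i" .
 qed
 also have "\<dots> = Jc l \<beta> ?q a b d" by (subst Jc_Nehari[OF N]) (simp_all add: sum_distrib_left)
 finally show ?thesis .
qed

definition energy_deriv :: "nat => real => (nat => real^'n => real) => (nat => real^'n => real^'n) =>
 (nat => real^'n => real) => (nat => real^'n => real^'n) => real" where
 "energy_deriv l \<beta> U Gr \<psi> H = (\<Sum>i\<in>{1..l}. (LBINT x. Gr i x \<bullet> H i x) - (LBINT x. kk (crit_exp CARD('n) / 2) (U i x) (U i x) * \<psi> i x)
 - \<beta> * (\<Sum>j\<in>{1..l} - {i}. \<integral>x. kk (crit_exp CARD('n) / 2) (U i x) (U j x) * \<psi> i x \<partial>lborel))"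

text \<open>U + \<epsilon>\<psi> is projected to the Nehari set by factors t -> 1. Minimality gives
  E \<le> J(t (U + \<epsilon>\<psi>)), and \<open>Jc_ray_le\<close> gives J(t U) \<le> E. The
  difference of the two energies, divided by \<epsilon>, is therefore nonnegative and tends to the
  derivative of J at U, at whatever rate t -> 1.\<close>

lemma energy_deriv_nonneg:
 fixes U :: "nat => real^'n => real"
 assumes N: "CARD('n) >= 3" and G: "orth_closed G" and P: "perms G \<phi> l" and \<beta>: "\<beta> < 0"
 and U: "adm G \<phi> l UNIV U Gr" and nz: "!!i. i \<in> {1..l} ==> \<not> (AE x in lborel. U i x = 0)"
 and eq: "!!i. i \<in> {1..l} ==> aa Gr i - bb U i - \<beta> * (\<Sum>j\<in>{1..l} - {i}. dd U i j) = 0"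
 and min: "!!w. w \<in> Nehari G \<phi> l \<beta> UNIV ==> Jc l \<beta> (crit_exp CARD('n)) (aa Gr) (bb U) (dd U) <= J \<beta> l UNIV w"
 and \<psi>: "adm G \<phi> l UNIV \<psi> H"
 shows "energy_deriv l \<beta> U Gr \<psi> H >= 0"
proof -
 define p where "p = crit_exp CARD('n) / 2"
 have p: "p > 1" "crit_exp CARD('n) = 2 * p" using crit_exp_gt(1)[OF N] by (auto simp: p_def)
 have D: "Dlim UNIV (U i) (Gr i)" "Dlim UNIV (\<psi> i) (H i)" if "i \<in> {1..l}" for i using U \<psi> that by (auto simp: adm_def)
 define V where "V \<epsilon> i x = U i x + \<epsilon> * \<psi> i x" for \<epsilon> i x
 define K where "K \<epsilon> i x = Gr i x + \<epsilon> *\<^sub>R H i x" for \<epsilon> i x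
 have V: "adm G \<phi> l UNIV (V \<epsilon>) (K \<epsilon>)" for \<epsilon>
 unfolding adm_def
 proof (intro conjI ballI)
 show "Dlim UNIV (V \<epsilon> i) (K \<epsilon> i)" if "i \<in> {1..l}" for i
 unfolding V_def[abs_def] K_def[abs_def] by (rule Dlim_lincomb[OF D[OF that] N])
 show "AE x in lborel. \<forall>i\<in>{1..l}. V \<epsilon> i (g *v x) = V \<epsilon> (\<phi> g i) x" if "g \<in> G" for g
 proof -
 have "AE x in lborel. \<forall>i\<in>{1..l}. U i (g *v x) = U (\<phi> g i) x" "AE x in lborel. \<forall>i\<in>{1..l}. \<psi> i (g *v x) = \<psi> (\<phi> g i) x"
 using U \<psi> that by (auto simp: adm_def)
 then show ?thesis by eventually_elim (simp add: V_def)
 qed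
 qed
 have V0: "V 0 = U" "K 0 = Gr" by (auto simp: V_def K_def fun_eq_iff)
 have pos: "aa Gr i > 0" "bb U i > 0" if "i \<in> {1..l}" for i using adm_positive[OF N U that nz[OF that]] .
 define e where "e i j = (LBINT x. kk p (U i x) (U j x) * \<psi> i x)" for i j
 define a' where "a' i = 2 * (LBINT x. Gr i x \<bullet> H i x)" for i
 have da: "((%\<epsilon>. aa (K \<epsilon>) i) has_real_derivative a' i) (at 0)" if i: "i \<in> {1..l}" for i
 proof -
 have q: "crit_exp CARD('n) > 0" using p by simp
 have int: "integrable lborel (%x. (norm (Gr i x))^2)" "integrable lborel (%x. (norm (H i x))^2)" "integrable lborel (%x. Gr i x \<bullet> H i x)"
 using D[OF i] N q by (auto intro!: Dlim_integrable_q(2) N2_inner_integrable Dlim_finite(2) Dlim_measurable(2))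
 have "aa (K \<epsilon>) i = aa Gr i + (\<epsilon> * a' i + \<epsilon>\<^sup>2 * aa H i)" for \<epsilon>
 proof -
 have "(norm (K \<epsilon> i x))^2 = (norm (Gr i x))^2 + (\<epsilon> * (2 * (Gr i x \<bullet> H i x)) + \<epsilon>\<^sup>2 * (norm (H i x))^2)" for x
 unfolding K_def power2_norm_eq_inner by (simp add: power2_eq_square algebra_simps inner_commute)
 then show ?thesis using int by (simp add: aa_def a'_def)
 qed
 then show ?thesis by (auto intro!: derivative_eq_intros)
 qed
 have dd': "((%\<epsilon>. dd (V \<epsilon>) i j) has_real_derivative p * (e i j + e j i)) (at 0)" if ij: "i \<in> {1..l}" "j \<in> {1..l}" for i j
 using dd_deriv[OF N D(1)[OF ij(1)] D(1)[OF ij(2)] D(2)[OF ij(1)] D(2)[OF ij(2)]] by (simp add: dd_def V_def e_def p_def)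
 have bd: "bb W i = dd W i i" for W :: "nat => real^'n => real" and i
 unfolding bb_def dd_def by (simp add: powr_add[symmetric])
 have lim: "(f \<longlongrightarrow> f 0) (at_right 0)" if "(f has_real_derivative d) (at 0)" for f d
 using DERIV_isCont[OF that] unfolding isCont_def by (rule tendsto_within_subset) simp
 note la = lim[OF da, unfolded V0] and ld = lim[OF dd', unfolded V0]
 have lb: "((%\<epsilon>. bb (V \<epsilon>) i) \<longlongrightarrow> bb U i) (at_right 0)" if "i \<in> {1..l}" for i unfolding bd by (rule ld[OF that that])
 define E where "E = Jc l \<beta> (2 * p) (aa Gr) (bb U) (dd U)"
 have ex: "\<exists>\<epsilon> t. 0 < \<epsilon> \<and> \<epsilon> < \<delta> \<and> (\<forall>i\<in>{1..l}. 1 - \<delta> <= t i \<and> t i <= 1 + \<delta>) \<and>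
 E <= Jc l \<beta> (2 * p) (%i. (t i)^2 * aa (K \<epsilon>) i) (%i. t i powr (2 * p) * bb (V \<epsilon>) i) (%i j. (t i powr p * t j powr p) * dd (V \<epsilon>) i j)"
 if \<delta>: "0 < \<delta>" "\<delta> < 1" for \<delta>
 proof -
 have "\<forall>\<^sub>F \<epsilon> in at_right 0. \<exists>t. (\<forall>i\<in>{1..l}. 1 - \<delta> <= t i \<and> t i <= 1 + \<delta>) \<and>
 E <= Jc l \<beta> (2 * p) (%i. (t i)^2 * aa (K \<epsilon>) i) (%i. t i powr (2 * p) * bb (V \<epsilon>) i) (%i j. (t i powr p * t j powr p) * dd (V \<epsilon>) i j)"
 unfolding E_def p(2)[symmetric] p_def
 by (rule eventually_mono, rule project_Nehari[where F = "at_right 0", OF open_UNIV N G P \<beta> V \<delta> la lb ld pos eq], assumption+)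
 (elim exE conjE bexE, intro exI conjI, assumption, drule min, simp)
 moreover have "\<forall>\<^sub>F \<epsilon> in at_right 0. \<epsilon> < \<delta>" by (rule order_tendstoD(2)[OF tendsto_ident_at \<delta>(1)])
 moreover have "\<forall>\<^sub>F \<epsilon>::real in at_right 0. \<epsilon> > 0" by (rule eventually_at_right_less)
 ultimately have "\<forall>\<^sub>F \<epsilon> in at_right 0. 0 < \<epsilon> \<and> \<epsilon> < \<delta> \<and> (\<exists>t. (\<forall>i\<in>{1..l}. 1 - \<delta> <= t i \<and> t i <= 1 + \<delta>) \<and>
 E <= Jc l \<beta> (2 * p) (%i. (t i)^2 * aa (K \<epsilon>) i) (%i. t i powr (2 * p) * bb (V \<epsilon>) i) (%i j. (t i powr p * t j powr p) * dd (V \<epsilon>) i j))"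
 by eventually_elim blast
 from eventually_happens'[OF trivial_limit_at_right_real this] show ?thesis by blast
 qed
 define \<delta> where "\<delta> n = 1 / (real n + 2)" for n
 have \<delta>: "0 < \<delta> n" "\<delta> n < 1" for n by (auto simp: \<delta>_def)
 have \<delta>0: "\<delta> ~> 0" unfolding \<delta>_def[abs_def] by real_asymp
 obtain \<epsilon> t where \<epsilon>: "!!n. 0 < \<epsilon> n" "!!n. \<epsilon> n < \<delta> n" and t: "!!n i. i \<in> {1..l} ==> 1 - \<delta> n <= t n i \<and> t n i <= 1 + \<delta> n"
 and EJ: "!!n. E <= Jc l \<beta> (2 * p) (%i. (t n i)^2 * aa (K (\<epsilon> n)) i) (%i. t n i powr (2 * p) * bb (V (\<epsilon> n)) i) (%i j. (t n i powr p * t n j powr p) * dd (V (\<epsilon> n)) i j)"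
 proof -
 let ?P = "%n z. 0 < fst z \<and> fst z < \<delta> n \<and> (\<forall>i\<in>{1..l}. 1 - \<delta> n <= snd z i \<and> snd z i <= 1 + \<delta> n) \<and>
 E <= Jc l \<beta> (2 * p) (%i. (snd z i)^2 * aa (K (fst z)) i) (%i. snd z i powr (2 * p) * bb (V (fst z)) i) (%i j. (snd z i powr p * snd z j powr p) * dd (V (fst z)) i j)"
 have "\<exists>z. ?P n z" for n
 unfolding split_paired_Ex fst_conv snd_conv by (rule ex[OF \<delta>])
 then have "\<forall>n. \<exists>z. ?P n z" ..
 from choice[OF this] obtain z where z: "\<forall>n. ?P n (z n)" ..
 show ?thesis by (rule that[of "%n. fst (z n)" "%n. snd (z n)"]) (use z in auto)
 qed
 have tp: "t n i > 0" if "i \<in> {1..l}" for n i using t[OF that, of n] \<delta>(2)[of n] by linarith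
 have tl: "(%n. t n i) ~> 1" if "i \<in> {1..l}" for i
 proof (rule tendsto_sandwich)
 show "(%n. 1 - \<delta> n) ~> 1" "(%n. 1 + \<delta> n) ~> 1"
 using tendsto_diff[OF tendsto_const \<delta>0, of 1] tendsto_add[OF tendsto_const \<delta>0, of 1] by auto
 qed (use t[OF that] in auto)
 have \<epsilon>0: "\<epsilon> ~> 0" by (rule tendsto_sandwich[OF _ _ tendsto_const \<delta>0]) (use \<epsilon> in \<open>auto simp: less_imp_le\<close>)
 have dq: "(%n. (f (\<epsilon> n) - f 0) / \<epsilon> n) ~> d" if "(f has_real_derivative d) (at 0)" for f d
 proof -
 have "((%y. (f y - f 0) / (y - 0)) \<longlongrightarrow> d) (at 0)" using that by (simp add: has_field_derivative_iff)
 then show ?thesis unfolding tendsto_at_iff_sequentially comp_def using \<epsilon>(1) \<epsilon>0 by (auto simp: less_imp_neq[symmetric] dest!: spec[of _ \<epsilon>])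
 qed
 note qa = dq[OF da, unfolded V0] and qd = dq[OF dd', unfolded V0]
 have qb: "(%n. (bb (V (\<epsilon> n)) i - bb U i) / \<epsilon> n) ~> p * (e i i + e i i)" if "i \<in> {1..l}" for i
 unfolding bd by (rule qd[OF that that])
 \<comment> \<open>The quotient (J(t (U + \<epsilon>\<psi>)) - J(t U)) / \<epsilon>; by linearity of
   \<open>Jc\<close> it is \<open>Jc\<close> of the difference quotients with powers of t in
   front.\<close>
 define R where "R n = Jc l \<beta> (2 * p) (%i. (t n i)^2 * ((aa (K (\<epsilon> n)) i - aa Gr i) / \<epsilon> n)) (%i. t n i powr (2 * p) * ((bb (V (\<epsilon> n)) i - bb U i) / \<epsilon> n))
 (%i j. (t n i powr p * t n j powr p) * ((dd (V (\<epsilon> n)) i j - dd U i j) / \<epsilon> n))" for n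
 have R0: "R n >= 0" for n
 proof -
 have lin: "Jc l \<beta> (2 * p) a b d - Jc l \<beta> (2 * p) a1 b1 d1 = \<epsilon> n * Jc l \<beta> (2 * p) (%i. (a i - a1 i) / \<epsilon> n) (%i. (b i - b1 i) / \<epsilon> n) (%i j. (d i j - d1 i j) / \<epsilon> n)" for a b d a1 b1 d1
 proof -
 have "\<epsilon> n ~= 0" using \<epsilon>(1)[of n] by simp
 then have "(c1 * x - c2 * y - c3 * z) - (c1 * x1 - c2 * y1 - c3 * z1) = \<epsilon> n * (c1 * ((x - x1) / \<epsilon> n) - c2 * ((y - y1) / \<epsilon> n) - c3 * ((z - z1) / \<epsilon> n))"
 for c1 c2 c3 x y z x1 y1 z1 :: real by (simp add: field_simps)
 then show ?thesis unfolding Jc_def sum_divide_distrib[symmetric] sum_subtractf .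
 qed
 have "Jc l \<beta> (2 * p) (%i. (t n i)^2 * aa Gr i) (%i. t n i powr (2 * p) * bb U i) (%i j. (t n i powr p * t n j powr p) * dd U i j) <= E"
 unfolding E_def by (rule Jc_ray_le[OF _ dd_nonneg _ \<beta> p(1) eq tp]) (auto simp: less_imp_le pos dd_def mult.commute)
 with EJ[of n] lin[of "%i. (t n i)^2 * aa (K (\<epsilon> n)) i" "%i. t n i powr (2 * p) * bb (V (\<epsilon> n)) i" "%i j. (t n i powr p * t n j powr p) * dd (V (\<epsilon> n)) i j"
 "%i. (t n i)^2 * aa Gr i" "%i. t n i powr (2 * p) * bb U i" "%i j. (t n i powr p * t n j powr p) * dd U i j"]
 have "0 <= \<epsilon> n * R n" unfolding R_def by (simp add: right_diff_distrib[symmetric])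
 then show ?thesis using \<epsilon>(1)[of n] by (simp add: zero_le_mult_iff)
 qed
 have "R ~> Jc l \<beta> (2 * p) (%i. 1\<^sup>2 * a' i) (%i. 1 powr (2 * p) * (p * (e i i + e i i))) (%i j. (1 powr p * 1 powr p) * (p * (e i j + e j i)))"
 unfolding R_def[abs_def] Jc_def
 by (intro tendsto_diff tendsto_mult tendsto_const tendsto_sum tendsto_power tendsto_powr tl qa qb qd) auto
 then have "Jc l \<beta> (2 * p) (%i. 1\<^sup>2 * a' i) (%i. 1 powr (2 * p) * (p * (e i i + e i i))) (%i j. (1 powr p * 1 powr p) * (p * (e i j + e j i))) >= 0"
 using R0 by (intro LIMSEQ_le_const) auto
 also have "Jc l \<beta> (2 * p) (%i. 1\<^sup>2 * a' i) (%i. 1 powr (2 * p) * (p * (e i i + e i i))) (%i j. (1 powr p * 1 powr p) * (p * (e i j + e j i))) = energy_deriv l \<beta> U Gr \<psi> H"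
 proof -
 have s: "(\<Sum>i\<in>{1..l}. \<Sum>j\<in>{1..l} - {i}. p * (e i j + e j i)) = (2 * p) * (\<Sum>i\<in>{1..l}. \<Sum>j\<in>{1..l} - {i}. e i j)"
 unfolding sum_distrib_left[symmetric] sum.distrib offdiag_swap[where f = e, OF finite_atLeastAtMost] by simp
 have "Jc l \<beta> (2 * p) (%i. 1\<^sup>2 * a' i) (%i. 1 powr (2 * p) * (p * (e i i + e i i))) (%i j. (1 powr p * 1 powr p) * (p * (e i j + e j i)))
 = (\<Sum>i\<in>{1..l}. \<integral>x. Gr i x \<bullet> H i x \<partial>lborel) - (\<Sum>i\<in>{1..l}. e i i) - \<beta> * (\<Sum>i\<in>{1..l}. \<Sum>j\<in>{1..l} - {i}. e i j)"
 unfolding Jc_def powr_one_eq_one power_one mult_1 s unfolding a'_def sum_distrib_left[symmetric] sum.distrib using p(1) by simp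
 then show ?thesis unfolding energy_deriv_def e_def p_def sum_subtractf sum_distrib_left .
 qed
 finally show ?thesis .
qed

text \<open>\<open>energy_deriv_nonneg\<close> for \<psi> and for -\<psi>.\<close>

lemma energy_deriv_zero:
 fixes U :: "nat => real^'n => real"
 assumes N: "CARD('n) >= 3" and G: "orth_closed G" and P: "perms G \<phi> l" and \<beta>: "\<beta> < 0"
 and U: "adm G \<phi> l UNIV U Gr" and nz: "!!i. i \<in> {1..l} ==> \<not> (AE x in lborel. U i x = 0)"
 and eq: "!!i. i \<in> {1..l} ==> aa Gr i - bb U i - \<beta> * (\<Sum>j\<in>{1..l} - {i}. dd U i j) = 0"
 and min: "!!w. w \<in> Nehari G \<phi> l \<beta> UNIV ==> Jc l \<beta> (crit_exp CARD('n)) (aa Gr) (bb U) (dd U) <= J \<beta> l UNIV w"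
 and \<psi>: "adm G \<phi> l UNIV \<psi> H"
 shows "energy_deriv l \<beta> U Gr \<psi> H = 0"
proof -
 have "adm G \<phi> l UNIV (%i x. (- 1) * \<psi> i x) (%i x. (- 1) *\<^sub>R H i x)"
 using \<psi> unfolding adm_def by (auto intro!: Dlim_cmult[where c = "- 1", simplified] N)
 from energy_deriv_nonneg[OF N G P \<beta> U nz eq min this]
 have "energy_deriv l \<beta> U Gr \<psi> H <= 0" unfolding energy_deriv_def by (simp add: sum_negf algebra_simps sum_subtractf)
 then show ?thesis using energy_deriv_nonneg[OF N G P \<beta> U nz eq min \<psi>] by simp
qed

section \<open>Boundedness\<close>

text \<open>A smooth odd version of the truncation sgn(s) max(|s| - h', 0), as
  \<open>Dlim_compose\<close> demands, built from f(y) = y exp(-1/y). The bound f' \<le> 1 is (1 +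
  x) exp(-x) \<le> 1 with x = 1/y; the factor \<open>exp 1\<close> is the loss in f(y) \<ge> y / exp
  1 for y \<ge> 1.\<close>

lemma truncation:
 fixes h h' :: real
 assumes h: "0 < h'" "h' < h"
 obtains T T' where "!!k. Dk k T" "!!s. (T has_real_derivative T' s) (at s)" "T 0 = 0" "!!s. 0 <= T' s" "!!s. T' s <= 1"
 "continuous_on UNIV T'" "!!s. \<bar>s\<bar> <= h' ==> T s = 0" "!!s. \<bar>T s\<bar> <= \<bar>s\<bar>" "!!s. 0 <= sgn s * T s"
 "!!s. \<bar>s\<bar> > h ==> \<bar>T s\<bar> >= (\<bar>s\<bar> - h') / exp 1"
proof
 define a where "a = h - h'"
 have a: "a > 0" using h by (simp add: a_def)
 define f where "f y = y * expm 0 y" for y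
 define f' where "f' y = expm 0 y + y * expm 2 y" for y
 let ?T = "%s. a * f ((1 / a) * s + - (h' / a)) + (- a) * f ((- 1 / a) * s + - (h' / a))"
 let ?T' = "%s. f' ((1 / a) * s + - (h' / a)) + f' ((- 1 / a) * s + - (h' / a))"
 have f0: "f y = 0" "f' y = 0" if "y <= 0" for y using that by (auto simp: f_def f'_def expm_def)
 have f1: "0 <= f y" "f y <= y" "0 <= f' y" "f' y <= 1" if y: "y > 0" for y
 proof -
 show "0 <= f y" "f y <= y" "0 <= f' y" using y by (auto simp: f_def f'_def expm_def)
 have "f' y = (1 + 1 / y) * exp (- (1 / y))" using y by (simp add: f'_def expm_def field_simps power2_eq_square)
 also have "\<dots> <= exp (1 / y) * exp (- (1 / y))" using exp_ge_add_one_self[of "1 / y"] by (intro mult_right_mono) auto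
 finally show "f' y <= 1" by (simp add: exp_add[symmetric])
 qed
 have f2: "f y >= y / exp 1" if "y >= 1" for y
 proof -
 have "exp (- 1) <= exp (- (1 / y))" using that by simp
 then show ?thesis using that by (simp add: f_def expm_def exp_minus field_simps)
 qed
 have fd: "(f has_real_derivative f' y) (at y)" for y
 unfolding f_def[abs_def] f'_def using DERIV_mult[OF DERIV_ident expm_deriv[of 0 y]] by (simp add: add_ac mult_ac numeral_2_eq_2)
 show "Dk k ?T" for k
 proof -
 have "Dk k f" unfolding f_def[abs_def] by (intro Dk_mult Dk_id Dk_expm)
 then show ?thesis by (intro Dk_add Dk_mult Dk_const Dk_affine)
 qed
 show "(?T has_real_derivative ?T' s) (at s)" for s
 by (rule DERIV_cong[OF DERIV_add[OF DERIV_cmult[OF DERIV_chain2[OF fd]] DERIV_cmult[OF DERIV_chain2[OF fd]]]])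
 (use a in \<open>auto intro!: derivative_eq_intros simp: field_simps\<close>)
 show "?T 0 = 0" using h a by (simp add: f0)
 have fc: "continuous_on UNIV f'"
 unfolding f'_def[abs_def] by (intro continuous_intros DERIV_continuous_on[OF has_field_derivative_at_within[OF expm_deriv]])
 show "continuous_on UNIV ?T'" by (intro continuous_intros continuous_on_compose2[OF fc]) auto
 have arg: "(1 / a) * s + - (h' / a) = (s - h') / a" "(- 1 / a) * s + - (h' / a) = (- s - h') / a" for s
 using a by (simp_all add: field_simps)
 have c: "?T s = (if s > h' then a * f ((s - h') / a) else if s < - h' then - a * f ((- s - h') / a) else 0) \<and>
 ?T' s = (if s > h' then f' ((s - h') / a) else if s < - h' then f' ((- s - h') / a) else 0)" for s
 unfolding arg using h a by (auto simp: f0 divide_nonpos_pos)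
 then have cT: "!!s. ?T s = (if s > h' then a * f ((s - h') / a) else if s < - h' then - a * f ((- s - h') / a) else 0)"
 and cT': "!!s. ?T' s = (if s > h' then f' ((s - h') / a) else if s < - h' then f' ((- s - h') / a) else 0)" by blast+
 show "0 <= ?T' s" "?T' s <= 1" for s unfolding cT' using f1 a by auto
 show "\<bar>s\<bar> <= h' ==> ?T s = 0" for s unfolding cT by auto
 have b: "a * f (y / a) <= y" "0 <= a * f (y / a)" if "y > 0" for y
 using f1(1,2)[of "y / a"] that a by (auto simp: field_simps)
 show "\<bar>?T s\<bar> <= \<bar>s\<bar>" for s unfolding cT using b[of "s - h'"] b[of "- s - h'"] h by (auto simp: abs_if)
 show "0 <= sgn s * ?T s" for s unfolding cT using b[of "s - h'"] b[of "- s - h'"] h by (auto simp: sgn_if)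
 have g: "a * f (y / a) >= y / exp 1" if "y > a" for y
 using f2[of "y / a"] that a by (auto simp: field_simps)
 show "\<bar>?T s\<bar> >= (\<bar>s\<bar> - h') / exp 1" if "\<bar>s\<bar> > h" for s
 proof -
 have ha: "h = a + h'" by (simp add: a_def)
 show ?thesis unfolding cT using g[of "s - h'"] g[of "- s - h'"] b(2)[of "s - h'"] b(2)[of "- s - h'"] that h
 unfolding ha by (auto simp: abs_if)
 qed
qed

text \<open>Along the levels h_k = M (2 - 2^-k) the constants grow like 2^(kq), which the power p >
  1 beats if A starts small enough: A(h_k) \<le> s r^k. A small start exists because A tends to 0,
  and monotonicity carries the decay to the level 2M.\<close>

lemma De_Giorgi:
 fixes A :: "real => real"
 assumes A0: "!!h. A h >= 0" and mono: "!!h h'. h' <= h ==> A h <= A h'" and lim: "(%n. A (real n)) ~> 0"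
 and p: "p > 1" and q: "q > 0" and K: "K > 0"
 and step: "!!h' h. 0 < h' ==> h' < h ==> A h <= K * (h / (h - h')) powr q * A h' powr p"
 shows "\<exists>M>0. A M = 0"
proof -
 define K' where "K' = K * 4 powr q"
 \<comment> \<open>r satisfies 2^q r^(p-1) = 1, which cancels the growth of the constants; s below
   satisfies K' s^(p-1) = r, so that each step gains exactly one factor r.\<close>
 define r where "r = 2 powr (- (q / (p - 1)))"
 have K': "K' > 0" using K by (simp add: K'_def)
 have r: "0 < r" "r < 1" using p q by (auto simp: r_def powr_less_one)
 define s where "s = (r / K') powr (1 / (p - 1))"
 have s: "s > 0" "K' * s powr (p - 1) = r" using r K' p by (auto simp: s_def powr_powr)
 have "eventually (%n. A (real n) < s) sequentially" by (rule order_tendstoD(2)[OF lim s(1)])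
 then have "eventually (%n. A (real n) < s \<and> n > 0) sequentially" using eventually_gt_at_top[of 0] by eventually_elim auto
 then obtain n where n: "A (real n) < s" "n > 0" using eventually_happens'[OF sequentially_bot] by blast
 define M where "M = real n"
 define h where "h k = M * (2 - (1 / 2) ^ k)" for k :: nat
 have M: "M > 0" using n by (simp add: M_def)
 have hp: "h k > 0" "h k <= 2 * M" "h (Suc k) - h k = M * (1 / 2) ^ Suc k" for k
 proof -
 have "(1 / 2 :: real) ^ k <= 1" by (rule power_le_one) auto
 then show "h k > 0" using M by (simp add: h_def)
 show "h k <= 2 * M" "h (Suc k) - h k = M * (1 / 2) ^ Suc k" using M by (auto simp: h_def algebra_simps)
 qed
 have Ak: "A (h k) <= s * r ^ k" for k
 proof (induction k)
 case 0 then show ?case using n by (simp add: h_def M_def)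
 next
 case (Suc k)
 have lt: "h k < h (Suc k)" using hp(3)[of k] M by (smt (verit) mult_pos_pos zero_less_power half_gt_zero_iff zero_less_one)
 have "h (Suc k) / (h (Suc k) - h k) <= (2 * M) / (M * (1 / 2) ^ Suc k)"
 unfolding hp(3) using hp(2) M by (intro divide_right_mono) auto
 also have "\<dots> = 4 * 2 ^ k" using M by (simp add: field_simps)
 finally have "(h (Suc k) / (h (Suc k) - h k)) powr q <= (4 * 2 ^ k) powr q"
 using q lt hp(1)[of "Suc k"] by (intro powr_mono2) auto
 also have "\<dots> = 4 powr q * 2 powr (q * real k)" by (simp add: powr_mult powr_powr mult.commute flip: powr_realpow)
 finally have 1: "K * (h (Suc k) / (h (Suc k) - h k)) powr q <= K' * 2 powr (q * real k)"
 using K unfolding K'_def by (simp add: mult.assoc)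
 have rk: "r ^ k = 2 powr (- (q / (p - 1)) * real k)" by (simp add: r_def powr_realpow[symmetric] powr_powr)
 have "A (h (Suc k)) <= (K * (h (Suc k) / (h (Suc k) - h k)) powr q) * A (h k) powr p" by (rule step[OF hp(1) lt])
 also have "\<dots> <= (K' * 2 powr (q * real k)) * (s * r ^ k) powr p"
 using 1 Suc.IH A0 p K' by (intro mult_mono[OF 1] powr_mono2) auto
 also have "(s * r ^ k) powr p = (s * r ^ k) powr (1 + (p - 1))" by simp
 also have "\<dots> = (s * r ^ k) powr 1 * (s * r ^ k) powr (p - 1)" by (rule powr_add)
 also have "\<dots> = (s * r ^ k) * (s powr (p - 1) * (r ^ k) powr (p - 1))" using s r by (simp add: powr_mult)
 also have "(r ^ k) powr (p - 1) = 2 powr (- (q * real k))"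
 proof -
 have "- (q / (p - 1)) * real k * (p - 1) = - (q * real k)" using p by simp
 then show ?thesis unfolding rk powr_powr by (simp only:)
 qed
 also have "(K' * 2 powr (q * real k)) * ((s * r ^ k) * (s powr (p - 1) * 2 powr (- (q * real k)))) = (K' * s powr (p - 1)) * (s * r ^ k)"
 by (simp add: powr_minus field_simps)
 also have "\<dots> = s * r ^ Suc k" unfolding s(2) by simp
 finally show ?case .
 qed
 have "A (2 * M) <= s * r ^ k" for k using mono[OF hp(2)[of k]] Ak[of k] by linarith
 moreover have "(%k. s * r ^ k) ~> s * 0" using r by (intro tendsto_intros LIMSEQ_power_zero) auto
 ultimately have "A (2 * M) <= 0" by (intro LIMSEQ_le_const[of "%k. s * r ^ k"]) auto
 then show ?thesis using A0[of "2 * M"] M by (intro exI[of _ "2 * M"]) auto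
qed

text \<open>The equation is tested with T(u_i), the same T for every component, so that the
  variation is equivariant. As \<beta> < 0 the coupling terms have the favourable sign and drop out,
  and the energy of the truncations above h' is at most the mass A(h') of |u|^q above h'. Sobolev
  raises this to the power q/2 > 1. At critical growth the smallness that starts the iteration comes
  from A(h) -> 0.\<close>

lemma solution_bounded:
 fixes U :: "nat => real^'n => real"
 assumes N: "CARD('n) >= 3" and \<beta>: "\<beta> < 0" and U: "adm G \<phi> l UNIV U Gr"
 and EL: "!!\<psi> H. adm G \<phi> l UNIV \<psi> H ==> energy_deriv l \<beta> U Gr \<psi> H = 0"
 shows "\<exists>M>0. \<forall>i\<in>{1..l}. AE x in lborel. \<bar>U i x\<bar> <= M"
proof -
 define q where "q = crit_exp CARD('n)"
 have q: "q > 2" using crit_exp_gt(1)[OF N] by (simp add: q_def)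
 have D: "Dlim UNIV (U i) (Gr i)" if "i \<in> {1..l}" for i using U that by (auto simp: adm_def)
 have m: "U i \<in> BM" "Gr i \<in> BM" if "i \<in> {1..l}" for i using Dlim_measurable[OF D[OF that]] by auto
 have iq: "integrable lborel (%x. \<bar>U i x\<bar> powr q)" if "i \<in> {1..l}" for i unfolding q_def by (rule Dlim_integrable_q(1)[OF D[OF that] N])
 define c where "c h s = (if \<bar>s\<bar> > h then \<bar>s\<bar> powr q else 0)" for h s :: real
 have [measurable]: "c h \<in> BM" for h unfolding c_def[abs_def] by measurable
 have c0: "0 <= c h s" "c h s <= \<bar>s\<bar> powr q" for h s by (auto simp: c_def)
 have ci: "integrable lborel (%x. c h (U i x))" if "i \<in> {1..l}" for i h
 by (rule integrable_dom[OF iq[OF that]]) (use c0 m[OF that] in auto)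
 define A where "A h = (\<Sum>i\<in>{1..l}. \<integral>x. c h (U i x) \<partial>lborel)" for h
 have A0: "A h >= 0" for h unfolding A_def by (intro sum_nonneg integral_nonneg_AE) (auto simp: c0)
 have mono: "A h <= A h'" if "h' <= h" for h h'
 unfolding A_def by (intro sum_mono integral_mono ci) (use that in \<open>auto simp: c_def\<close>)
 have lim: "(%n. A (real n)) ~> 0"
 proof -
 have "(%n. A (real n)) ~> (\<Sum>i\<in>{1..l}. \<integral>x. 0 \<partial>(lborel :: (real^'n) measure))" unfolding A_def
 proof (rule tendsto_sum)
 fix i assume i: "i \<in> {1..l}"
 note [measurable] = m[OF i]
 show "(%n. \<integral>x. c (real n) (U i x) \<partial>lborel) ~> (\<integral>x. 0 \<partial>(lborel :: (real^'n) measure))"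
 proof (rule integral_dominated_convergence[where w = "%x. \<bar>U i x\<bar> powr q"])
 show "AE x in lborel. (%n. c (real n) (U i x)) ~> 0"
 proof (rule AE_I2, rule tendsto_eventually)
 fix x
 show "\<forall>\<^sub>F n in sequentially. c (real n) (U i x) = 0"
 using eventually_ge_at_top[of "nat \<lceil>\<bar>U i x\<bar>\<rceil>"] by eventually_elim (auto simp: c_def not_less nat_le_iff ceiling_le_iff)
 qed
 qed (use iq[OF i] c0 in auto)
 qed
 then show ?thesis by simp
 qed
 obtain C where C: "C > 0" "!!\<Omega> u g. Dlim (\<Omega> :: (real^'n) set) u g ==> Nq u <= ennreal ((C * enn2real (N2 g)) powr (q / 2))"
 using Sobolev[OF N] unfolding q_def by blast
 define K where "K = (real l + 1) * exp 1 powr q * C powr (q / 2)"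
 have K: "K > 0" using C by (auto simp: K_def)
 have step: "A h <= K * (h / (h - h')) powr q * A h' powr (q / 2)" if h: "0 < h'" "h' < h" for h' h
 proof -
 obtain T T' where T: "!!k. Dk k T" "!!s. (T has_real_derivative T' s) (at s)" "T 0 = 0" "!!s. 0 <= T' s" "!!s. T' s <= 1"
 "continuous_on UNIV T'" "!!s. \<bar>s\<bar> <= h' ==> T s = 0" "!!s. \<bar>T s\<bar> <= \<bar>s\<bar>" "!!s. 0 <= sgn s * T s"
 "!!s. \<bar>s\<bar> > h ==> \<bar>T s\<bar> >= (\<bar>s\<bar> - h') / exp 1" using truncation[OF h] by blast
 have [measurable]: "T' \<in> BM" "T \<in> BM"
 using T(6) DERIV_continuous_on[OF has_field_derivative_at_within[OF T(2)]] by (auto intro: borel_measurable_continuous_onI)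
 let ?\<psi> = "%i x. T (U i x)" and ?H = "%i x. T' (U i x) *\<^sub>R Gr i x"
 have DT: "Dlim UNIV (?\<psi> i) (?H i)" if "i \<in> {1..l}" for i
 by (rule Dlim_compose[OF D[OF that] N T(1,2,3) _ T(6)]) (use T(4,5) in auto)
 have "adm G \<phi> l UNIV ?\<psi> ?H" unfolding adm_def
 proof (intro conjI ballI DT)
 fix g assume "g \<in> G"
 then have "AE x in lborel. \<forall>i\<in>{1..l}. U i (g *v x) = U (\<phi> g i) x" using U by (auto simp: adm_def)
 then show "AE x in lborel. \<forall>i\<in>{1..l}. T (U i (g *v x)) = T (U (\<phi> g i) x)" by eventually_elim auto
 qed
 note E = EL[OF this, unfolded energy_deriv_def]
 have kT: "0 <= kk p a b * T a" for p a b
 using T(9)[of a] unfolding kk_def by (simp add: mult_ac zero_le_mult_iff mult_less_0_iff sgn_if split: if_splits)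
 define a where "a i = (LBINT x. Gr i x \<bullet> ?H i x)" for i
 have a0: "a i >= 0" for i unfolding a_def by (rule integral_nonneg_AE) (simp add: T(4))
 have "a i - (LBINT x. c h' (U i x)) <= a i - (LBINT x. kk (q / 2) (U i x) (U i x) * ?\<psi> i x)
 - \<beta> * (\<Sum>j\<in>{1..l} - {i}. \<integral>x. kk (q / 2) (U i x) (U j x) * ?\<psi> i x \<partial>lborel)" if i: "i \<in> {1..l}" for i
 proof -
 have "(LBINT x. kk (q / 2) (U i x) (U i x) * ?\<psi> i x) <= (LBINT x. c h' (U i x))"
 proof (rule integral_mono[OF _ ci[OF i]])
 show "integrable lborel (%x. kk (q / 2) (U i x) (U i x) * ?\<psi> i x)" unfolding q_def by (rule kk_integrable[OF N D[OF i] D[OF i] DT[OF i]])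
 show "kk (q / 2) (U i x) (U i x) * ?\<psi> i x <= c h' (U i x)" for x
 proof (cases "\<bar>U i x\<bar> <= h'")
 case False
 have "kk (q / 2) (U i x) (U i x) * ?\<psi> i x <= \<bar>U i x\<bar> powr (2 * (q / 2))"
 using kk_mult_le[of "q / 2" "U i x" "\<bar>U i x\<bar>" "U i x" "?\<psi> i x"] q T(8)[of "U i x"] by linarith
 then show ?thesis using False by (simp add: c_def)
 qed (simp add: T(7) c_def)
 qed
 moreover have "(\<Sum>j\<in>{1..l} - {i}. \<integral>x. kk (q / 2) (U i x) (U j x) * ?\<psi> i x \<partial>lborel) >= 0"
 by (intro sum_nonneg integral_nonneg_AE AE_I2 kT)
 then have "\<beta> * (\<Sum>j\<in>{1..l} - {i}. \<integral>x. kk (q / 2) (U i x) (U j x) * ?\<psi> i x \<partial>lborel) <= 0" using \<beta> by (simp add: mult_nonpos_nonneg)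
 ultimately show ?thesis by linarith
 qed
 then have "(\<Sum>i\<in>{1..l}. a i - (LBINT x. c h' (U i x))) <= 0"
 unfolding E[folded q_def a_def, symmetric] by (rule sum_mono)
 then have sa: "(\<Sum>i\<in>{1..l}. a i) <= A h'" unfolding A_def sum_subtractf by simp
 have Nb: "Nq (?\<psi> i) <= ennreal ((C * A h') powr (q / 2))" if i: "i \<in> {1..l}" for i
 proof -
 note [measurable] = m[OF i]
 have N2f: "N2 (?H i) < \<infinity>" using Dlim_finite(2)[OF DT[OF i]] q by (simp add: q_def)
 have Hm: "?H i \<in> BM" by measurable
 have "enn2real (N2 (?H i)) = (LBINT x. (norm (?H i x))^2)" unfolding N2_integrable(2)[OF Hm N2f] by simp
 also have "\<dots> <= a i" unfolding a_def
 proof (rule integral_mono)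
 show "integrable lborel (%x. (norm (?H i x))^2)" by (rule N2_integrable(1)[OF Hm N2f])
 show "integrable lborel (%x. Gr i x \<bullet> ?H i x)"
 by (rule N2_inner_integrable[OF m(2)[OF i] Hm _ N2f]) (use Dlim_finite(2)[OF D[OF i]] q in \<open>simp add: q_def\<close>)
 show "(norm (?H i x))^2 <= Gr i x \<bullet> ?H i x" for x
 proof -
 have "T' (U i x) * T' (U i x) <= T' (U i x)" using T(4,5)[of "U i x"] by (simp add: mult_left_le)
 from mult_right_mono[OF this, of "Gr i x \<bullet> Gr i x"] show ?thesis unfolding power2_norm_eq_inner by (simp add: mult.assoc)
 qed
 qed
 also have "a i <= (\<Sum>i\<in>{1..l}. a i)" using i a0 by (intro member_le_sum) auto
 finally have "enn2real (N2 (?H i)) <= A h'" using sa by simp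
 then have "(C * enn2real (N2 (?H i))) powr (q / 2) <= (C * A h') powr (q / 2)" using C q by (intro powr_mono2 mult_left_mono) auto
 with C(2)[OF DT[OF i]] show ?thesis by (meson ennreal_leI order_trans)
 qed
 \<comment> \<open>For |s| > h the distance |s| - h' is at least the fraction (h - h')/h of |s|;
   with the loss \<open>exp 1\<close> of the truncation this gives |s| \<le> R |T s|.\<close>
 define R where "R = exp 1 * (h / (h - h'))"
 have R: "R > 0" using h by (simp add: R_def)
 have Rb: "c h s <= R powr q * \<bar>T s\<bar> powr q" for s
 proof (cases "\<bar>s\<bar> > h")
 case True
 have "h' * h <= h' * \<bar>s\<bar>" using True h by (intro mult_left_mono) auto
 then have "\<bar>s\<bar> * (h - h') <= h * (\<bar>s\<bar> - h')" by (simp add: algebra_simps)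
 then have "\<bar>s\<bar> <= (h / (h - h')) * (\<bar>s\<bar> - h')" using h by (simp add: field_simps)
 also have "\<dots> = R * ((\<bar>s\<bar> - h') / exp 1)" by (simp add: R_def)
 also have "\<dots> <= R * \<bar>T s\<bar>" using R T(10)[OF True] by (intro mult_left_mono) auto
 finally have "\<bar>s\<bar> powr q <= (R * \<bar>T s\<bar>) powr q" using q by (intro powr_mono2) auto
 then show ?thesis using True R by (simp add: c_def powr_mult)
 qed (simp add: c_def)
 have "(LBINT x. c h (U i x)) <= R powr q * (C * A h') powr (q / 2)" if i: "i \<in> {1..l}" for i
 proof -
 have Ti: "integrable lborel (%x. \<bar>?\<psi> i x\<bar> powr q)" unfolding q_def by (rule Dlim_integrable_q(1)[OF DT[OF i] N])
 have "(LBINT x. c h (U i x)) <= (LBINT x. R powr q * \<bar>?\<psi> i x\<bar> powr q)"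
 by (intro integral_mono ci i integrable_mult_right Ti Rb)
 also have "\<dots> = R powr q * (LBINT x. \<bar>?\<psi> i x\<bar> powr q)" by simp
 also have "(LBINT x. \<bar>?\<psi> i x\<bar> powr q) <= (C * A h') powr (q / 2)"
 using Nb[OF i] Dlim_integrable_q(3)[OF DT[OF i] N] by (simp add: q_def)
 finally show ?thesis by (simp add: mult_left_mono)
 qed
 then have "A h <= (\<Sum>i\<in>{1..l}. R powr q * (C * A h') powr (q / 2))" unfolding A_def[of h] by (rule sum_mono)
 also have "\<dots> <= (real l + 1) * (R powr q * (C * A h') powr (q / 2))" by (simp add: mult_right_mono)
 also have "\<dots> = K * (h / (h - h')) powr q * A h' powr (q / 2)"
 proof -
 have "R powr q = exp 1 powr q * (h / (h - h')) powr q" unfolding R_def by (rule powr_mult)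
 then show ?thesis using C A0[of h'] by (simp add: K_def powr_mult)
 qed
 finally show ?thesis .
 qed
 obtain M where M: "M > 0" "A M = 0" using De_Giorgi[OF A0 mono lim _ _ K step] q by auto
 have "AE x in lborel. \<bar>U i x\<bar> <= M" if i: "i \<in> {1..l}" for i
 proof -
 have "(LBINT x. c M (U i x)) = 0"
 using M(2) i unfolding A_def by (subst (asm) sum_nonneg_eq_0_iff) (auto intro!: integral_nonneg_AE simp: c0)
 then have "AE x in lborel. c M (U i x) = 0" using integral_nonneg_eq_0_iff_AE[OF ci[OF i]] c0 by simp
 then show ?thesis by eventually_elim (use M(1) in \<open>auto simp: c_def split: if_splits\<close>)
 qed
 then show ?thesis using M(1) by blast
qed

section \<open>The mollified system\<close>

text \<open>Radiality supplies both the evenness needed for \<open>conv_fubini\<close> and the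
  invariance needed for \<open>conv_orthogonal\<close>.\<close>

lemma Lap_mollh_radial:
 fixes z w :: "real^'n"
 shows "norm z = norm w ==> Lap (mollh r) z = Lap (mollh r) w"
proof -
 assume "norm z = norm w"
 then have zw: "z \<bullet> z = w \<bullet> w" by (simp add: norm_eq_sqrt_inner)
 have L: "Lap (%h. %y. (a *\<^sub>R y + (b * (v \<bullet> y)) *\<^sub>R v)) x = a * real CARD('n) + b * (v \<bullet> v)" for a b and v x :: "real^'n"
 unfolding Lap_def by (simp add: inner_add_left sum.distrib sum_distrib_left[symmetric] mult.assoc flip: euclidean_inner)
 have e: "Lap (mollh r) v = Lap (%h. mollh r v) v" for v :: "real^'n" unfolding Lap_def ..
 show ?thesis unfolding e[of z] e[of w] unfolding mollh_def[abs_def] L zw ..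
qed

lemma bij_betw_minus: "bij_betw \<sigma> I I ==> j \<in> I ==> bij_betw \<sigma> (I - {j}) (I - {\<sigma> j})"
 by (auto simp: bij_betw_def inj_on_def)

text \<open>The right-hand side of the system when p is half the critical exponent.\<close>

definition react :: "nat => real => real => (nat => real^'n => real) => nat => real^'n => real" where
 "react l \<beta> p U i x = kk p (U i x) (U i x) + \<beta> * (\<Sum>j\<in>{1..l} - {i}. kk p (U i x) (U j x))"

lemma react_measurable:
 assumes "!!i. i \<in> {1..l} ==> U i \<in> BM" "i \<in> {1..l}"
 shows "react l \<beta> p U i \<in> BM"
 unfolding react_def[abs_def] using assms
 by (intro borel_measurable_add borel_measurable_times borel_measurable_const borel_measurable_sum kk_measurable) auto

text \<open>With q the critical exponent and s = |u| + |v|, the value of \<open>kk\<close> is at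
  most s^(q-1) \<le> 1 + s^q, and 1 is integrable on balls.\<close>

lemma kk_locint:
 fixes u :: "real^'n => real"
 assumes N: "CARD('n) >= 3" and D: "Dlim \<Omega> u g" "Dlim \<Omega>' v h"
 shows "locint (%x. kk (crit_exp CARD('n) / 2) (u x) (v x))"
 unfolding locint_def
proof (intro conjI allI)
 note [measurable] = D[THEN Dlim_measurable(1)]
 show m: "(%x. kk (crit_exp CARD('n) / 2) (u x) (v x)) \<in> BM" by measurable
 have p: "crit_exp CARD('n) / 2 > 1" using crit_exp_gt(1)[OF N] by simp
 fix R
 let ?s = "%x. \<bar>u x\<bar> + 0 * \<bar>u x\<bar> + (\<bar>v x\<bar> + 0 * \<bar>u x\<bar>)"
 show "integrable lborel (%y. indicator (cball 0 R) y * kk (crit_exp CARD('n) / 2) (u y) (v y))"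
 proof (rule integrable_dom)
 show "integrable lborel (%y. indicator (cball 0 R) y + ?s y powr crit_exp CARD('n))"
 using emeasure_cball_finite[of "0::real^'n" R] by (intro integrable_plus integrable_real_indicator sum4_integrable[OF N D D(1) D(1)]) auto
 show "AE y in lborel. norm (indicator (cball 0 R) y * kk (crit_exp CARD('n) / 2) (u y) (v y)) <= norm (indicator (cball 0 R) y + ?s y powr crit_exp CARD('n))"
 proof (rule AE_I2)
 fix y
 have k: "\<bar>kk (crit_exp CARD('n) / 2) (u y) (v y)\<bar> <= ?s y powr (crit_exp CARD('n) - 1)"
 using kk_le[OF p, of "u y" "?s y" "v y"] by simp
 also have "\<dots> <= 1 + ?s y powr crit_exp CARD('n)"
 proof (cases "?s y <= 1")
 case True then show ?thesis using powr_le1[of "crit_exp CARD('n) - 1" "?s y"] p by (simp add: add_increasing2)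
 next
 case False then show ?thesis
 proof -
 have "?s y powr (crit_exp CARD('n) - 1) <= ?s y powr crit_exp CARD('n)" by (rule powr_mono) (use False in auto)
 then show ?thesis by linarith
 qed
 qed
 finally show "norm (indicator (cball 0 R) y * kk (crit_exp CARD('n) / 2) (u y) (v y)) <= norm (indicator (cball 0 R) y + ?s y powr crit_exp CARD('n))"
 by (auto simp: indicator_def abs_mult)
 qed
 qed (use m in measurable)
qed

text \<open>Symmetric criticality: the mollified residual \<open>S\<close> of the system is itself equivariant, so that its truncation
 to a ball, mollified once more, is an admissible variation; testing with it gives \<open>\<Sum>\<integral>\<^bsub>B\<^esub>S\<^sub>i\<^sup>2 = 0\<close>.\<close>

lemma mollified_equation:
 fixes U :: "nat => real^'n => real"
 assumes N: "CARD('n) >= 3" and G: "orth_closed G" and P: "perms G \<phi> l" and U: "adm G \<phi> l UNIV U Gr"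
 and EL: "!!\<psi> H. adm G \<phi> l UNIV \<psi> H ==> energy_deriv l \<beta> U Gr \<psi> H = 0" and r: "r > 0" and i: "i \<in> {1..l}"
 shows "conv (Lap (mollh r)) (U i) x = - conv (moll r) (react l \<beta> (crit_exp CARD('n) / 2) U i) x"
proof -
 define p where "p = crit_exp CARD('n) / 2"
 define F where "F = react l \<beta> p U"
 have D: "Dlim UNIV (U i) (Gr i)" if "i \<in> {1..l}" for i using U that by (auto simp: adm_def)
 have m: "U i \<in> BM" "Gr i \<in> BM" if "i \<in> {1..l}" for i using Dlim_measurable[OF D[OF that]] by auto
 have Fm: "F i \<in> BM" if "i \<in> {1..l}" for i unfolding F_def using m that by (intro react_measurable) auto
 have Ul: "locint (U i)" if "i \<in> {1..l}" for i by (rule Dlim_locint(1)[OF D[OF that] N])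
 have Fl: "locint (F i)" if i: "i \<in> {1..l}" for i
 proof -
 have "integrable lborel (%y. indicator (cball 0 R) y * kk p (U i y) (U j y))" if "j \<in> {1..l}" for j R
 using kk_locint[OF N D[OF i] D[OF that]] by (simp add: locint_def p_def)
 then have "integrable lborel (%y. indicator (cball 0 R) y * kk p (U i y) (U i y) + \<beta> * (\<Sum>j\<in>{1..l} - {i}. indicator (cball 0 R) y * kk p (U i y) (U j y)))" for R
 using i by (intro integrable_plus integrable_mult_right Bochner_Integration.integrable_sum) auto
 then show ?thesis using Fm[OF i] unfolding locint_def F_def react_def
 proof (intro conjI allI, goal_cases)
 case (2 R)
 have "c * (a + \<beta> * sum f J) = c * a + \<beta> * (\<Sum>j\<in>J. c * f j)" for c a f and J :: "nat set"
 by (simp add: distrib_left sum_distrib_left mult_ac)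
 then show ?case using 2 by (simp only:)
 qed
 qed
 obtain Hm where C2: "C2_on UNIV (moll r :: real^'n => real) Hm (mollh r)" using moll_C2 by blast
 note mt = moll_props(1)[OF r]
 have Lt: "Lap (mollh r) \<in> test_functions (UNIV :: (real^'n) set)" by (rule conv_C2(4)[OF Ul[OF i] mt C2])
 have Le: "Lap (mollh r) (- z) = Lap (mollh r) z" for z :: "real^'n" by (rule Lap_mollh_radial) simp
 have [measurable]: "Lap (mollh r) \<in> borel_measurable (borel :: (real^'n) measure)" "moll r \<in> borel_measurable (borel :: (real^'n) measure)"
 using test_measurable[OF Lt] test_measurable[OF mt] by auto
 define S where "S i x = conv (Lap (mollh r)) (U i) x + conv (moll r) (F i) x" for i x
 have Sc: "continuous_on UNIV (S i)" if "i \<in> {1..l}" for i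
 unfolding S_def[abs_def] using Ul[OF that] Fl[OF that] Lt mt by (intro continuous_intros smooth_continuous conv_smooth)
 have Sm [measurable]: "S i \<in> BM" if "i \<in> {1..l}" for i by (rule borel_measurable_continuous_onI[OF Sc[OF that]])
 have Sg: "S i (g *v x) = S (\<phi> g i) x" if g: "g \<in> G" and i: "i \<in> {1..l}" for g i x
 proof -
 have o: "orthogonal_matrix g" by (rule orthD[OF G g])
 have gi: "\<phi> g i \<in> {1..l}" by (rule permsD[OF P g i])
 have b: "bij_betw (\<phi> g) {1..l} {1..l}" using P g by (simp add: perms_def)
 have e: "AE x in lborel. \<forall>i\<in>{1..l}. U i (g *v x) = U (\<phi> g i) x" using U g by (auto simp: adm_def)
 have gm: "(*v) g \<in> BM" using mp_orthogonal[OF o] by (simp add: mp_def)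
 have eU: "AE x in lborel. U i (g *v x) = U (\<phi> g i) x" using e i by (auto elim!: eventually_mono)
 have eF: "AE x in lborel. F i (g *v x) = F (\<phi> g i) x" using e
 proof eventually_elim
 case (elim y)
 from sum.reindex_bij_betw[OF bij_betw_minus[OF b i], of "%j. kk p (U (\<phi> g i) y) (U j y)"]
 moreover have "(\<Sum>j\<in>{1..l} - {i}. kk p (U i (g *v y)) (U j (g *v y))) = (\<Sum>j\<in>{1..l} - {i}. kk p (U (\<phi> g i) y) (U (\<phi> g j) y))"
 by (intro sum.cong refl) (use elim i in auto)
 ultimately have "(\<Sum>j\<in>{1..l} - {i}. kk p (U i (g *v y)) (U j (g *v y))) = (\<Sum>j\<in>{1..l} - {\<phi> g i}. kk p (U (\<phi> g i) y) (U j y))" by simp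
 then show ?case using elim i by (simp add: F_def react_def)
 qed
 have "conv (Lap (mollh r)) (U i) (g *v x) = conv (Lap (mollh r)) (U (\<phi> g i)) x"
 using m[OF i] m[OF gi] gm by (subst conv_orthogonal[OF o]) (auto intro!: Lap_mollh_radial conv_cong_AE[OF eU] simp: norm_orthogonal_matrix_mult[OF o])
 moreover have "conv (moll r) (F i) (g *v x) = conv (moll r) (F (\<phi> g i)) x"
 using Fm[OF i] Fm[OF gi] gm by (subst conv_orthogonal[OF o]) (auto intro!: conv_cong_AE[OF eF] simp: moll_props(5)[OF r o])
 ultimately show ?thesis by (simp add: S_def)
 qed
 have S0: "AE x in lborel. norm x <= R --> S i x = 0" if R: "R > 0" for R
 proof -
 define b where "b i x = indicator (cball 0 R) x * S i x" for i x
 have bz: "b i y = 0" if "norm y > R" for i y using that by (simp add: b_def)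
 have [measurable]: "b i \<in> BM" if "i \<in> {1..l}" for i unfolding b_def[abs_def] using Sm[OF that] by measurable
 have bi: "integrable lborel (b i)" "integrable lborel (%x. S i x * b i x)" if i: "i \<in> {1..l}" for i
 proof -
 note [measurable] = Sm[OF i]
 have c: "compact (S i ` cball 0 R)" by (intro compact_continuous_image continuous_on_subset[OF Sc[OF i]]) auto
 then obtain B where B: "!!x. norm x <= R ==> \<bar>S i x\<bar> <= B" using compact_imp_bounded[OF c] unfolding bounded_iff by force
 have B0: "B >= 0" using B[of 0] R by simp
 have s: "S i x * S i x <= B + B * B" if "norm x <= R" for x
 using mult_mono[OF B[OF that] B[OF that] B0] B0 by (simp add: abs_mult_self_eq)
 have ci: "integrable lborel (%x. (B + B * B) * indicator (cball (0::real^'n) R) x)"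
 using emeasure_cball_finite[of "0::real^'n" R] by (intro integrable_mult_right integrable_real_indicator) auto
 show "integrable lborel (b i)"
 by (rule integrable_dom[OF ci]) (use i B B0 in \<open>auto simp: b_def indicator_def intro!: add_increasing2\<close>)
 show "integrable lborel (%x. S i x * b i x)"
 by (rule integrable_dom[OF ci]) (use i B0 s in \<open>auto simp: b_def indicator_def\<close>)
 qed
 have bl: "locint (b i)" if "i \<in> {1..l}" for i by (rule locint_integrable[OF bi(1)[OF that]])
 define \<psi> where "\<psi> i = conv (moll r) (b i)" for i
 have \<psi>t: "\<psi> i \<in> test_functions UNIV" if "i \<in> {1..l}" for i unfolding \<psi>_def by (rule conv_test_functions[OF bl[OF that] mt bz])
 have a: "adm G \<phi> l UNIV \<psi> (%i. grad (\<psi> i))" unfolding adm_def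
 proof (intro conjI ballI AE_I2)
 show "Dlim UNIV (\<psi> i) (grad (\<psi> i))" if "i \<in> {1..l}" for i by (rule Dlim_test[OF \<psi>t[OF that]])
 show "\<psi> i (g *v x) = \<psi> (\<phi> g i) x" if g: "g \<in> G" and i: "i \<in> {1..l}" for g i x
 proof -
 have o: "orthogonal_matrix g" by (rule orthD[OF G g])
 have "(%y. b i (g *v y)) = b (\<phi> g i)" by (rule ext) (simp add: b_def Sg[OF g i] indicator_def norm_orthogonal_matrix_mult[OF o])
 then show ?thesis unfolding \<psi>_def using i by (subst conv_orthogonal[OF o]) (auto simp: moll_props(5)[OF r o])
 qed
 qed
 \<comment> \<open>Two transfers by \<open>conv_fubini\<close> move the kernels from the variation
   onto U and F, and an integration by parts in each coordinate turns the gradient term into the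
   Laplacian of the mollifier; what remains is the residual tested with \<open>b\<close>.\<close>
 have tm: "(LBINT x. Gr i x \<bullet> grad (\<psi> i) x) - (LBINT x. kk p (U i x) (U i x) * \<psi> i x)
 - \<beta> * (\<Sum>j\<in>{1..l} - {i}. \<integral>x. kk p (U i x) (U j x) * \<psi> i x \<partial>lborel) = - (LBINT x. S i x * b i x)" if i: "i \<in> {1..l}" for i
 proof -
 have ki: "integrable lborel (%x. kk p (U i x) (U j x) * \<psi> i x)" if "j \<in> {1..l}" for j
 unfolding p_def by (rule kk_integrable[OF N D[OF i] D[OF that] Dlim_test[OF \<psi>t[OF i]]])
 have "(LBINT x. F i x * \<psi> i x) = (LBINT x. kk p (U i x) (U i x) * \<psi> i x + \<beta> * (\<Sum>j\<in>{1..l} - {i}. kk p (U i x) (U j x) * \<psi> i x))"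
 by (intro Bochner_Integration.integral_cong refl) (simp only: F_def react_def distrib_right mult.assoc sum_distrib_right)
 also have "\<dots> = (LBINT x. kk p (U i x) (U i x) * \<psi> i x) + (LBINT x. \<beta> * (\<Sum>j\<in>{1..l} - {i}. kk p (U i x) (U j x) * \<psi> i x))"
 using i by (intro integral_plus integrable_mult_right Bochner_Integration.integrable_sum ki) auto
 also have "(LBINT x. \<beta> * (\<Sum>j\<in>{1..l} - {i}. kk p (U i x) (U j x) * \<psi> i x)) = \<beta> * (\<Sum>j\<in>{1..l} - {i}. \<integral>x. kk p (U i x) (U j x) * \<psi> i x \<partial>lborel)"
 using ki by (simp add: Bochner_Integration.integral_sum)
 finally have 1: "(LBINT x. F i x * \<psi> i x) = (LBINT x. kk p (U i x) (U i x) * \<psi> i x) + \<beta> * (\<Sum>j\<in>{1..l} - {i}. \<integral>x. kk p (U i x) (U j x) * \<psi> i x \<partial>lborel)" .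
 have F2: "(LBINT x. F i x * \<psi> i x) = (LBINT x. conv (moll r) (F i) x * b i x)"
 unfolding \<psi>_def by (rule conv_fubini[OF Fl[OF i] bi(1)[OF i] bz mt moll_props(6)[OF r]])
 define A where "A = (%x h. \<Sum>e\<in>Basis. conv (%z. mollh r z h \<bullet> e) (b i) x *\<^sub>R e)"
 have A: "C2_on UNIV (\<psi> i) (grad (\<psi> i)) A" "Lap A x = conv (Lap (mollh r)) (b i) x" for x
 unfolding A_def \<psi>_def by (rule conv_C2(1)[OF bl[OF i] mt C2], rule conv_C2(2)[OF bl[OF i] mt C2])
 have gA: "grad (%x. grad (\<psi> i) x \<bullet> e) x = A x e" for e x
 proof (rule grad_eqI)
 have "((%x. grad (\<psi> i) x \<bullet> e) has_derivative (%h. A x h \<bullet> e)) (at x)" by (intro has_derivative_inner_left C2_onD(2)[OF A(1)] UNIV_I)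
 then show "((%x. grad (\<psi> i) x \<bullet> e) has_derivative (%h. A x e \<bullet> h)) (at x)"
 using C2_onD(3)[OF A(1) UNIV_I, of x e] by (simp add: inner_commute)
 qed
 note w = Dlim_weak_derivative[OF D[OF i] N deriv_test_functions[OF \<psi>t[OF i]], unfolded gA]
 have "(LBINT x. U i x * conv (Lap (mollh r)) (b i) x) = (LBINT x. (\<Sum>e\<in>Basis. U i x * (A x e \<bullet> e)))"
 unfolding A(2)[symmetric] Lap_def by (simp add: sum_distrib_left)
 also have "\<dots> = (\<Sum>e\<in>Basis. \<integral>x. U i x * (A x e \<bullet> e) \<partial>lborel)" by (intro Bochner_Integration.integral_sum w(2))
 also have "\<dots> = (\<Sum>e\<in>Basis. - (LBINT x. (Gr i x \<bullet> e) * (grad (\<psi> i) x \<bullet> e)))" by (intro sum.cong refl w(1))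
 also have "\<dots> = - (LBINT x. (\<Sum>e\<in>Basis. (Gr i x \<bullet> e) * (grad (\<psi> i) x \<bullet> e)))"
 unfolding sum_negf by (subst Bochner_Integration.integral_sum[OF w(3)]) simp
 also have "\<dots> = - (LBINT x. Gr i x \<bullet> grad (\<psi> i) x)" unfolding euclidean_inner[symmetric] ..
 finally have 2: "(LBINT x. Gr i x \<bullet> grad (\<psi> i) x) = - (LBINT x. U i x * conv (Lap (mollh r)) (b i) x)" by simp
 have F3: "(LBINT x. U i x * conv (Lap (mollh r)) (b i) x) = (LBINT x. conv (Lap (mollh r)) (U i) x * b i x)"
 by (rule conv_fubini[OF Ul[OF i] bi(1)[OF i] bz Lt Le])
 have I: "integrable lborel (%x. conv k v x * b i x)" if k: "locint v" "k \<in> test_functions UNIV" for k v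
 proof -
 have "continuous_on UNIV (conv k v)" by (intro smooth_continuous conv_smooth[OF k])
 note [measurable] = borel_measurable_continuous_onI[OF this] and c = compact_imp_bounded[OF compact_continuous_image[OF continuous_on_subset[OF this subset_UNIV] compact_cball[of 0 R]]]
 obtain B where B: "!!x. norm x <= R ==> \<bar>conv k v x\<bar> <= B" using c unfolding bounded_iff by force
 show ?thesis
 proof (rule integrable_dom[OF integrable_mult_right[OF bi(1)[OF i], of B]])
 show "AE x in lborel. norm (conv k v x * b i x) <= norm (B * b i x)"
 proof (rule AE_I2)
 fix x show "norm (conv k v x * b i x) <= norm (B * b i x)"
 proof (cases "norm x <= R")
 case True
 then show ?thesis using B[OF True] unfolding norm_mult by (intro mult_right_mono) auto
 qed (simp add: bz)
 qed
 qed (use i in measurable)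
 qed
 have "(LBINT x. S i x * b i x) = (LBINT x. conv (Lap (mollh r)) (U i) x * b i x) + (LBINT x. conv (moll r) (F i) x * b i x)"
 unfolding S_def distrib_right by (rule integral_plus[OF I[OF Ul[OF i] Lt] I[OF Fl[OF i] mt]])
 then show ?thesis using 1 2 F2 F3 by linarith
 qed
 have "(\<Sum>i\<in>{1..l}. - (LBINT x. S i x * b i x)) = 0"
 using EL[OF a] unfolding energy_deriv_def p_def[symmetric] by (subst (asm) sum.cong[OF refl tm]) auto
 then have z: "(\<Sum>i\<in>{1..l}. \<integral>x. S i x * b i x \<partial>lborel) = 0" by (simp add: sum_negf)
 have sb: "0 <= S i x * b i x" for i x by (simp add: b_def indicator_def)
 have "(LBINT x. S i x * b i x) = 0"
 using z i by (subst (asm) sum_nonneg_eq_0_iff) (auto intro!: integral_nonneg_AE simp: sb)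
 then have "AE x in lborel. S i x * b i x = 0" using integral_nonneg_eq_0_iff_AE[OF bi(2)[OF i]] sb by simp
 then show ?thesis by eventually_elim (auto simp: b_def indicator_def split: if_splits)
 qed
 \<comment> \<open>The residual vanishes almost everywhere on every ball. Its zero set is closed,
   hence everything, so the identity holds at every point.\<close>
 have "AE x in lborel. \<forall>k::nat. norm x <= real k + 1 --> S i x = 0" unfolding AE_all_countable by (intro allI S0) simp
 then have "AE x in lborel. x \<in> {x. S i x = 0}"
 proof eventually_elim
 case (elim x)
 obtain k where "norm x <= real k" using real_arch_simple by blast
 then show ?case using elim[rule_format, of k] by simp
 qed
 then have "AE x in lebesgue. x \<in> {x. S i x = 0}" by (rule AE_completion)
 moreover have "closed {x. S i x = 0}" using closed_Collect_eq[OF Sc[OF i] continuous_on_const] by simp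
 ultimately have "x \<in> {x. S i x = 0}" by (intro mem_closed_if_AE_lebesgue)
 then show ?thesis by (simp add: S_def F_def p_def)
qed

section \<open>Non-existence of minimizers\<close>

lemma no_minimizer:
 fixes \<Omega> :: "(real^'n) set"
 assumes \<Omega>: "open \<Omega>" and N: "CARD('n) >= 3" and l: "l >= 1" and inv: "G_invariant G \<Omega>" and G: "orth_closed G" and P: "perms G \<phi> l" and \<beta>: "\<beta> < 0"
 and x1: "x1 \<in> interior (- \<Omega>)" and u: "u \<in> Nehari G \<phi> l \<beta> \<Omega>"
 and min: "!!w. w \<in> Nehari G \<phi> l \<beta> UNIV ==> J \<beta> l \<Omega> u <= J \<beta> l UNIV w"
 shows False
proof -
 define p where "p = crit_exp CARD('n) / 2"
 have p: "p > 1" using crit_exp_gt(1)[OF N] by (simp add: p_def)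
 obtain U Gr where U\<Omega>: "adm G \<phi> l \<Omega> U Gr" and Uz: "!!i x. i \<in> {1..l} ==> x \<notin> \<Omega> ==> U i x = 0"
 and nz: "!!i. i \<in> {1..l} ==> \<not> (AE x in lborel. U i x = 0)"
 and eq: "!!i. i \<in> {1..l} ==> aa Gr i - bb U i - \<beta> * (\<Sum>j\<in>{1..l} - {i}. dd U i j) = 0"
 and J: "J \<beta> l \<Omega> u = Jc l \<beta> (crit_exp CARD('n)) (aa Gr) (bb U) (dd U)"
 using Nehari_adm[OF \<Omega> N inv G P u] by blast
 have U: "adm G \<phi> l UNIV U Gr" using U\<Omega> by (auto simp: adm_def intro: Dlim_mono[OF _ subset_UNIV])
 have D: "Dlim UNIV (U i) (Gr i)" if "i \<in> {1..l}" for i using U that by (auto simp: adm_def)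
 have m: "U i \<in> BM" "Gr i \<in> BM" if "i \<in> {1..l}" for i using Dlim_measurable[OF D[OF that]] by auto
 note EL = energy_deriv_zero[OF N G P \<beta> U nz eq min[unfolded J]]
 obtain M where M: "M > 0" "!!i. i \<in> {1..l} ==> AE x in lborel. \<bar>U i x\<bar> <= M"
 using solution_bounded[OF N \<beta> U EL] by blast
 obtain \<rho> where \<rho>: "\<rho> > 0" "ball x1 \<rho> \<subseteq> - \<Omega>" using x1 unfolding mem_interior by blast
 \<comment> \<open>The centre of a ball missing \<open>\<Omega>\<close> is moved to the origin, and
   values above M, taken on a null set only, are replaced by 0, so that the pointwise bounds of
   \<open>unique_continuation\<close> hold everywhere.\<close>
 define V where "V i x = (if \<bar>U i (x + x1)\<bar> <= M then U i (x + x1) else 0)" for i x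
 have mt: "(%x. x + x1) \<in> BM" by measurable
 have Um: "(%x. U i (x + x1)) \<in> BM" "(%x. Gr i (x + x1)) \<in> BM" if "i \<in> {1..l}" for i
 using measurable_compose[OF mt m(1)[OF that]] measurable_compose[OF mt m(2)[OF that]] by auto
 have Vm: "V i \<in> BM" if "i \<in> {1..l}" for i unfolding V_def[abs_def] using Um(1)[OF that] by measurable
 have Vb: "\<bar>V i x\<bar> <= M" for i x using M(1) by (simp add: V_def)
 have e: "AE x in lborel. U i (x + x1) = V i x" if i: "i \<in> {1..l}" for i
 using mp_AE[OF mp_translate M(2)[OF i], of x1] by eventually_elim (simp add: V_def)
 have DV: "Dlim UNIV (V i) (%x. Gr i (x + x1))" if i: "i \<in> {1..l}" for i
 proof (rule Dlim_cong_AE[OF _ e[OF i] _ Vm[OF i] Um(2)[OF i]])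
 have "Dlim UNIV (%x. 1 * U i (id x + x1)) (%x. 1 *\<^sub>R id (Gr i (id x + x1)))"
 by (rule Dlim_affine[where A = id and B = id and A' = id and C = 1, OF D[OF i] N])
 (use mp_nn[OF mp_translate] in \<open>auto simp: linear_id\<close>)
 then show "Dlim UNIV (%x. U i (x + x1)) (%x. Gr i (x + x1))" by simp
 qed simp
 define C where "C = M powr (p - 1) * M powr (p - 1)"
 \<comment> \<open>The bound is taken in b and not in a: a enters with the power p - 1, which may be
   less than 1, while |b|^p \<le> M^(p-1) |b|.\<close>
 have kb: "\<bar>kk p a b\<bar> <= C * \<bar>b\<bar>" if "\<bar>a\<bar> <= M" "\<bar>b\<bar> <= M" for a b
 proof -
 have "\<bar>b\<bar> powr p = \<bar>b\<bar> powr (p - 1) * \<bar>b\<bar>" using powr_mult_base[of "\<bar>b\<bar>" "p - 1"] by (simp add: mult.commute)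
 also have "\<dots> <= M powr (p - 1) * \<bar>b\<bar>" using that p by (intro mult_right_mono powr_mono2) auto
 finally have "\<bar>a\<bar> powr (p - 1) * \<bar>b\<bar> powr p <= M powr (p - 1) * (M powr (p - 1) * \<bar>b\<bar>)"
 using that p by (intro mult_mono powr_mono2) auto
 then show ?thesis by (auto simp: kk_def abs_mult C_def abs_sgn_eq)
 qed
 have Fb: "\<bar>react l \<beta> p V i x\<bar> <= (C + \<bar>\<beta>\<bar> * C) * (\<Sum>j\<in>{1..l}. \<bar>V j x\<bar>)" if i: "i \<in> {1..l}" for i x
 proof -
 have C0: "C >= 0" by (simp add: C_def)
 have "\<bar>\<Sum>j\<in>{1..l} - {i}. kk p (V i x) (V j x)\<bar> <= (\<Sum>j\<in>{1..l} - {i}. C * \<bar>V j x\<bar>)"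
 by (rule order_trans[OF sum_abs]) (intro sum_mono kb Vb)
 also have "\<dots> <= (\<Sum>j\<in>{1..l}. C * \<bar>V j x\<bar>)" using C0 by (intro sum_mono2) auto
 finally have 1: "\<bar>\<Sum>j\<in>{1..l} - {i}. kk p (V i x) (V j x)\<bar> <= C * (\<Sum>j\<in>{1..l}. \<bar>V j x\<bar>)" by (simp add: sum_distrib_left)
 have "\<bar>V i x\<bar> <= (\<Sum>j\<in>{1..l}. \<bar>V j x\<bar>)" using i by (intro member_le_sum) auto
 then have 2: "\<bar>kk p (V i x) (V i x)\<bar> <= C * (\<Sum>j\<in>{1..l}. \<bar>V j x\<bar>)"
 using kb[OF Vb Vb, of i x i x] C0 by (meson mult_left_mono order_trans)
 have "\<bar>react l \<beta> p V i x\<bar> <= \<bar>kk p (V i x) (V i x)\<bar> + \<bar>\<beta>\<bar> * \<bar>\<Sum>j\<in>{1..l} - {i}. kk p (V i x) (V j x)\<bar>"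
 unfolding react_def by (rule order_trans[OF abs_triangle_ineq]) (simp add: abs_mult)
 also have "\<dots> <= C * (\<Sum>j\<in>{1..l}. \<bar>V j x\<bar>) + \<bar>\<beta>\<bar> * (C * (\<Sum>j\<in>{1..l}. \<bar>V j x\<bar>))" using 1 2 by (intro add_mono mult_left_mono) auto
 finally show ?thesis by (simp add: algebra_simps)
 qed
 have tr: "conv k (%y. v (y + x1)) x = conv k v (x + x1)" if [measurable]: "k \<in> BM" "v \<in> BM" for k v and x :: "real^'n"
 using mp_integral[OF mp_translate, of "%y. k (x + x1 - y) * v y" x1] by (simp add: conv_def)
 have pde: "conv (Lap (mollh r)) (V i) x = - conv (moll r) (react l \<beta> p V i) x" if r: "r > 0" and i: "i \<in> {1..l}" for r i x
 proof -
 obtain H where "C2_on UNIV (moll r :: real^'n => real) H (mollh r)" using moll_C2 by blast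
 from test_measurable[OF conv_C2(4)[OF Dlim_locint(1)[OF D[OF i] N] moll_props(1)[OF r] this]]
 have Lm: "Lap (mollh r) \<in> borel_measurable (borel :: (real^'n) measure)" .
 have km: "moll r \<in> borel_measurable (borel :: (real^'n) measure)" by (rule test_measurable[OF moll_props(1)[OF r]])
 have Rm: "react l \<beta> p U i \<in> BM" by (rule react_measurable) (use m i in auto)
 have eR: "AE x in lborel. react l \<beta> p U i (x + x1) = react l \<beta> p V i x"
 proof -
 have "AE x in lborel. \<forall>j\<in>{1..l}. U j (x + x1) = V j x" by (subst AE_finite_all) (auto simp: e)
 then show ?thesis
 proof eventually_elim
 case (elim x)
 then have "(\<Sum>j\<in>{1..l} - {i}. kk p (V i x) (U j (x + x1))) = (\<Sum>j\<in>{1..l} - {i}. kk p (V i x) (V j x))" by (intro sum.cong) auto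
 then show ?case using elim i by (simp add: react_def)
 qed
 qed
 have "conv (Lap (mollh r)) (V i) x = conv (Lap (mollh r)) (U i) (x + x1)"
 unfolding tr[OF Lm m(1)[OF i], symmetric] by (rule conv_cong_AE[OF e[OF i] Um(1)[OF i] Vm[OF i] Lm, symmetric])
 also have "\<dots> = - conv (moll r) (react l \<beta> p U i) (x + x1)" unfolding p_def by (rule mollified_equation[OF N G P U EL r i])
 also have "conv (moll r) (react l \<beta> p U i) (x + x1) = conv (moll r) (react l \<beta> p V i) x"
 unfolding tr[OF km Rm, symmetric]
 by (rule conv_cong_AE[OF eR measurable_compose[OF mt Rm] _ km]) (rule react_measurable, use Vm i in auto)
 finally show ?thesis .
 qed
 have z: "V i x = 0" if "i \<in> {1..l}" "norm x < \<rho>" for i x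
 proof -
 have "x + x1 \<in> ball x1 \<rho>" using that by (simp add: dist_norm)
 then have "x + x1 \<notin> \<Omega>" using \<rho>(2) by blast
 then show ?thesis using Uz[OF that(1)] by (simp add: V_def)
 qed
 have Vm': "react l \<beta> p V i \<in> BM" if "i \<in> {1..l}" for i by (rule react_measurable) (use Vm that in auto)
 have "\<forall>i\<in>{1..l}. AE x in lborel. V i x = 0"
 by (rule unique_continuation[OF N finite_atLeastAtMost DV Vm' Fb _ pde \<rho>(1) z]) (auto simp: C_def)
 then have "AE x in lborel. V 1 x = 0" using l by simp
 then have "AE x in lborel. U 1 (x + x1) = 0" using e[of 1] l by (auto elim: eventually_elim2)
 from mp_AE[OF mp_translate this, of "- x1"] have "AE x in lborel. U 1 x = 0" by simp
 then show False using nz[of 1] l by simp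
qed

theorem theorem1p5:
  fixes \<Omega> :: "(real^'n) set"
    and G :: "(real^'n^'n) set"
    and \<phi> :: "real^'n^'n \<Rightarrow> nat \<Rightarrow> nat"
    and l :: nat
    and \<beta> :: real
  assumes "CARD('n) \<ge> 3"
    and "l \<ge> 1"
    and "\<beta> < 0"
    and "subgroup G O_group"
    and "closed G"
    and "\<phi> \<in> hom (O_group\<lparr>carrier := G\<rparr>) (perm_group l)"
    and "continuous_map (top_of_set G) (discrete_topology (carrier (perm_group l))) \<phi>"
    and "smooth_domain \<Omega>"
    and "G_invariant G \<Omega>"
  shows "(\<Omega> \<inter> Fix G \<noteq> {} \<longrightarrow> c_inf G \<phi> l \<beta> \<Omega> = c_inf G \<phi> l \<beta> UNIV) \<and>
         (\<Omega> \<inter> Fix G \<noteq> {} \<and> interior (- \<Omega>) \<noteq> {} \<longrightarrow>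
           \<not> (\<exists>u. least_energy_solution G \<phi> l \<beta> \<Omega> u))"
proof -
 have \<Omega>: "open \<Omega>" using assms(8) by (simp add: smooth_domain_def)
 have G: "orth_closed G" unfolding orth_closed_def
 proof (intro ballI conjI)
 fix g assume g: "g \<in> G"
 then have gO: "g \<in> carrier O_group" using subgroup.subset[OF assms(4)] by blast
 then show o: "orthogonal_matrix g" by (simp add: O_group_def)
 have "inv\<^bsub>O_group\<^esub> g \<in> G" by (rule subgroup.m_inv_closed[OF assms(4) g])
 moreover have "inv\<^bsub>O_group\<^esub> g = transpose g"
 by (rule group.inv_equality[OF group_O_group _ gO]) (use o in \<open>auto simp: O_group_def orthogonal_matrix_def\<close>)
 ultimately show "transpose g \<in> G" by simp
 qed
 have P: "perms G \<phi> l" unfolding perms_def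
 proof
 fix g assume "g \<in> G"
 then have "\<phi> g \<in> carrier (perm_group l)" using assms(6) by (auto simp: hom_def)
 then show "bij_betw (\<phi> g) {1..l} {1..l}" by (intro permutes_imp_bij) (simp add: perm_group_def sym_group_def)
 qed
 have eq: "c_inf G \<phi> l \<beta> \<Omega> = c_inf G \<phi> l \<beta> UNIV" if "\<Omega> \<inter> Fix G ~= {}"
 proof (rule antisym)
 from that obtain x0 where "x0 \<in> \<Omega>" "x0 \<in> Fix G" by blast
 then have x0: "x0 \<in> \<Omega>" "!!g. g \<in> G ==> g *v x0 = x0" by (simp_all add: Fix_def)
 show "c_inf G \<phi> l \<beta> \<Omega> <= c_inf G \<phi> l \<beta> UNIV" unfolding c_inf_def[of G \<phi> l \<beta> UNIV]
 proof (rule INF_greatest)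
 fix u assume u: "u \<in> Nehari G \<phi> l \<beta> UNIV"
 show "c_inf G \<phi> l \<beta> \<Omega> <= ereal (J \<beta> l UNIV u)"
 proof (rule ereal_le_epsilon2)
 fix e :: real assume "0 < e"
 then obtain w where w: "w \<in> Nehari G \<phi> l \<beta> \<Omega>" "J \<beta> l \<Omega> w <= J \<beta> l UNIV u + e"
 using Nehari_localize[OF \<Omega> assms(1) G P assms(3) x0 u] by blast
 have "c_inf G \<phi> l \<beta> \<Omega> <= ereal (J \<beta> l \<Omega> w)" unfolding c_inf_def by (rule INF_lower[OF w(1)])
 also have "\<dots> <= ereal (J \<beta> l UNIV u) + ereal e" using w(2) by simp
 finally show "c_inf G \<phi> l \<beta> \<Omega> <= ereal (J \<beta> l UNIV u) + ereal e" .
 qed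
 qed
 show "c_inf G \<phi> l \<beta> UNIV <= c_inf G \<phi> l \<beta> \<Omega>" unfolding c_inf_def[of G \<phi> l \<beta> \<Omega>]
 proof (rule INF_greatest)
 fix u assume u: "u \<in> Nehari G \<phi> l \<beta> \<Omega>"
 obtain U Gr where U: "adm G \<phi> l \<Omega> U Gr" "!!i. i \<in> {1..l} ==> \<not> (AE x in lborel. U i x = 0)"
 "!!i. i \<in> {1..l} ==> aa Gr i - bb U i - \<beta> * (\<Sum>j\<in>{1..l} - {i}. dd U i j) = 0"
 "J \<beta> l \<Omega> u = Jc l \<beta> (crit_exp CARD('n)) (aa Gr) (bb U) (dd U)"
 using Nehari_adm[OF \<Omega> assms(1,9) G P u] by blast
 have "adm G \<phi> l UNIV U Gr" using U(1) by (auto simp: adm_def intro: Dlim_mono[OF _ subset_UNIV])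
 from adm_Nehari[OF open_UNIV assms(1) this U(2,3)] show "c_inf G \<phi> l \<beta> UNIV <= ereal (J \<beta> l \<Omega> u)"
 unfolding c_inf_def U(4) by (metis INF_lower)
 qed
 qed
 moreover have False if "\<Omega> \<inter> Fix G ~= {}" "x1 \<in> interior (- \<Omega>)" "least_energy_solution G \<phi> l \<beta> \<Omega> u" for x1 u
 proof (rule no_minimizer[OF \<Omega> assms(1,2,9) G P assms(3) that(2)])
 show "u \<in> Nehari G \<phi> l \<beta> \<Omega>" using that(3) by (simp add: least_energy_solution_def)
 have c: "ereal (J \<beta> l \<Omega> u) = c_inf G \<phi> l \<beta> UNIV" using that(3) eq[OF that(1)] by (simp add: least_energy_solution_def)
 fix w assume "w \<in> Nehari G \<phi> l \<beta> UNIV"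
 then have "c_inf G \<phi> l \<beta> UNIV <= ereal (J \<beta> l UNIV w)" unfolding c_inf_def by (rule INF_lower)
 then show "J \<beta> l \<Omega> u <= J \<beta> l UNIV w" unfolding c[symmetric] by simp
 qed
 ultimately show ?thesis by blast
qed

end
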